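(* Let $\mathrm{t}:\mathfrak{A}\to\dot{\mathfrak{A}}$ be an $\mathsf{a}$-inclusion, $\mathfrak{H}$ a bicategorically complete 2-category, and $\mathcal{A},\mathcal{B}:\dot{\mathfrak{A}}\to\mathfrak{H}$ pseudofunctors. Assume that $\alpha:\mathcal{A}\to\mathcal{B}$ is a pseudonatural transformation satisfying the Beck–Chevalley condition and that all components of $\alpha\mathrm{t}=\alpha*\mathrm{Id}_{\mathrm{t}}$ are monadic. \begin{itemize} \item If $\mathcal{B}$ is of almost $\mathrm{t}$-descent, then: $\alpha_{\mathsf{a}}$ is almost monadic (i.e. of almost $\mathrm{m}$-descent) if and only if $\mathcal{A}$ is of almost $\mathrm{t}$-descent. \item If $\mathcal{B}$ is of $\mathrm{t}$-descent, then: $\alpha_{\mathsf{a}}$ is premonadic if and only if $\mathcal{A}$ is of $\mathrm{t}$-descent. \item If $\mathcal{B}$ is of effective $\mathrm{t}$-descent, then: $\alpha_{\mathsf{a}}$ is monadic if and only if $\mathcal{A}$ is of effective $\mathrm{t}$-descent. \end{itemize}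
   Context: An $\mathsf{a}$-inclusion is a full inclusion (fully faithful 2-functor) $\mathrm{t}:\mathfrak{A}\to\dot{\mathfrak{A}}$ of small 2-categories with $\mathrm{obj}(\dot{\mathfrak{A}})=\mathrm{obj}(\mathfrak{A})\sqcup\{\mathsf{a}\}$. $[-,-]_{PS}$ denotes 2-categories of pseudofunctors, pseudonatural transformations and modifications. $\mathfrak{H}$ is bicategorically complete if it has all small weighted bilimits: objects $\mathrm{bilim}(\mathcal{W},\mathcal{D})$ with equivalences $\mathfrak{H}(X,\mathrm{bilim}(\mathcal{W},\mathcal{D}))\simeq[\mathfrak{S},\mathsf{CAT}]_{PS}(\mathcal{W},\mathfrak{H}(X,\mathcal{D}-))$ pseudonatural in $X$, for $\mathfrak{S}$ small, $\mathcal{W}:\mathfrak{S}\to\mathsf{CAT}$ and $\mathcal{D}:\mathfrak{S}\to\mathfrak{H}$. A 1-cell $f$ of $\mathfrak{H}$ is faithful/fully faithful if $\mathfrak{H}(X,f)$ is faithful/fully faithful for all $X$. $\mathrm{PsRan}_{\mathrm{t}}$ denotes the right biadjoint of $-\circ\mathrm{t}:[\dot{\mathfrak{A}},\mathfrak{H}]_{PS}\to[\mathfrak{A},\mathfrak{H}]_{PS}$, and $\eta_{\mathcal{A}}:\mathcal{A}\to\mathrm{PsRan}_{\mathrm{t}}(\mathcal{A}\circ\mathrm{t})$ the unit. $\mathcal{A}:\dot{\mathfrak{A}}\to\mathfrak{H}$ is of effective $\mathrm{t}$-descent / $\mathrm{t}$-descent / almost $\mathrm{t}$-descent if the component $\eta^{\mathsf{a}}_{\mathcal{A}}:\mathcal{A}(\mathsf{a})\to\mathrm{PsRan}_{\mathrm{t}}(\mathcal{A}\circ\mathrm{t})(\mathsf{a})\simeq\mathrm{bilim}(\dot{\mathfrak{A}}(\mathsf{a},\mathrm{t}-),\mathcal{A}\circ\mathrm{t})$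 is an equivalence / fully faithful / faithful. Beck–Chevalley condition: every 1-cell component $\alpha_w:\mathcal{A}(w)\to\mathcal{B}(w)$ has a left adjoint $\widehat{\alpha}^w\dashv\alpha_w$ in $\mathfrak{H}$ and, for each 1-cell $f:w\to c$ of $\dot{\mathfrak{A}}$, the mate of the invertible 2-cell $\alpha_f:\mathcal{B}(f)\alpha_w\Rightarrow\alpha_c\mathcal{A}(f)$ with respect to the adjunctions $\widehat{\alpha}^w\dashv\alpha_w$ and $\widehat{\alpha}^c\dashv\alpha_c$ is invertible. Monadicity: let $u:y\to b$ be a 1-cell of $\mathfrak{H}$ with a left adjoint, inducing the monad $T$ on $b$. The (bicategorical) Eilenberg–Moore object $b^T$ is the object with equivalences, pseudonatural in $X$, between $\mathfrak{H}(X,b^T)$ and the category of algebras of the monad $\mathfrak{H}(X,T)$ on $\mathfrak{H}(X,b)$. The 1-cell $u$ is monadic / premonadic / almost monadic (of almost $\mathrm{m}$-descent) if the canonical comparison $y\to b^T$ is an equivalence / fully faithful / faithful. *)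

theory Defs
  imports Main "HOL-Library.FuncSet"
begin

unbundle cardinal_syntax

section \<open>Categories, functors, natural transformations\<close>

text \<open>
  Functors, natural transformations, pseudofunctors, pseudonatural transformations and
  modifications carry their source and target (where they are cells of a 2-category) and are
  extensional, so that the strict laws of the 2-categories formed from them are equations in HOL.
\<close>

record ('a, 'b) cat =
  Ob :: "'a set"
  Ar :: "'b set"
  Dom :: "'b \<Rightarrow> 'a"
  Cod :: "'b \<Rightarrow> 'a"
  Idt :: "'a \<Rightarrow> 'b"
  Cmp :: "'b \<Rightarrow> 'b \<Rightarrow> 'b" (infixr "\<cdot>\<index>" 75)

locale category =
  fixes C :: "('a, 'b) cat" (structure)
  assumes Dom_Ob: "f \<in> Ar C \<Longrightarrow> Dom C f \<in> Ob C"
    and Cod_Ob: "f \<in> Ar C \<Longrightarrow> Cod C f \<in> Ob C"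
    and Id_Ar: "x \<in> Ob C \<Longrightarrow> Idt C x \<in> Ar C"
    and Dom_Id: "x \<in> Ob C \<Longrightarrow> Dom C (Idt C x) = x"
    and Cod_Id: "x \<in> Ob C \<Longrightarrow> Cod C (Idt C x) = x"
    and Cmp_Ar: "\<lbrakk>g \<in> Ar C; f \<in> Ar C; Dom C g = Cod C f\<rbrakk> \<Longrightarrow> g \<cdot> f \<in> Ar C"
    and Dom_Cmp: "\<lbrakk>g \<in> Ar C; f \<in> Ar C; Dom C g = Cod C f\<rbrakk> \<Longrightarrow> Dom C (g \<cdot> f) = Dom C f"
    and Cod_Cmp: "\<lbrakk>g \<in> Ar C; f \<in> Ar C; Dom C g = Cod C f\<rbrakk> \<Longrightarrow> Cod C (g \<cdot> f) = Cod C g"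
    and Cmp_Id: "f \<in> Ar C \<Longrightarrow> f \<cdot> Idt C (Dom C f) = f"
    and Id_Cmp: "f \<in> Ar C \<Longrightarrow> Idt C (Cod C f) \<cdot> f = f"
    and Cmp_assoc: "\<lbrakk>h \<in> Ar C; g \<in> Ar C; f \<in> Ar C; Dom C h = Cod C g; Dom C g = Cod C f\<rbrakk>
      \<Longrightarrow> (h \<cdot> g) \<cdot> f = h \<cdot> (g \<cdot> f)"

definition Homset :: "('a, 'b) cat \<Rightarrow> 'a \<Rightarrow> 'a \<Rightarrow> 'b set" where
  "Homset C x y = {f \<in> Ar C. Dom C f = x \<and> Cod C f = y}"

definition inverse_arrows :: "('a, 'b) cat \<Rightarrow> 'b \<Rightarrow> 'b \<Rightarrow> bool" where
  "inverse_arrows C f g \<longleftrightarrow> f \<in> Ar C \<and> g \<in> Ar C \<and> Dom C g = Cod C f \<and> Cod C g = Dom C f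
     \<and> g \<cdot>\<^bsub>C\<^esub> f = Idt C (Dom C f) \<and> f \<cdot>\<^bsub>C\<^esub> g = Idt C (Cod C f)"

definition is_iso :: "('a, 'b) cat \<Rightarrow> 'b \<Rightarrow> bool" where
  "is_iso C f \<longleftrightarrow> (\<exists>g. inverse_arrows C f g)"

record ('a, 'b, 'c, 'd) func =
  fdom :: "('a, 'b) cat"
  fcod :: "('c, 'd) cat"
  fob :: "'a \<Rightarrow> 'c"
  far :: "'b \<Rightarrow> 'd"

locale is_functor =
  fixes F :: "('a, 'b, 'c, 'd) func"
  assumes cat_fdom: "category (fdom F)"
    and cat_fcod: "category (fcod F)"
    and fob_ext: "fob F \<in> extensional (Ob (fdom F))"
    and far_ext: "far F \<in> extensional (Ar (fdom F))"
    and fob_Ob: "x \<in> Ob (fdom F) \<Longrightarrow> fob F x \<in> Ob (fcod F)"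
    and far_Ar: "f \<in> Ar (fdom F) \<Longrightarrow> far F f \<in> Ar (fcod F)"
    and Dom_far: "f \<in> Ar (fdom F) \<Longrightarrow> Dom (fcod F) (far F f) = fob F (Dom (fdom F) f)"
    and Cod_far: "f \<in> Ar (fdom F) \<Longrightarrow> Cod (fcod F) (far F f) = fob F (Cod (fdom F) f)"
    and far_Id: "x \<in> Ob (fdom F) \<Longrightarrow> far F (Idt (fdom F) x) = Idt (fcod F) (fob F x)"
    and far_Cmp: "\<lbrakk>g \<in> Ar (fdom F); f \<in> Ar (fdom F); Dom (fdom F) g = Cod (fdom F) f\<rbrakk>
      \<Longrightarrow> far F (g \<cdot>\<^bsub>fdom F\<^esub> f) = far F g \<cdot>\<^bsub>fcod F\<^esub> far F f"

record ('a, 'b, 'c, 'd) nattr =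
  ntdom :: "('a, 'b, 'c, 'd) func"
  ntcod :: "('a, 'b, 'c, 'd) func"
  ntc :: "'a \<Rightarrow> 'd"

locale is_nattr =
  fixes \<tau> :: "('a, 'b, 'c, 'd) nattr"
  assumes fun_ntdom: "is_functor (ntdom \<tau>)"
    and fun_ntcod: "is_functor (ntcod \<tau>)"
    and same_fdom: "fdom (ntcod \<tau>) = fdom (ntdom \<tau>)"
    and same_fcod: "fcod (ntcod \<tau>) = fcod (ntdom \<tau>)"
    and ntc_ext: "ntc \<tau> \<in> extensional (Ob (fdom (ntdom \<tau>)))"
    and ntc_hom: "x \<in> Ob (fdom (ntdom \<tau>)) \<Longrightarrow>
      ntc \<tau> x \<in> Homset (fcod (ntdom \<tau>)) (fob (ntdom \<tau>) x) (fob (ntcod \<tau>) x)"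
    and ntc_nat: "f \<in> Ar (fdom (ntdom \<tau>)) \<Longrightarrow>
      ntc \<tau> (Cod (fdom (ntdom \<tau>)) f) \<cdot>\<^bsub>fcod (ntdom \<tau>)\<^esub> far (ntdom \<tau>) f
      = far (ntcod \<tau>) f \<cdot>\<^bsub>fcod (ntdom \<tau>)\<^esub> ntc \<tau> (Dom (fdom (ntdom \<tau>)) f)"

definition is_nat_iso :: "('a, 'b, 'c, 'd) nattr \<Rightarrow> bool" where
  "is_nat_iso \<tau> \<longleftrightarrow> is_nattr \<tau> \<and> (\<forall>x \<in> Ob (fdom (ntdom \<tau>)). is_iso (fcod (ntdom \<tau>)) (ntc \<tau> x))"

definition func_id :: "('a, 'b) cat \<Rightarrow> ('a, 'b, 'a, 'b) func" where
  "func_id C = \<lparr>fdom = C, fcod = C, fob = (\<lambda>x \<in> Ob C. x), far = (\<lambda>f \<in> Ar C. f)\<rparr>"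

definition func_comp ::
  "('c, 'd, 'e, 'f) func \<Rightarrow> ('a, 'b, 'c, 'd) func \<Rightarrow> ('a, 'b, 'e, 'f) func" (infixr "\<circ>\<^sub>F" 75) where
  "G \<circ>\<^sub>F F = \<lparr>fdom = fdom F, fcod = fcod G,
     fob = (\<lambda>x \<in> Ob (fdom F). fob G (fob F x)), far = (\<lambda>f \<in> Ar (fdom F). far G (far F f))\<rparr>"

definition nt_id :: "('a, 'b, 'c, 'd) func \<Rightarrow> ('a, 'b, 'c, 'd) nattr" where
  "nt_id F = \<lparr>ntdom = F, ntcod = F, ntc = (\<lambda>x \<in> Ob (fdom F). Idt (fcod F) (fob F x))\<rparr>"

definition nt_vcomp ::
  "('a, 'b, 'c, 'd) nattr \<Rightarrow> ('a, 'b, 'c, 'd) nattr \<Rightarrow> ('a, 'b, 'c, 'd) nattr" (infixr "\<cdot>\<^sub>N" 75) where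
  "\<tau> \<cdot>\<^sub>N \<sigma> = \<lparr>ntdom = ntdom \<sigma>, ntcod = ntcod \<tau>,
     ntc = (\<lambda>x \<in> Ob (fdom (ntdom \<sigma>)). ntc \<tau> x \<cdot>\<^bsub>fcod (ntdom \<sigma>)\<^esub> ntc \<sigma> x)\<rparr>"

definition nt_hcomp ::
  "('c, 'd, 'e, 'f) nattr \<Rightarrow> ('a, 'b, 'c, 'd) nattr \<Rightarrow> ('a, 'b, 'e, 'f) nattr" (infixr "\<star>\<^sub>N" 80) where
  "\<tau> \<star>\<^sub>N \<sigma> = \<lparr>ntdom = ntdom \<tau> \<circ>\<^sub>F ntdom \<sigma>, ntcod = ntcod \<tau> \<circ>\<^sub>F ntcod \<sigma>,
     ntc = (\<lambda>x \<in> Ob (fdom (ntdom \<sigma>)).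
       ntc \<tau> (fob (ntcod \<sigma>) x) \<cdot>\<^bsub>fcod (ntdom \<tau>)\<^esub> far (ntdom \<tau>) (ntc \<sigma> x))\<rparr>"

definition faithful_functor :: "('a, 'b, 'c, 'd) func \<Rightarrow> bool" where
  "faithful_functor F \<longleftrightarrow> is_functor F \<and>
     (\<forall>x \<in> Ob (fdom F). \<forall>y \<in> Ob (fdom F). inj_on (far F) (Homset (fdom F) x y))"

definition fully_faithful_functor :: "('a, 'b, 'c, 'd) func \<Rightarrow> bool" where
  "fully_faithful_functor F \<longleftrightarrow> is_functor F \<and>
     (\<forall>x \<in> Ob (fdom F). \<forall>y \<in> Ob (fdom F).
       bij_betw (far F) (Homset (fdom F) x y) (Homset (fcod F) (fob F x) (fob F y)))"

definition equivalence_functor :: "('a, 'b, 'c, 'd) func \<Rightarrow> bool" where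
  "equivalence_functor F \<longleftrightarrow> is_functor F \<and>
     (\<exists>G \<sigma> \<tau>. is_functor G \<and> fdom G = fcod F \<and> fcod G = fdom F \<and>
        is_nat_iso \<sigma> \<and> ntdom \<sigma> = func_id (fdom F) \<and> ntcod \<sigma> = G \<circ>\<^sub>F F \<and>
        is_nat_iso \<tau> \<and> ntdom \<tau> = F \<circ>\<^sub>F G \<and> ntcod \<tau> = func_id (fcod F))"

text \<open>The category of algebras of the monad \<^term>\<open>T\<close> on \<^term>\<open>C\<close> with unit \<^term>\<open>\<eta>\<close> and
  multiplication \<^term>\<open>\<mu>\<close>; an arrow is a triple of source, target and underlying arrow.\<close>

definition is_algebra ::
  "('a, 'b) cat \<Rightarrow> ('a, 'b, 'a, 'b) func \<Rightarrow> ('a, 'b, 'a, 'b) nattr \<Rightarrow> ('a, 'b, 'a, 'b) nattr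
    \<Rightarrow> 'a \<times> 'b \<Rightarrow> bool" where
  "is_algebra C T \<eta> \<mu> = (\<lambda>(x, h). x \<in> Ob C \<and> h \<in> Homset C (fob T x) x \<and>
     h \<cdot>\<^bsub>C\<^esub> ntc \<eta> x = Idt C x \<and> h \<cdot>\<^bsub>C\<^esub> far T h = h \<cdot>\<^bsub>C\<^esub> ntc \<mu> x)"

definition algebra_cat ::
  "('a, 'b) cat \<Rightarrow> ('a, 'b, 'a, 'b) func \<Rightarrow> ('a, 'b, 'a, 'b) nattr \<Rightarrow> ('a, 'b, 'a, 'b) nattr
    \<Rightarrow> ('a \<times> 'b, ('a \<times> 'b) \<times> ('a \<times> 'b) \<times> 'b) cat" where
  "algebra_cat C T \<eta> \<mu> = \<lparr>
     Ob = {p. is_algebra C T \<eta> \<mu> p},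
     Ar = {(p, q, s). is_algebra C T \<eta> \<mu> p \<and> is_algebra C T \<eta> \<mu> q \<and> s \<in> Homset C (fst p) (fst q)
             \<and> s \<cdot>\<^bsub>C\<^esub> snd p = snd q \<cdot>\<^bsub>C\<^esub> far T s},
     Dom = (\<lambda>(p, q, s). p),
     Cod = (\<lambda>(p, q, s). q),
     Idt = (\<lambda>p. (p, p, Idt C (fst p))),
     Cmp = (\<lambda>(q', r, s') (p, q, s). (p, r, s' \<cdot>\<^bsub>C\<^esub> s))\<rparr>"


section \<open>2-categories\<close>

text \<open>1-cells have source and target objects, 2-cells have domain and codomain 1-cells.
  \<open>g \<odot> f\<close> is composition of 1-cells, \<open>\<tau> \<bullet> \<sigma>\<close> vertical and \<open>\<tau> \<star> \<sigma>\<close> horizontal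
  composition of 2-cells, all in applicative order.\<close>

record ('o, 'm, 'c) tcat =
  obs :: "'o set"
  ars :: "'m set"
  cells :: "'c set"
  src :: "'m \<Rightarrow> 'o"
  tgt :: "'m \<Rightarrow> 'o"
  cdom :: "'c \<Rightarrow> 'm"
  ccod :: "'c \<Rightarrow> 'm"
  id1 :: "'o \<Rightarrow> 'm"
  id2 :: "'m \<Rightarrow> 'c"
  comp1 :: "'m \<Rightarrow> 'm \<Rightarrow> 'm" (infixr "\<odot>\<index>" 80)
  vcomp :: "'c \<Rightarrow> 'c \<Rightarrow> 'c" (infixr "\<bullet>\<index>" 75)
  hcomp :: "'c \<Rightarrow> 'c \<Rightarrow> 'c" (infixr "\<star>\<index>" 80)

definition cat1 :: "('o, 'm, 'c) tcat \<Rightarrow> ('o, 'm) cat" where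
  "cat1 K = \<lparr>Ob = obs K, Ar = ars K, Dom = src K, Cod = tgt K, Idt = id1 K, Cmp = comp1 K\<rparr>"

definition vcat :: "('o, 'm, 'c) tcat \<Rightarrow> ('m, 'c) cat" where
  "vcat K = \<lparr>Ob = ars K, Ar = cells K, Dom = cdom K, Cod = ccod K, Idt = id2 K, Cmp = vcomp K\<rparr>"

definition hom_cat :: "('o, 'm, 'c) tcat \<Rightarrow> 'o \<Rightarrow> 'o \<Rightarrow> ('m, 'c) cat" where
  "hom_cat K x y = \<lparr>Ob = {f \<in> ars K. src K f = x \<and> tgt K f = y},
     Ar = {\<sigma> \<in> cells K. src K (cdom K \<sigma>) = x \<and> tgt K (cdom K \<sigma>) = y},
     Dom = cdom K, Cod = ccod K, Idt = id2 K, Cmp = vcomp K\<rparr>"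

locale two_category =
  fixes K :: "('o, 'm, 'c) tcat" (structure)
  assumes category_cat1: "category (cat1 K)"
    and category_vcat: "category (vcat K)"
    and src_cod: "\<sigma> \<in> cells K \<Longrightarrow> src K (ccod K \<sigma>) = src K (cdom K \<sigma>)"
    and tgt_cod: "\<sigma> \<in> cells K \<Longrightarrow> tgt K (ccod K \<sigma>) = tgt K (cdom K \<sigma>)"
    and hcomp_cells: "\<lbrakk>\<tau> \<in> cells K; \<sigma> \<in> cells K; src K (cdom K \<tau>) = tgt K (cdom K \<sigma>)\<rbrakk>
      \<Longrightarrow> \<tau> \<star> \<sigma> \<in> cells K"
    and dom_hcomp: "\<lbrakk>\<tau> \<in> cells K; \<sigma> \<in> cells K; src K (cdom K \<tau>) = tgt K (cdom K \<sigma>)\<rbrakk>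
      \<Longrightarrow> cdom K (\<tau> \<star> \<sigma>) = cdom K \<tau> \<odot> cdom K \<sigma>"
    and cod_hcomp: "\<lbrakk>\<tau> \<in> cells K; \<sigma> \<in> cells K; src K (cdom K \<tau>) = tgt K (cdom K \<sigma>)\<rbrakk>
      \<Longrightarrow> ccod K (\<tau> \<star> \<sigma>) = ccod K \<tau> \<odot> ccod K \<sigma>"
    and hcomp_id2: "\<lbrakk>g \<in> ars K; f \<in> ars K; src K g = tgt K f\<rbrakk>
      \<Longrightarrow> id2 K g \<star> id2 K f = id2 K (g \<odot> f)"
    and interchange: "\<lbrakk>\<tau>' \<in> cells K; \<tau> \<in> cells K; \<sigma>' \<in> cells K; \<sigma> \<in> cells K;
        cdom K \<tau>' = ccod K \<tau>; cdom K \<sigma>' = ccod K \<sigma>;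
        src K (cdom K \<tau>) = tgt K (cdom K \<sigma>)\<rbrakk>
      \<Longrightarrow> (\<tau>' \<bullet> \<tau>) \<star> (\<sigma>' \<bullet> \<sigma>) = (\<tau>' \<star> \<sigma>') \<bullet> (\<tau> \<star> \<sigma>)"
    and hcomp_assoc: "\<lbrakk>\<rho> \<in> cells K; \<tau> \<in> cells K; \<sigma> \<in> cells K;
        src K (cdom K \<rho>) = tgt K (cdom K \<tau>);
        src K (cdom K \<tau>) = tgt K (cdom K \<sigma>)\<rbrakk>
      \<Longrightarrow> (\<rho> \<star> \<tau>) \<star> \<sigma> = \<rho> \<star> (\<tau> \<star> \<sigma>)"
    and hcomp_unit_right: "\<sigma> \<in> cells K \<Longrightarrow> \<sigma> \<star> id2 K (id1 K (src K (cdom K \<sigma>))) = \<sigma>"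
    and hcomp_unit_left: "\<sigma> \<in> cells K \<Longrightarrow> id2 K (id1 K (tgt K (cdom K \<sigma>))) \<star> \<sigma> = \<sigma>"

definition in_hom1 :: "('o, 'm, 'c) tcat \<Rightarrow> 'm \<Rightarrow> 'o \<Rightarrow> 'o \<Rightarrow> bool" where
  "in_hom1 K f x y \<longleftrightarrow> f \<in> ars K \<and> src K f = x \<and> tgt K f = y"

definition in_hom2 :: "('o, 'm, 'c) tcat \<Rightarrow> 'c \<Rightarrow> 'm \<Rightarrow> 'm \<Rightarrow> bool" where
  "in_hom2 K \<sigma> f g \<longleftrightarrow> \<sigma> \<in> cells K \<and> cdom K \<sigma> = f \<and> ccod K \<sigma> = g"

abbreviation invertible2 :: "('o, 'm, 'c) tcat \<Rightarrow> 'c \<Rightarrow> bool" where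
  "invertible2 K \<equiv> is_iso (vcat K)"

definition inv2 :: "('o, 'm, 'c) tcat \<Rightarrow> 'c \<Rightarrow> 'c" where
  "inv2 K \<sigma> = (THE \<tau>. inverse_arrows (vcat K) \<sigma> \<tau>)"

definition cpairs :: "('o, 'm, 'c) tcat \<Rightarrow> ('m \<times> 'm) set" where
  "cpairs K = {(g, f). g \<in> ars K \<and> f \<in> ars K \<and> src K g = tgt K f}"

text \<open>The dual with reversed 1-cells (and unreversed 2-cells).\<close>

definition op1 :: "('o, 'm, 'c) tcat \<Rightarrow> ('o, 'm, 'c) tcat" where
  "op1 K = K\<lparr>src := tgt K, tgt := src K, comp1 := (\<lambda>g f. f \<odot>\<^bsub>K\<^esub> g), hcomp := (\<lambda>\<tau> \<sigma>. \<sigma> \<star>\<^bsub>K\<^esub> \<tau>)\<rparr>"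

text \<open>The 2-category of all categories with objects in \<^typ>\<open>'a\<close> and arrows in \<^typ>\<open>'b\<close>.\<close>

definition CAT ::
  "(('a, 'b) cat, ('a, 'b, 'a, 'b) func, ('a, 'b, 'a, 'b) nattr) tcat" where
  "CAT = \<lparr>obs = {C. category C}, ars = {F. is_functor F}, cells = {\<tau>. is_nattr \<tau>},
     src = fdom, tgt = fcod, cdom = ntdom, ccod = ntcod, id1 = func_id, id2 = nt_id,
     comp1 = func_comp, vcomp = nt_vcomp, hcomp = nt_hcomp\<rparr>"


section \<open>Pseudofunctors, pseudonatural transformations, modifications\<close>

text \<open>\<open>pfc F (g, f) : F g \<odot> F f \<Rightarrow> F (g \<odot> f)\<close> and \<open>pfi F x : id \<Rightarrow> F (id x)\<close> are the
  coherence cells.\<close>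

record ('o, 'm, 'c, 'p, 'n, 'd) psfun =
  pf0 :: "'o \<Rightarrow> 'p"
  pf1 :: "'m \<Rightarrow> 'n"
  pf2 :: "'c \<Rightarrow> 'd"
  pfc :: "'m \<times> 'm \<Rightarrow> 'd"
  pfi :: "'o \<Rightarrow> 'd"

locale pseudofunctor =
  fixes S :: "('o, 'm, 'c) tcat" and K :: "('p, 'n, 'd) tcat" (structure)
    and F :: "('o, 'm, 'c, 'p, 'n, 'd) psfun"
  assumes pf0_ext: "pf0 F \<in> extensional (obs S)"
    and pf1_ext: "pf1 F \<in> extensional (ars S)"
    and pf2_ext: "pf2 F \<in> extensional (cells S)"
    and pfc_ext: "pfc F \<in> extensional (cpairs S)"
    and pfi_ext: "pfi F \<in> extensional (obs S)"
    and pf0_obs: "x \<in> obs S \<Longrightarrow> pf0 F x \<in> obs K"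
    and pf1_hom: "f \<in> ars S \<Longrightarrow> in_hom1 K (pf1 F f) (pf0 F (src S f)) (pf0 F (tgt S f))"
    and pf2_hom: "\<sigma> \<in> cells S \<Longrightarrow> in_hom2 K (pf2 F \<sigma>) (pf1 F (cdom S \<sigma>)) (pf1 F (ccod S \<sigma>))"
    and pf2_id2: "f \<in> ars S \<Longrightarrow> pf2 F (id2 S f) = id2 K (pf1 F f)"
    and pf2_vcomp: "\<lbrakk>\<tau> \<in> cells S; \<sigma> \<in> cells S; cdom S \<tau> = ccod S \<sigma>\<rbrakk>
      \<Longrightarrow> pf2 F (\<tau> \<bullet>\<^bsub>S\<^esub> \<sigma>) = pf2 F \<tau> \<bullet> pf2 F \<sigma>"
    and pfc_hom: "(g, f) \<in> cpairs S \<Longrightarrow>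
      in_hom2 K (pfc F (g, f)) (pf1 F g \<odot> pf1 F f) (pf1 F (g \<odot>\<^bsub>S\<^esub> f))"
    and pfc_inv: "(g, f) \<in> cpairs S \<Longrightarrow> invertible2 K (pfc F (g, f))"
    and pfi_hom: "x \<in> obs S \<Longrightarrow> in_hom2 K (pfi F x) (id1 K (pf0 F x)) (pf1 F (id1 S x))"
    and pfi_inv: "x \<in> obs S \<Longrightarrow> invertible2 K (pfi F x)"
    and pfc_nat: "\<lbrakk>\<tau> \<in> cells S; \<sigma> \<in> cells S; src S (cdom S \<tau>) = tgt S (cdom S \<sigma>)\<rbrakk>
      \<Longrightarrow> pf2 F (\<tau> \<star>\<^bsub>S\<^esub> \<sigma>) \<bullet> pfc F (cdom S \<tau>, cdom S \<sigma>)
        = pfc F (ccod S \<tau>, ccod S \<sigma>) \<bullet> (pf2 F \<tau> \<star> pf2 F \<sigma>)"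
    and pfc_assoc: "\<lbrakk>(h, g) \<in> cpairs S; (g, f) \<in> cpairs S\<rbrakk>
      \<Longrightarrow> pfc F (h, g \<odot>\<^bsub>S\<^esub> f) \<bullet> (id2 K (pf1 F h) \<star> pfc F (g, f))
        = pfc F (h \<odot>\<^bsub>S\<^esub> g, f) \<bullet> (pfc F (h, g) \<star> id2 K (pf1 F f))"
    and pfc_unit_right: "f \<in> ars S
      \<Longrightarrow> pfc F (f, id1 S (src S f)) \<bullet> (id2 K (pf1 F f) \<star> pfi F (src S f)) = id2 K (pf1 F f)"
    and pfc_unit_left: "f \<in> ars S
      \<Longrightarrow> pfc F (id1 S (tgt S f), f) \<bullet> (pfi F (tgt S f) \<star> id2 K (pf1 F f)) = id2 K (pf1 F f)"

text \<open>The pseudofunctor with the given action on cells and identities as coherence cells.\<close>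

definition strict_psfun ::
  "('o, 'm, 'c) tcat \<Rightarrow> ('p, 'n, 'd) tcat \<Rightarrow> ('o \<Rightarrow> 'p) \<Rightarrow> ('m \<Rightarrow> 'n) \<Rightarrow> ('c \<Rightarrow> 'd)
    \<Rightarrow> ('o, 'm, 'c, 'p, 'n, 'd) psfun" where
  "strict_psfun S K F0 F1 F2 = \<lparr>
     pf0 = restrict F0 (obs S), pf1 = restrict F1 (ars S), pf2 = restrict F2 (cells S),
     pfc = (\<lambda>(g, f) \<in> cpairs S. id2 K (F1 (g \<odot>\<^bsub>S\<^esub> f))), pfi = (\<lambda>x \<in> obs S. id2 K (F1 (id1 S x)))\<rparr>"

definition two_functor ::
  "('o, 'm, 'c) tcat \<Rightarrow> ('p, 'n, 'd) tcat \<Rightarrow> ('o, 'm, 'c, 'p, 'n, 'd) psfun \<Rightarrow> bool" where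
  "two_functor S K F \<longleftrightarrow> pseudofunctor S K F
     \<and> (\<forall>(g, f) \<in> cpairs S. pfc F (g, f) = id2 K (pf1 F (g \<odot>\<^bsub>S\<^esub> f)))
     \<and> (\<forall>x \<in> obs S. pfi F x = id2 K (pf1 F (id1 S x)))"

definition psfun_id :: "('o, 'm, 'c) tcat \<Rightarrow> ('o, 'm, 'c, 'o, 'm, 'c) psfun" where
  "psfun_id K = strict_psfun K K (\<lambda>x. x) (\<lambda>f. f) (\<lambda>\<sigma>. \<sigma>)"

text \<open>\<open>psfun_comp S K G F\<close> is \<open>G \<circ> F\<close>, where \<open>F\<close> starts in \<^term>\<open>S\<close> and \<open>G\<close> ends in \<^term>\<open>K\<close>.\<close>

definition psfun_comp ::
  "('o, 'm, 'c) tcat \<Rightarrow> ('q, 'l, 'e) tcat \<Rightarrow> ('p, 'n, 'd, 'q, 'l, 'e) psfun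
    \<Rightarrow> ('o, 'm, 'c, 'p, 'n, 'd) psfun \<Rightarrow> ('o, 'm, 'c, 'q, 'l, 'e) psfun" where
  "psfun_comp S K G F = \<lparr>
     pf0 = (\<lambda>x \<in> obs S. pf0 G (pf0 F x)),
     pf1 = (\<lambda>f \<in> ars S. pf1 G (pf1 F f)),
     pf2 = (\<lambda>\<sigma> \<in> cells S. pf2 G (pf2 F \<sigma>)),
     pfc = (\<lambda>(g, f) \<in> cpairs S. pf2 G (pfc F (g, f)) \<bullet>\<^bsub>K\<^esub> pfc G (pf1 F g, pf1 F f)),
     pfi = (\<lambda>x \<in> obs S. pf2 G (pfi F x) \<bullet>\<^bsub>K\<^esub> pfi G (pf0 F x))\<rparr>"

record ('o, 'm, 'c, 'p, 'n, 'd) psnat =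
  psrc :: "('o, 'm, 'c, 'p, 'n, 'd) psfun"
  ptgt :: "('o, 'm, 'c, 'p, 'n, 'd) psfun"
  pcomp :: "'o \<Rightarrow> 'n"
  pnat :: "'m \<Rightarrow> 'd"

locale pseudonatural =
  fixes S :: "('o, 'm, 'c) tcat" and K :: "('p, 'n, 'd) tcat" (structure)
    and \<alpha> :: "('o, 'm, 'c, 'p, 'n, 'd) psnat"
  assumes psrc_psfun: "pseudofunctor S K (psrc \<alpha>)"
    and ptgt_psfun: "pseudofunctor S K (ptgt \<alpha>)"
    and pcomp_ext: "pcomp \<alpha> \<in> extensional (obs S)"
    and pnat_ext: "pnat \<alpha> \<in> extensional (ars S)"
    and pcomp_hom: "x \<in> obs S \<Longrightarrow> in_hom1 K (pcomp \<alpha> x) (pf0 (psrc \<alpha>) x) (pf0 (ptgt \<alpha>) x)"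
    and pnat_hom: "f \<in> ars S \<Longrightarrow> in_hom2 K (pnat \<alpha> f)
      (pf1 (ptgt \<alpha>) f \<odot> pcomp \<alpha> (src S f)) (pcomp \<alpha> (tgt S f) \<odot> pf1 (psrc \<alpha>) f)"
    and pnat_inv: "f \<in> ars S \<Longrightarrow> invertible2 K (pnat \<alpha> f)"
    and pnat_nat: "\<sigma> \<in> cells S \<Longrightarrow>
      pnat \<alpha> (ccod S \<sigma>) \<bullet> (pf2 (ptgt \<alpha>) \<sigma> \<star> id2 K (pcomp \<alpha> (src S (cdom S \<sigma>))))
      = (id2 K (pcomp \<alpha> (tgt S (cdom S \<sigma>))) \<star> pf2 (psrc \<alpha>) \<sigma>) \<bullet> pnat \<alpha> (cdom S \<sigma>)"
    and pnat_comp: "(g, f) \<in> cpairs S \<Longrightarrow>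
      pnat \<alpha> (g \<odot>\<^bsub>S\<^esub> f) \<bullet> (pfc (ptgt \<alpha>) (g, f) \<star> id2 K (pcomp \<alpha> (src S f)))
      = (id2 K (pcomp \<alpha> (tgt S g)) \<star> pfc (psrc \<alpha>) (g, f))
        \<bullet> (pnat \<alpha> g \<star> id2 K (pf1 (psrc \<alpha>) f)) \<bullet> (id2 K (pf1 (ptgt \<alpha>) g) \<star> pnat \<alpha> f)"
    and pnat_unit: "x \<in> obs S \<Longrightarrow>
      pnat \<alpha> (id1 S x) \<bullet> (pfi (ptgt \<alpha>) x \<star> id2 K (pcomp \<alpha> x))
      = id2 K (pcomp \<alpha> x) \<star> pfi (psrc \<alpha>) x"

record ('o, 'm, 'c, 'p, 'n, 'd) modif =
  msrc :: "('o, 'm, 'c, 'p, 'n, 'd) psnat"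
  mtgt :: "('o, 'm, 'c, 'p, 'n, 'd) psnat"
  mcomp :: "'o \<Rightarrow> 'd"

locale modification =
  fixes S :: "('o, 'm, 'c) tcat" and K :: "('p, 'n, 'd) tcat" (structure)
    and \<Gamma> :: "('o, 'm, 'c, 'p, 'n, 'd) modif"
  assumes msrc_psnat: "pseudonatural S K (msrc \<Gamma>)"
    and mtgt_psnat: "pseudonatural S K (mtgt \<Gamma>)"
    and same_psrc: "psrc (mtgt \<Gamma>) = psrc (msrc \<Gamma>)"
    and same_ptgt: "ptgt (mtgt \<Gamma>) = ptgt (msrc \<Gamma>)"
    and mcomp_ext: "mcomp \<Gamma> \<in> extensional (obs S)"
    and mcomp_hom: "x \<in> obs S \<Longrightarrow> in_hom2 K (mcomp \<Gamma> x) (pcomp (msrc \<Gamma>) x) (pcomp (mtgt \<Gamma>) x)"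
    and mcomp_nat: "f \<in> ars S \<Longrightarrow>
      pnat (mtgt \<Gamma>) f \<bullet> (id2 K (pf1 (ptgt (msrc \<Gamma>)) f) \<star> mcomp \<Gamma> (src S f))
      = (mcomp \<Gamma> (tgt S f) \<star> id2 K (pf1 (psrc (msrc \<Gamma>)) f)) \<bullet> pnat (msrc \<Gamma>) f"

definition psnat_id ::
  "('o, 'm, 'c) tcat \<Rightarrow> ('p, 'n, 'd) tcat \<Rightarrow> ('o, 'm, 'c, 'p, 'n, 'd) psfun
    \<Rightarrow> ('o, 'm, 'c, 'p, 'n, 'd) psnat" where
  "psnat_id S K F = \<lparr>psrc = F, ptgt = F,
     pcomp = (\<lambda>x \<in> obs S. id1 K (pf0 F x)), pnat = (\<lambda>f \<in> ars S. id2 K (pf1 F f))\<rparr>"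

definition psnat_comp ::
  "('o, 'm, 'c) tcat \<Rightarrow> ('p, 'n, 'd) tcat \<Rightarrow> ('o, 'm, 'c, 'p, 'n, 'd) psnat
    \<Rightarrow> ('o, 'm, 'c, 'p, 'n, 'd) psnat \<Rightarrow> ('o, 'm, 'c, 'p, 'n, 'd) psnat" where
  "psnat_comp S K \<beta> \<alpha> = \<lparr>psrc = psrc \<alpha>, ptgt = ptgt \<beta>,
     pcomp = (\<lambda>x \<in> obs S. pcomp \<beta> x \<odot>\<^bsub>K\<^esub> pcomp \<alpha> x),
     pnat = (\<lambda>f \<in> ars S. (id2 K (pcomp \<beta> (tgt S f)) \<star>\<^bsub>K\<^esub> pnat \<alpha> f)
               \<bullet>\<^bsub>K\<^esub> (pnat \<beta> f \<star>\<^bsub>K\<^esub> id2 K (pcomp \<alpha> (src S f))))\<rparr>"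

text \<open>The 2-category of pseudofunctors from \<^term>\<open>S\<close> to \<^term>\<open>K\<close>, pseudonatural transformations and
  modifications.\<close>

definition PS :: "('o, 'm, 'c) tcat \<Rightarrow> ('p, 'n, 'd) tcat \<Rightarrow>
  (('o, 'm, 'c, 'p, 'n, 'd) psfun, ('o, 'm, 'c, 'p, 'n, 'd) psnat, ('o, 'm, 'c, 'p, 'n, 'd) modif) tcat"
  where
  "PS S K = \<lparr>
     obs = {F. pseudofunctor S K F}, ars = {\<alpha>. pseudonatural S K \<alpha>}, cells = {\<Gamma>. modification S K \<Gamma>},
     src = psrc, tgt = ptgt, cdom = msrc, ccod = mtgt,
     id1 = psnat_id S K,
     id2 = (\<lambda>\<alpha>. \<lparr>msrc = \<alpha>, mtgt = \<alpha>, mcomp = (\<lambda>x \<in> obs S. id2 K (pcomp \<alpha> x))\<rparr>),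
     comp1 = psnat_comp S K,
     vcomp = (\<lambda>\<Delta> \<Gamma>. \<lparr>msrc = msrc \<Gamma>, mtgt = mtgt \<Delta>,
        mcomp = (\<lambda>x \<in> obs S. mcomp \<Delta> x \<bullet>\<^bsub>K\<^esub> mcomp \<Gamma> x)\<rparr>),
     hcomp = (\<lambda>\<Delta> \<Gamma>. \<lparr>msrc = psnat_comp S K (msrc \<Delta>) (msrc \<Gamma>),
        mtgt = psnat_comp S K (mtgt \<Delta>) (mtgt \<Gamma>),
        mcomp = (\<lambda>x \<in> obs S. mcomp \<Delta> x \<star>\<^bsub>K\<^esub> mcomp \<Gamma> x)\<rparr>)\<rparr>"

text \<open>\<open>psnat_wr S K \<alpha> D\<close> is \<open>\<alpha> * D\<close> for a pseudofunctor \<open>D\<close> starting in \<^term>\<open>S\<close>;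
  \<open>psnat_wl S K G \<alpha>\<close> is \<open>G * \<alpha>\<close> for a pseudofunctor \<open>G\<close> ending in \<^term>\<open>K\<close> and \<open>\<alpha>\<close> defined
  on \<^term>\<open>S\<close>.\<close>

definition psnat_wr ::
  "('o, 'm, 'c) tcat \<Rightarrow> ('q, 'l, 'e) tcat \<Rightarrow> ('p, 'n, 'd, 'q, 'l, 'e) psnat
    \<Rightarrow> ('o, 'm, 'c, 'p, 'n, 'd) psfun \<Rightarrow> ('o, 'm, 'c, 'q, 'l, 'e) psnat" where
  "psnat_wr S K \<alpha> D = \<lparr>psrc = psfun_comp S K (psrc \<alpha>) D, ptgt = psfun_comp S K (ptgt \<alpha>) D,
     pcomp = (\<lambda>x \<in> obs S. pcomp \<alpha> (pf0 D x)), pnat = (\<lambda>f \<in> ars S. pnat \<alpha> (pf1 D f))\<rparr>"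

definition psnat_wl ::
  "('o, 'm, 'c) tcat \<Rightarrow> ('q, 'l, 'e) tcat \<Rightarrow> ('p, 'n, 'd, 'q, 'l, 'e) psfun
    \<Rightarrow> ('o, 'm, 'c, 'p, 'n, 'd) psnat \<Rightarrow> ('o, 'm, 'c, 'q, 'l, 'e) psnat" where
  "psnat_wl S K G \<alpha> = \<lparr>psrc = psfun_comp S K G (psrc \<alpha>), ptgt = psfun_comp S K G (ptgt \<alpha>),
     pcomp = (\<lambda>x \<in> obs S. pf1 G (pcomp \<alpha> x)),
     pnat = (\<lambda>f \<in> ars S. inv2 K (pfc G (pcomp \<alpha> (tgt S f), pf1 (psrc \<alpha>) f))
               \<bullet>\<^bsub>K\<^esub> pf2 G (pnat \<alpha> f)
               \<bullet>\<^bsub>K\<^esub> pfc G (pf1 (ptgt \<alpha>) f, pcomp \<alpha> (src S f)))\<rparr>"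

definition modif_wr ::
  "('o, 'm, 'c) tcat \<Rightarrow> ('q, 'l, 'e) tcat \<Rightarrow> ('p, 'n, 'd, 'q, 'l, 'e) modif
    \<Rightarrow> ('o, 'm, 'c, 'p, 'n, 'd) psfun \<Rightarrow> ('o, 'm, 'c, 'q, 'l, 'e) modif" where
  "modif_wr S K \<Gamma> D = \<lparr>msrc = psnat_wr S K (msrc \<Gamma>) D, mtgt = psnat_wr S K (mtgt \<Gamma>) D,
     mcomp = (\<lambda>x \<in> obs S. mcomp \<Gamma> (pf0 D x))\<rparr>"

text \<open>Precomposition \<open>- \<circ> D : [T, K]\<^sub>P\<^sub>S \<rightarrow> [S, K]\<^sub>P\<^sub>S\<close> with \<open>D : S \<rightarrow> T\<close>.\<close>

definition precomp ::
  "('o, 'm, 'c) tcat \<Rightarrow> ('p, 'n, 'd) tcat \<Rightarrow> ('q, 'l, 'e) tcat \<Rightarrow> ('o, 'm, 'c, 'p, 'n, 'd) psfun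
   \<Rightarrow> (('p, 'n, 'd, 'q, 'l, 'e) psfun, ('p, 'n, 'd, 'q, 'l, 'e) psnat, ('p, 'n, 'd, 'q, 'l, 'e) modif,
       ('o, 'm, 'c, 'q, 'l, 'e) psfun, ('o, 'm, 'c, 'q, 'l, 'e) psnat, ('o, 'm, 'c, 'q, 'l, 'e) modif)
      psfun" where
  "precomp S T K D = strict_psfun (PS T K) (PS S K)
     (\<lambda>G. psfun_comp S K G D) (\<lambda>\<alpha>. psnat_wr S K \<alpha> D) (\<lambda>\<Gamma>. modif_wr S K \<Gamma> D)"


section \<open>Representables\<close>

text \<open>\<open>corep K x = K(x, -) : K \<rightarrow> CAT\<close>; contravariant hom-functors are \<open>corep (op1 K) x\<close>.\<close>

definition corep_ar ::
  "('o, 'm, 'c) tcat \<Rightarrow> 'o \<Rightarrow> 'm \<Rightarrow> ('m, 'c, 'm, 'c) func" where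
  "corep_ar K x g = \<lparr>fdom = hom_cat K x (src K g), fcod = hom_cat K x (tgt K g),
     fob = (\<lambda>f \<in> Ob (hom_cat K x (src K g)). g \<odot>\<^bsub>K\<^esub> f),
     far = (\<lambda>\<sigma> \<in> Ar (hom_cat K x (src K g)). id2 K g \<star>\<^bsub>K\<^esub> \<sigma>)\<rparr>"

definition corep_cell ::
  "('o, 'm, 'c) tcat \<Rightarrow> 'o \<Rightarrow> 'c \<Rightarrow> ('m, 'c, 'm, 'c) nattr" where
  "corep_cell K x \<tau> = \<lparr>ntdom = corep_ar K x (cdom K \<tau>), ntcod = corep_ar K x (ccod K \<tau>),
     ntc = (\<lambda>f \<in> Ob (hom_cat K x (src K (cdom K \<tau>))). \<tau> \<star>\<^bsub>K\<^esub> id2 K f)\<rparr>"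

definition corep ::
  "('o, 'm, 'c) tcat \<Rightarrow> 'o \<Rightarrow> ('o, 'm, 'c, ('m, 'c) cat, ('m, 'c, 'm, 'c) func, ('m, 'c, 'm, 'c) nattr) psfun"
  where
  "corep K x = strict_psfun K CAT (hom_cat K x) (corep_ar K x) (corep_cell K x)"

text \<open>The 2-functor \<open>K\<^sup>o\<^sup>p \<rightarrow> [K, CAT]\<^sub>P\<^sub>S\<close>, \<open>x \<mapsto> K(x, -)\<close>. On 1-cells and 2-cells it is given by
  the covariant action of \<open>K\<^sup>o\<^sup>p\<close> on \<open>K\<^sup>o\<^sup>p(y, -)\<close> in each component \<^term>\<open>y\<close>; the naturality cells
  are identities.\<close>

definition yoneda_ar ::
  "('o, 'm, 'c) tcat \<Rightarrow> 'm \<Rightarrow>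
    ('o, 'm, 'c, ('m, 'c) cat, ('m, 'c, 'm, 'c) func, ('m, 'c, 'm, 'c) nattr) psnat" where
  "yoneda_ar K f = \<lparr>psrc = corep K (tgt K f), ptgt = corep K (src K f),
     pcomp = (\<lambda>y \<in> obs K. corep_ar (op1 K) y f),
     pnat = (\<lambda>g \<in> ars K. nt_id (corep_ar K (src K f) g \<circ>\<^sub>F corep_ar (op1 K) (src K g) f))\<rparr>"

definition yoneda_cell ::
  "('o, 'm, 'c) tcat \<Rightarrow> 'c \<Rightarrow>
    ('o, 'm, 'c, ('m, 'c) cat, ('m, 'c, 'm, 'c) func, ('m, 'c, 'm, 'c) nattr) modif" where
  "yoneda_cell K \<phi> = \<lparr>msrc = yoneda_ar K (cdom K \<phi>), mtgt = yoneda_ar K (ccod K \<phi>),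
     mcomp = (\<lambda>y \<in> obs K. corep_cell (op1 K) y \<phi>)\<rparr>"

definition yoneda ::
  "('o, 'm, 'c) tcat \<Rightarrow> ('o, 'm, 'c,
     ('o, 'm, 'c, ('m, 'c) cat, ('m, 'c, 'm, 'c) func, ('m, 'c, 'm, 'c) nattr) psfun,
     ('o, 'm, 'c, ('m, 'c) cat, ('m, 'c, 'm, 'c) func, ('m, 'c, 'm, 'c) nattr) psnat,
     ('o, 'm, 'c, ('m, 'c) cat, ('m, 'c, 'm, 'c) func, ('m, 'c, 'm, 'c) nattr) modif) psfun" where
  "yoneda K = strict_psfun (op1 K) (PS K CAT) (corep K) (yoneda_ar K) (yoneda_cell K)"

text \<open>A pseudonatural family of equivalences of categories between \<open>CAT\<close>-valued pseudofunctors. The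
  categories on the two sides may live in different types, so that this is not an instance of
  \<^const>\<open>pseudonatural\<close>; the axioms are the same.\<close>

locale pseudonat_equivalence =
  fixes S :: "('o, 'm, 'c) tcat"
    and F :: "('o, 'm, 'c, ('a, 'b) cat, ('a, 'b, 'a, 'b) func, ('a, 'b, 'a, 'b) nattr) psfun"
    and G :: "('o, 'm, 'c, ('x, 'y) cat, ('x, 'y, 'x, 'y) func, ('x, 'y, 'x, 'y) nattr) psfun"
    and \<Phi> :: "'o \<Rightarrow> ('a, 'b, 'x, 'y) func"
    and \<phi> :: "'m \<Rightarrow> ('a, 'b, 'x, 'y) nattr"
  assumes psfun_F: "pseudofunctor S CAT F"
    and psfun_G: "pseudofunctor S CAT G"
    and equiv: "x \<in> obs S \<Longrightarrow>
      equivalence_functor (\<Phi> x) \<and> fdom (\<Phi> x) = pf0 F x \<and> fcod (\<Phi> x) = pf0 G x"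
    and nat_iso: "f \<in> ars S \<Longrightarrow> is_nat_iso (\<phi> f)
      \<and> ntdom (\<phi> f) = pf1 G f \<circ>\<^sub>F \<Phi> (src S f) \<and> ntcod (\<phi> f) = \<Phi> (tgt S f) \<circ>\<^sub>F pf1 F f"
    and natural: "\<sigma> \<in> cells S \<Longrightarrow>
      \<phi> (ccod S \<sigma>) \<cdot>\<^sub>N (pf2 G \<sigma> \<star>\<^sub>N nt_id (\<Phi> (src S (cdom S \<sigma>))))
      = (nt_id (\<Phi> (tgt S (cdom S \<sigma>))) \<star>\<^sub>N pf2 F \<sigma>) \<cdot>\<^sub>N \<phi> (cdom S \<sigma>)"
    and coherence_comp: "(g, f) \<in> cpairs S \<Longrightarrow>
      \<phi> (g \<odot>\<^bsub>S\<^esub> f) \<cdot>\<^sub>N (pfc G (g, f) \<star>\<^sub>N nt_id (\<Phi> (src S f)))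
      = (nt_id (\<Phi> (tgt S g)) \<star>\<^sub>N pfc F (g, f))
        \<cdot>\<^sub>N (\<phi> g \<star>\<^sub>N nt_id (pf1 F f)) \<cdot>\<^sub>N (nt_id (pf1 G g) \<star>\<^sub>N \<phi> f)"
    and coherence_unit: "x \<in> obs S \<Longrightarrow>
      \<phi> (id1 S x) \<cdot>\<^sub>N (pfi G x \<star>\<^sub>N nt_id (\<Phi> x)) = nt_id (\<Phi> x) \<star>\<^sub>N pfi F x"


section \<open>Weighted bilimits and bicategorical completeness\<close>

text \<open>The 2-functor \<open>X \<mapsto> [S, CAT]\<^sub>P\<^sub>S(W, H(X, D -))\<close> from \<open>H\<^sup>o\<^sup>p\<close> to \<open>CAT\<close>.\<close>

definition weighted_cones where
  "weighted_cones H S W D = psfun_comp (op1 H) CAT (corep (PS S CAT) W)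
     (psfun_comp (op1 H) (PS S CAT) (precomp S H CAT D) (yoneda H))"

definition is_bilimit where
  "is_bilimit H S W D L \<longleftrightarrow> L \<in> obs H \<and>
     (\<exists>\<Phi> \<phi>. pseudonat_equivalence (op1 H) (corep (op1 H) L) (weighted_cones H S W D) \<Phi> \<phi>)"

text \<open>A cardinal \<open>\<kappa>\<close> on the type \<^typ>\<open>'k\<close> delimits the small sets. \<^typ>\<open>'k\<close> itself plays the role
  of the larger universe in which the (possibly large) hom-categories of \<open>H\<close> live. A Grothendieck
  universe corresponds to an inaccessible \<open>\<kappa>\<close>. Weights of small bilimits take small values.\<close>

definition small_set :: "'k rel \<Rightarrow> 'a set \<Rightarrow> bool" where
  "small_set \<kappa> X \<longleftrightarrow> |X| <o \<kappa>"

definition small_cat :: "'k rel \<Rightarrow> ('a, 'b) cat \<Rightarrow> bool" where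
  "small_cat \<kappa> C \<longleftrightarrow> category C \<and> small_set \<kappa> (Ob C) \<and> small_set \<kappa> (Ar C)"

definition small_two_category :: "'k rel \<Rightarrow> ('o, 'm, 'c) tcat \<Rightarrow> bool" where
  "small_two_category \<kappa> S \<longleftrightarrow>
     two_category S \<and> small_set \<kappa> (obs S) \<and> small_set \<kappa> (ars S) \<and> small_set \<kappa> (cells S)"

definition bicategorically_complete :: "'k rel \<Rightarrow> ('o, 'k, 'k) tcat \<Rightarrow> bool" where
  "bicategorically_complete \<kappa> H \<longleftrightarrow>
     (\<forall>(S :: ('k, 'k, 'k) tcat) W D.
        small_two_category \<kappa> S \<and> pseudofunctor S CAT W \<and> (\<forall>s \<in> obs S. small_cat \<kappa> (pf0 W s))
          \<and> pseudofunctor S H D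
        \<longrightarrow> (\<exists>L. is_bilimit H S (W :: ('k, 'k, 'k, ('k, 'k) cat, _, _) psfun) D L))"


section \<open>1-cells, adjunctions and monadicity\<close>

definition faithful1 :: "('o, 'm, 'c) tcat \<Rightarrow> 'm \<Rightarrow> bool" where
  "faithful1 H f \<longleftrightarrow> f \<in> ars H \<and> (\<forall>x \<in> obs H. faithful_functor (pf1 (corep H x) f))"

definition fully_faithful1 :: "('o, 'm, 'c) tcat \<Rightarrow> 'm \<Rightarrow> bool" where
  "fully_faithful1 H f \<longleftrightarrow> f \<in> ars H \<and> (\<forall>x \<in> obs H. fully_faithful_functor (pf1 (corep H x) f))"

definition equivalence1 :: "('o, 'm, 'c) tcat \<Rightarrow> 'm \<Rightarrow> bool" where
  "equivalence1 H f \<longleftrightarrow> f \<in> ars H \<and>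
     (\<exists>g \<sigma> \<tau>. in_hom1 H g (tgt H f) (src H f)
        \<and> in_hom2 H \<sigma> (id1 H (src H f)) (g \<odot>\<^bsub>H\<^esub> f) \<and> invertible2 H \<sigma>
        \<and> in_hom2 H \<tau> (f \<odot>\<^bsub>H\<^esub> g) (id1 H (tgt H f)) \<and> invertible2 H \<tau>)"

text \<open>\<open>l \<stileturn> u\<close> with unit \<open>\<eta>\<close> and counit \<open>\<epsilon>\<close>.\<close>

locale adjunction1 =
  fixes H :: "('o, 'm, 'c) tcat" (structure) and l u :: 'm and \<eta> \<epsilon> :: 'c
  assumes u_ar: "u \<in> ars H"
    and l_hom: "in_hom1 H l (tgt H u) (src H u)"
    and unit_hom: "in_hom2 H \<eta> (id1 H (tgt H u)) (u \<odot> l)"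
    and counit_hom: "in_hom2 H \<epsilon> (l \<odot> u) (id1 H (src H u))"
    and triangle_u: "(id2 H u \<star> \<epsilon>) \<bullet> (\<eta> \<star> id2 H u) = id2 H u"
    and triangle_l: "(\<epsilon> \<star> id2 H l) \<bullet> (id2 H l \<star> \<eta>) = id2 H l"

text \<open>The 2-functor from \<open>H\<^sup>o\<^sup>p\<close> to \<open>CAT\<close> sending \<open>X\<close> to the category of algebras of the monad
  \<open>H(X, T)\<close> on \<open>H(X, b)\<close>, where \<open>(T, \<eta>, \<mu>)\<close> is a monad on the object \<open>b\<close>.\<close>

definition algebras where
  "algebras H b T \<eta> \<mu> = (let
     alg = (\<lambda>X. algebra_cat (hom_cat H X b) (pf1 (corep H X) T) (pf2 (corep H X) \<eta>) (pf2 (corep H X) \<mu>));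
     act = (\<lambda>f (x, h). (x \<odot>\<^bsub>H\<^esub> f, h \<star>\<^bsub>H\<^esub> id2 H f));
     alg1 = (\<lambda>f. \<lparr>fdom = alg (tgt H f), fcod = alg (src H f),
       fob = restrict (act f) (Ob (alg (tgt H f))),
       far = (\<lambda>(p, q, s) \<in> Ar (alg (tgt H f)). (act f p, act f q, s \<star>\<^bsub>H\<^esub> id2 H f))\<rparr>);
     alg2 = (\<lambda>\<phi>. \<lparr>ntdom = alg1 (cdom H \<phi>), ntcod = alg1 (ccod H \<phi>),
       ntc = (\<lambda>p \<in> Ob (alg (tgt H (cdom H \<phi>))).
         (act (cdom H \<phi>) p, act (ccod H \<phi>) p, id2 H (fst p) \<star>\<^bsub>H\<^esub> \<phi>))\<rparr>)
   in strict_psfun (op1 H) CAT alg alg1 alg2)"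

text \<open>\<open>k : y \<rightarrow> L\<close> is a comparison 1-cell for the adjunction \<open>l \<stileturn> u : y \<rightarrow> b\<close>: \<open>L\<close> is a bicategorical
  Eilenberg-Moore object of the induced monad \<open>T = u l\<close>, and \<open>k\<close> corresponds, up to isomorphism, to
  the \<open>T\<close>-algebra \<open>(u, u * \<epsilon>)\<close> in \<open>H(y, b)\<close>.\<close>

definition comparison1 :: "('o, 'm, 'c) tcat \<Rightarrow> 'm \<Rightarrow> 'm \<Rightarrow> 'c \<Rightarrow> 'c \<Rightarrow> 'm \<Rightarrow> bool" where
  "comparison1 H l u \<eta> \<epsilon> k \<longleftrightarrow> (\<exists>L \<Phi> \<phi>.
     let A = algebras H (tgt H u) (u \<odot>\<^bsub>H\<^esub> l) \<eta> (id2 H u \<star>\<^bsub>H\<^esub> \<epsilon> \<star>\<^bsub>H\<^esub> id2 H l)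
     in L \<in> obs H \<and> pseudonat_equivalence (op1 H) (corep (op1 H) L) A \<Phi> \<phi>
        \<and> in_hom1 H k (src H u) L
        \<and> (\<exists>s \<in> Homset (pf0 A (src H u)) (fob (\<Phi> (src H u)) k) (u, id2 H u \<star>\<^bsub>H\<^esub> \<epsilon>).
             is_iso (pf0 A (src H u)) s))"

text \<open>Left adjoints, Eilenberg-Moore objects and comparison 1-cells are unique up to isomorphism or
  equivalence, so the existential choices below are immaterial.\<close>

definition monadic :: "('o, 'm, 'c) tcat \<Rightarrow> 'm \<Rightarrow> bool" where
  "monadic H u \<longleftrightarrow>
     (\<exists>l \<eta> \<epsilon> k. adjunction1 H l u \<eta> \<epsilon> \<and> comparison1 H l u \<eta> \<epsilon> k \<and> equivalence1 H k)"

definition premonadic :: "('o, 'm, 'c) tcat \<Rightarrow> 'm \<Rightarrow> bool" where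
  "premonadic H u \<longleftrightarrow>
     (\<exists>l \<eta> \<epsilon> k. adjunction1 H l u \<eta> \<epsilon> \<and> comparison1 H l u \<eta> \<epsilon> k \<and> fully_faithful1 H k)"

definition almost_monadic :: "('o, 'm, 'c) tcat \<Rightarrow> 'm \<Rightarrow> bool" where
  "almost_monadic H u \<longleftrightarrow>
     (\<exists>l \<eta> \<epsilon> k. adjunction1 H l u \<eta> \<epsilon> \<and> comparison1 H l u \<eta> \<epsilon> k \<and> faithful1 H k)"


section \<open>The Beck-Chevalley condition\<close>

text \<open>The mate of \<open>\<alpha>\<^sub>f : B f \<odot> \<alpha>\<^sub>w \<Rightarrow> \<alpha>\<^sub>c \<odot> A f\<close>, a 2-cell \<open>l\<^sub>c \<odot> B f \<Rightarrow> A f \<odot> l\<^sub>w\<close>.\<close>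

definition mate where
  "mate S H \<alpha> l \<eta> \<epsilon> f =
     (\<epsilon> (tgt S f) \<star>\<^bsub>H\<^esub> id2 H (pf1 (psrc \<alpha>) f \<odot>\<^bsub>H\<^esub> l (src S f)))
     \<bullet>\<^bsub>H\<^esub> (id2 H (l (tgt S f)) \<star>\<^bsub>H\<^esub> pnat \<alpha> f \<star>\<^bsub>H\<^esub> id2 H (l (src S f)))
     \<bullet>\<^bsub>H\<^esub> (id2 H (l (tgt S f) \<odot>\<^bsub>H\<^esub> pf1 (ptgt \<alpha>) f) \<star>\<^bsub>H\<^esub> \<eta> (src S f))"

definition beck_chevalley ::
  "('o, 'm, 'c) tcat \<Rightarrow> ('p, 'n, 'd) tcat \<Rightarrow> ('o, 'm, 'c, 'p, 'n, 'd) psnat \<Rightarrow> bool" where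
  "beck_chevalley S H \<alpha> \<longleftrightarrow> (\<exists>l \<eta> \<epsilon>.
     (\<forall>w \<in> obs S. adjunction1 H (l w) (pcomp \<alpha> w) (\<eta> w) (\<epsilon> w)) \<and>
     (\<forall>f \<in> ars S. invertible2 H (mate S H \<alpha> l \<eta> \<epsilon> f)))"


section \<open>Biadjunctions, pseudo-Kan extensions and descent\<close>

text \<open>\<open>L \<stileturn> R\<close> for \<open>L : X \<rightarrow> Y\<close> with unit \<open>\<rho>\<close>, counit \<open>\<epsilon>\<close> and invertible triangle modifications
  \<open>v : Id \<Rightarrow> (\<epsilon> L)(L \<rho>)\<close> and \<open>w : (R \<epsilon>)(\<rho> R) \<Rightarrow> Id\<close>, subject to the two swallowtail identities.\<close>

locale biadjunction =
  fixes X :: "('o, 'm, 'c) tcat" and Y :: "('p, 'n, 'd) tcat"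
    and L :: "('o, 'm, 'c, 'p, 'n, 'd) psfun" and R :: "('p, 'n, 'd, 'o, 'm, 'c) psfun"
    and \<rho> :: "('o, 'm, 'c, 'o, 'm, 'c) psnat" and \<epsilon> :: "('p, 'n, 'd, 'p, 'n, 'd) psnat"
    and v :: "('o, 'm, 'c, 'p, 'n, 'd) modif" and w :: "('p, 'n, 'd, 'o, 'm, 'c) modif"
  assumes L_psfun: "pseudofunctor X Y L"
    and R_psfun: "pseudofunctor Y X R"
    and unit: "in_hom1 (PS X X) \<rho> (psfun_id X) (psfun_comp X X R L)"
    and counit: "in_hom1 (PS Y Y) \<epsilon> (psfun_comp Y Y L R) (psfun_id Y)"
    and triangle_L: "in_hom2 (PS X Y) v (psnat_id X Y L)
      (psnat_comp X Y (psnat_wr X Y \<epsilon> L) (psnat_wl X Y L \<rho>))"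
    and triangle_L_inv: "invertible2 (PS X Y) v"
    and triangle_R: "in_hom2 (PS Y X) w
      (psnat_comp Y X (psnat_wl Y X R \<epsilon>) (psnat_wr Y X \<rho> R)) (psnat_id Y X R)"
    and triangle_R_inv: "invertible2 (PS Y X) w"
    and swallowtail_unit: "x \<in> obs X \<Longrightarrow>
      (mcomp w (pf0 L x) \<star>\<^bsub>X\<^esub> id2 X (pcomp \<rho> x))
      \<bullet>\<^bsub>X\<^esub> (id2 X (pf1 R (pcomp \<epsilon> (pf0 L x))) \<star>\<^bsub>X\<^esub> pnat \<rho> (pcomp \<rho> x))
      \<bullet>\<^bsub>X\<^esub> (inv2 X (pfc R (pcomp \<epsilon> (pf0 L x), pf1 L (pcomp \<rho> x))) \<star>\<^bsub>X\<^esub> id2 X (pcomp \<rho> x))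
      \<bullet>\<^bsub>X\<^esub> (pf2 R (mcomp v x) \<star>\<^bsub>X\<^esub> id2 X (pcomp \<rho> x))
      \<bullet>\<^bsub>X\<^esub> (pfi R (pf0 L x) \<star>\<^bsub>X\<^esub> id2 X (pcomp \<rho> x))
      = id2 X (pcomp \<rho> x)"
    and swallowtail_counit: "y \<in> obs Y \<Longrightarrow>
      (id2 Y (pcomp \<epsilon> y) \<star>\<^bsub>Y\<^esub> inv2 Y (pfi L (pf0 R y)))
      \<bullet>\<^bsub>Y\<^esub> (id2 Y (pcomp \<epsilon> y) \<star>\<^bsub>Y\<^esub> pf2 L (mcomp w y))
      \<bullet>\<^bsub>Y\<^esub> (id2 Y (pcomp \<epsilon> y) \<star>\<^bsub>Y\<^esub> pfc L (pf1 R (pcomp \<epsilon> y), pcomp \<rho> (pf0 R y)))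
      \<bullet>\<^bsub>Y\<^esub> (pnat \<epsilon> (pcomp \<epsilon> y) \<star>\<^bsub>Y\<^esub> id2 Y (pf1 L (pcomp \<rho> (pf0 R y))))
      \<bullet>\<^bsub>Y\<^esub> (id2 Y (pcomp \<epsilon> y) \<star>\<^bsub>Y\<^esub> mcomp v (pf0 R y))
      = id2 Y (pcomp \<epsilon> y)"

definition a_inclusion ::
  "'k rel \<Rightarrow> ('k, 'k, 'k) tcat \<Rightarrow> ('k, 'k, 'k) tcat \<Rightarrow> ('k, 'k, 'k, 'k, 'k, 'k) psfun \<Rightarrow> 'k \<Rightarrow> bool"
  where
  "a_inclusion \<kappa> A Ad t a \<longleftrightarrow>
     small_two_category \<kappa> A \<and> small_two_category \<kappa> Ad \<and> two_functor A Ad t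
     \<and> inj_on (pf0 t) (obs A) \<and> a \<notin> pf0 t ` obs A \<and> obs Ad = insert a (pf0 t ` obs A)
     \<and> (\<forall>x \<in> obs A. \<forall>y \<in> obs A.
          bij_betw (pf1 t) (Ob (hom_cat A x y)) (Ob (hom_cat Ad (pf0 t x) (pf0 t y))) \<and>
          bij_betw (pf2 t) (Ar (hom_cat A x y)) (Ar (hom_cat Ad (pf0 t x) (pf0 t y))))"

text \<open>\<open>\<eta>\<close> is the unit of a biadjunction \<open>- \<circ> t \<stileturn> PsRan\<^sub>t\<close>. Right biadjoints are unique up to equivalence,
  so the choice does not matter below.\<close>

definition psran_unit where
  "psran_unit A Ad t H \<eta> \<longleftrightarrow>
     (\<exists>R \<epsilon> v w. biadjunction (PS Ad H) (PS A H) (precomp A Ad H t) R \<eta> \<epsilon> v w)"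

definition effective_descent where
  "effective_descent A Ad t a H F \<longleftrightarrow>
     (\<exists>\<eta>. psran_unit A Ad t H \<eta> \<and> equivalence1 H (pcomp (pcomp \<eta> F) a))"

definition descent where
  "descent A Ad t a H F \<longleftrightarrow>
     (\<exists>\<eta>. psran_unit A Ad t H \<eta> \<and> fully_faithful1 H (pcomp (pcomp \<eta> F) a))"

definition almost_descent where
  "almost_descent A Ad t a H F \<longleftrightarrow>
     (\<exists>\<eta>. psran_unit A Ad t H \<eta> \<and> faithful1 H (pcomp (pcomp \<eta> F) a))"

end

theory Submission
  imports Defs
begin

text \<open>
  By the Beck-Chevalley condition, the pointwise left adjoints of \<open>\<alpha>\<close> form a left adjoint of \<open>\<alpha>\<close> in the 2-category
  of pseudofunctors, so that \<open>\<alpha>\<close> carries an algebra structure for the induced monad \<open>T\<close> on \<open>B\<close>. Eilenberg-Moore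
  objects of pseudofunctors are pointwise; since the components of \<open>\<alpha> t\<close> are monadic, \<open>\<alpha> t\<close> exhibits \<open>A t\<close> as the
  Eilenberg-Moore object of \<open>T t\<close>. The right biadjoint \<open>PsRan\<^sub>t\<close> preserves it: \<open>PsRan\<^sub>t (A t)\<close> is the
  Eilenberg-Moore object of the monad \<open>T'\<close> induced by \<open>T t\<close> on \<open>PsRan\<^sub>t (B t)\<close>. At \<open>a\<close>, the unit components then form a
  square of monad algebras over \<open>\<eta>\<^sub>B\<close>, and if \<open>\<eta>\<^sub>B\<close> is faithful, fully faithful or an equivalence at \<open>a\<close>,
  then the comparison of \<open>\<alpha>\<^sub>a\<close> with \<open>T\<close>-algebras has the same property if and only if \<open>\<eta>\<^sub>A\<close> has it at \<open>a\<close>.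
  Eilenberg-Moore objects exist because they are built from an inserter and two equifiers, which are weighted bilimits.
\<close>

text \<open>Every notion is tested on hom-categories: \<open>faith1\<close>, \<open>full1\<close>,
  \<open>ess1\<close> and their versions relative to a monad speak of whiskering alone, so
  universality of an algebra and descent become statements of the same kind. One lemma about
  ordinary categories, the transfer along \<open>alg_square\<close>, then does all the comparing:
  over identities it relates a 1-cell to its comparison 1-cell, along the counit of a right
  biadjoint it lifts universality to Kan extensions, and along the unit at \<open>a\<close> it gives
  the theorem. The obstacle is coherence. Pointwise lifts are determined only up to isomorphism and
  have to be assembled into pseudofunctors and pseudonatural transformations; this works because a
  universal algebra is faithful, so that a coherence equation between lifts holds as soon as it
  holds underneath. Descent of the two pseudofunctors may be witnessed by two different units. The
  final square is therefore built from two biadjunctions, one for the source of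
  \<open>\<alpha>\<close> and one for its target.\<close>

abbreviation lwhisk :: "('o, 'm, 'c) tcat \<Rightarrow> 'm \<Rightarrow> 'c \<Rightarrow> 'c" (infixr "<|\<index>" 80) where
  "f <|\<^bsub>K\<^esub> \<sigma> \<equiv> id2 K f \<star>\<^bsub>K\<^esub> \<sigma>"

abbreviation rwhisk :: "('o, 'm, 'c) tcat \<Rightarrow> 'c \<Rightarrow> 'm \<Rightarrow> 'c" (infixr "|>\<index>" 80) where
  "\<sigma> |>\<^bsub>K\<^esub> f \<equiv> \<sigma> \<star>\<^bsub>K\<^esub> id2 K f"

section \<open>Calculus in a 2-category\<close>

context category
begin

lemma inverse_arrows_unique:
  assumes "inverse_arrows C f g" "inverse_arrows C f g'"
  shows "g = g'"
proof -
  show ?thesis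
    using assms Cmp_assoc[of g f g'] Cmp_Id[of g] Id_Cmp[of g'] by (simp add: inverse_arrows_def)
qed

lemma inverse_arrows_sym: "inverse_arrows C f g ==> inverse_arrows C g f"
  by (simp add: inverse_arrows_def)

lemma inverse_arrows_Idt: "x : Ob C ==> inverse_arrows C (Idt C x) (Idt C x)"
  using Cmp_Id[of "Idt C x"] by (simp add: inverse_arrows_def Id_Ar Dom_Id Cod_Id)

lemma inverse_arrows_Cmp:
  assumes "inverse_arrows C f f'" "inverse_arrows C g g'" "Dom C g = Cod C f"
  shows "inverse_arrows C (g \<cdot> f) (f' \<cdot> g')"
proof -
  have 1: "(g \<cdot> f) \<cdot> (f' \<cdot> g') = g \<cdot> ((f \<cdot> f') \<cdot> g')" "(f' \<cdot> g') \<cdot> (g \<cdot> f) = f' \<cdot> ((g' \<cdot> g) \<cdot> f)"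
    using assms Cmp_assoc[of g f "f' \<cdot> g'"] Cmp_assoc[of f f' g'] Cmp_assoc[of f' g' "g \<cdot> f"] Cmp_assoc[of g' g f]
    by (simp_all add: inverse_arrows_def Cmp_Ar Dom_Cmp Cod_Cmp)
  show ?thesis
    using assms Id_Cmp[of g'] Id_Cmp[of f] unfolding inverse_arrows_def 1
    by (simp add: inverse_arrows_def Cmp_Ar Dom_Cmp Cod_Cmp)
qed

end

section \<open>Whiskering, interchange and invertible 2-cells\<close>

context two_category
begin

lemma two_cat1 [simp]:
  shows id1_ar: "x : obs K ==> id1 K x : ars K"
    and src_id1: "x : obs K ==> src K (id1 K x) = x"
    and tgt_id1: "x : obs K ==> tgt K (id1 K x) = x"
    and src_obs: "f : ars K ==> src K f : obs K"
    and tgt_obs: "f : ars K ==> tgt K f : obs K"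
    and comp1_ar: "[|g : ars K; f : ars K; src K g = tgt K f|] ==> g \<odot> f : ars K"
    and src_comp1: "[|g : ars K; f : ars K; src K g = tgt K f|] ==> src K (g \<odot> f) = src K f"
    and tgt_comp1: "[|g : ars K; f : ars K; src K g = tgt K f|] ==> tgt K (g \<odot> f) = tgt K g"
    and comp1_id1: "[|f : ars K; x = src K f|] ==> f \<odot> id1 K x = f"
    and id1_comp1: "[|f : ars K; x = tgt K f|] ==> id1 K x \<odot> f = f"
    and comp1_assoc: "[|h : ars K; g : ars K; f : ars K; src K h = tgt K g; src K g = tgt K f|]
      ==> (h \<odot> g) \<odot> f = h \<odot> g \<odot> f"
  using category_cat1 unfolding category_def cat1_def by simp_all

lemma two_cat2 [simp]:
  shows cdom_ars: "s : cells K ==> cdom K s : ars K"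
    and ccod_ars: "s : cells K ==> ccod K s : ars K"
    and id2_cell: "f : ars K ==> id2 K f : cells K"
    and cdom_id2: "f : ars K ==> cdom K (id2 K f) = f"
    and ccod_id2: "f : ars K ==> ccod K (id2 K f) = f"
    and vcomp_cell: "[|t : cells K; s : cells K; cdom K t = ccod K s|] ==> t \<bullet> s : cells K"
    and cdom_vcomp: "[|t : cells K; s : cells K; cdom K t = ccod K s|] ==> cdom K (t \<bullet> s) = cdom K s"
    and ccod_vcomp: "[|t : cells K; s : cells K; cdom K t = ccod K s|] ==> ccod K (t \<bullet> s) = ccod K t"
    and vcomp_id2: "[|s : cells K; f = cdom K s|] ==> s \<bullet> id2 K f = s"
    and id2_vcomp: "[|s : cells K; f = ccod K s|] ==> id2 K f \<bullet> s = s"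
    and vcomp_assoc: "[|\<rho> : cells K; t : cells K; s : cells K; cdom K \<rho> = ccod K t; cdom K t = ccod K s|]
      ==> (\<rho> \<bullet> t) \<bullet> s = \<rho> \<bullet> t \<bullet> s"
  using category_vcat unfolding category_def vcat_def by simp_all

declare src_cod [simp] tgt_cod [simp] hcomp_cells [simp] dom_hcomp [simp] cod_hcomp [simp]
  hcomp_id2 [simp] hcomp_assoc [simp]

lemma hcomp_units [simp]:
  "[|s : cells K; x = src K (cdom K s)|] ==> s |> (id1 K x) = s"
  "[|s : cells K; x = tgt K (cdom K s)|] ==> (id1 K x) <| s = s"
  using hcomp_unit_left hcomp_unit_right by auto

text \<open>Together with associativity these rules fix a normal form: a right-nested vertical
  composite of atomic cells, each whiskered by one composite 1-cell on either side. Later proofs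
  whisker a known equation by \<open>arg_cong\<close>, normalise it with \<open>simplified\<close>,
  and rewrite inside such composites.\<close>

lemma whisker [simp]:
  shows lwhisker_lwhisker: "[|g : ars K; f : ars K; s : cells K; src K g = tgt K f; src K f = tgt K (cdom K s)|]
    ==> g <| f <| s = (g \<odot> f) <| s"
  and lwhisker_vcomp: "[|f : ars K; t : cells K; s : cells K; cdom K t = ccod K s; src K f = tgt K (cdom K s)|]
    ==> f <| (t \<bullet> s) = f <| t \<bullet> f <| s"
  and rwhisker_vcomp: "[|f : ars K; t : cells K; s : cells K; cdom K t = ccod K s; src K (cdom K s) = tgt K f|]
    ==> (t \<bullet> s) |> f = t |> f \<bullet> s |> f"
  using hcomp_assoc[of "id2 K g" "id2 K f" s] interchange[of "id2 K f" "id2 K f" t s] interchange[of t s "id2 K f" "id2 K f"]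
  by simp_all

lemma hcomp_eq:
  assumes "t : cells K" "s : cells K" "src K (cdom K t) = tgt K (cdom K s)"
  shows "t \<star> s = t |> (ccod K s) \<bullet> (cdom K t) <| s"
    and "t \<star> s = (ccod K t) <| s \<bullet> t |> (cdom K s)"
  using interchange[of t "id2 K (cdom K t)" "id2 K (ccod K s)" s]
    interchange[of "id2 K (ccod K t)" t s "id2 K (cdom K s)"] assms by simp_all

text \<open>Both sides are the horizontal composite of \<open>t\<close> and \<open>s\<close>. In
  this form interchange lets one cell move past another that acts on a disjoint part of the
  composite 1-cell.\<close>

lemma slide:
  assumes "t : cells K" "s : cells K" "src K (cdom K t) = tgt K (cdom K s)"
    "cdom K t = g" "ccod K t = g'" "cdom K s = f" "ccod K s = f'"
  shows "t |> f' \<bullet> g <| s = g' <| s \<bullet> t |> f"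
  using hcomp_eq[OF assms(1-3)] assms(4-) by simp

lemmas slide_refl = slide[OF _ _ _ refl refl refl refl]

text \<open>An equation between composites, prepared for rewriting inside a longer right-nested composite.\<close>

lemma vc21: "[|A \<bullet> B = C; A : cells K; B : cells K; cdom K A = ccod K B; R : cells K; cdom K B = ccod K R|]
  ==> A \<bullet> B \<bullet> R = C \<bullet> R"
  using vcomp_assoc[of A B R] by simp

lemma vc22: "[|A \<bullet> B = C \<bullet> D; A : cells K; B : cells K; cdom K A = ccod K B;
    C : cells K; D : cells K; cdom K C = ccod K D; R : cells K; cdom K B = ccod K R|]
  ==> A \<bullet> B \<bullet> R = C \<bullet> D \<bullet> R"
proof -
  assume a: "A \<bullet> B = C \<bullet> D" "A : cells K" "B : cells K" "cdom K A = ccod K B"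
    "C : cells K" "D : cells K" "cdom K C = ccod K D" "R : cells K" "cdom K B = ccod K R"
  have "cdom K D = cdom K B"
    using cdom_vcomp[OF a(2-4)] cdom_vcomp[OF a(5-7)] a(1) by simp
  with a(9) have "cdom K D = ccod K R" by simp
  then show "A \<bullet> B \<bullet> R = C \<bullet> D \<bullet> R"
    using vcomp_assoc[OF a(2,3,8,4,9)] vcomp_assoc[OF a(5,6,8,7)] a(1) by metis
qed

lemma vc32: "[|A \<bullet> B \<bullet> C = D \<bullet> E; A : cells K; B : cells K; C : cells K; cdom K A = ccod K B; cdom K B = ccod K C;
    D : cells K; E : cells K; cdom K D = ccod K E;
    R : cells K; cdom K C = ccod K R|]
  ==> A \<bullet> B \<bullet> C \<bullet> R = D \<bullet> E \<bullet> R"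
  using vc22[of A "B \<bullet> C" D E R] by simp

lemma vc23: "[|D \<bullet> E = A \<bullet> B \<bullet> C; A : cells K; B : cells K; C : cells K; cdom K A = ccod K B; cdom K B = ccod K C;
    D : cells K; E : cells K; cdom K D = ccod K E;
    R : cells K; cdom K E = ccod K R|]
  ==> D \<bullet> E \<bullet> R = A \<bullet> B \<bullet> C \<bullet> R"
proof -
  assume a: "D \<bullet> E = A \<bullet> B \<bullet> C" "A : cells K" "B : cells K" "C : cells K" "cdom K A = ccod K B"
    "cdom K B = ccod K C"
    "D : cells K" "E : cells K" "cdom K D = ccod K E" "R : cells K" "cdom K E = ccod K R"
  have "cdom K (A \<bullet> B \<bullet> C) = cdom K C" "cdom K (D \<bullet> E) = cdom K E"
    using a(2-9) by simp_all
  with a(1,11) have "cdom K C = ccod K R" by simp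
  then show ?thesis using vc22[OF a(1), of R] a(2-) by simp
qed

text \<open>This is \<open>inverse_arrows (vcat K)\<close> with the record \<open>vcat\<close>
  unfolded, so that simplification only meets the operations of \<open>K\<close>.\<close>

definition iso2 :: "'c \<Rightarrow> 'c \<Rightarrow> bool" where
  "iso2 \<sigma> \<tau> \<longleftrightarrow> \<sigma> : cells K & \<tau> : cells K & cdom K \<tau> = ccod K \<sigma> & ccod K \<tau> = cdom K \<sigma>
     & \<tau> \<bullet> \<sigma> = id2 K (cdom K \<sigma>) & \<sigma> \<bullet> \<tau> = id2 K (ccod K \<sigma>)"

lemma inverse_arrows_vcat [simp]: "inverse_arrows (vcat K) s t \<longleftrightarrow> iso2 s t"
  by (auto simp: inverse_arrows_def iso2_def vcat_def)

lemma invertible2_iff: "invertible2 K s \<longleftrightarrow> (EX t. iso2 s t)"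
  by (simp add: is_iso_def)

lemma iso2_unique: "iso2 s t ==> iso2 s t' ==> t = t'"
  using category.inverse_arrows_unique[OF category_vcat, of s t t'] by simp

lemma iso2_inv2: "invertible2 K s ==> iso2 s (inv2 K s)"
  unfolding invertible2_iff inv2_def inverse_arrows_vcat
  by (rule theI') (blast intro: iso2_unique)

lemma inv2_eq: "iso2 s t ==> inv2 K s = t"
  using iso2_inv2 invertible2_iff iso2_unique by blast

lemma inv2_simps [simp]:
  assumes "invertible2 K s"
  shows inv2_cell: "inv2 K s : cells K"
    and cdom_inv2: "cdom K (inv2 K s) = ccod K s"
    and ccod_inv2: "ccod K (inv2 K s) = cdom K s"
    and inv2_vcomp: "inv2 K s \<bullet> s = id2 K (cdom K s)"
    and vcomp_inv2: "s \<bullet> inv2 K s = id2 K (ccod K s)"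
  using iso2_inv2[OF assms] by (simp_all add: iso2_def)

lemma invertible2_cell: "invertible2 K s ==> s : cells K"
  using iso2_inv2 by (auto simp: iso2_def)

lemma iso2_sym: "iso2 s t ==> iso2 t s"
  by (auto simp: iso2_def)

lemma iso2_id2: "f : ars K ==> iso2 (id2 K f) (id2 K f)"
  by (simp add: iso2_def)

lemma iso2_vcomp:
  "[|iso2 t t'; iso2 s s'; cdom K t = ccod K s|] ==> iso2 (t \<bullet> s) (s' \<bullet> t')"
  using category.inverse_arrows_Cmp[OF category_vcat, of s s' t t'] by simp (simp add: vcat_def)

lemma iso2_lwhisker:
  assumes "iso2 s t" "f : ars K" "src K f = tgt K (cdom K s)"
  shows "iso2 (f <| s) (f <| t)"
  using assms lwhisker_vcomp[of f t s] lwhisker_vcomp[of f s t] tgt_cod[of s]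
  by (simp add: iso2_def del: lwhisker_vcomp)

lemma iso2_rwhisker:
  assumes "iso2 s t" "f : ars K" "src K (cdom K s) = tgt K f"
  shows "iso2 (s |> f) (t |> f)"
  using assms rwhisker_vcomp[of f t s] rwhisker_vcomp[of f s t] src_cod[of s]
  by (simp add: iso2_def del: rwhisker_vcomp)

lemma invertible2 [simp]:
  shows invertible2_id2: "f : ars K ==> invertible2 K (id2 K f)"
    and invertible2_inv2: "invertible2 K s ==> invertible2 K (inv2 K s)"
    and invertible2_vcomp: "[|invertible2 K t; invertible2 K s; cdom K t = ccod K s|] ==> invertible2 K (t \<bullet> s)"
    and invertible2_lwhisker: "[|f : ars K; invertible2 K s; src K f = tgt K (cdom K s)|]
      ==> invertible2 K (f <| s)"
    and invertible2_rwhisker: "[|f : ars K; invertible2 K s; src K (cdom K s) = tgt K f|]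
      ==> invertible2 K (s |> f)"
  unfolding invertible2_iff
  by (blast intro: iso2_id2 iso2_vcomp iso2_lwhisker iso2_rwhisker)
    (metis invertible2_iff iso2_inv2 iso2_sym, blast intro: iso2_vcomp, blast intro: iso2_lwhisker,
      blast intro: iso2_rwhisker)

text \<open>In normal form a cell and its inverse meet only after whiskering has been distributed
  over composites, so cancellation is needed for every whiskered shape.\<close>

lemma whiskered_inverses [simp]:
  assumes "invertible2 K s" and f: "f : ars K"
  shows "src K f = tgt K (cdom K s) ==> (f <| s) \<bullet> (f <| inv2 K s) = id2 K (f \<odot> ccod K s)"
    and "src K f = tgt K (cdom K s) ==> (f <| inv2 K s) \<bullet> (f <| s) = id2 K (f \<odot> cdom K s)"
    and "src K (cdom K s) = tgt K f ==> (s |> f) \<bullet> (inv2 K s |> f) = id2 K (ccod K s \<odot> f)"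
    and "src K (cdom K s) = tgt K f ==> (inv2 K s |> f) \<bullet> (s |> f) = id2 K (cdom K s \<odot> f)"
    and "[|g : ars K; src K f = tgt K (cdom K s); src K (cdom K s) = tgt K g|]
      ==> (f <| s |> g) \<bullet> (f <| inv2 K s |> g) = id2 K (f \<odot> ccod K s \<odot> g)"
    and "[|g : ars K; src K f = tgt K (cdom K s); src K (cdom K s) = tgt K g|]
      ==> (f <| inv2 K s |> g) \<bullet> (f <| s |> g) = id2 K (f \<odot> cdom K s \<odot> g)"
proof -
  note [simp] = assms invertible2_cell[OF assms(1)] inv2_cell[OF assms(1)]
  show "src K f = tgt K (cdom K s) ==> (f <| s) \<bullet> (f <| inv2 K s) = id2 K (f \<odot> ccod K s)"
    "src K f = tgt K (cdom K s) ==> (f <| inv2 K s) \<bullet> (f <| s) = id2 K (f \<odot> cdom K s)"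
    "src K (cdom K s) = tgt K f ==> (s |> f) \<bullet> (inv2 K s |> f) = id2 K (ccod K s \<odot> f)"
    "src K (cdom K s) = tgt K f ==> (inv2 K s |> f) \<bullet> (s |> f) = id2 K (cdom K s \<odot> f)"
    using lwhisker_vcomp[of f s "inv2 K s"] lwhisker_vcomp[of f "inv2 K s" s]
      rwhisker_vcomp[of f s "inv2 K s"] rwhisker_vcomp[of f "inv2 K s" s] tgt_cod[of s] src_cod[of s]
    by (simp_all del: lwhisker_vcomp rwhisker_vcomp)
  then show "[|g : ars K; src K f = tgt K (cdom K s); src K (cdom K s) = tgt K g|]
      ==> (f <| s |> g) \<bullet> (f <| inv2 K s |> g) = id2 K (f \<odot> ccod K s \<odot> g)"
    "[|g : ars K; src K f = tgt K (cdom K s); src K (cdom K s) = tgt K g|]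
      ==> (f <| inv2 K s |> g) \<bullet> (f <| s |> g) = id2 K (f \<odot> cdom K s \<odot> g)"
    using rwhisker_vcomp[of g "f <| s" "f <| inv2 K s"]
      rwhisker_vcomp[of g "f <| inv2 K s" "f <| s"] tgt_cod[of s] src_cod[of s]
    by (simp_all del: rwhisker_vcomp)
qed

lemmas whiskered_inverses_vc [simp] = whiskered_inverses[THEN vc21] inv2_vcomp[THEN vc21] vcomp_inv2[THEN vc21]

lemma vcomp_cancel_left:
  assumes "invertible2 K s" "s \<bullet> \<rho> = s \<bullet> \<rho>'" "\<rho> : cells K" "\<rho>' : cells K" "cdom K s = ccod K \<rho>" "cdom K s = ccod K \<rho>'"
  shows "\<rho> = \<rho>'"
proof -
  have "\<rho> = inv2 K s \<bullet> s \<bullet> \<rho>" using assms(1,3,5) invertible2_cell[OF assms(1)] by simp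
  also have "\<dots> = \<rho>'"
    unfolding assms(2) using assms(1,4,6) invertible2_cell[OF assms(1)] by simp
  finally show ?thesis .
qed

lemma vcomp_cancel_right:
  assumes "invertible2 K s" "\<rho> \<bullet> s = \<rho>' \<bullet> s" "\<rho> : cells K" "\<rho>' : cells K" "cdom K \<rho> = ccod K s" "cdom K \<rho>' = ccod K s"
  shows "\<rho> = \<rho>'"
proof -
  have "\<rho> = (\<rho> \<bullet> s) \<bullet> inv2 K s" using assms(1,3,5) invertible2_cell[OF assms(1)] by simp
  also have "\<dots> = \<rho>'"
    unfolding assms(2) using assms(1,4,6) invertible2_cell[OF assms(1)] by simp
  finally show ?thesis .
qed

lemma category_hom_cat: "category (hom_cat K x y)"
  by unfold_locales (auto simp: hom_cat_def)

lemma inverse_arrows_hom_cat: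
  "inverse_arrows (hom_cat K x y) s t \<longleftrightarrow> iso2 s t & src K (cdom K s) = x & tgt K (cdom K s) = y"
  using src_cod[of s] tgt_cod[of s] by (auto simp: inverse_arrows_def iso2_def hom_cat_def)

lemma is_iso_hom_cat:
  "is_iso (hom_cat K x y) s \<longleftrightarrow> invertible2 K s & src K (cdom K s) = x & tgt K (cdom K s) = y"
  unfolding invertible2_iff by (simp add: is_iso_def inverse_arrows_hom_cat)

end

section \<open>The 2-category of pseudofunctors\<close>

context pseudofunctor
begin

lemma pf_simps [simp]:
  shows "x : obs S ==> pf0 F x : obs K"
    and "f : ars S ==> pf1 F f : ars K"
    and "f : ars S ==> src K (pf1 F f) = pf0 F (src S f)"
    and "f : ars S ==> tgt K (pf1 F f) = pf0 F (tgt S f)"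
    and "s : cells S ==> pf2 F s : cells K"
    and "s : cells S ==> cdom K (pf2 F s) = pf1 F (cdom S s)"
    and "s : cells S ==> ccod K (pf2 F s) = pf1 F (ccod S s)"
    and "f : ars S ==> pf2 F (id2 S f) = id2 K (pf1 F f)"
    and "[|g : ars S; f : ars S; src S g = tgt S f|] ==> pfc F (g, f) : cells K"
    and "[|g : ars S; f : ars S; src S g = tgt S f|] ==> cdom K (pfc F (g, f)) = pf1 F g \<odot> pf1 F f"
    and "[|g : ars S; f : ars S; src S g = tgt S f|] ==> ccod K (pfc F (g, f)) = pf1 F (g \<odot>\<^bsub>S\<^esub> f)"
    and "[|g : ars S; f : ars S; src S g = tgt S f|] ==> invertible2 K (pfc F (g, f))"
    and "x : obs S ==> pfi F x : cells K"
    and "x : obs S ==> cdom K (pfi F x) = id1 K (pf0 F x)"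
    and "x : obs S ==> ccod K (pfi F x) = pf1 F (id1 S x)"
    and "x : obs S ==> invertible2 K (pfi F x)"
  using pf0_obs pf1_hom pf2_hom pf2_id2 pfc_hom pfc_inv pfi_hom pfi_inv
  by (auto simp: in_hom1_def in_hom2_def cpairs_def)

end

lemma cpairs_iff [simp]: "(g, f) : cpairs S \<longleftrightarrow> g : ars S & f : ars S & src S g = tgt S f"
  by (simp add: cpairs_def)

sublocale pseudonatural \<subseteq> psrc: pseudofunctor S K "psrc \<alpha>"
  by (rule psrc_psfun)

sublocale pseudonatural \<subseteq> ptgt: pseudofunctor S K "ptgt \<alpha>"
  by (rule ptgt_psfun)

sublocale modification \<subseteq> msrc: pseudonatural S K "msrc \<Gamma>"
  by (rule msrc_psnat)

sublocale modification \<subseteq> mtgt: pseudonatural S K "mtgt \<Gamma>"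
  by (rule mtgt_psnat)

context pseudonatural
begin

lemma pn_simps [simp]:
  shows "x : obs S ==> pcomp \<alpha> x : ars K"
    and "x : obs S ==> src K (pcomp \<alpha> x) = pf0 (psrc \<alpha>) x"
    and "x : obs S ==> tgt K (pcomp \<alpha> x) = pf0 (ptgt \<alpha>) x"
    and "f : ars S ==> pnat \<alpha> f : cells K"
    and "f : ars S ==> cdom K (pnat \<alpha> f) = pf1 (ptgt \<alpha>) f \<odot> pcomp \<alpha> (src S f)"
    and "f : ars S ==> ccod K (pnat \<alpha> f) = pcomp \<alpha> (tgt S f) \<odot> pf1 (psrc \<alpha>) f"
    and "f : ars S ==> invertible2 K (pnat \<alpha> f)"
  using pcomp_hom pnat_hom pnat_inv by (auto simp: in_hom1_def in_hom2_def)

end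

context modification
begin

lemma mod_simps [simp]:
  shows "psrc (mtgt \<Gamma>) = psrc (msrc \<Gamma>)"
    and "ptgt (mtgt \<Gamma>) = ptgt (msrc \<Gamma>)"
    and "x : obs S ==> mcomp \<Gamma> x : cells K"
    and "x : obs S ==> cdom K (mcomp \<Gamma> x) = pcomp (msrc \<Gamma>) x"
    and "x : obs S ==> ccod K (mcomp \<Gamma> x) = pcomp (mtgt \<Gamma>) x"
  using mcomp_hom same_psrc same_ptgt by (auto simp: in_hom1_def in_hom2_def)

end

lemma PS_simps [simp]:
  shows "F : obs (PS S K) \<longleftrightarrow> pseudofunctor S K F"
    and "\<alpha> : ars (PS S K) \<longleftrightarrow> pseudonatural S K \<alpha>"
    and "\<Gamma> : cells (PS S K) \<longleftrightarrow> modification S K \<Gamma>"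
    and "src (PS S K) \<alpha> = psrc \<alpha>"
    and "tgt (PS S K) \<alpha> = ptgt \<alpha>"
    and "cdom (PS S K) \<Gamma> = msrc \<Gamma>"
    and "ccod (PS S K) \<Gamma> = mtgt \<Gamma>"
    and "psrc (id1 (PS S K) F) = F"
    and "ptgt (id1 (PS S K) F) = F"
    and "x : obs S ==> pcomp (id1 (PS S K) F) x = id1 K (pf0 F x)"
    and "f : ars S ==> pnat (id1 (PS S K) F) f = id2 K (pf1 F f)"
    and "psrc (\<beta> \<odot>\<^bsub>PS S K\<^esub> \<alpha>) = psrc \<alpha>"
    and "ptgt (\<beta> \<odot>\<^bsub>PS S K\<^esub> \<alpha>) = ptgt \<beta>"
    and "x : obs S ==> pcomp (\<beta> \<odot>\<^bsub>PS S K\<^esub> \<alpha>) x = pcomp \<beta> x \<odot>\<^bsub>K\<^esub> pcomp \<alpha> x"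
    and "f : ars S ==> pnat (\<beta> \<odot>\<^bsub>PS S K\<^esub> \<alpha>) f = ((pcomp \<beta> (tgt S f)) <|\<^bsub>K\<^esub> pnat \<alpha> f)
      \<bullet>\<^bsub>K\<^esub> pnat \<beta> f |>\<^bsub>K\<^esub> (pcomp \<alpha> (src S f))"
    and "msrc (id2 (PS S K) \<alpha>) = \<alpha>"
    and "mtgt (id2 (PS S K) \<alpha>) = \<alpha>"
    and "x : obs S ==> mcomp (id2 (PS S K) \<alpha>) x = id2 K (pcomp \<alpha> x)"
    and "msrc (\<Delta> \<bullet>\<^bsub>PS S K\<^esub> \<Gamma>) = msrc \<Gamma>"
    and "mtgt (\<Delta> \<bullet>\<^bsub>PS S K\<^esub> \<Gamma>) = mtgt \<Delta>"
    and "x : obs S ==> mcomp (\<Delta> \<bullet>\<^bsub>PS S K\<^esub> \<Gamma>) x = mcomp \<Delta> x \<bullet>\<^bsub>K\<^esub> mcomp \<Gamma> x"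
    and "msrc (\<Delta> \<star>\<^bsub>PS S K\<^esub> \<Gamma>) = msrc \<Delta> \<odot>\<^bsub>PS S K\<^esub> msrc \<Gamma>"
    and "mtgt (\<Delta> \<star>\<^bsub>PS S K\<^esub> \<Gamma>) = mtgt \<Delta> \<odot>\<^bsub>PS S K\<^esub> mtgt \<Gamma>"
    and "x : obs S ==> mcomp (\<Delta> \<star>\<^bsub>PS S K\<^esub> \<Gamma>) x = mcomp \<Delta> x \<star>\<^bsub>K\<^esub> mcomp \<Gamma> x"
  by (simp_all add: PS_def psnat_id_def psnat_comp_def)

lemma PS_ext [simp]:
  shows "pcomp (id1 (PS S K) F) : extensional (obs S)"
    and "pnat (id1 (PS S K) F) : extensional (ars S)"
    and "pcomp (\<beta> \<odot>\<^bsub>PS S K\<^esub> \<alpha>) : extensional (obs S)"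
    and "pnat (\<beta> \<odot>\<^bsub>PS S K\<^esub> \<alpha>) : extensional (ars S)"
    and "mcomp (id2 (PS S K) \<alpha>) : extensional (obs S)"
    and "mcomp (\<Delta> \<bullet>\<^bsub>PS S K\<^esub> \<Gamma>) : extensional (obs S)"
    and "mcomp (\<Delta> \<star>\<^bsub>PS S K\<^esub> \<Gamma>) : extensional (obs S)"
  by (simp_all add: PS_def psnat_id_def psnat_comp_def)

lemma psnat_eqI:
  fixes \<alpha> \<beta> :: "('o, 'm, 'c, 'p, 'n, 'd) psnat"
  assumes "pseudonatural S K \<alpha>" "pseudonatural S K \<beta>" "psrc \<alpha> = psrc \<beta>" "ptgt \<alpha> = ptgt \<beta>"
    "!!x. x : obs S ==> pcomp \<alpha> x = pcomp \<beta> x" "!!f. f : ars S ==> pnat \<alpha> f = pnat \<beta> f"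
  shows "\<alpha> = \<beta>"
proof -
  interpret \<alpha>: pseudonatural S K \<alpha> by fact
  interpret \<beta>: pseudonatural S K \<beta> by fact
  have "pcomp \<alpha> = pcomp \<beta>" "pnat \<alpha> = pnat \<beta>"
    using assms(5,6) \<alpha>.pcomp_ext \<beta>.pcomp_ext \<alpha>.pnat_ext \<beta>.pnat_ext
    by (auto intro!: extensionalityI)
  with assms(3,4) show ?thesis by simp
qed

lemma modif_eqI:
  fixes \<Gamma> \<Delta> :: "('o, 'm, 'c, 'p, 'n, 'd) modif"
  assumes "modification S K \<Gamma>" "modification S K \<Delta>" "msrc \<Gamma> = msrc \<Delta>" "mtgt \<Gamma> = mtgt \<Delta>"
    "!!x. x : obs S ==> mcomp \<Gamma> x = mcomp \<Delta> x"
  shows "\<Gamma> = \<Delta>"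
proof -
  interpret \<Gamma>: modification S K \<Gamma> by fact
  interpret \<Delta>: modification S K \<Delta> by fact
  have "mcomp \<Gamma> = mcomp \<Delta>"
    using assms(5) \<Gamma>.mcomp_ext \<Delta>.mcomp_ext by (auto intro!: extensionalityI)
  with assms(3,4) show ?thesis by simp
qed

section \<open>The 2-category laws for pseudonatural transformations and modifications\<close>

locale two_categories = S: two_category S + K: two_category K
  for S :: "('o, 'm, 'c) tcat" and K :: "('p, 'n, 'd) tcat" (structure)
begin

lemma psnat_id1: "pseudofunctor S K F ==> pseudonatural S K (id1 (PS S K) F)"
proof -
  assume "pseudofunctor S K F"
  then interpret F: pseudofunctor S K F .
  show ?thesis
    unfolding pseudonatural_def
    by (auto simp: in_hom1_def in_hom2_def intro: F.pseudofunctor_axioms)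
qed

text \<open>The axioms are those of \<open>\<beta>\<close> whiskered by components of
  \<open>\<alpha>\<close>, combined with those of \<open>\<alpha>\<close> whiskered by components of
  \<open>\<beta>\<close>. For composites of arrows, the naturality cells of \<open>\<beta>\<close>
  at \<open>g\<close> and of \<open>\<alpha>\<close> at \<open>f\<close> must also be exchanged,
  which is \<open>e3\<close>.\<close>

lemma psnat_comp1:
  assumes "pseudonatural S K \<beta>" "pseudonatural S K \<alpha>" "psrc \<beta> = ptgt \<alpha>"
  shows "pseudonatural S K (\<beta> \<odot>\<^bsub>PS S K\<^esub> \<alpha>)"
proof -
  interpret \<beta>: pseudonatural S K \<beta> by fact
  interpret \<alpha>: pseudonatural S K \<alpha> by fact
  note [simp] = assms(3)
  show ?thesis
    unfolding pseudonatural_def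
  proof (intro conjI allI impI)
    fix \<sigma> assume s [simp]: "\<sigma> : cells S"
    let ?x = "src S (cdom S \<sigma>)" and ?y = "tgt S (cdom S \<sigma>)"
    note e1 = arg_cong[OF \<beta>.pnat_nat[OF s], of "%s. s |> (pcomp \<alpha> ?x)", simplified]
    note e2 = arg_cong[OF \<alpha>.pnat_nat[OF s], of "%s. (pcomp \<beta> ?y) <| s", simplified]
    show "pnat (\<beta> \<odot>\<^bsub>PS S K\<^esub> \<alpha>) (ccod S \<sigma>) \<bullet> (pf2 (ptgt (\<beta> \<odot>\<^bsub>PS S K\<^esub> \<alpha>)) \<sigma> |> (pcomp (\<beta> \<odot>\<^bsub>PS S K\<^esub> \<alpha>) ?x))
      = (pcomp (\<beta> \<odot>\<^bsub>PS S K\<^esub> \<alpha>) ?y) <| pf2 (psrc (\<beta> \<odot>\<^bsub>PS S K\<^esub> \<alpha>)) \<sigma> \<bullet> pnat (\<beta> \<odot>\<^bsub>PS S K\<^esub> \<alpha>) (cdom S \<sigma>)"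
      by (simp add: e1 e2[THEN K.vc22])
  next
    fix g f assume "(g, f) : cpairs S"
    then have gf [simp]: "g : ars S" "f : ars S" "src S g = tgt S f" by simp_all
    let ?x = "src S f" and ?y = "tgt S f" and ?z = "tgt S g"
    note e1 = arg_cong[OF \<beta>.pnat_comp[of g f], of "%s. s |> (pcomp \<alpha> ?x)", simplified]
    note e2 = arg_cong[OF \<alpha>.pnat_comp[of g f], of "%s. (pcomp \<beta> ?z) <| s", simplified]
    have e3: "pnat \<beta> g |> (pcomp \<alpha> ?y \<odot> pf1 (psrc \<alpha>) f) \<bullet> ((pf1 (ptgt \<beta>) g \<odot> pcomp \<beta> ?y) <| pnat \<alpha> f)
      = (pcomp \<beta> ?z \<odot> pf1 (ptgt \<alpha>) g) <| pnat \<alpha> f \<bullet> pnat \<beta> g |> (pf1 (ptgt \<alpha>) f \<odot> pcomp \<alpha> ?x)"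
      by (rule K.slide) simp_all
    show "pnat (\<beta> \<odot>\<^bsub>PS S K\<^esub> \<alpha>) (g \<odot>\<^bsub>S\<^esub> f) \<bullet> (pfc (ptgt (\<beta> \<odot>\<^bsub>PS S K\<^esub> \<alpha>)) (g, f) |> (pcomp (\<beta> \<odot>\<^bsub>PS S K\<^esub> \<alpha>) ?x))
      = ((pcomp (\<beta> \<odot>\<^bsub>PS S K\<^esub> \<alpha>) ?z) <| pfc (psrc (\<beta> \<odot>\<^bsub>PS S K\<^esub> \<alpha>)) (g, f))
        \<bullet> (pnat (\<beta> \<odot>\<^bsub>PS S K\<^esub> \<alpha>) g |> (pf1 (psrc (\<beta> \<odot>\<^bsub>PS S K\<^esub> \<alpha>)) f))
        \<bullet> (pf1 (ptgt (\<beta> \<odot>\<^bsub>PS S K\<^esub> \<alpha>)) g) <| pnat (\<beta> \<odot>\<^bsub>PS S K\<^esub> \<alpha>) f"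
      by (simp add: e1 e2[THEN K.vc23] e3 e3[THEN K.vc22])
  next
    fix x assume x [simp]: "x : obs S"
    note e1 = arg_cong[OF \<beta>.pnat_unit[of x], of "%s. s |> (pcomp \<alpha> x)", simplified]
    note e2 = arg_cong[OF \<alpha>.pnat_unit[of x], of "%s. (pcomp \<beta> x) <| s", simplified]
    show "pnat (\<beta> \<odot>\<^bsub>PS S K\<^esub> \<alpha>) (id1 S x) \<bullet> (pfi (ptgt (\<beta> \<odot>\<^bsub>PS S K\<^esub> \<alpha>)) x |> (pcomp (\<beta> \<odot>\<^bsub>PS S K\<^esub> \<alpha>) x))
      = (pcomp (\<beta> \<odot>\<^bsub>PS S K\<^esub> \<alpha>) x) <| pfi (psrc (\<beta> \<odot>\<^bsub>PS S K\<^esub> \<alpha>)) x"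
      by (simp add: e1 e2)
  qed (auto simp: in_hom1_def in_hom2_def intro: \<alpha>.psrc_psfun \<beta>.ptgt_psfun)
qed

lemma modif_id2: "pseudonatural S K \<alpha> ==> modification S K (id2 (PS S K) \<alpha>)"
proof -
  assume a: "pseudonatural S K \<alpha>"
  then interpret pseudonatural S K \<alpha> .
  show ?thesis
    using a by (simp add: modification_def in_hom2_def)
qed

lemma modif_vcomp:
  assumes "modification S K \<Delta>" "modification S K \<Gamma>" "msrc \<Delta> = mtgt \<Gamma>"
  shows "modification S K (\<Delta> \<bullet>\<^bsub>PS S K\<^esub> \<Gamma>)"
proof -
  interpret \<Delta>: modification S K \<Delta> by fact
  interpret \<Gamma>: modification S K \<Gamma> by fact
  note [simp] = assms(3)
  show ?thesis
    unfolding modification_def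
  proof (intro conjI allI impI)
    fix f assume f [simp]: "f : ars S"
    note e1 = \<Delta>.mcomp_nat[OF f, simplified]
    note e2 = \<Gamma>.mcomp_nat[OF f]
    show "pnat (mtgt (\<Delta> \<bullet>\<^bsub>PS S K\<^esub> \<Gamma>)) f \<bullet> ((pf1 (ptgt (msrc (\<Delta> \<bullet>\<^bsub>PS S K\<^esub> \<Gamma>))) f) <| mcomp (\<Delta> \<bullet>\<^bsub>PS S K\<^esub> \<Gamma>) (src S f))
      = mcomp (\<Delta> \<bullet>\<^bsub>PS S K\<^esub> \<Gamma>) (tgt S f) |> (pf1 (psrc (msrc (\<Delta> \<bullet>\<^bsub>PS S K\<^esub> \<Gamma>))) f) \<bullet> pnat (msrc (\<Delta> \<bullet>\<^bsub>PS S K\<^esub> \<Gamma>)) f"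
      by (simp add: e1[THEN K.vc22] e2)
  qed (auto simp: in_hom2_def \<Delta>.mtgt_psnat \<Gamma>.msrc_psnat)
qed

lemma modif_hcomp:
  assumes "modification S K \<Delta>" "modification S K \<Gamma>" "psrc (msrc \<Delta>) = ptgt (msrc \<Gamma>)"
  shows "modification S K (\<Delta> \<star>\<^bsub>PS S K\<^esub> \<Gamma>)"
proof -
  interpret \<Delta>: modification S K \<Delta> by fact
  interpret \<Gamma>: modification S K \<Gamma> by fact
  note [simp] = assms(3)
  show ?thesis
    unfolding modification_def
  proof (intro conjI allI impI)
    fix f assume f [simp]: "f : ars S"
    let ?x = "src S f" and ?y = "tgt S f"
    \<comment> \<open>The horizontal composite is split into whiskerings because the modification
      axioms of the factors are stated by whiskering.\<close>
    have [simp]: "mcomp \<Delta> z \<star> mcomp \<Gamma> z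
      = mcomp \<Delta> z |> (pcomp (mtgt \<Gamma>) z) \<bullet> (pcomp (msrc \<Delta>) z) <| mcomp \<Gamma> z" if "z : obs S" for z
      using that K.hcomp_eq(1)[of "mcomp \<Delta> z" "mcomp \<Gamma> z"] by simp
    note e1 = arg_cong[OF \<Delta>.mcomp_nat[OF f], of "%s. s |> (pcomp (mtgt \<Gamma>) ?x)", simplified]
    note e2 = arg_cong[OF \<Gamma>.mcomp_nat[OF f], of "%s. (pcomp (msrc \<Delta>) ?y) <| s", simplified]
    have e3: "pnat (msrc \<Delta>) f |> (pcomp (mtgt \<Gamma>) ?x) \<bullet> ((pf1 (ptgt (msrc \<Delta>)) f \<odot> pcomp (msrc \<Delta>) ?x) <| mcomp \<Gamma> ?x)
       = (pcomp (msrc \<Delta>) ?y \<odot> pf1 (psrc (msrc \<Delta>)) f) <| mcomp \<Gamma> ?x \<bullet> pnat (msrc \<Delta>) f |> (pcomp (msrc \<Gamma>) ?x)"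
      by (rule K.slide) simp_all
    have e4: "mcomp \<Delta> ?y |> (pcomp (mtgt \<Gamma>) ?y \<odot> pf1 (psrc (msrc \<Gamma>)) f) \<bullet> ((pcomp (msrc \<Delta>) ?y) <| pnat (mtgt \<Gamma>) f)
       = (pcomp (mtgt \<Delta>) ?y) <| pnat (mtgt \<Gamma>) f \<bullet> mcomp \<Delta> ?y |> (pf1 (ptgt (msrc \<Gamma>)) f \<odot> pcomp (mtgt \<Gamma>) ?x)"
      by (rule K.slide) simp_all
    show "pnat (mtgt (\<Delta> \<star>\<^bsub>PS S K\<^esub> \<Gamma>)) f \<bullet> ((pf1 (ptgt (msrc (\<Delta> \<star>\<^bsub>PS S K\<^esub> \<Gamma>))) f) <| mcomp (\<Delta> \<star>\<^bsub>PS S K\<^esub> \<Gamma>) (src S f))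
      = mcomp (\<Delta> \<star>\<^bsub>PS S K\<^esub> \<Gamma>) (tgt S f) |> (pf1 (psrc (msrc (\<Delta> \<star>\<^bsub>PS S K\<^esub> \<Gamma>))) f) \<bullet> pnat (msrc (\<Delta> \<star>\<^bsub>PS S K\<^esub> \<Gamma>)) f"
      by (simp add: e1[THEN K.vc22] e2[symmetric] e2[symmetric, THEN K.vc22] e3 e4[THEN K.vc22])
  qed (auto simp: in_hom2_def intro!: psnat_comp1 \<Delta>.msrc_psnat \<Gamma>.msrc_psnat \<Delta>.mtgt_psnat \<Gamma>.mtgt_psnat)
qed

text \<open>Since all data are extensional and carry source and target, every law is an equation of
  records that \<open>psnat_eqI\<close> and \<open>modif_eqI\<close> reduce to the same law in
  \<open>K\<close> at each object or arrow.\<close>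

lemma two_category_PS: "two_category (PS S K)"
proof -
  note psnat [simp] = psnat_id1 psnat_comp1 modif_id2 modif_vcomp modif_hcomp
    modification.msrc_psnat modification.mtgt_psnat modification.mod_simps(1,2)
    pseudonatural.psrc_psfun pseudonatural.ptgt_psfun pseudonatural.pn_simps[of S K]
    modification.mod_simps(3-)[of S K] pseudofunctor.pf_simps[of S K]
  show ?thesis
  proof (unfold two_category_def, intro conjI allI impI)
    show "category (cat1 (PS S K))"
      by (auto simp: category_def cat1_def intro!: psnat_eqI[of S K])
    show "category (vcat (PS S K))"
      by (auto simp: category_def vcat_def intro!: modif_eqI[of S K])
  next
    fix t' t :: "('o, 'm, 'c, 'p, 'n, 'd) modif" and s' s
    assume "t' : cells (PS S K)" "t : cells (PS S K)" "s' : cells (PS S K)" "s : cells (PS S K)"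
      "cdom (PS S K) t' = ccod (PS S K) t" "cdom (PS S K) s' = ccod (PS S K) s"
      "src (PS S K) (cdom (PS S K) t) = tgt (PS S K) (cdom (PS S K) s)"
    then show "(t' \<bullet>\<^bsub>PS S K\<^esub> t) \<star>\<^bsub>PS S K\<^esub> (s' \<bullet>\<^bsub>PS S K\<^esub> s)
        = (t' \<star>\<^bsub>PS S K\<^esub> s') \<bullet>\<^bsub>PS S K\<^esub> (t \<star>\<^bsub>PS S K\<^esub> s)"
      by (intro modif_eqI[of S K]) (simp_all add: K.interchange)
  qed (auto intro!: modif_eqI[of S K] psnat_eqI[of S K])
qed

end

sublocale two_categories \<subseteq> PS: two_category "PS S K"
  by (rule two_category_PS)

section \<open>Algebras and comparison functors\<close>

context category
begin

lemma cat_simps [simp]: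
  "f : Ar C ==> Dom C f : Ob C" "f : Ar C ==> Cod C f : Ob C"
  "x : Ob C ==> Idt C x : Ar C" "x : Ob C ==> Dom C (Idt C x) = x" "x : Ob C ==> Cod C (Idt C x) = x"
  "[|g : Ar C; f : Ar C; Dom C g = Cod C f|] ==> g \<cdot> f : Ar C"
  "[|g : Ar C; f : Ar C; Dom C g = Cod C f|] ==> Dom C (g \<cdot> f) = Dom C f"
  "[|g : Ar C; f : Ar C; Dom C g = Cod C f|] ==> Cod C (g \<cdot> f) = Cod C g"
  "[|f : Ar C; x = Dom C f|] ==> f \<cdot> Idt C x = f"
  "[|f : Ar C; x = Cod C f|] ==> Idt C x \<cdot> f = f"
  "[|h : Ar C; g : Ar C; f : Ar C; Dom C h = Cod C g; Dom C g = Cod C f|] ==> (h \<cdot> g) \<cdot> f = h \<cdot> (g \<cdot> f)"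
  using Dom_Ob Cod_Ob Id_Ar Dom_Id Cod_Id Cmp_Ar Dom_Cmp Cod_Cmp Cmp_Id Id_Cmp Cmp_assoc by auto

lemma c21: "[|a \<cdot> b = c; a : Ar C; b : Ar C; Dom C a = Cod C b; r : Ar C; Dom C b = Cod C r|]
  ==> a \<cdot> b \<cdot> r = c \<cdot> r"
  using Cmp_assoc[of a b r] by simp

lemma c22: "[|a \<cdot> b = c \<cdot> d; a : Ar C; b : Ar C; Dom C a = Cod C b; c : Ar C; d : Ar C; Dom C c = Cod C d;
    r : Ar C; Dom C b = Cod C r|] ==> a \<cdot> b \<cdot> r = c \<cdot> d \<cdot> r"
  by (metis Cmp_assoc Dom_Cmp)

lemma iso_cancel_right:
  assumes "inverse_arrows C s t" "f \<cdot> s = g \<cdot> s" "f : Ar C" "g : Ar C" "Dom C f = Cod C s" "Dom C g = Cod C s"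
  shows "f = g"
proof -
  have "f = (f \<cdot> s) \<cdot> t" using assms(1,3,5) by (simp add: inverse_arrows_def)
  also have "\<dots> = g" unfolding assms(2) using assms(1,4,6) by (simp add: inverse_arrows_def)
  finally show ?thesis .
qed

lemma iso_cancel_left:
  assumes "inverse_arrows C s t" "s \<cdot> f = s \<cdot> g" "f : Ar C" "g : Ar C" "Dom C s = Cod C f" "Dom C s = Cod C g"
  shows "f = g"
proof -
  have [simp]: "t \<cdot> s \<cdot> f = f" "t \<cdot> s \<cdot> g = g"
    using assms(1,3-) by (simp_all add: inverse_arrows_def c21)
  have "f = t \<cdot> s \<cdot> f" by simp
  also have "\<dots> = g" unfolding assms(2) by simp
  finally show ?thesis .
qed

end

text \<open>Functors are treated here as bare pairs of maps, without extensionality. Whiskering by a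
  1-cell is then a functor between hom-categories as it stands, with no record around it.\<close>

definition functor_on :: "('a, 'b) cat \<Rightarrow> ('c, 'd) cat \<Rightarrow> ('a \<Rightarrow> 'c) \<Rightarrow> ('b \<Rightarrow> 'd) \<Rightarrow> bool" where
  "functor_on C D Fo Fa \<longleftrightarrow> (ALL x : Ob C. Fo x : Ob D) &
     (ALL f : Ar C. Fa f : Ar D & Dom D (Fa f) = Fo (Dom C f) & Cod D (Fa f) = Fo (Cod C f)) &
     (ALL x : Ob C. Fa (Idt C x) = Idt D (Fo x)) &
     (ALL g : Ar C. ALL f : Ar C. Dom C g = Cod C f --> Fa (g \<cdot>\<^bsub>C\<^esub> f) = Fa g \<cdot>\<^bsub>D\<^esub> Fa f)"

lemma functor_onD:
  assumes "functor_on C D Fo Fa"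
  shows "x : Ob C ==> Fo x : Ob D"
    and "f : Ar C ==> Fa f : Ar D" "f : Ar C ==> Dom D (Fa f) = Fo (Dom C f)"
    and "f : Ar C ==> Cod D (Fa f) = Fo (Cod C f)"
    and "x : Ob C ==> Fa (Idt C x) = Idt D (Fo x)"
    and "[|g : Ar C; f : Ar C; Dom C g = Cod C f|] ==> Fa (g \<cdot>\<^bsub>C\<^esub> f) = Fa g \<cdot>\<^bsub>D\<^esub> Fa f"
  using assms by (simp_all add: functor_on_def)

lemma functor_on_inverse:
  assumes "functor_on C D Fo Fa" "category C" "inverse_arrows C s t"
  shows "inverse_arrows D (Fa s) (Fa t)"
proof -
  interpret C: category C by fact
  note [simp] = functor_onD[OF assms(1)]
  have s [simp]: "s : Ar C" "t : Ar C" "Dom C t = Cod C s" "Cod C t = Dom C s"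
    and ts: "t \<cdot>\<^bsub>C\<^esub> s = Idt C (Dom C s)" "s \<cdot>\<^bsub>C\<^esub> t = Idt C (Cod C s)"
    using assms(3) by (simp_all add: inverse_arrows_def)
  have "Fa t \<cdot>\<^bsub>D\<^esub> Fa s = Idt D (Fo (Dom C s))"
    by (subst functor_onD(6)[OF assms(1), symmetric]) (simp_all add: ts)
  moreover have "Fa s \<cdot>\<^bsub>D\<^esub> Fa t = Idt D (Fo (Cod C s))"
    by (subst functor_onD(6)[OF assms(1), symmetric]) (simp_all add: ts)
  ultimately show ?thesis by (simp add: inverse_arrows_def)
qed

definition faithful_on :: "('a, 'b) cat \<Rightarrow> ('b \<Rightarrow> 'd) \<Rightarrow> bool" where
  "faithful_on C Fa \<longleftrightarrow> (ALL r : Ar C. ALL r' : Ar C. Dom C r = Dom C r' --> Cod C r = Cod C r' -->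
     Fa r = Fa r' --> r = r')"

definition full_on :: "('a, 'b) cat \<Rightarrow> ('c, 'd) cat \<Rightarrow> ('a \<Rightarrow> 'c) \<Rightarrow> ('b \<Rightarrow> 'd) \<Rightarrow> bool" where
  "full_on C D Fo Fa \<longleftrightarrow> (ALL x : Ob C. ALL y : Ob C. ALL s : Homset D (Fo x) (Fo y). EX r : Homset C x y. Fa r = s)"

definition ess_surj_on :: "('a, 'b) cat \<Rightarrow> ('c, 'd) cat \<Rightarrow> ('a \<Rightarrow> 'c) \<Rightarrow> bool" where
  "ess_surj_on C D Fo \<longleftrightarrow> (ALL y : Ob D. EX x : Ob C. EX s : Homset D (Fo x) y. is_iso D s)"

definition alg_obj where
  "alg_obj B To Ta \<eta> \<mu> x k \<longleftrightarrow> x : Ob B & k : Homset B (To x) x &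
     k \<cdot>\<^bsub>B\<^esub> \<eta> x = Idt B x & k \<cdot>\<^bsub>B\<^esub> Ta k = k \<cdot>\<^bsub>B\<^esub> \<mu> x"

text \<open>Fullness and essential surjectivity of the functor \<open>c \<mapsto> (Po c, h c)\<close> into the algebras of
  a monad \<open>T\<close> on \<open>B\<close>.\<close>

definition alg_full where
  "alg_full C B Po Pa Ta h \<longleftrightarrow> (ALL c : Ob C. ALL d : Ob C. ALL s : Homset B (Po c) (Po d).
     s \<cdot>\<^bsub>B\<^esub> h c = h d \<cdot>\<^bsub>B\<^esub> Ta s --> (EX r : Homset C c d. Pa r = s))"

definition alg_ess_surj where
  "alg_ess_surj C B Po h To Ta \<eta> \<mu> \<longleftrightarrow> (ALL x k. alg_obj B To Ta \<eta> \<mu> x k -->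
     (EX c : Ob C. EX s : Homset B (Po c) x. is_iso B s & s \<cdot>\<^bsub>B\<^esub> h c = k \<cdot>\<^bsub>B\<^esub> Ta s))"

text \<open>A strong monad morphism \<open>(Q, \<phi>) : (B, T) \<rightarrow> (B', T')\<close> and functors \<open>P\<close>, \<open>P'\<close> into algebras, related by
  \<open>M : C \<rightarrow> C'\<close> and \<open>i : P' M \<cong> Q P\<close>.\<close>

locale alg_square =
  C: category C + B: category B + C': category C' + B': category B'
  for C :: "('a, 'b) cat" and B :: "('c, 'd) cat" and C' :: "('e, 'f) cat" and B' :: "('g, 'h) cat" +
  fixes Po Pa h Po' Pa' h' Mo Ma Qo Qa To Ta \<eta> \<mu> To' Ta' \<eta>' \<mu>' \<phi> i
  assumes P: "functor_on C B Po Pa" and P': "functor_on C' B' Po' Pa'"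
    and M: "functor_on C C' Mo Ma" and Q: "functor_on B B' Qo Qa"
    and T: "functor_on B B To Ta" and T': "functor_on B' B' To' Ta'"
    and eta: "x : Ob B ==> \<eta> x : Homset B x (To x)" and mu: "x : Ob B ==> \<mu> x : Homset B (To (To x)) (To x)"
    and eta': "y : Ob B' ==> \<eta>' y : Homset B' y (To' y)"
    and mu': "y : Ob B' ==> \<mu>' y : Homset B' (To' (To' y)) (To' y)"
    and eta'_nat: "f : Ar B' ==> Ta' f \<cdot>\<^bsub>B'\<^esub> \<eta>' (Dom B' f) = \<eta>' (Cod B' f) \<cdot>\<^bsub>B'\<^esub> f"
    and mu'_nat: "f : Ar B' ==> Ta' f \<cdot>\<^bsub>B'\<^esub> \<mu>' (Dom B' f) = \<mu>' (Cod B' f) \<cdot>\<^bsub>B'\<^esub> Ta' (Ta' f)"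
    and h: "c : Ob C ==> h c : Homset B (To (Po c)) (Po c)"
    and h_nat: "r : Ar C ==> Pa r \<cdot>\<^bsub>B\<^esub> h (Dom C r) = h (Cod C r) \<cdot>\<^bsub>B\<^esub> Ta (Pa r)"
    and h': "c' : Ob C' ==> alg_obj B' To' Ta' \<eta>' \<mu>' (Po' c') (h' c')"
    and h'_nat: "r' : Ar C' ==> Pa' r' \<cdot>\<^bsub>B'\<^esub> h' (Dom C' r') = h' (Cod C' r') \<cdot>\<^bsub>B'\<^esub> Ta' (Pa' r')"
    and phi: "x : Ob B ==> \<phi> x : Homset B' (To' (Qo x)) (Qo (To x))" and phi_iso: "x : Ob B ==> is_iso B' (\<phi> x)"
    and phi_nat: "s : Ar B ==> Qa (Ta s) \<cdot>\<^bsub>B'\<^esub> \<phi> (Dom B s) = \<phi> (Cod B s) \<cdot>\<^bsub>B'\<^esub> Ta' (Qa s)"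
    and phi_eta: "x : Ob B ==> \<phi> x \<cdot>\<^bsub>B'\<^esub> \<eta>' (Qo x) = Qa (\<eta> x)"
    and phi_mu: "x : Ob B ==> \<phi> x \<cdot>\<^bsub>B'\<^esub> \<mu>' (Qo x) = Qa (\<mu> x) \<cdot>\<^bsub>B'\<^esub> \<phi> (To x) \<cdot>\<^bsub>B'\<^esub> Ta' (\<phi> x)"
    and i: "c : Ob C ==> i c : Homset B' (Po' (Mo c)) (Qo (Po c))" and i_iso: "c : Ob C ==> is_iso B' (i c)"
    and i_nat: "r : Ar C ==> Qa (Pa r) \<cdot>\<^bsub>B'\<^esub> i (Dom C r) = i (Cod C r) \<cdot>\<^bsub>B'\<^esub> Pa' (Ma r)"
    and i_alg: "c : Ob C ==> i c \<cdot>\<^bsub>B'\<^esub> h' (Mo c) = Qa (h c) \<cdot>\<^bsub>B'\<^esub> \<phi> (Po c) \<cdot>\<^bsub>B'\<^esub> Ta' (i c)"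
begin

lemmas functors [simp] = functor_onD[OF P] functor_onD[OF P'] functor_onD[OF M] functor_onD[OF Q]
  functor_onD[OF T] functor_onD[OF T']

lemma typing [simp]:
  "x : Ob B ==> \<eta> x : Ar B" "x : Ob B ==> Dom B (\<eta> x) = x" "x : Ob B ==> Cod B (\<eta> x) = To x"
  "x : Ob B ==> \<mu> x : Ar B" "x : Ob B ==> Dom B (\<mu> x) = To (To x)" "x : Ob B ==> Cod B (\<mu> x) = To x"
  "y : Ob B' ==> \<eta>' y : Ar B'" "y : Ob B' ==> Dom B' (\<eta>' y) = y" "y : Ob B' ==> Cod B' (\<eta>' y) = To' y"
  "y : Ob B' ==> \<mu>' y : Ar B'" "y : Ob B' ==> Dom B' (\<mu>' y) = To' (To' y)" "y : Ob B' ==> Cod B' (\<mu>' y) = To' y"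
  "c : Ob C ==> h c : Ar B" "c : Ob C ==> Dom B (h c) = To (Po c)" "c : Ob C ==> Cod B (h c) = Po c"
  "c' : Ob C' ==> h' c' : Ar B'" "c' : Ob C' ==> Dom B' (h' c') = To' (Po' c')" "c' : Ob C' ==> Cod B' (h' c') = Po' c'"
  "x : Ob B ==> \<phi> x : Ar B'" "x : Ob B ==> Dom B' (\<phi> x) = To' (Qo x)" "x : Ob B ==> Cod B' (\<phi> x) = Qo (To x)"
  "c : Ob C ==> i c : Ar B'" "c : Ob C ==> Dom B' (i c) = Po' (Mo c)" "c : Ob C ==> Cod B' (i c) = Qo (Po c)"
  using eta mu eta' mu' h h' phi i by (auto simp: Homset_def alg_obj_def)

definition j where "j c = (SOME t. inverse_arrows B' (i c) t)"
definition \<psi> where "\<psi> x = (SOME t. inverse_arrows B' (\<phi> x) t)"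

lemma j: "c : Ob C ==> inverse_arrows B' (i c) (j c)"
  unfolding j_def by (rule someI_ex) (use i_iso[of c] in \<open>simp add: is_iso_def\<close>)

lemma psi: "x : Ob B ==> inverse_arrows B' (\<phi> x) (\<psi> x)"
  unfolding \<psi>_def by (rule someI_ex) (use phi_iso[of x] in \<open>simp add: is_iso_def\<close>)

lemma j_simps [simp]:
  assumes "c : Ob C"
  shows "j c : Ar B'" "Dom B' (j c) = Qo (Po c)" "Cod B' (j c) = Po' (Mo c)"
    "j c \<cdot>\<^bsub>B'\<^esub> i c = Idt B' (Po' (Mo c))" "i c \<cdot>\<^bsub>B'\<^esub> j c = Idt B' (Qo (Po c))"
  using j[OF assms] assms by (simp_all add: inverse_arrows_def)

lemma psi_simps [simp]:
  assumes "x : Ob B"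
  shows "\<psi> x : Ar B'" "Dom B' (\<psi> x) = Qo (To x)" "Cod B' (\<psi> x) = To' (Qo x)"
    "\<psi> x \<cdot>\<^bsub>B'\<^esub> \<phi> x = Idt B' (To' (Qo x))" "\<phi> x \<cdot>\<^bsub>B'\<^esub> \<psi> x = Idt B' (Qo (To x))"
  using psi[OF assms] assms by (simp_all add: inverse_arrows_def)

lemmas inv_vc [simp] = j_simps(4,5)[THEN B'.c21] psi_simps(4,5)[THEN B'.c21]

lemmas functor_inverse = functor_on_inverse[OF _ B'.category_axioms]

text \<open>The isomorphisms \<open>i\<close> make the composites of \<open>P\<close> with
  \<open>Q\<close> and of \<open>M\<close> with \<open>P'\<close> naturally isomorphic, hence they
  identify the same parallel arrows.\<close>

lemma QP_M:
  assumes "r : Ar C" "r' : Ar C" "Dom C r = Dom C r'" "Cod C r = Cod C r'"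
  shows "Qa (Pa r) = Qa (Pa r') \<longleftrightarrow> Pa' (Ma r) = Pa' (Ma r')"
proof
  assume "Qa (Pa r) = Qa (Pa r')"
  then have "i (Cod C r) \<cdot>\<^bsub>B'\<^esub> Pa' (Ma r) = i (Cod C r) \<cdot>\<^bsub>B'\<^esub> Pa' (Ma r')"
    using i_nat[of r] i_nat[of r'] assms by simp
  then show "Pa' (Ma r) = Pa' (Ma r')"
    by (rule B'.iso_cancel_left[OF j, rotated]) (use assms in simp_all)
next
  assume "Pa' (Ma r) = Pa' (Ma r')"
  then have "Qa (Pa r) \<cdot>\<^bsub>B'\<^esub> i (Dom C r) = Qa (Pa r') \<cdot>\<^bsub>B'\<^esub> i (Dom C r)"
    using i_nat[of r] i_nat[of r'] assms by simp
  then show "Qa (Pa r) = Qa (Pa r')"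
    by (rule B'.iso_cancel_right[OF j, rotated]) (use assms in simp_all)
qed

text \<open>Faithfulness of \<open>Q\<close> and of \<open>P'\<close> turns equality under
  \<open>P\<close> and equality under \<open>M\<close> into two equalities in \<open>B'\<close>,
  which the square identifies.\<close>

lemma faithful_iff:
  assumes "faithful_on B Qa" "faithful_on C' Pa'"
  shows "faithful_on C Pa \<longleftrightarrow> faithful_on C Ma"
proof -
  have "Pa r = Pa r' \<longleftrightarrow> Ma r = Ma r'"
    if "r : Ar C" "r' : Ar C" "Dom C r = Dom C r'" "Cod C r = Cod C r'" for r r'
  proof -
    have "Pa r = Pa r' \<longleftrightarrow> Qa (Pa r) = Qa (Pa r')"
      using assms(1) that unfolding faithful_on_def by auto
    also have "\<dots> \<longleftrightarrow> Pa' (Ma r) = Pa' (Ma r')" using QP_M that by blast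
    also have "\<dots> \<longleftrightarrow> Ma r = Ma r'"
      using assms(2) that unfolding faithful_on_def by auto
    finally show ?thesis .
  qed
  then show ?thesis unfolding faithful_on_def by blast
qed

text \<open>Conjugation with \<open>i\<close> carries \<open>s\<close> to \<open>s'\<close>, and
  \<open>i_alg\<close> with naturality of \<open>\<phi>\<close> carries one compatibility with the
  actions to the other, up to an invertible factor. Faithfulness of \<open>Q\<close> reflects the
  equation back to \<open>B\<close>.\<close>

lemma hom_iff:
  assumes Qf: "faithful_on B Qa"
    and c: "c : Ob C" "d : Ob C" and s: "s : Homset B (Po c) (Po d)"
    and s': "s' : Homset B' (Po' (Mo c)) (Po' (Mo d))" and r: "Qa s \<cdot>\<^bsub>B'\<^esub> i c = i d \<cdot>\<^bsub>B'\<^esub> s'"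
  shows "s \<cdot>\<^bsub>B\<^esub> h c = h d \<cdot>\<^bsub>B\<^esub> Ta s \<longleftrightarrow> s' \<cdot>\<^bsub>B'\<^esub> h' (Mo c) = h' (Mo d) \<cdot>\<^bsub>B'\<^esub> Ta' s'"
proof -
  from s s' have [simp]: "s : Ar B" "Dom B s = Po c" "Cod B s = Po d"
    "s' : Ar B'" "Dom B' s' = Po' (Mo c)" "Cod B' s' = Po' (Mo d)" by (auto simp: Homset_def)
  note [simp] = c
  note r2 = arg_cong[OF r, of Ta', simplified]
  have 1: "i d \<cdot>\<^bsub>B'\<^esub> s' \<cdot>\<^bsub>B'\<^esub> h' (Mo c) = Qa (s \<cdot>\<^bsub>B\<^esub> h c) \<cdot>\<^bsub>B'\<^esub> \<phi> (Po c) \<cdot>\<^bsub>B'\<^esub> Ta' (i c)"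
    using r[symmetric, THEN B'.c22, of "h' (Mo c)"] i_alg[of c] by simp
  have 2: "i d \<cdot>\<^bsub>B'\<^esub> h' (Mo d) \<cdot>\<^bsub>B'\<^esub> Ta' s' = Qa (h d \<cdot>\<^bsub>B\<^esub> Ta s) \<cdot>\<^bsub>B'\<^esub> \<phi> (Po c) \<cdot>\<^bsub>B'\<^esub> Ta' (i c)"
  proof -
    have "i d \<cdot>\<^bsub>B'\<^esub> h' (Mo d) \<cdot>\<^bsub>B'\<^esub> Ta' s' = (Qa (h d) \<cdot>\<^bsub>B'\<^esub> \<phi> (Po d)) \<cdot>\<^bsub>B'\<^esub> Ta' (i d) \<cdot>\<^bsub>B'\<^esub> Ta' s'"
      using B'.Cmp_assoc[of "i d" "h' (Mo d)" "Ta' s'"] i_alg[of d] by simp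
    also have "\<dots> = Qa (h d) \<cdot>\<^bsub>B'\<^esub> \<phi> (Po d) \<cdot>\<^bsub>B'\<^esub> Ta' (Qa s) \<cdot>\<^bsub>B'\<^esub> Ta' (i c)"
      by (simp add: r2)
    also have "\<dots> = Qa (h d \<cdot>\<^bsub>B\<^esub> Ta s) \<cdot>\<^bsub>B'\<^esub> \<phi> (Po c) \<cdot>\<^bsub>B'\<^esub> Ta' (i c)"
      using phi_nat[of s, symmetric, simplified, THEN B'.c22, of "Ta' (i c)"] by simp
    finally show ?thesis .
  qed
  \<comment> \<open>The common right factor of \<open>1\<close> and \<open>2\<close>; it can be
    cancelled because both of its parts are invertible.\<close>
  have inv: "inverse_arrows B' (\<phi> (Po c) \<cdot>\<^bsub>B'\<^esub> Ta' (i c)) (Ta' (j c) \<cdot>\<^bsub>B'\<^esub> \<psi> (Po c))"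
    by (rule B'.inverse_arrows_Cmp) (simp_all add: functor_inverse[OF T' j] psi)
  show ?thesis
  proof
    assume "s \<cdot>\<^bsub>B\<^esub> h c = h d \<cdot>\<^bsub>B\<^esub> Ta s"
    then have "i d \<cdot>\<^bsub>B'\<^esub> s' \<cdot>\<^bsub>B'\<^esub> h' (Mo c) = i d \<cdot>\<^bsub>B'\<^esub> h' (Mo d) \<cdot>\<^bsub>B'\<^esub> Ta' s'"
      unfolding 1 2 by simp
    then show "s' \<cdot>\<^bsub>B'\<^esub> h' (Mo c) = h' (Mo d) \<cdot>\<^bsub>B'\<^esub> Ta' s'"
      by (rule B'.iso_cancel_left[OF j, rotated]) simp_all
  next
    assume "s' \<cdot>\<^bsub>B'\<^esub> h' (Mo c) = h' (Mo d) \<cdot>\<^bsub>B'\<^esub> Ta' s'"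
    then have "Qa (s \<cdot>\<^bsub>B\<^esub> h c) \<cdot>\<^bsub>B'\<^esub> \<phi> (Po c) \<cdot>\<^bsub>B'\<^esub> Ta' (i c)
        = Qa (h d \<cdot>\<^bsub>B\<^esub> Ta s) \<cdot>\<^bsub>B'\<^esub> \<phi> (Po c) \<cdot>\<^bsub>B'\<^esub> Ta' (i c)"
      using 1 2 by metis
    then have "Qa (s \<cdot>\<^bsub>B\<^esub> h c) = Qa (h d \<cdot>\<^bsub>B\<^esub> Ta s)"
      by (rule B'.iso_cancel_right[OF inv]) simp_all
    then show "s \<cdot>\<^bsub>B\<^esub> h c = h d \<cdot>\<^bsub>B\<^esub> Ta s"
      using Qf unfolding faithful_on_def by simp
  qed
qed

text \<open>Fully faithful \<open>Q\<close> matches algebra maps between the objects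
  \<open>Po c\<close> and \<open>Po d\<close> with algebra maps between their images in
  \<open>B'\<close>, and these are exactly the images of arrows of \<open>C'\<close>. So lifting
  along \<open>P\<close> and lifting along \<open>M\<close> are the same problem.\<close>

lemma full_iff:
  assumes Q1: "faithful_on B Qa" "full_on B B' Qo Qa"
    and P1: "faithful_on C' Pa'" "alg_full C' B' Po' Pa' Ta' h'"
  shows "alg_full C B Po Pa Ta h \<longleftrightarrow> full_on C C' Mo Ma"
proof
  assume l: "alg_full C B Po Pa Ta h"
  show "full_on C C' Mo Ma"
    unfolding full_on_def
  proof (intro ballI)
    fix c d s' assume c [simp]: "c : Ob C" "d : Ob C" and s': "s' : Homset C' (Mo c) (Mo d)"
    then have [simp]: "s' : Ar C'" "Dom C' s' = Mo c" "Cod C' s' = Mo d" by (auto simp: Homset_def)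
    \<comment> \<open>The arrow \<open>Pa' s'\<close> is moved along \<open>i\<close> between
      objects in the image of \<open>Q\<close>, where fullness of \<open>Q\<close> applies.\<close>
    have "i d \<cdot>\<^bsub>B'\<^esub> Pa' s' \<cdot>\<^bsub>B'\<^esub> j c : Homset B' (Qo (Po c)) (Qo (Po d))"
      by (simp add: Homset_def)
    then obtain s where s: "s : Homset B (Po c) (Po d)" "Qa s = i d \<cdot>\<^bsub>B'\<^esub> Pa' s' \<cdot>\<^bsub>B'\<^esub> j c"
      using Q1(2) unfolding full_on_def by (meson c functors(1))
    have "s \<cdot>\<^bsub>B\<^esub> h c = h d \<cdot>\<^bsub>B\<^esub> Ta s"
      using hom_iff[OF Q1(1) c s(1), of "Pa' s'"] h'_nat[of s'] by (simp add: Homset_def s(2))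
    then obtain r where r: "r : Homset C c d" "Pa r = s" using l s unfolding alg_full_def by (meson c)
    then have r' [simp]: "r : Ar C" "Dom C r = c" "Cod C r = d" by (auto simp: Homset_def)
    have "i d \<cdot>\<^bsub>B'\<^esub> Pa' (Ma r) = i d \<cdot>\<^bsub>B'\<^esub> Pa' s'"
      using i_nat[of r, symmetric] by (simp add: r(2) s(2))
    then have "Pa' (Ma r) = Pa' s'" by (rule B'.iso_cancel_left[OF j, rotated]) simp_all
    then have "Ma r = s'" using P1(1) unfolding faithful_on_def by simp
    with r show "EX r : Homset C c d. Ma r = s'" by blast
  qed
next
  assume l: "full_on C C' Mo Ma"
  show "alg_full C B Po Pa Ta h"
    unfolding alg_full_def
  proof (intro ballI impI)
    fix c d s assume c [simp]: "c : Ob C" "d : Ob C" and s: "s : Homset B (Po c) (Po d)"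
      and a: "s \<cdot>\<^bsub>B\<^esub> h c = h d \<cdot>\<^bsub>B\<^esub> Ta s"
    then have [simp]: "s : Ar B" "Dom B s = Po c" "Cod B s = Po d" by (auto simp: Homset_def)
    \<comment> \<open>The inverse conjugation, from \<open>B\<close> to algebra maps in the image of
      \<open>P'\<close>.\<close>
    let ?t = "j d \<cdot>\<^bsub>B'\<^esub> Qa s \<cdot>\<^bsub>B'\<^esub> i c"
    have t: "?t : Homset B' (Po' (Mo c)) (Po' (Mo d))" by (simp add: Homset_def)
    have "?t \<cdot>\<^bsub>B'\<^esub> h' (Mo c) = h' (Mo d) \<cdot>\<^bsub>B'\<^esub> Ta' ?t"
      using hom_iff[OF Q1(1) c s t] a by simp
    then obtain s' where s': "s' : Homset C' (Mo c) (Mo d)" "Pa' s' = ?t"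
      using P1(2) t unfolding alg_full_def by (meson c functors(13))
    then obtain r where r: "r : Homset C c d" "Ma r = s'" using l unfolding full_on_def by (meson c)
    then have r' [simp]: "r : Ar C" "Dom C r = c" "Cod C r = d" by (auto simp: Homset_def)
    have "Qa (Pa r) \<cdot>\<^bsub>B'\<^esub> i c = Qa s \<cdot>\<^bsub>B'\<^esub> i c"
      using i_nat[of r] by (simp add: r(2) s'(2))
    then have "Qa (Pa r) = Qa s" by (rule B'.iso_cancel_right[OF j, rotated]) simp_all
    then have "Pa r = s" using Q1(1) unfolding faithful_on_def by simp
    with r show "EX r : Homset C c d. Pa r = s" by blast
  qed
qed

lemma faithful_full_reflects_iso:
  assumes "functor_on X Y Fo Fa" "category X" "category Y" "faithful_on X Fa" "full_on X Y Fo Fa"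
    and "s : Ar X" "is_iso Y (Fa s)"
  shows "is_iso X s"
proof -
  interpret X: category X by fact
  interpret Y: category Y by fact
  note [simp] = functor_onD[OF assms(1)] assms(6)
  from assms(7) obtain t where t: "inverse_arrows Y (Fa s) t" by (auto simp: is_iso_def)
  then have "t : Homset Y (Fo (Cod X s)) (Fo (Dom X s))" by (auto simp: inverse_arrows_def Homset_def)
  then obtain r where "r : Homset X (Cod X s) (Dom X s)" and r2 [simp]: "Fa r = t"
    using assms(5) unfolding full_on_def by (meson X.Cod_Ob X.Dom_Ob assms(6))
  then have [simp]: "r : Ar X" "Dom X r = Cod X s" "Cod X r = Dom X s" by (auto simp: Homset_def)
  have "Fa (r \<cdot>\<^bsub>X\<^esub> s) = Fa (Idt X (Dom X s))" "Fa (s \<cdot>\<^bsub>X\<^esub> r) = Fa (Idt X (Cod X s))"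
    using t by (simp_all add: inverse_arrows_def)
  then have "r \<cdot>\<^bsub>X\<^esub> s = Idt X (Dom X s)" "s \<cdot>\<^bsub>X\<^esub> r = Idt X (Cod X s)"
    using assms(4) unfolding faithful_on_def by simp_all
  then show ?thesis by (auto simp: is_iso_def inverse_arrows_def intro!: exI[of _ r])
qed

text \<open>Composition with \<open>\<phi>\<close> turns an action of \<open>T\<close> on
  \<open>x\<close> into an action of \<open>T'\<close> on its image. Both algebra laws become the
  images under \<open>Q\<close> of the original ones, the second up to an invertible factor, so
  faithfulness of \<open>Q\<close> also reflects them.\<close>

lemma push_alg_iff:
  assumes "faithful_on B Qa" and x: "x : Ob B" and k: "k : Homset B (To x) x"
  shows "alg_obj B' To' Ta' \<eta>' \<mu>' (Qo x) (Qa k \<cdot>\<^bsub>B'\<^esub> \<phi> x) \<longleftrightarrow> alg_obj B To Ta \<eta> \<mu> x k"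
proof -
  from k have [simp]: "k : Ar B" "Dom B k = To x" "Cod B k = x" by (auto simp: Homset_def)
  note [simp] = x
  let ?k = "Qa k \<cdot>\<^bsub>B'\<^esub> \<phi> x"
  have e: "?k \<cdot>\<^bsub>B'\<^esub> \<eta>' (Qo x) = Qa (k \<cdot>\<^bsub>B\<^esub> \<eta> x)"
    using phi_eta[of x] by simp
  have "Qa (k \<cdot>\<^bsub>B\<^esub> \<eta> x) = Qa (Idt B x) ==> k \<cdot>\<^bsub>B\<^esub> \<eta> x = Idt B x"
    by (rule assms(1)[unfolded faithful_on_def, rule_format]) simp_all
  then have 1: "?k \<cdot>\<^bsub>B'\<^esub> \<eta>' (Qo x) = Idt B' (Qo x) \<longleftrightarrow> k \<cdot>\<^bsub>B\<^esub> \<eta> x = Idt B x"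
    unfolding e using functor_onD(5)[OF Q x] by metis
  have a: "?k \<cdot>\<^bsub>B'\<^esub> Ta' ?k = Qa (k \<cdot>\<^bsub>B\<^esub> Ta k) \<cdot>\<^bsub>B'\<^esub> \<phi> (To x) \<cdot>\<^bsub>B'\<^esub> Ta' (\<phi> x)"
    using phi_nat[of k, symmetric, simplified, THEN B'.c22, of "Ta' (\<phi> x)"] by simp
  have b: "?k \<cdot>\<^bsub>B'\<^esub> \<mu>' (Qo x) = Qa (k \<cdot>\<^bsub>B\<^esub> \<mu> x) \<cdot>\<^bsub>B'\<^esub> \<phi> (To x) \<cdot>\<^bsub>B'\<^esub> Ta' (\<phi> x)"
    using phi_mu[of x] by simp
  have inv: "inverse_arrows B' (\<phi> (To x) \<cdot>\<^bsub>B'\<^esub> Ta' (\<phi> x)) (Ta' (\<psi> x) \<cdot>\<^bsub>B'\<^esub> \<psi> (To x))"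
    by (rule B'.inverse_arrows_Cmp) (simp_all add: functor_inverse[OF T' psi] psi)
  have 2: "?k \<cdot>\<^bsub>B'\<^esub> Ta' ?k = ?k \<cdot>\<^bsub>B'\<^esub> \<mu>' (Qo x) \<longleftrightarrow> k \<cdot>\<^bsub>B\<^esub> Ta k = k \<cdot>\<^bsub>B\<^esub> \<mu> x"
  proof
    assume "?k \<cdot>\<^bsub>B'\<^esub> Ta' ?k = ?k \<cdot>\<^bsub>B'\<^esub> \<mu>' (Qo x)"
    then have "Qa (k \<cdot>\<^bsub>B\<^esub> Ta k) = Qa (k \<cdot>\<^bsub>B\<^esub> \<mu> x)"
      unfolding a b by (rule B'.iso_cancel_right[OF inv]) simp_all
    then show "k \<cdot>\<^bsub>B\<^esub> Ta k = k \<cdot>\<^bsub>B\<^esub> \<mu> x"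
      using assms(1) unfolding faithful_on_def by simp
  qed (simp only: a b)
  show ?thesis using 1 2 by (simp add: alg_obj_def Homset_def)
qed

text \<open>Transport of structure: conjugating an action by an isomorphism preserves the laws, by
  naturality of the unit and the multiplication.\<close>

lemma alg_obj_iso:
  assumes y: "alg_obj B' To' Ta' \<eta>' \<mu>' y k'" and s: "inverse_arrows B' s t" "Cod B' s = y"
  shows "alg_obj B' To' Ta' \<eta>' \<mu>' (Dom B' s) (t \<cdot>\<^bsub>B'\<^esub> k' \<cdot>\<^bsub>B'\<^esub> Ta' s)"
proof -
  let ?x = "Dom B' s"
  from y s have [simp]: "y : Ob B'" "k' : Ar B'" "Dom B' k' = To' y" "Cod B' k' = y" "Cod B' s = y"
    "s : Ar B'" "t : Ar B'" "Dom B' t = y" "Cod B' t = Dom B' s" "t \<cdot>\<^bsub>B'\<^esub> s = Idt B' ?x" "s \<cdot>\<^bsub>B'\<^esub> t = Idt B' y"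
    by (auto simp: inverse_arrows_def Homset_def alg_obj_def)
  note e1 = eta'_nat[of s, simplified] and e2 = mu'_nat[of s, simplified]
  have e3: "k' \<cdot>\<^bsub>B'\<^esub> \<eta>' y = Idt B' y" and e4: "k' \<cdot>\<^bsub>B'\<^esub> Ta' k' = k' \<cdot>\<^bsub>B'\<^esub> \<mu>' y"
    using y by (auto simp: alg_obj_def)
  have e5: "Ta' s \<cdot>\<^bsub>B'\<^esub> Ta' t = Idt B' (To' y)"
    using functor_onD(6)[OF T', of s t] by simp
  show ?thesis
    by (simp add: alg_obj_def Homset_def e1 e2 e3[THEN B'.c21] e4[THEN B'.c22] e5[THEN B'.c21])
qed

text \<open>An object of \<open>C'\<close> yields an algebra in \<open>B'\<close>, which is moved
  into the image of \<open>Q\<close>, reflected to an algebra in \<open>B\<close> and realised there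
  by an object of \<open>C\<close>; the resulting isomorphism of algebras lifts along
  \<open>P'\<close>. In the other direction an algebra in \<open>B\<close> is pushed to
  \<open>B'\<close> and realised in \<open>C'\<close>, then in \<open>C\<close> up to isomorphism,
  and the isomorphism is reflected by \<open>Q\<close>.\<close>

lemma ess_surj_iff:
  assumes Q1: "faithful_on B Qa" "full_on B B' Qo Qa" "ess_surj_on B B' Qo"
    and P1: "faithful_on C' Pa'" "alg_full C' B' Po' Pa' Ta' h'" "alg_ess_surj C' B' Po' h' To' Ta' \<eta>' \<mu>'"
    and M1: "faithful_on C Ma" "full_on C C' Mo Ma"
  shows "alg_ess_surj C B Po h To Ta \<eta> \<mu> \<longleftrightarrow> ess_surj_on C C' Mo"
proof
  assume l: "alg_ess_surj C B Po h To Ta \<eta> \<mu>"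
  show "ess_surj_on C C' Mo"
    unfolding ess_surj_on_def
  proof
    fix n assume n [simp]: "n : Ob C'"
    then obtain x s where x [simp]: "x : Ob B" and s: "s : Homset B' (Qo x) (Po' n)" "is_iso B' s"
      using Q1(3) unfolding ess_surj_on_def by (meson functors(7))
    then obtain t where t: "inverse_arrows B' s t" by (auto simp: is_iso_def)
    from s t have [simp]: "s : Ar B'" "Dom B' s = Qo x" "Cod B' s = Po' n" "t : Ar B'" "Dom B' t = Po' n" "Cod B' t = Qo x"
      "s \<cdot>\<^bsub>B'\<^esub> t = Idt B' (Po' n)" "t \<cdot>\<^bsub>B'\<^esub> s = Idt B' (Qo x)"
      by (auto simp: Homset_def inverse_arrows_def)
    \<comment> \<open>The action of \<open>Po' n\<close>, transported along \<open>s\<close> to an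
      object in the image of \<open>Q\<close>.\<close>
    let ?k = "t \<cdot>\<^bsub>B'\<^esub> h' n \<cdot>\<^bsub>B'\<^esub> Ta' s"
    have a: "alg_obj B' To' Ta' \<eta>' \<mu>' (Qo x) ?k"
      using alg_obj_iso[OF h'[OF n] t] by simp
    \<comment> \<open>Composing with the inverse of \<open>\<phi> x\<close> gives the action a
      domain in the image of \<open>Q\<close>, so that it has a preimage.\<close>
    have "?k \<cdot>\<^bsub>B'\<^esub> \<psi> x : Homset B' (Qo (To x)) (Qo x)" by (simp add: Homset_def)
    then obtain k where k: "k : Homset B (To x) x" "Qa k = ?k \<cdot>\<^bsub>B'\<^esub> \<psi> x"
      using Q1(2) unfolding full_on_def by (meson x functors(25))
    then have [simp]: "k : Ar B" "Dom B k = To x" "Cod B k = x" by (auto simp: Homset_def)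
    have k2: "Qa k \<cdot>\<^bsub>B'\<^esub> \<phi> x = ?k" unfolding k(2) by simp
    have "alg_obj B To Ta \<eta> \<mu> x k" using push_alg_iff[OF Q1(1) x k(1)] a k2 by simp
    then obtain c p where c [simp]: "c : Ob C" and p: "p : Homset B (Po c) x" "is_iso B p"
        and p2: "p \<cdot>\<^bsub>B\<^esub> h c = k \<cdot>\<^bsub>B\<^esub> Ta p"
      using l unfolding alg_ess_surj_def by blast
    from p have [simp]: "p : Ar B" "Dom B p = Po c" "Cod B p = x" by (auto simp: Homset_def)
    \<comment> \<open>The composite isomorphism from the algebra of \<open>Mo c\<close> to that of
      \<open>n\<close>. It and its inverse both have to be algebra maps, since both are lifted along
      \<open>P'\<close>.\<close>
    let ?r = "s \<cdot>\<^bsub>B'\<^esub> Qa p \<cdot>\<^bsub>B'\<^esub> i c"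
    note q1 = i_alg[OF c] and q2 = arg_cong[OF p2, of Qa, simplified] and q3 = phi_nat[of p, simplified]
    have q4: "Qa k \<cdot>\<^bsub>B'\<^esub> \<phi> x \<cdot>\<^bsub>B'\<^esub> R = t \<cdot>\<^bsub>B'\<^esub> h' n \<cdot>\<^bsub>B'\<^esub> Ta' s \<cdot>\<^bsub>B'\<^esub> R"
      if "R : Ar B'" "Cod B' R = To' (Qo x)" for R
      using k2[THEN B'.c21, of R] that by simp
    have "s \<cdot>\<^bsub>B'\<^esub> t \<cdot>\<^bsub>B'\<^esub> R = R" if "R : Ar B'" "Cod B' R = Po' n" for R
      using B'.Cmp_assoc[of s t R] that by simp
    then have "?r \<cdot>\<^bsub>B'\<^esub> h' (Mo c) = h' n \<cdot>\<^bsub>B'\<^esub> Ta' ?r"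
      by (simp add: q1 q2[THEN B'.c22] q3[THEN B'.c22] q4)
    moreover have r: "?r : Homset B' (Po' (Mo c)) (Po' n)" by (simp add: Homset_def)
    ultimately obtain m where m: "m : Homset C' (Mo c) n" "Pa' m = ?r"
      using P1(2) unfolding alg_full_def by (meson c functors(13) n)
    from m have [simp]: "m : Ar C'" "Dom C' m = Mo c" "Cod C' m = n" by (auto simp: Homset_def)
    from p(2) obtain p' where p': "inverse_arrows B p p'" by (auto simp: is_iso_def)
    then have [simp]: "p' : Ar B" "Dom B p' = x" "Cod B p' = Po c" by (auto simp: inverse_arrows_def)
    have Qp: "inverse_arrows B' (Qa p) (Qa p')"
      by (rule functor_on_inverse[OF Q B.category_axioms p'])
    let ?r' = "j c \<cdot>\<^bsub>B'\<^esub> Qa p' \<cdot>\<^bsub>B'\<^esub> t"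
    have ri: "inverse_arrows B' ?r ?r'"
    proof -
      have "inverse_arrows B' (s \<cdot>\<^bsub>B'\<^esub> (Qa p \<cdot>\<^bsub>B'\<^esub> i c)) ((j c \<cdot>\<^bsub>B'\<^esub> Qa p') \<cdot>\<^bsub>B'\<^esub> t)"
        by (intro B'.inverse_arrows_Cmp Qp t j) simp_all
      then show ?thesis by simp
    qed
    have "?r' : Homset B' (Po' n) (Po' (Mo c))" by (simp add: Homset_def)
    \<comment> \<open>The inverse of an invertible algebra map is an algebra map; the equation is
      checked after composing with the invertible arrow \<open>Ta' ?r\<close>.\<close>
    moreover have "?r' \<cdot>\<^bsub>B'\<^esub> h' n = h' (Mo c) \<cdot>\<^bsub>B'\<^esub> Ta' ?r'"
    proof -
      have Ti: "inverse_arrows B' (Ta' ?r) (Ta' ?r')" by (rule functor_inverse[OF T' ri])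
      have rr: "?r' \<cdot>\<^bsub>B'\<^esub> ?r = Idt B' (Po' (Mo c))" using ri by (simp add: inverse_arrows_def)
      have "(?r' \<cdot>\<^bsub>B'\<^esub> h' n) \<cdot>\<^bsub>B'\<^esub> Ta' ?r = ?r' \<cdot>\<^bsub>B'\<^esub> (h' n \<cdot>\<^bsub>B'\<^esub> Ta' ?r)"
        by (rule B'.Cmp_assoc) simp_all
      also have "\<dots> = ?r' \<cdot>\<^bsub>B'\<^esub> (?r \<cdot>\<^bsub>B'\<^esub> h' (Mo c))"
        using \<open>?r \<cdot>\<^bsub>B'\<^esub> h' (Mo c) = h' n \<cdot>\<^bsub>B'\<^esub> Ta' ?r\<close> by (simp only:)
      also have "\<dots> = (?r' \<cdot>\<^bsub>B'\<^esub> ?r) \<cdot>\<^bsub>B'\<^esub> h' (Mo c)"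
        by (rule B'.Cmp_assoc[symmetric]) simp_all
      also have "\<dots> = h' (Mo c) \<cdot>\<^bsub>B'\<^esub> Ta' (?r' \<cdot>\<^bsub>B'\<^esub> ?r)" unfolding rr by simp
      also have "\<dots> = h' (Mo c) \<cdot>\<^bsub>B'\<^esub> (Ta' ?r' \<cdot>\<^bsub>B'\<^esub> Ta' ?r)"
        by (subst functor_onD(6)[OF T']) simp_all
      also have "\<dots> = (h' (Mo c) \<cdot>\<^bsub>B'\<^esub> Ta' ?r') \<cdot>\<^bsub>B'\<^esub> Ta' ?r"
        by (rule B'.Cmp_assoc[symmetric]) simp_all
      finally show ?thesis
        by (rule B'.iso_cancel_right[OF Ti]) simp_all
    qed
    ultimately obtain m' where m': "m' : Homset C' n (Mo c)" "Pa' m' = ?r'"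
      using P1(2) unfolding alg_full_def by (meson c functors(13) n)
    from m' have [simp]: "m' : Ar C'" "Dom C' m' = n" "Cod C' m' = Mo c" by (auto simp: Homset_def)
    have "Pa' (m' \<cdot>\<^bsub>C'\<^esub> m) = Pa' (Idt C' (Mo c))" "Pa' (m \<cdot>\<^bsub>C'\<^esub> m') = Pa' (Idt C' n)"
      using ri by (simp_all add: inverse_arrows_def m(2) m'(2))
    then have "m' \<cdot>\<^bsub>C'\<^esub> m = Idt C' (Mo c)" "m \<cdot>\<^bsub>C'\<^esub> m' = Idt C' n"
      using P1(1) unfolding faithful_on_def by simp_all
    then have "is_iso C' m" by (auto simp: is_iso_def inverse_arrows_def intro!: exI[of _ m'])
    then show "EX c : Ob C. EX s : Homset C' (Mo c) n. is_iso C' s" using m c by blast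
  qed
next
  assume l: "ess_surj_on C C' Mo"
  show "alg_ess_surj C B Po h To Ta \<eta> \<mu>"
    unfolding alg_ess_surj_def
  proof (intro allI impI)
    fix x k assume a: "alg_obj B To Ta \<eta> \<mu> x k"
    then have x [simp]: "x : Ob B" and k: "k : Homset B (To x) x" by (auto simp: alg_obj_def)
    then have [simp]: "k : Ar B" "Dom B k = To x" "Cod B k = x" by (auto simp: Homset_def)
    have "alg_obj B' To' Ta' \<eta>' \<mu>' (Qo x) (Qa k \<cdot>\<^bsub>B'\<^esub> \<phi> x)"
      using push_alg_iff[OF Q1(1) x k] a by simp
    then obtain n s where n [simp]: "n : Ob C'" and s: "s : Homset B' (Po' n) (Qo x)" "is_iso B' s"
      and s2: "s \<cdot>\<^bsub>B'\<^esub> h' n = (Qa k \<cdot>\<^bsub>B'\<^esub> \<phi> x) \<cdot>\<^bsub>B'\<^esub> Ta' s"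
      using P1(3) unfolding alg_ess_surj_def by blast
    from s have [simp]: "s : Ar B'" "Dom B' s = Po' n" "Cod B' s = Qo x" by (auto simp: Homset_def)
    obtain c m where c [simp]: "c : Ob C" and m: "m : Homset C' (Mo c) n" "is_iso C' m"
      using l n unfolding ess_surj_on_def by blast
    from m have [simp]: "m : Ar C'" "Dom C' m = Mo c" "Cod C' m = n" by (auto simp: Homset_def)
    from m(2) obtain m' where m': "inverse_arrows C' m m'" by (auto simp: is_iso_def)
    have Pm: "inverse_arrows B' (Pa' m) (Pa' m')"
      by (rule functor_on_inverse[OF P' C'.category_axioms m'])
    from s(2) obtain t where t: "inverse_arrows B' s t" by (auto simp: is_iso_def)
    \<comment> \<open>An isomorphism between images under \<open>Q\<close>; its preimage
      \<open>p\<close> is again invertible because \<open>Q\<close> is fully faithful.\<close>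
    let ?r = "s \<cdot>\<^bsub>B'\<^esub> Pa' m \<cdot>\<^bsub>B'\<^esub> j c"
    have "?r : Homset B' (Qo (Po c)) (Qo x)" by (simp add: Homset_def)
    then obtain p where p: "p : Homset B (Po c) x" "Qa p = ?r"
      using Q1(2) unfolding full_on_def by (meson c functors(1) x)
    then have [simp]: "p : Ar B" "Dom B p = Po c" "Cod B p = x" by (auto simp: Homset_def)
    have "inverse_arrows B' ?r ((i c \<cdot>\<^bsub>B'\<^esub> Pa' m') \<cdot>\<^bsub>B'\<^esub> t)"
      by (intro B'.inverse_arrows_Cmp Pm t B'.inverse_arrows_sym[OF j]) simp_all
    then have "is_iso B' (Qa p)" unfolding p(2) is_iso_def by blast
    then have iso: "is_iso B p"
      using faithful_full_reflects_iso[OF Q B.category_axioms B'.category_axioms Q1(1,2), of p] by simp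
    have "Qa (p \<cdot>\<^bsub>B\<^esub> h c) \<cdot>\<^bsub>B'\<^esub> \<phi> (Po c) \<cdot>\<^bsub>B'\<^esub> Ta' (i c) = ?r \<cdot>\<^bsub>B'\<^esub> i c \<cdot>\<^bsub>B'\<^esub> h' (Mo c)"
      using i_alg[OF c] by (simp add: p(2))
    also have "\<dots> = s \<cdot>\<^bsub>B'\<^esub> h' n \<cdot>\<^bsub>B'\<^esub> Ta' (Pa' m)"
      using h'_nat[of m] by simp
    also have "\<dots> = Qa k \<cdot>\<^bsub>B'\<^esub> \<phi> x \<cdot>\<^bsub>B'\<^esub> Ta' s \<cdot>\<^bsub>B'\<^esub> Ta' (Pa' m)"
      using s2[THEN B'.c22, of "Ta' (Pa' m)"] by simp
    also have "\<dots> = Qa k \<cdot>\<^bsub>B'\<^esub> \<phi> x \<cdot>\<^bsub>B'\<^esub> Ta' (Qa p) \<cdot>\<^bsub>B'\<^esub> Ta' (i c)"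
    proof -
      have "Qa p \<cdot>\<^bsub>B'\<^esub> i c = s \<cdot>\<^bsub>B'\<^esub> Pa' m" by (simp add: p(2))
      from arg_cong[OF this, of Ta'] show ?thesis by simp
    qed
    also have "\<dots> = Qa (k \<cdot>\<^bsub>B\<^esub> Ta p) \<cdot>\<^bsub>B'\<^esub> \<phi> (Po c) \<cdot>\<^bsub>B'\<^esub> Ta' (i c)"
      using phi_nat[of p, symmetric, simplified, THEN B'.c22, of "Ta' (i c)"] by simp
    finally have "Qa (p \<cdot>\<^bsub>B\<^esub> h c) = Qa (k \<cdot>\<^bsub>B\<^esub> Ta p)"
    proof (rule B'.iso_cancel_right[rotated])
      show "inverse_arrows B' (\<phi> (Po c) \<cdot>\<^bsub>B'\<^esub> Ta' (i c)) (Ta' (j c) \<cdot>\<^bsub>B'\<^esub> \<psi> (Po c))"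
        by (rule B'.inverse_arrows_Cmp) (simp_all add: functor_inverse[OF T' j] psi)
    qed simp_all
    then have "p \<cdot>\<^bsub>B\<^esub> h c = k \<cdot>\<^bsub>B\<^esub> Ta p" using Q1(1) unfolding faithful_on_def by simp
    then show "EX c : Ob C. EX s : Homset B (Po c) x. is_iso B s & s \<cdot>\<^bsub>B\<^esub> h c = k \<cdot>\<^bsub>B\<^esub> Ta s"
      using c p(1) iso by blast
  qed
qed

end

section \<open>Monads and their algebras in a 2-category\<close>

lemma hom_cat_simps [simp]:
  "f : Ob (hom_cat K x y) \<longleftrightarrow> f : ars K & src K f = x & tgt K f = y"
  "s : Ar (hom_cat K x y) \<longleftrightarrow> s : cells K & src K (cdom K s) = x & tgt K (cdom K s) = y"
  "Dom (hom_cat K x y) = cdom K" "Cod (hom_cat K x y) = ccod K" "Idt (hom_cat K x y) = id2 K"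
  "Cmp (hom_cat K x y) = vcomp K"
  "s : Homset (hom_cat K x y) f g \<longleftrightarrow> s : cells K & cdom K s = f & ccod K s = g & src K f = x & tgt K f = y"
  by (auto simp: hom_cat_def Homset_def)

definition monad2 where
  "monad2 K b T \<eta> \<mu> \<longleftrightarrow> b : obs K & in_hom1 K T b b & in_hom2 K \<eta> (id1 K b) T & in_hom2 K \<mu> (T \<odot>\<^bsub>K\<^esub> T) T &
     \<mu> \<bullet>\<^bsub>K\<^esub> (\<eta> |>\<^bsub>K\<^esub> T) = id2 K T & \<mu> \<bullet>\<^bsub>K\<^esub> (T <|\<^bsub>K\<^esub> \<eta>) = id2 K T &
     \<mu> \<bullet>\<^bsub>K\<^esub> (T <|\<^bsub>K\<^esub> \<mu>) = \<mu> \<bullet>\<^bsub>K\<^esub> \<mu> |>\<^bsub>K\<^esub> T"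

text \<open>The source of \<open>f\<close> is arbitrary: these are the objects of the categories of
  algebras of \<open>H(X, T)\<close> for all \<open>X\<close> at once, that is, the algebras on
  generalised elements of the object carrying the monad.\<close>

definition alg2 where
  "alg2 K T \<eta> \<mu> f h \<longleftrightarrow> in_hom1 K f (src K f) (src K T) & in_hom2 K h (T \<odot>\<^bsub>K\<^esub> f) f &
     h \<bullet>\<^bsub>K\<^esub> (\<eta> |>\<^bsub>K\<^esub> f) = id2 K f & h \<bullet>\<^bsub>K\<^esub> (T <|\<^bsub>K\<^esub> h) = h \<bullet>\<^bsub>K\<^esub> \<mu> |>\<^bsub>K\<^esub> f"

text \<open>Equivalences are split into \<open>faith1\<close>, \<open>full1\<close> and
  \<open>ess1\<close>, each tested on all hom-categories, because the three bullets of the theorem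
  need these parts separately.\<close>

definition faith1 where
  "faith1 K p \<longleftrightarrow> (ALL X : obs K. faithful_on (hom_cat K X (src K p)) (%r. p <|\<^bsub>K\<^esub> r))"

definition full1 where
  "full1 K p \<longleftrightarrow> (ALL X : obs K. full_on (hom_cat K X (src K p)) (hom_cat K X (tgt K p))
     (%g. p \<odot>\<^bsub>K\<^esub> g) (%r. p <|\<^bsub>K\<^esub> r))"

definition ess1 where
  "ess1 K p \<longleftrightarrow> (ALL X : obs K. ess_surj_on (hom_cat K X (src K p)) (hom_cat K X (tgt K p)) (%g. p \<odot>\<^bsub>K\<^esub> g))"

definition alg_full1 where
  "alg_full1 K T p h \<longleftrightarrow> (ALL X : obs K. alg_full (hom_cat K X (src K p)) (hom_cat K X (tgt K p))
     (%g. p \<odot>\<^bsub>K\<^esub> g) (%r. p <|\<^bsub>K\<^esub> r) (%s. T <|\<^bsub>K\<^esub> s) (%g. h |>\<^bsub>K\<^esub> g))"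

definition alg_ess1 where
  "alg_ess1 K T \<eta> \<mu> p h \<longleftrightarrow> (ALL X : obs K. alg_ess_surj (hom_cat K X (src K p)) (hom_cat K X (tgt K p))
     (%g. p \<odot>\<^bsub>K\<^esub> g) (%g. h |>\<^bsub>K\<^esub> g)
     (%f. T \<odot>\<^bsub>K\<^esub> f) (%s. T <|\<^bsub>K\<^esub> s) (%f. \<eta> |>\<^bsub>K\<^esub> f) (%f. \<mu> |>\<^bsub>K\<^esub> f))"

text \<open>\<open>(p, h)\<close> is a universal \<open>T\<close>-algebra: its source is an Eilenberg-Moore object of \<open>T\<close>.\<close>

definition em where
  "em K T \<eta> \<mu> p h \<longleftrightarrow> alg2 K T \<eta> \<mu> p h & faith1 K p & alg_full1 K T p h & alg_ess1 K T \<eta> \<mu> p h"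

locale monad_in = two_category K for K :: "('o, 'm, 'c) tcat" (structure) +
  fixes b T \<eta> \<mu>
  assumes monad: "monad2 K b T \<eta> \<mu>"
begin

lemma monad_simps [simp]:
  shows "b : obs K" "T : ars K" "src K T = b" "tgt K T = b"
    "\<eta> : cells K" "cdom K \<eta> = id1 K b" "ccod K \<eta> = T"
    "\<mu> : cells K" "cdom K \<mu> = T \<odot> T" "ccod K \<mu> = T"
  using monad by (simp_all add: monad2_def in_hom1_def in_hom2_def)

lemma monad_unit: "\<mu> \<bullet> (\<eta> |> T) = id2 K T" "\<mu> \<bullet> (T <| \<eta>) = id2 K T"
  using monad by (simp_all add: monad2_def)

lemma monad_assoc: "\<mu> \<bullet> (T <| \<mu>) = \<mu> \<bullet> \<mu> |> T"
  using monad by (simp add: monad2_def)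

lemma alg_obj_hom_cat:
  "alg_obj (hom_cat K X b) (%f. T \<odot> f) (%s. T <| s) (%f. \<eta> |> f) (%f. \<mu> |> f) f h
    \<longleftrightarrow> alg2 K T \<eta> \<mu> f h & src K f = X"
  unfolding alg_obj_def alg2_def in_hom1_def in_hom2_def
  by (rule iffI; elim conjE; intro conjI; simp)

lemma alg2_comp1:
  assumes a: "alg2 K T \<eta> \<mu> f h" and g [simp]: "g : ars K" "tgt K g = src K f"
  shows "alg2 K T \<eta> \<mu> (f \<odot> g) (h |> g)"
proof -
  from a have [simp]: "f : ars K" "tgt K f = b" "h : cells K" "cdom K h = T \<odot> f" "ccod K h = f"
    by (simp_all add: alg2_def in_hom1_def in_hom2_def)
  have 1: "h \<bullet> (\<eta> |> f) = id2 K f" "h \<bullet> (T <| h) = h \<bullet> \<mu> |> f"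
    using a by (simp_all add: alg2_def)
  show ?thesis
    using arg_cong[OF 1(1), of "%s. s |> g"] arg_cong[OF 1(2), of "%s. s |> g"]
    by (simp add: alg2_def in_hom1_def in_hom2_def)
qed

end

lemma alg2D:
  assumes "alg2 K T \<eta> \<mu> f h"
  shows "f : ars K" "tgt K f = src K T" "h : cells K" "cdom K h = T \<odot>\<^bsub>K\<^esub> f" "ccod K h = f"
    "h \<bullet>\<^bsub>K\<^esub> (\<eta> |>\<^bsub>K\<^esub> f) = id2 K f" "h \<bullet>\<^bsub>K\<^esub> (T <|\<^bsub>K\<^esub> h) = h \<bullet>\<^bsub>K\<^esub> \<mu> |>\<^bsub>K\<^esub> f"
  using assms by (simp_all add: alg2_def in_hom1_def in_hom2_def)

section \<open>The representable conditions in elementary form\<close>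

context two_category
begin

lemma hom_functor: "g : ars K ==> src K g = x ==> tgt K g = y
    ==> functor_on (hom_cat K X x) (hom_cat K X y) (%f. g \<odot> f) (%s. g <| s)"
  by (simp add: functor_on_def)

lemma faith1_iff:
  "faith1 K p \<longleftrightarrow> (ALL r : cells K. ALL r' : cells K. cdom K r = cdom K r' --> ccod K r = ccod K r' -->
     tgt K (cdom K r) = src K p --> p <| r = p <| r' --> r = r')"
  (is "_ \<longleftrightarrow> ?R")
proof
  assume a: "faith1 K p"
  show ?R
  proof (intro ballI impI)
    fix r r' assume "r : cells K" "r' : cells K" "cdom K r = cdom K r'" "ccod K r = ccod K r'"
      "tgt K (cdom K r) = src K p" "p <| r = p <| r'"
    then show "r = r'"
      using a[unfolded faith1_def faithful_on_def, rule_format, of "src K (cdom K r')" r r'] by simp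
  qed
next
  assume ?R
  then show "faith1 K p" unfolding faith1_def faithful_on_def by simp
qed

lemma faith1D:
  "[|faith1 K p; p <| r = p <| r'; r : cells K; r' : cells K; cdom K r = cdom K r'; ccod K r = ccod K r';
     tgt K (cdom K r) = src K p|] ==> r = r'"
  unfolding faith1_iff by blast

lemma faith1I:
  assumes "!!r r'. [|r : cells K; r' : cells K; cdom K r = cdom K r'; ccod K r = ccod K r';
     tgt K (cdom K r') = src K p; p <| r = p <| r'|] ==> r = r'"
  shows "faith1 K p"
  unfolding faith1_iff using assms by metis

lemma full1I:
  assumes "!!g g' s. [|g : ars K; g' : ars K; src K g = src K g'; tgt K g = src K p;
     tgt K g' = src K p; s : cells K; cdom K s = p \<odot> g; ccod K s = p \<odot> g'|]
     ==> EX r. r : cells K & cdom K r = g & ccod K r = g' & p <| r = s"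
  shows "full1 K p"
  unfolding full1_def full_on_def
proof (intro ballI)
  fix X c d s assume "c : Ob (hom_cat K X (src K p))" "d : Ob (hom_cat K X (src K p))"
    "s : Homset (hom_cat K X (tgt K p)) (p \<odot> c) (p \<odot> d)"
  then show "EX r:Homset (hom_cat K X (src K p)) c d. p <| r = s"
    using assms[of c d s] by (simp add: Bex_def conj_ac)
qed

lemma full1D:
  "[|full1 K p; p : ars K; g : ars K; g' : ars K; src K g = src K g'; tgt K g = src K p;
     tgt K g' = src K p; s : cells K; cdom K s = p \<odot> g; ccod K s = p \<odot> g'|]
     ==> EX r. r : cells K & cdom K r = g & ccod K r = g' & p <| r = s"
  unfolding full1_def full_on_def
  by (drule bspec[of _ _ "src K g'"], simp, drule bspec[of _ _ g], simp, drule bspec[of _ _ g'], simp,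
      drule bspec[of _ _ s]) (simp_all add: Bex_def conj_ac)

lemma ess1I:
  assumes "p : ars K"
    and "!!f. [|f : ars K; tgt K f = tgt K p|] ==> EX g s. g : ars K & src K g = src K f & tgt K g = src K p &
      s : cells K & cdom K s = p \<odot> g & ccod K s = f & invertible2 K s"
  shows "ess1 K p"
  unfolding ess1_def ess_surj_on_def
proof (intro ballI)
  fix X f assume "f : Ob (hom_cat K X (tgt K p))"
  then have f: "f : ars K" "src K f = X" "tgt K f = tgt K p" by simp_all
  then obtain g s where "g : ars K" "src K g = X" "tgt K g = src K p" "s : cells K" "cdom K s = p \<odot> g"
    "ccod K s = f" "invertible2 K s"
    using assms(2)[of f] by metis
  then show "EX x:Ob (hom_cat K X (src K p)). EX s:Homset (hom_cat K X (tgt K p)) (p \<odot> x) f. is_iso (hom_cat K X (tgt K p)) s"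
    using f assms(1) by (intro bexI[of _ g] bexI[of _ s]) (simp_all add: is_iso_hom_cat)
qed

lemma ess1D:
  "[|ess1 K p; f : ars K; tgt K f = tgt K p|] ==> EX g s. g : ars K & src K g = src K f & tgt K g = src K p &
      s : cells K & cdom K s = p \<odot> g & ccod K s = f & invertible2 K s"
  unfolding ess1_def ess_surj_on_def is_iso_hom_cat
  by (drule bspec[of _ _ "src K f"], simp, drule bspec[of _ _ f]) (simp_all add: Bex_def conj_ac, blast)

lemma alg_full1I:
  assumes "!!g g' s. [|g : ars K; g' : ars K; src K g = src K g'; tgt K g = src K p;
     tgt K g' = src K p; s : cells K; cdom K s = p \<odot> g; ccod K s = p \<odot> g';
     s \<bullet> h |> g = h |> g' \<bullet> (T <| s)|]
     ==> EX r. r : cells K & cdom K r = g & ccod K r = g' & p <| r = s"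
  shows "alg_full1 K T p h"
  unfolding alg_full1_def alg_full_def
proof (intro ballI impI)
  fix X c d s assume "c : Ob (hom_cat K X (src K p))" "d : Ob (hom_cat K X (src K p))"
    "s : Homset (hom_cat K X (tgt K p)) (p \<odot> c) (p \<odot> d)"
    "s \<cdot>\<^bsub>hom_cat K X (tgt K p)\<^esub> (h |> c) = (h |> d) \<cdot>\<^bsub>hom_cat K X (tgt K p)\<^esub> (T <| s)"
  then show "EX r:Homset (hom_cat K X (src K p)) c d. p <| r = s"
    using assms[of c d s] by (simp add: Bex_def conj_ac)
qed

lemma alg_full1D:
  "[|alg_full1 K T p h; p : ars K; g : ars K; g' : ars K; src K g = src K g'; tgt K g = src K p;
     tgt K g' = src K p; s : cells K; cdom K s = p \<odot> g; ccod K s = p \<odot> g';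
     s \<bullet> h |> g = h |> g' \<bullet> (T <| s)|]
     ==> EX r. r : cells K & cdom K r = g & ccod K r = g' & p <| r = s"
  unfolding alg_full1_def alg_full_def
  by (drule bspec[of _ _ "src K g'"], simp, drule bspec[of _ _ g], simp, drule bspec[of _ _ g'], simp,
      drule bspec[of _ _ s]) (simp_all add: Bex_def conj_ac)

lemma alg_ess1I:
  assumes "monad2 K b T \<eta> \<mu>" and p: "p : ars K" "tgt K p = b"
    and "!!f k. alg2 K T \<eta> \<mu> f k ==> EX g s. g : ars K & src K g = src K f & tgt K g = src K p &
      s : cells K & cdom K s = p \<odot> g & ccod K s = f & invertible2 K s & s \<bullet> (h |> g) = k \<bullet> T <| s"
  shows "alg_ess1 K T \<eta> \<mu> p h"
  unfolding alg_ess1_def alg_ess_surj_def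
proof (intro ballI allI impI)
  interpret monad_in K b T \<eta> \<mu> using assms(1) by unfold_locales
  fix X f k assume "alg_obj (hom_cat K X (tgt K p)) ((\<odot>) T) ((\<star>) (id2 K T)) (%f. \<eta> |> f) (%f. \<mu> |> f) f k"
  then have f: "alg2 K T \<eta> \<mu> f k" "src K f = X" by (simp_all add: alg_obj_hom_cat p)
  then obtain g s where "g : ars K" "src K g = X" "tgt K g = src K p" "s : cells K" "cdom K s = p \<odot> g"
    "ccod K s = f" "invertible2 K s" "s \<bullet> (h |> g) = k \<bullet> T <| s"
    using assms(4)[of f k] by metis
  then show "EX c:Ob (hom_cat K X (src K p)). EX s:Homset (hom_cat K X (tgt K p)) (p \<odot> c) f.
      is_iso (hom_cat K X (tgt K p)) s & s \<cdot>\<^bsub>hom_cat K X (tgt K p)\<^esub> (h |> c) = k \<cdot>\<^bsub>hom_cat K X (tgt K p)\<^esub> (T <| s)"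
    using f p by (intro bexI[of _ g] bexI[of _ s]) (simp_all add: is_iso_hom_cat)
qed

lemma alg_ess1D:
  assumes "monad2 K b T \<eta> \<mu>" "tgt K p = b" and a: "alg_ess1 K T \<eta> \<mu> p h" and k: "alg2 K T \<eta> \<mu> f k"
  shows "EX g s. g : ars K & src K g = src K f & tgt K g = src K p &
      s : cells K & cdom K s = p \<odot> g & ccod K s = f & invertible2 K s & s \<bullet> (h |> g) = k \<bullet> T <| s"
proof -
  interpret monad_in K b T \<eta> \<mu> using assms(1) by unfold_locales
  have "alg_obj (hom_cat K (src K f) (tgt K p)) ((\<odot>) T) ((\<star>) (id2 K T)) (%f. \<eta> |> f) (%f. \<mu> |> f) f k"
    using k by (simp add: alg_obj_hom_cat assms(2))
  moreover have "src K f : obs K" using alg2D(1)[OF k] by simp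
  ultimately obtain g s where "g : Ob (hom_cat K (src K f) (src K p))"
    "s : Homset (hom_cat K (src K f) (tgt K p)) (p \<odot> g) f" "is_iso (hom_cat K (src K f) (tgt K p)) s"
    "s \<cdot>\<^bsub>hom_cat K (src K f) (tgt K p)\<^esub> (h |> g) = k \<cdot>\<^bsub>hom_cat K (src K f) (tgt K p)\<^esub> (T <| s)"
    using a unfolding alg_ess1_def alg_ess_surj_def by blast
  then show ?thesis by (intro exI[of _ g] exI[of _ s]) (simp add: is_iso_hom_cat)
qed

text \<open>A 1-cell that is representably an equivalence is one: a quasi-inverse comes from
  essential surjectivity at the identity of the target, and the unit from fullness.\<close>

lemma equivalence1_iff:
  assumes p: "p : ars K"
  shows "equivalence1 K p \<longleftrightarrow> faith1 K p & full1 K p & ess1 K p"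
proof
  assume "equivalence1 K p"
  then obtain g \<sigma> \<tau> where g [simp]: "g : ars K" "src K g = tgt K p" "tgt K g = src K p"
    and s: "\<sigma> : cells K" "cdom K \<sigma> = id1 K (src K p)" "ccod K \<sigma> = g \<odot> p" "invertible2 K \<sigma>"
    and t: "\<tau> : cells K" "cdom K \<tau> = p \<odot> g" "ccod K \<tau> = id1 K (tgt K p)" "invertible2 K \<tau>"
    unfolding equivalence1_def in_hom1_def in_hom2_def by blast
  note [simp] = s t p
  have sl: "(g \<odot> p) <| r \<bullet> \<sigma> |> (cdom K r) = \<sigma> |> (ccod K r) \<bullet> r"
    if "r : cells K" "tgt K (cdom K r) = src K p" for r
    using slide_refl[of \<sigma> r] that by simp
  have tl: "\<tau> |> (ccod K r) \<bullet> ((p \<odot> g) <| r) = r \<bullet> \<tau> |> (cdom K r)"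
    if "r : cells K" "tgt K (cdom K r) = tgt K p" for r
    using slide_refl[of \<tau> r] that by simp
  have f: "faith1 K p"
    unfolding faith1_iff
  proof (intro ballI impI)
    fix r r' assume r [simp]: "r : cells K" "r' : cells K" "cdom K r = cdom K r'" "ccod K r = ccod K r'"
      "tgt K (cdom K r) = src K p" and e: "p <| r = p <| r'"
    then have [simp]: "tgt K (cdom K r') = src K p" by simp
    have "(g \<odot> p) <| r = (g \<odot> p) <| r'"
      using arg_cong[OF e, of "%s. g <| s"] by simp
    then have "\<sigma> |> (ccod K r') \<bullet> r = \<sigma> |> (ccod K r') \<bullet> r'"
      using sl[of r] sl[of r'] by simp
    then show "r = r'" by (rule vcomp_cancel_left[rotated]) simp_all
  qed
  \<comment> \<open>The quasi-inverse is faithful too, by the counit. Fullness of \<open>p\<close>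
    needs this to recognise a candidate preimage.\<close>
  have fg: "r = r'" if r: "r : cells K" "r' : cells K" "cdom K r = cdom K r'" "ccod K r = ccod K r'"
      "tgt K (cdom K r) = tgt K p" and e: "g <| r = g <| r'" for r r'
  proof -
    note [simp] = r
    have [simp]: "tgt K (cdom K r') = tgt K p" using r by simp
    have "(p \<odot> g) <| r = (p \<odot> g) <| r'"
      using arg_cong[OF e, of "%s. p <| s"] by simp
    then have "r \<bullet> (\<tau> |> (cdom K r')) = r' \<bullet> \<tau> |> (cdom K r')"
      using tl[of r] tl[of r'] by simp
    then show "r = r'" by (rule vcomp_cancel_right[rotated]) simp_all
  qed
  have "full1 K p"
  proof (rule full1I)
    fix h h' s assume [simp]: "h : ars K" "h' : ars K" "src K h = src K h'" "tgt K h = src K p" "tgt K h' = src K p"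
      "s : cells K" "cdom K s = p \<odot> h" "ccod K s = p \<odot> h'"
    \<comment> \<open>The preimage is the transpose of \<open>s\<close> through the unit of the
      equivalence.\<close>
    define r where "r = inv2 K (\<sigma> |> h') \<bullet> g <| s \<bullet> \<sigma> |> h"
    have r [simp]: "r : cells K" "cdom K r = h" "ccod K r = h'" by (simp_all add: r_def)
    have "(g \<odot> p) <| r \<bullet> \<sigma> |> h = g <| s \<bullet> \<sigma> |> h"
      using sl[of r] by (simp add: r_def vcomp_inv2[THEN vc21])
    then have "(g \<odot> p) <| r = g <| s"
      by (rule vcomp_cancel_right[rotated]) simp_all
    then have "g <| (p <| r) = g <| s" by simp
    then have "p <| r = s" by (rule fg[rotated -1]) simp_all
    then show "EX r. r : cells K & cdom K r = h & ccod K r = h' & p <| r = s" using r by blast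
  qed
  moreover have "ess1 K p"
  proof (rule ess1I[OF p])
    fix f assume [simp]: "f : ars K" "tgt K f = tgt K p"
    show "EX ga s. ga : ars K & src K ga = src K f & tgt K ga = src K p &
         s : cells K & cdom K s = p \<odot> ga & ccod K s = f & invertible2 K s"
      by (rule exI[of _ "g \<odot> f"], rule exI[of _ "\<tau> |> f"]) simp
  qed
  ultimately show "faith1 K p & full1 K p & ess1 K p" using f by blast
next
  assume a: "faith1 K p & full1 K p & ess1 K p"
  note [simp] = p
  \<comment> \<open>The object to be hit is the identity of the target, so \<open>t\<close> is the
    counit.\<close>
  obtain g t where g [simp]: "g : ars K" "src K g = tgt K p" "tgt K g = src K p"
    and t [simp]: "t : cells K" "cdom K t = p \<odot> g" "ccod K t = id1 K (tgt K p)" "invertible2 K t"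
    using ess1D[OF a[THEN conjunct2, THEN conjunct2], of "id1 K (tgt K p)"] by (simp add: conj_ac) metis
  \<comment> \<open>The unit is the lift along \<open>p\<close> of the cell that the triangle
    identity prescribes.\<close>
  obtain s where s [simp]: "s : cells K" "cdom K s = id1 K (src K p)" "ccod K s = g \<odot> p"
    "p <| s = inv2 K (t |> p)"
    using full1D[OF a[THEN conjunct2, THEN conjunct1], of "id1 K (src K p)" "g \<odot> p" "inv2 K (t |> p)"] by (simp add: conj_ac) metis
  obtain s' where s' [simp]: "s' : cells K" "cdom K s' = g \<odot> p" "ccod K s' = id1 K (src K p)"
    "p <| s' = t |> p"
    using full1D[OF a[THEN conjunct2, THEN conjunct1], of "g \<odot> p" "id1 K (src K p)" "t |> p"] by (simp add: conj_ac) metis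
  have "s' \<bullet> s = id2 K (id1 K (src K p))"
    by (rule faith1D[OF a[THEN conjunct1]]) simp_all
  moreover have "s \<bullet> s' = id2 K (g \<odot> p)"
    by (rule faith1D[OF a[THEN conjunct1]]) simp_all
  ultimately have "invertible2 K s" unfolding invertible2_iff iso2_def by (intro exI[of _ s']) simp
  then show "equivalence1 K p"
    unfolding equivalence1_def in_hom1_def in_hom2_def
    by (intro conjI p exI[of _ g] exI[of _ s] exI[of _ t]) simp_all
qed

end

text \<open>The internal form of \<open>alg_square\<close>: \<open>(q, \<phi>)\<close> is a strong
  monad morphism, and \<open>m\<close> lies over it between the 1-cells \<open>p\<close> and
  \<open>p'\<close> with their actions. What the transfer lemmas decide is how far \<open>p\<close>
  is from being universal, once this is known for \<open>p'\<close>.\<close>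

locale alg_square1 = two_category K + m: monad_in K b T \<eta> \<mu> + m': monad_in K b' T' \<eta>' \<mu>'
  for K :: "('o, 'm, 'c) tcat" (structure) and b T \<eta> \<mu> b' T' \<eta>' \<mu>' +
  fixes q \<phi> p h p' h' m i
  assumes q [simp]: "q : ars K" "src K q = b" "tgt K q = b'"
    and phi [simp]: "cdom K \<phi> = T' \<odot> q" "ccod K \<phi> = q \<odot> T" "invertible2 K \<phi>"
    and phi_eta: "\<phi> \<bullet> (\<eta>' |> q) = q <| \<eta>"
    and phi_mu: "\<phi> \<bullet> \<mu>' |> q = q <| \<mu> \<bullet> \<phi> |> T \<bullet> T' <| \<phi>"
    and p [simp]: "p : ars K" "tgt K p = b" and h [simp]: "h : cells K" "cdom K h = T \<odot> p" "ccod K h = p"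
    and alg': "alg2 K T' \<eta>' \<mu>' p' h'"
    and m [simp]: "m : ars K" "src K m = src K p" "tgt K m = src K p'"
    and i [simp]: "cdom K i = p' \<odot> m" "ccod K i = q \<odot> p" "invertible2 K i"
    and i_alg: "i \<bullet> h' |> m = q <| h \<bullet> \<phi> |> p \<bullet> T' <| i"
begin

lemma typing [simp]: "\<phi> : cells K" "i : cells K" "p' : ars K" "tgt K p' = b'"
    "h' : cells K" "cdom K h' = T' \<odot> p'" "ccod K h' = p'"
  using invertible2_cell[OF phi(3)] invertible2_cell[OF i(3)] alg2D[OF alg'] by simp_all

text \<open>The functor \<open>H(X, -)\<close> sends the internal square to a square of categories,
  with every natural transformation given by right whiskering; naturality is interchange.\<close>

lemma square:
  assumes X [simp]: "X : obs K"
  shows "alg_square (hom_cat K X (src K p)) (hom_cat K X b) (hom_cat K X (src K p')) (hom_cat K X b')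
     (%g. p \<odot> g) (%r. p <| r) (%g. h |> g) (%g. p' \<odot> g) (%r. p' <| r) (%g. h' |> g)
     (%g. m \<odot> g) (%r. m <| r) (%g. q \<odot> g) (%r. q <| r)
     (%g. T \<odot> g) (%r. T <| r) (%f. \<eta> |> f) (%f. \<mu> |> f)
     (%g. T' \<odot> g) (%r. T' <| r) (%f. \<eta>' |> f) (%f. \<mu>' |> f)
     (%f. \<phi> |> f) (%g. i |> g)"
proof -
  have sl: "(ccod K t) <| \<sigma> \<bullet> t |> (cdom K \<sigma>) = t |> (ccod K \<sigma>) \<bullet> (cdom K t) <| \<sigma>"
    if "t : cells K" "\<sigma> : cells K" "src K (cdom K t) = tgt K (cdom K \<sigma>)" for t \<sigma>
    using slide[OF that refl refl refl refl] by simp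
  have e: "\<phi> |> x \<bullet> (\<eta>' |> (q \<odot> x)) = q <| \<eta> |> x"
    "\<phi> |> x \<bullet> (\<mu>' |> (q \<odot> x))
      = q <| \<mu> |> x \<bullet> \<phi> |> (T \<odot> x) \<bullet> T' <| \<phi> |> x"
    if "x : ars K" "tgt K x = b" for x
    using arg_cong[OF phi_eta, of "%s. s |> x"] arg_cong[OF phi_mu, of "%s. s |> x"] that by simp_all
  have e': "i |> x \<bullet> (h' |> (m \<odot> x))
      = q <| h |> x \<bullet> \<phi> |> (p \<odot> x) \<bullet> T' <| i |> x"
    if "x : ars K" "tgt K x = src K p" for x
    using arg_cong[OF i_alg, of "%s. s |> x"] that by simp
  note category_hom_cat [simp]
  have a: "alg_obj (hom_cat K X b') ((\<odot>) T') ((\<star>) (id2 K T')) (%f. \<eta>' |> f) (%f. \<mu>' |> f)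
     (p' \<odot> c) (h' |> c)" if "c : ars K" "src K c = X" "tgt K c = src K p'" for c
    using m'.alg2_comp1[OF alg', of c] that by (simp add: m'.alg_obj_hom_cat)
  show ?thesis
    by (intro alg_square.intro alg_square_axioms.intro)
      (simp_all add: hom_functor is_iso_hom_cat a e e' sl[of \<eta>', simplified] sl[of \<mu>', simplified] sl[of h, simplified]
        sl[of h', simplified] sl[of \<phi>, simplified] sl[of i, simplified])
qed

lemma faith1_transfer: "faith1 K q ==> faith1 K p' ==> faith1 K p \<longleftrightarrow> faith1 K m"
  using alg_square.faithful_iff[OF square] unfolding faith1_def by simp

lemma alg_full1_transfer:
  "faith1 K q ==> full1 K q ==> faith1 K p' ==> alg_full1 K T' p' h' ==> alg_full1 K T p h \<longleftrightarrow> full1 K m"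
  using alg_square.full_iff[OF square] unfolding faith1_def full1_def alg_full1_def by simp

lemma alg_ess1_transfer:
  "[|faith1 K q; full1 K q; ess1 K q; faith1 K p'; alg_full1 K T' p' h'; alg_ess1 K T' \<eta>' \<mu>' p' h';
    faith1 K m; full1 K m|] ==> alg_ess1 K T \<eta> \<mu> p h \<longleftrightarrow> ess1 K m"
  using alg_square.ess_surj_iff[OF square]
  unfolding faith1_def full1_def alg_full1_def ess1_def alg_ess1_def by simp

end

section \<open>Monads induced by adjunctions, and change of the left adjoint\<close>

context two_category
begin

lemma identity_equivalence:
  assumes [simp]: "b : obs K"
  shows "faith1 K (id1 K b)" "full1 K (id1 K b)" "ess1 K (id1 K b)"
proof -
  show "faith1 K (id1 K b)" by (rule faith1I) simp
  show "full1 K (id1 K b)"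
  proof (rule full1I)
    fix g g' s assume a: "g : ars K" "g' : ars K" "src K g = src K g'" "tgt K g = src K (id1 K b)" "tgt K g' = src K (id1 K b)"
      "s : cells K" "cdom K s = id1 K b \<odot> g" "ccod K s = id1 K b \<odot> g'"
    then show "EX r. r : cells K & cdom K r = g & ccod K r = g' & (id1 K b) <| r = s"
      by (intro exI[of _ s]) simp
  qed
  show "ess1 K (id1 K b)"
  proof (rule ess1I)
    fix f assume "f : ars K" "tgt K f = tgt K (id1 K b)"
    then show "EX g s. g : ars K & src K g = src K f & tgt K g = src K (id1 K b) &
       s : cells K & cdom K s = id1 K b \<odot> g & ccod K s = f & invertible2 K s"
      by (intro exI[of _ f] exI[of _ "id2 K f"]) simp
  qed simp
qed

lemma adjunction_simps:
  assumes "adjunction1 K l u \<eta> \<epsilon>"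
  shows "u : ars K" "l : ars K" "src K l = tgt K u" "tgt K l = src K u"
    "\<eta> : cells K" "cdom K \<eta> = id1 K (tgt K u)" "ccod K \<eta> = u \<odot> l"
    "\<epsilon> : cells K" "cdom K \<epsilon> = l \<odot> u" "ccod K \<epsilon> = id1 K (src K u)"
    "u <| \<epsilon> \<bullet> (\<eta> |> u) = id2 K u" "\<epsilon> |> l \<bullet> (l <| \<eta>) = id2 K l"
  using assms unfolding adjunction1_def in_hom1_def in_hom2_def by simp_all

text \<open>Associativity, both of the multiplication and of the canonical action on
  \<open>u\<close>, is interchange of the counit with itself; the unit laws are whiskered triangle
  identities.\<close>

lemma adjunction_monad:
  assumes a: "adjunction1 K l u \<eta> \<epsilon>"
  shows "monad2 K (tgt K u) (u \<odot> l) \<eta> (u <| \<epsilon> |> l)"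
    and "alg2 K (u \<odot> l) \<eta> (u <| \<epsilon> |> l) u (u <| \<epsilon>)"
proof -
  note [simp] = adjunction_simps(1-10)[OF a]
  have 1: "u <| \<epsilon> |> l \<bullet> (\<eta> |> (u \<odot> l)) = id2 K (u \<odot> l)"
    using arg_cong[OF adjunction_simps(11)[OF a], of "%s. s |> l"] by simp
  have 2: "u <| \<epsilon> |> l \<bullet> ((u \<odot> l) <| \<eta>) = id2 K (u \<odot> l)"
    using arg_cong[OF adjunction_simps(12)[OF a], of "%s. u <| s"] by simp
  have sl: "\<epsilon> \<bullet> ((l \<odot> u) <| \<epsilon>) = \<epsilon> \<bullet> \<epsilon> |> (l \<odot> u)"
    using slide_refl[of \<epsilon> \<epsilon>] by simp
  note 3 = arg_cong[OF sl, of "%s. u <| s", simplified]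
  note 4 = arg_cong[OF 3, of "%s. s |> l", simplified]
  show "monad2 K (tgt K u) (u \<odot> l) \<eta> (u <| \<epsilon> |> l)"
    by (simp add: monad2_def in_hom1_def in_hom2_def 1 2 4)
  show "alg2 K (u \<odot> l) \<eta> (u <| \<epsilon> |> l) u (u <| \<epsilon>)"
    by (simp add: alg2_def in_hom1_def in_hom2_def 3 adjunction_simps(11)[OF a])
qed

text \<open>Two left adjoints of \<open>u\<close> are canonically isomorphic, by the mate
  \<open>\<theta>\<close> of the identity of \<open>u\<close>. Whiskered with \<open>u\<close>, it
  is an isomorphism of the induced monads respecting the canonical actions on
  \<open>u\<close>.\<close>

lemma adjunction_change:
  assumes a: "adjunction1 K l u \<eta> \<epsilon>" and a': "adjunction1 K l' u \<eta>' \<epsilon>'"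
  obtains \<phi> where "alg_square1 K (tgt K u) (u \<odot> l) \<eta> (u <| \<epsilon> |> l)
     (tgt K u) (u \<odot> l') \<eta>' (u <| \<epsilon>' |> l') (id1 K (tgt K u)) \<phi> u (u <| \<epsilon>) u (u <| \<epsilon>')
     (id1 K (src K u)) (id2 K u)"
proof -
  note [simp] = adjunction_simps(1-10)[OF a] adjunction_simps(1-10)[OF a']
  define \<theta> where "\<theta> = \<epsilon>' |> l \<bullet> l' <| \<eta>"
  define \<theta>' where "\<theta>' = \<epsilon> |> l' \<bullet> l <| \<eta>'"
  have [simp]: "\<theta> : cells K" "cdom K \<theta> = l'" "ccod K \<theta> = l" "\<theta>' : cells K" "cdom K \<theta>' = l" "ccod K \<theta>' = l'"
    by (simp_all add: \<theta>_def \<theta>'_def)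
  \<comment> \<open>Stated for an arbitrary pair of adjunctions, so that \<open>inv\<close> can use
    it in both orders.\<close>
  have unit: "u <| \<epsilon>2 |> l1 \<bullet> (u \<odot> l2) <| \<eta>1 \<bullet> \<eta>2 = \<eta>1"
    and counit: "\<epsilon>1 \<bullet> \<epsilon>2 |> (l1 \<odot> u) \<bullet> (l2 <| \<eta>1 |> u) = \<epsilon>2"
    if "adjunction1 K l1 u \<eta>1 \<epsilon>1" "adjunction1 K l2 u \<eta>2 \<epsilon>2" for l1 l2 \<eta>1 \<eta>2 \<epsilon>1 \<epsilon>2
  proof -
    note [simp] = adjunction_simps(1-10)[OF that(1)] adjunction_simps(1-10)[OF that(2)]
    have s: "(u \<odot> l2) <| \<eta>1 \<bullet> \<eta>2 = \<eta>2 |> (u \<odot> l1) \<bullet> \<eta>1"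
      using slide_refl[of \<eta>2 \<eta>1] by simp
    note t = arg_cong[OF adjunction_simps(11)[OF that(2)], of "%s. s |> l1", simplified]
    show "u <| \<epsilon>2 |> l1 \<bullet> (u \<odot> l2) <| \<eta>1 \<bullet> \<eta>2 = \<eta>1"
      by (simp add: s t[THEN vc21])
    have s: "\<epsilon>1 \<bullet> (\<epsilon>2 |> (l1 \<odot> u)) = \<epsilon>2 \<bullet> (l2 \<odot> u) <| \<epsilon>1"
      using slide_refl[of \<epsilon>2 \<epsilon>1] by simp
    note t = arg_cong[OF adjunction_simps(11)[OF that(1)], of "%s. l2 <| s", simplified]
    show "\<epsilon>1 \<bullet> \<epsilon>2 |> (l1 \<odot> u) \<bullet> (l2 <| \<eta>1 |> u) = \<epsilon>2"
      by (simp add: s[THEN vc22] t)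
  qed
  have inv: "((\<epsilon>2 |> l1) \<bullet> (l2 <| \<eta>1)) \<bullet> ((\<epsilon>1 |> l2) \<bullet> (l1 <| \<eta>2)) = id2 K l1"
    if "adjunction1 K l1 u \<eta>1 \<epsilon>1" "adjunction1 K l2 u \<eta>2 \<epsilon>2" for l1 l2 \<eta>1 \<eta>2 \<epsilon>1 \<epsilon>2
  proof -
    note [simp] = adjunction_simps(1-10)[OF that(1)] adjunction_simps(1-10)[OF that(2)]
    have s1: "l2 <| \<eta>1 \<bullet> \<epsilon>1 |> l2 = \<epsilon>1 |> (l2 \<odot> u \<odot> l1) \<bullet> (l1 \<odot> u \<odot> l2) <| \<eta>1"
      using slide_refl[of "\<epsilon>1 |> l2" \<eta>1] by simp
    have s2: "\<epsilon>2 |> l1 \<bullet> \<epsilon>1 |> (l2 \<odot> u \<odot> l1) = \<epsilon>1 |> l1 \<bullet> (l1 \<odot> u) <| \<epsilon>2 |> l1"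
      using slide_refl[of \<epsilon>1 "\<epsilon>2 |> l1"] by simp
    note u = arg_cong[OF unit[OF that], of "%s. l1 <| s", simplified]
    show ?thesis by (simp add: s1[THEN vc22] s2[THEN vc22] u adjunction_simps(12)[OF that(1)])
  qed
  have "iso2 \<theta> \<theta>'"
    using inv[OF a a'] inv[OF a' a] by (simp add: iso2_def) (simp add: \<theta>_def \<theta>'_def)
  then have [simp]: "invertible2 K \<theta>" unfolding invertible2_iff by blast
  have e1: "u <| \<theta> \<bullet> \<eta>' = \<eta>"
    using unit[OF a a'] by (simp add: \<theta>_def)
  have e2: "\<epsilon> \<bullet> (\<theta> |> u) = \<epsilon>'"
    using counit[OF a a'] by (simp add: \<theta>_def)
  note e3 = arg_cong[OF e2, of "%s. u <| s", simplified]
  note e4 = arg_cong[OF e3, of "%s. s |> l'", simplified]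
  have s: "u <| \<theta> \<bullet> u <| \<epsilon> |> l' = u <| \<epsilon> |> l \<bullet> (u \<odot> l \<odot> u) <| \<theta>"
    using slide_refl[of "u <| \<epsilon>" \<theta>] by simp
  have s': "(u \<odot> l \<odot> u) <| \<theta> \<bullet> (u <| \<theta> |> (u \<odot> l'))
    = u <| \<theta> |> (u \<odot> l) \<bullet> (u \<odot> l' \<odot> u) <| \<theta>"
    using slide_refl[of "u <| \<theta> |> u" \<theta>] by simp
  have e5: "u <| \<theta> \<bullet> (u <| \<epsilon>' |> l')
    = u <| \<epsilon> |> l \<bullet> u <| \<theta> |> (u \<odot> l) \<bullet> (u \<odot> l' \<odot> u) <| \<theta>"
    by (simp add: e4[symmetric] s[THEN vc22] s')
  show thesis
  proof (rule that[of "u <| \<theta>"])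
    show "alg_square1 K (tgt K u) (u \<odot> l) \<eta> (u <| \<epsilon> |> l)
     (tgt K u) (u \<odot> l') \<eta>' (u <| \<epsilon>' |> l') (id1 K (tgt K u)) (u <| \<theta>) u (u <| \<epsilon>) u (u <| \<epsilon>')
     (id1 K (src K u)) (id2 K u)"
      using adjunction_monad[OF a] adjunction_monad[OF a'] two_category_axioms
      by (simp add: alg_square1_def alg_square1_axioms_def monad_in_def monad_in_axioms_def e1 e3 e5)
  qed
qed

text \<open>The square of \<open>adjunction_change\<close> lies over identities, so universality
  transfers in both directions. This makes the choice of left adjoint in the definitions of
  monadicity immaterial.\<close>

lemma em_change:
  assumes a: "adjunction1 K l u \<eta> \<epsilon>" and a': "adjunction1 K l' u \<eta>' \<epsilon>'"
  shows "alg_full1 K (u \<odot> l) u (u <| \<epsilon>) & faith1 K u \<longleftrightarrow> alg_full1 K (u \<odot> l') u (u <| \<epsilon>') & faith1 K u"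
    and "em K (u \<odot> l) \<eta> (u <| \<epsilon> |> l) u (u <| \<epsilon>)
      \<longleftrightarrow> em K (u \<odot> l') \<eta>' (u <| \<epsilon>' |> l') u (u <| \<epsilon>')"
proof -
  have o [simp]: "tgt K u : obs K" "src K u : obs K" using adjunction_simps(1)[OF a] by simp_all
  have 1: "faith1 K u ==> alg_full1 K (u \<odot> l2) u (u <| \<epsilon>2) ==> alg_full1 K (u \<odot> l1) u (u <| \<epsilon>1)"
    and 2: "faith1 K u ==> alg_full1 K (u \<odot> l2) u (u <| \<epsilon>2) ==> alg_ess1 K (u \<odot> l2) \<eta>2 (u <| \<epsilon>2 |> l2) u (u <| \<epsilon>2)
      ==> alg_ess1 K (u \<odot> l1) \<eta>1 (u <| \<epsilon>1 |> l1) u (u <| \<epsilon>1)"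
    if a1: "adjunction1 K l1 u \<eta>1 \<epsilon>1" and a2: "adjunction1 K l2 u \<eta>2 \<epsilon>2" for l1 \<eta>1 \<epsilon>1 l2 \<eta>2 \<epsilon>2
  proof -
    obtain \<phi> where "alg_square1 K (tgt K u) (u \<odot> l1) \<eta>1 (u <| \<epsilon>1 |> l1)
     (tgt K u) (u \<odot> l2) \<eta>2 (u <| \<epsilon>2 |> l2) (id1 K (tgt K u)) \<phi> u (u <| \<epsilon>1) u (u <| \<epsilon>2)
     (id1 K (src K u)) (id2 K u)" using adjunction_change[OF a1 a2] by blast
    then interpret s: alg_square1 K "tgt K u" "u \<odot> l1" \<eta>1 "u <| \<epsilon>1 |> l1"
     "tgt K u" "u \<odot> l2" \<eta>2 "u <| \<epsilon>2 |> l2" "id1 K (tgt K u)" \<phi> u "u <| \<epsilon>1" u "u <| \<epsilon>2"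
     "id1 K (src K u)" "id2 K u" .
    show "faith1 K u ==> alg_full1 K (u \<odot> l2) u (u <| \<epsilon>2) ==> alg_full1 K (u \<odot> l1) u (u <| \<epsilon>1)"
      "faith1 K u ==> alg_full1 K (u \<odot> l2) u (u <| \<epsilon>2) ==> alg_ess1 K (u \<odot> l2) \<eta>2 (u <| \<epsilon>2 |> l2) u (u <| \<epsilon>2)
      ==> alg_ess1 K (u \<odot> l1) \<eta>1 (u <| \<epsilon>1 |> l1) u (u <| \<epsilon>1)"
      using s.alg_full1_transfer s.alg_ess1_transfer identity_equivalence[OF o(1)] identity_equivalence[OF o(2)] by blast+
  qed
  show "alg_full1 K (u \<odot> l) u (u <| \<epsilon>) & faith1 K u \<longleftrightarrow> alg_full1 K (u \<odot> l') u (u <| \<epsilon>') & faith1 K u"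
    using 1[OF a a'] 1[OF a' a] by blast
  then show "em K (u \<odot> l) \<eta> (u <| \<epsilon> |> l) u (u <| \<epsilon>)
      \<longleftrightarrow> em K (u \<odot> l') \<eta>' (u <| \<epsilon>' |> l') u (u <| \<epsilon>')"
    unfolding em_def using 2[OF a a'] 2[OF a' a] adjunction_monad(2)[OF a] adjunction_monad(2)[OF a'] by blast
qed

end

section \<open>Eilenberg-Moore objects of pseudofunctors are pointwise\<close>

locale PS_monad = two_categories S K
  for S :: "('o, 'm, 'c) tcat" and K :: "('p, 'n, 'd) tcat" (structure) +
  fixes N T \<eta> \<mu>
  assumes PS_monad: "monad2 (PS S K) N T \<eta> \<mu>"
begin

sublocale N: pseudofunctor S K N
  using PS_monad by (simp add: monad2_def)

sublocale T: pseudonatural S K T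
  using PS_monad by (simp add: monad2_def in_hom1_def)

sublocale \<eta>: modification S K \<eta>
  using PS_monad by (simp add: monad2_def in_hom2_def)

sublocale \<mu>: modification S K \<mu>
  using PS_monad by (simp add: monad2_def in_hom2_def)

lemma PS_monad_simps [simp]:
  "psrc T = N" "ptgt T = N" "msrc \<eta> = id1 (PS S K) N" "mtgt \<eta> = T" "msrc \<mu> = T \<odot>\<^bsub>PS S K\<^esub> T" "mtgt \<mu> = T"
  using PS_monad by (simp_all add: monad2_def in_hom1_def in_hom2_def)

lemma monad_at: "x : obs S ==> monad2 K (pf0 N x) (pcomp T x) (mcomp \<eta> x) (mcomp \<mu> x)"
proof -
  assume [simp]: "x : obs S"
  have 1: "\<mu> \<bullet>\<^bsub>PS S K\<^esub> (\<eta> |>\<^bsub>PS S K\<^esub> T) = id2 (PS S K) T"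
    "\<mu> \<bullet>\<^bsub>PS S K\<^esub> (T <|\<^bsub>PS S K\<^esub> \<eta>) = id2 (PS S K) T"
    "\<mu> \<bullet>\<^bsub>PS S K\<^esub> (T <|\<^bsub>PS S K\<^esub> \<mu>) = \<mu> \<bullet>\<^bsub>PS S K\<^esub> \<mu> |>\<^bsub>PS S K\<^esub> T"
    using PS_monad by (simp_all add: monad2_def)
  show ?thesis
    using 1[THEN arg_cong, of "%m. mcomp m x"] by (simp add: monad2_def in_hom1_def in_hom2_def)
qed

lemma alg_at: "alg2 (PS S K) T \<eta> \<mu> f k ==> x : obs S ==> alg2 K (pcomp T x) (mcomp \<eta> x) (mcomp \<mu> x) (pcomp f x) (mcomp k x)"
proof -
  assume a: "alg2 (PS S K) T \<eta> \<mu> f k" and [simp]: "x : obs S"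
  then interpret f: pseudonatural S K f by (simp add: alg2_def in_hom1_def)
  interpret k: modification S K k using a by (simp add: alg2_def in_hom2_def)
  have [simp]: "ptgt f = N" "msrc k = T \<odot>\<^bsub>PS S K\<^esub> f" "mtgt k = f"
    using a by (simp_all add: alg2_def in_hom1_def in_hom2_def)
  have 1: "k \<bullet>\<^bsub>PS S K\<^esub> (\<eta> |>\<^bsub>PS S K\<^esub> f) = id2 (PS S K) f"
    "k \<bullet>\<^bsub>PS S K\<^esub> (T <|\<^bsub>PS S K\<^esub> k) = k \<bullet>\<^bsub>PS S K\<^esub> \<mu> |>\<^bsub>PS S K\<^esub> f"
    using a by (simp_all add: alg2_def)
  show ?thesis
    using 1[THEN arg_cong, of "%m. mcomp m x"] by (simp add: alg2_def in_hom1_def in_hom2_def)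
qed

lemma alg_nat:
  assumes a: "alg2 (PS S K) T \<eta> \<mu> f k" and [simp]: "u : ars S"
  shows "pnat f u \<bullet> ((pf1 N u) <| mcomp k (src S u))
    = mcomp k (tgt S u) |> (pf1 (psrc f) u) \<bullet> ((pcomp T (tgt S u)) <| pnat f u)
      \<bullet> pnat T u |> (pcomp f (src S u))"
proof -
  interpret k: modification S K k using a by (simp add: alg2_def in_hom2_def)
  have [simp]: "ptgt f = N" "msrc k = T \<odot>\<^bsub>PS S K\<^esub> f" "mtgt k = f"
    using a by (simp_all add: alg2_def in_hom1_def in_hom2_def)
  show ?thesis using k.mcomp_nat[of u] by simp
qed

end

lemma modifI:
  assumes "pseudonatural S K g" "pseudonatural S K g'" "psrc g' = psrc g" "ptgt g' = ptgt g"
    and "!!x. x : obs S ==> r x : cells K & cdom K (r x) = pcomp g x & ccod K (r x) = pcomp g' x"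
    and "!!u. u : ars S ==> pnat g' u \<bullet>\<^bsub>K\<^esub> ((pf1 (ptgt g) u) <|\<^bsub>K\<^esub> r (src S u))
      = r (tgt S u) |>\<^bsub>K\<^esub> (pf1 (psrc g) u) \<bullet>\<^bsub>K\<^esub> pnat g u"
    and "two_category S"
  shows "modification S K \<lparr>msrc = g, mtgt = g', mcomp = restrict r (obs S)\<rparr>"
proof -
  interpret S: two_category S by fact
  show ?thesis using assms by (simp add: modification_def in_hom2_def)
qed

locale PS_alg = PS_monad S K N T \<eta> \<mu>
  for S :: "('o, 'm, 'c) tcat" and K :: "('p, 'n, 'd) tcat" (structure) and N T \<eta> \<mu> +
  fixes p h
  assumes alg: "alg2 (PS S K) T \<eta> \<mu> p h"
begin

sublocale p: pseudonatural S K p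
  using alg by (simp add: alg2_def in_hom1_def)

sublocale h: modification S K h
  using alg by (simp add: alg2_def in_hom2_def)

lemma alg_simps [simp]: "ptgt p = N" "msrc h = T \<odot>\<^bsub>PS S K\<^esub> p" "mtgt h = p"
  using alg by (simp_all add: alg2_def in_hom1_def in_hom2_def)

end

locale PS_em = PS_alg S K N T \<eta> \<mu> p h
  for S :: "('o, 'm, 'c) tcat" and K :: "('p, 'n, 'd) tcat" (structure) and N T \<eta> \<mu> p h +
  assumes em: "x : obs S ==> em K (pcomp T x) (mcomp \<eta> x) (mcomp \<mu> x) (pcomp p x) (mcomp h x)"
begin

lemma em_faith: "x : obs S ==> faith1 K (pcomp p x)"
  and em_full: "x : obs S ==> alg_full1 K (pcomp T x) (pcomp p x) (mcomp h x)"
  and em_ess: "x : obs S ==> alg_ess1 K (pcomp T x) (mcomp \<eta> x) (mcomp \<mu> x) (pcomp p x) (mcomp h x)"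
  using em by (auto simp: em_def)

lemma PS_faith: "faith1 (PS S K) p"
proof (rule PS.faith1I)
  fix r r' assume a: "r : cells (PS S K)" "r' : cells (PS S K)" "cdom (PS S K) r = cdom (PS S K) r'"
    "ccod (PS S K) r = ccod (PS S K) r'" "tgt (PS S K) (cdom (PS S K) r') = src (PS S K) p"
    "p <|\<^bsub>PS S K\<^esub> r = p <|\<^bsub>PS S K\<^esub> r'"
  then interpret r: modification S K r by simp
  interpret r': modification S K r' using a by simp
  from a have e [simp]: "msrc r = msrc r'" "mtgt r = mtgt r'" "ptgt (msrc r') = psrc p" by simp_all
  show "r = r'"
  proof (rule modif_eqI[of S K])
    fix x assume [simp]: "x : obs S"
    have "(pcomp p x) <| mcomp r x = (pcomp p x) <| mcomp r' x"
      using arg_cong[OF a(6), of "%m. mcomp m x"] by simp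
    then show "mcomp r x = mcomp r' x"
      by (rule K.faith1D[OF em_faith, rotated]) simp_all
  qed (use a in simp_all)
qed

text \<open>Lifts are chosen pointwise. They form a modification because the naturality equation
  holds after whiskering with the component of \<open>p\<close>, where it is naturality of
  \<open>s\<close>, and that component is faithful.\<close>

lemma PS_full: "alg_full1 (PS S K) T p h"
proof (rule PS.alg_full1I)
  fix g g' s assume a: "g : ars (PS S K)" "g' : ars (PS S K)" "src (PS S K) g = src (PS S K) g'"
    "tgt (PS S K) g = src (PS S K) p" "tgt (PS S K) g' = src (PS S K) p" "s : cells (PS S K)"
    "cdom (PS S K) s = p \<odot>\<^bsub>PS S K\<^esub> g" "ccod (PS S K) s = p \<odot>\<^bsub>PS S K\<^esub> g'"
    "s \<bullet>\<^bsub>PS S K\<^esub> h |>\<^bsub>PS S K\<^esub> g = h |>\<^bsub>PS S K\<^esub> g' \<bullet>\<^bsub>PS S K\<^esub> T <|\<^bsub>PS S K\<^esub> s"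
  then interpret g: pseudonatural S K g by simp
  interpret g': pseudonatural S K g' using a by simp
  interpret s: modification S K s using a by simp
  from a have e [simp]: "psrc g' = psrc g" "ptgt g = psrc p" "ptgt g' = psrc p" "msrc s = p \<odot>\<^bsub>PS S K\<^esub> g"
    "mtgt s = p \<odot>\<^bsub>PS S K\<^esub> g'" by simp_all
  have "EX r. r : cells K & cdom K r = pcomp g x & ccod K r = pcomp g' x & (pcomp p x) <| r = mcomp s x"
    if [simp]: "x : obs S" for x
  proof (rule K.alg_full1D[OF em_full])
    show "mcomp s x \<bullet> mcomp h x |> (pcomp g x) = mcomp h x |> (pcomp g' x) \<bullet> (pcomp T x) <| mcomp s x"
      using arg_cong[OF a(9), of "%m. mcomp m x"] by simp
  qed simp_all
  then obtain r where r [simp]: "!!x. x : obs S ==> r x : cells K" "!!x. x : obs S ==> cdom K (r x) = pcomp g x"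
    "!!x. x : obs S ==> ccod K (r x) = pcomp g' x" "!!x. x : obs S ==> (pcomp p x) <| r x = mcomp s x"
    by metis
  let ?r = "\<lparr>msrc = g, mtgt = g', mcomp = restrict r (obs S)\<rparr>"
  have m: "modification S K ?r"
  proof (rule modifI)
    fix u assume u [simp]: "u : ars S"
    let ?x = "src S u" and ?y = "tgt S u"
    have 1: "pnat p u |> (pcomp g' ?x) \<bullet> ((pf1 N u) <| mcomp s ?x)
      = (pcomp p ?y \<odot> pf1 (psrc p) u) <| r ?x \<bullet> pnat p u |> (pcomp g ?x)"
      using K.slide_refl[of "pnat p u" "r ?x"]
        K.lwhisker_lwhisker[of "pf1 N u" "pcomp p ?x" "r ?x", symmetric] by (simp del: K.lwhisker_lwhisker)
    have "(pcomp p ?y) <| (pnat g' u \<bullet> ((pf1 (ptgt g) u) <| r ?x)) \<bullet> (pnat p u |> (pcomp g ?x))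
      = (pcomp p ?y) <| pnat g' u \<bullet> (pcomp p ?y \<odot> pf1 (psrc p) u) <| r ?x \<bullet> pnat p u |> (pcomp g ?x)"
      by simp
    also have "\<dots> = pnat (p \<odot>\<^bsub>PS S K\<^esub> g') u \<bullet> (pf1 N u) <| mcomp s ?x"
      by (simp add: 1)
    also have "\<dots> = mcomp s ?y |> (pf1 (psrc g) u) \<bullet> pnat (p \<odot>\<^bsub>PS S K\<^esub> g) u"
      using s.mcomp_nat[OF u] by simp
    also have "\<dots> = (pcomp p ?y) <| ((r ?y |> (pf1 (psrc g) u)) \<bullet> pnat g u) \<bullet> pnat p u |> (pcomp g ?x)"
      using K.hcomp_assoc[of "id2 K (pcomp p ?y)" "r ?y" "id2 K (pf1 (psrc g) u)"] by simp
    finally have "(pcomp p ?y) <| (pnat g' u \<bullet> ((pf1 (ptgt g) u) <| r ?x))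
      = (pcomp p ?y) <| ((r ?y |> (pf1 (psrc g) u)) \<bullet> pnat g u)"
      by (rule K.vcomp_cancel_right[rotated]) simp_all
    then show "pnat g' u \<bullet> (pf1 (ptgt g) u) <| r ?x = r ?y |> (pf1 (psrc g) u) \<bullet> pnat g u"
      by (rule K.faith1D[OF em_faith, rotated]) simp_all
  qed (use a S.two_category_axioms in simp_all)
  show "EX r. r : cells (PS S K) & cdom (PS S K) r = g & ccod (PS S K) r = g' & p <|\<^bsub>PS S K\<^esub> r = s"
    by (rule exI[of _ ?r], intro conjI, use m in simp, simp, simp, rule modif_eqI[of S K])
      (use m s.modification_axioms modif_hcomp[OF modif_id2[OF p.pseudonatural_axioms] m] in simp_all)
qed

end

text \<open>The algebra \<open>(f, k)\<close> is lifted along a pointwise universal algebra; \<open>i\<close> consists of pointwise lifts.\<close>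

locale PS_em_lift = PS_em S K N T \<eta> \<mu> p h + f: PS_alg S K N T \<eta> \<mu> f k
  for S :: "('o, 'm, 'c) tcat" and K :: "('p, 'n, 'd) tcat" (structure) and N T \<eta> \<mu> p h f k +
  fixes g i
  assumes g: "x : obs S ==> g x : ars K & src K (g x) = pf0 (psrc f) x & tgt K (g x) = pf0 (psrc p) x"
    and i: "x : obs S ==> cdom K (i x) = pcomp p x \<odot> g x & ccod K (i x) = pcomp f x & invertible2 K (i x)"
    and i_alg: "x : obs S ==> i x \<bullet> (mcomp h x |> (g x)) = mcomp k x \<bullet> (pcomp T x) <| i x"
begin

lemma gi [simp]:
  "x : obs S ==> g x : ars K" "x : obs S ==> src K (g x) = pf0 (psrc f) x"
  "x : obs S ==> tgt K (g x) = pf0 (psrc p) x"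
  "x : obs S ==> cdom K (i x) = pcomp p x \<odot> g x" "x : obs S ==> ccod K (i x) = pcomp f x"
  "x : obs S ==> invertible2 K (i x)" "x : obs S ==> i x : cells K"
  using g i K.invertible2_cell by auto

abbreviation L where "L \<equiv> psrc p"
abbreviation X where "X \<equiv> psrc f"

text \<open>The cell which the naturality cell of the lifted transformation at \<open>u\<close> must
  become under the component of \<open>p\<close>: the naturality of \<open>f\<close>, conjugated by
  the pointwise lifts \<open>i\<close> and by the naturality of \<open>p\<close>.\<close>

definition c where "c u = inv2 K (i (tgt S u) |> (pf1 X u)) \<bullet> pnat f u \<bullet> ((pf1 N u) <| i (src S u))
  \<bullet> inv2 K (pnat p u |> (g (src S u)))"

lemma c_simps [simp]:
  assumes [simp]: "u : ars S"
  shows "c u : cells K" "cdom K (c u) = pcomp p (tgt S u) \<odot> pf1 L u \<odot> g (src S u)"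
    "ccod K (c u) = pcomp p (tgt S u) \<odot> g (tgt S u) \<odot> pf1 X u" "invertible2 K (c u)"
  by (simp_all add: c_def)

lemma c_eq:
  assumes [simp]: "u : ars S"
  shows "i (tgt S u) |> (pf1 X u) \<bullet> c u \<bullet> (pnat p u |> (g (src S u))) = pnat f u \<bullet> (pf1 N u) <| i (src S u)"
  by (simp add: c_def K.vcomp_inv2[THEN K.vc21])

text \<open>The cell can be lifted because it is an algebra map. This combines naturality of the
  actions \<open>h\<close> and \<open>k\<close> with the pointwise equations \<open>i_alg\<close>,
  after composition with invertible cells on both sides.\<close>

lemma c_alg:
  assumes u [simp]: "u : ars S"
  shows "c u \<bullet> (mcomp h (tgt S u) |> (pf1 L u \<odot> g (src S u)))
    = mcomp h (tgt S u) |> (g (tgt S u) \<odot> pf1 X u) \<bullet> (pcomp T (tgt S u)) <| c u"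
proof -
  let ?x = "src S u" and ?y = "tgt S u"
  let ?P = "(pcomp T ?y) <| pnat p u |> (g ?x) \<bullet> pnat T u |> (pcomp p ?x \<odot> g ?x)"
  let ?I = "i ?y |> (pf1 X u)"
  note h = arg_cong[OF alg_nat[OF alg u], of "%s. s |> (g ?x)", simplified]
  note k = alg_nat[OF f.alg u, simplified]
  note ix = arg_cong[OF i_alg[of ?x], of "%s. (pf1 N u) <| s", simplified]
  note iy = arg_cong[OF i_alg[of ?y], of "%s. s |> (pf1 X u)", simplified]
  note Tc = arg_cong[OF c_eq[OF u], of "%s. (pcomp T ?y) <| s", simplified]
  have sl: "pnat T u |> (pcomp f ?x) \<bullet> ((pf1 N u \<odot> pcomp T ?x) <| i ?x)
     = (pcomp T ?y \<odot> pf1 N u) <| i ?x \<bullet> pnat T u |> (pcomp p ?x \<odot> g ?x)"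
    using K.slide_refl[of "pnat T u" "i ?x"] by simp
  have "?I \<bullet> (c u \<bullet> (mcomp h ?y |> (pf1 L u \<odot> g ?x))) \<bullet> ?P
      = ?I \<bullet> c u \<bullet> pnat p u |> (g ?x) \<bullet> (pf1 N u) <| mcomp h ?x |> (g ?x)"
    by (simp add: h)
  also have "\<dots> = pnat f u \<bullet> (pf1 N u) <| mcomp k ?x \<bullet> (pf1 N u \<odot> pcomp T ?x) <| i ?x"
    by (simp add: c_eq[THEN K.vc32] ix)
  also have "\<dots> = mcomp k ?y |> (pf1 X u) \<bullet> (pcomp T ?y) <| pnat f u \<bullet> ((pcomp T ?y \<odot> pf1 N u) <| i ?x)
     \<bullet> pnat T u |> (pcomp p ?x \<odot> g ?x)"
    by (simp add: k[THEN K.vc23] sl)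
  also have "\<dots> = ?I \<bullet> ((mcomp h ?y |> (g ?y \<odot> pf1 X u)) \<bullet> ((pcomp T ?y) <| c u)) \<bullet> ?P"
    by (simp add: iy[THEN K.vc22] Tc[THEN K.vc32])
  finally have "(c u \<bullet> (mcomp h ?y |> (pf1 L u \<odot> g ?x))) \<bullet> ?P
      = ((mcomp h ?y |> (g ?y \<odot> pf1 X u)) \<bullet> ((pcomp T ?y) <| c u)) \<bullet> ?P"
    by (rule K.vcomp_cancel_left[rotated]) simp_all
  then show ?thesis by (rule K.vcomp_cancel_right[rotated]) simp_all
qed

lemma ex_d: "u : ars S ==> EX r. r : cells K & cdom K r = pf1 L u \<odot> g (src S u) & ccod K r = g (tgt S u) \<odot> pf1 X u
     & (pcomp p (tgt S u)) <| r = c u"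
  by (rule K.alg_full1D[OF em_full]) (simp_all add: c_alg)

definition d where "d u = (SOME r. r : cells K & cdom K r = pf1 L u \<odot> g (src S u) & ccod K r = g (tgt S u) \<odot> pf1 X u
     & (pcomp p (tgt S u)) <| r = c u)"

lemma d_simps [simp]:
  assumes "u : ars S"
  shows "d u : cells K" "cdom K (d u) = pf1 L u \<odot> g (src S u)" "ccod K (d u) = g (tgt S u) \<odot> pf1 X u"
    "(pcomp p (tgt S u)) <| d u = c u"
  using someI_ex[OF ex_d[OF assms]] unfolding d_def by blast+

lemma d_whisker [simp]:
  assumes "u : ars S"
  shows "[|v : ars K; tgt K v = pf0 X (src S u)|] ==> (pcomp p (tgt S u)) <| d u |> v = c u |> v"
    and "[|w : ars K; src K w = pf0 N (tgt S u)|] ==> (w \<odot> pcomp p (tgt S u)) <| d u = w <| c u"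
  using K.hcomp_assoc[of "id2 K (pcomp p (tgt S u))" "d u" "id2 K v"] K.lwhisker_lwhisker[of w "pcomp p (tgt S u)" "d u"] assms(1)
  by (simp_all del: K.lwhisker_lwhisker K.hcomp_assoc)

text \<open>The inverse of \<open>c u\<close> is again an algebra map, hence lifts as well;
  faithfulness makes the two lifts mutually inverse.\<close>

lemma invertible_d: "u : ars S ==> invertible2 K (d u)"
proof -
  assume u [simp]: "u : ars S"
  let ?x = "src S u" and ?y = "tgt S u"
  have "inv2 K (c u) \<bullet> mcomp h ?y |> (g ?y \<odot> pf1 X u) = mcomp h ?y |> (pf1 L u \<odot> g ?x) \<bullet> inv2 K ((pcomp T ?y) <| c u)"
  proof (rule K.vcomp_cancel_left[of "c u"])
    show "c u \<bullet> inv2 K (c u) \<bullet> (mcomp h ?y |> (g ?y \<odot> pf1 X u))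
      = c u \<bullet> mcomp h ?y |> (pf1 L u \<odot> g ?x) \<bullet> inv2 K ((pcomp T ?y) <| c u)"
      by (simp add: c_alg[THEN K.vc22])
  qed simp_all
  moreover have "inv2 K ((pcomp T ?y) <| c u) = (pcomp T ?y) <| inv2 K (c u)"
    by (rule K.inv2_eq, rule K.iso2_lwhisker) (simp_all add: K.iso2_inv2)
  ultimately have "EX r. r : cells K & cdom K r = g ?y \<odot> pf1 X u & ccod K r = pf1 L u \<odot> g ?x & (pcomp p ?y) <| r = inv2 K (c u)"
    by (intro K.alg_full1D[OF em_full]) simp_all
  then obtain r where r [simp]: "r : cells K" "cdom K r = g ?y \<odot> pf1 X u" "ccod K r = pf1 L u \<odot> g ?x" "(pcomp p ?y) <| r = inv2 K (c u)"
    by blast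
  have "r \<bullet> d u = id2 K (pf1 L u \<odot> g ?x)" by (rule K.faith1D[OF em_faith[of ?y]]) simp_all
  moreover have "d u \<bullet> r = id2 K (g ?y \<odot> pf1 X u)" by (rule K.faith1D[OF em_faith[of ?y]]) simp_all
  ultimately show ?thesis unfolding K.invertible2_iff K.iso2_def by (intro exI[of _ r]) simp
qed

text \<open>Cells into a lift are compared by applying the faithful component of \<open>p\<close>
  and composing with invertible cells. The shape is such that \<open>c_eq\<close> can be applied to
  both sides.\<close>

lemma cancel:
  assumes "x : obs S" and a: "a : cells K" "b : cells K" "cdom K a = cdom K b" "ccod K a = ccod K b"
    "ccod K b = g x \<odot> w" "w : ars K" "tgt K w = pf0 X x"
    and P: "invertible2 K P" "ccod K P = pcomp p x \<odot> cdom K b"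
    and eq: "i x |> w \<bullet> (pcomp p x) <| a \<bullet> P = i x |> w \<bullet> (pcomp p x) <| b \<bullet> P"
  shows "a = b"
proof -
  note [simp] = assms(1) a P K.invertible2_cell[OF P(1)]
  have "tgt K (g x \<odot> w) = pf0 (psrc p) x" by simp
  then have [simp]: "tgt K (cdom K b) = pf0 (psrc p) x" using K.tgt_cod[OF a(2)] by (simp only: a(5))
  from eq have "(pcomp p x) <| a \<bullet> P = (pcomp p x) <| b \<bullet> P"
    by (rule K.vcomp_cancel_left[rotated]) simp_all
  then have "(pcomp p x) <| a = (pcomp p x) <| b"
    by (rule K.vcomp_cancel_right[rotated]) simp_all
  then show ?thesis by (rule K.faith1D[OF em_faith, rotated]) simp_all
qed

definition G where "G = \<lparr>psrc = X, ptgt = L, pcomp = restrict g (obs S), pnat = restrict d (ars S)\<rparr>"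

text \<open>By \<open>cancel\<close>, each axiom becomes an equation underneath, where it is the
  same axiom of \<open>p\<close> followed by that of \<open>f\<close>.\<close>

lemma psnat_G: "pseudonatural S K G"
  unfolding pseudonatural_def
proof (intro conjI allI impI)
  fix \<sigma> assume s [simp]: "\<sigma> : cells S"
  let ?x = "src S (cdom S \<sigma>)" and ?y = "tgt S (cdom S \<sigma>)" and ?u = "cdom S \<sigma>" and ?v = "ccod S \<sigma>"
  note pn = arg_cong[OF p.pnat_nat[OF s], of "%s. s |> (g ?x)", simplified]
  note fn = f.p.pnat_nat[OF s, simplified]
  have s1: "(pf1 N ?v) <| i ?x \<bullet> pf2 N \<sigma> |> (pcomp p ?x \<odot> g ?x) = pf2 N \<sigma> |> (pcomp f ?x) \<bullet> (pf1 N ?u) <| i ?x"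
    using K.slide_refl[of "pf2 N \<sigma>" "i ?x"] by simp
  have s2: "i ?y |> (pf1 X ?v) \<bullet> (pcomp p ?y \<odot> g ?y) <| pf2 X \<sigma> = (pcomp f ?y) <| pf2 X \<sigma> \<bullet> i ?y |> (pf1 X ?u)"
    using K.slide_refl[of "i ?y" "pf2 X \<sigma>"] by simp
  note cv = c_eq[of ?v, simplified] and cu = c_eq[of ?u, simplified]
  have "d ?v \<bullet> pf2 L \<sigma> |> (g ?x) = (g ?y) <| pf2 X \<sigma> \<bullet> d ?u"
  proof (rule cancel[where x = ?y and w = "pf1 X ?v" and P = "pnat p ?u |> (g ?x)"])
    have "i ?y |> (pf1 X ?v) \<bullet> (pcomp p ?y) <| (d ?v \<bullet> (pf2 L \<sigma> |> (g ?x))) \<bullet> (pnat p ?u |> (g ?x))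
      = i ?y |> (pf1 X ?v) \<bullet> c ?v \<bullet> pnat p ?v |> (g ?x) \<bullet> pf2 N \<sigma> |> (pcomp p ?x \<odot> g ?x)"
      using d_simps(4)[of ?v] by (simp add: pn)
    also have "\<dots> = (pcomp f ?y) <| pf2 X \<sigma> \<bullet> pnat f ?u \<bullet> (pf1 N ?u) <| i ?x"
      by (simp add: cv[THEN K.vc32] s1 fn[THEN K.vc22])
    also have "\<dots> = i ?y |> (pf1 X ?v) \<bullet> (pcomp p ?y) <| (((g ?y) <| pf2 X \<sigma>) \<bullet> d ?u) \<bullet> pnat p ?u |> (g ?x)"
      by (simp add: s2[THEN K.vc22] cu)
    finally show "i ?y |> (pf1 X ?v) \<bullet> (pcomp p ?y) <| (d ?v \<bullet> (pf2 L \<sigma> |> (g ?x))) \<bullet> (pnat p ?u |> (g ?x))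
      = i ?y |> (pf1 X ?v) \<bullet> (pcomp p ?y) <| (((g ?y) <| pf2 X \<sigma>) \<bullet> d ?u) \<bullet> pnat p ?u |> (g ?x)" .
  qed simp_all
  then show "pnat G ?v \<bullet> pf2 (ptgt G) \<sigma> |> (pcomp G ?x) = (pcomp G ?y) <| pf2 (psrc G) \<sigma> \<bullet> pnat G ?u"
    by (simp add: G_def)
next
  fix v u assume "(v, u) : cpairs S"
  then have [simp]: "v : ars S" "u : ars S" "src S v = tgt S u" by simp_all
  let ?x = "src S u" and ?y = "tgt S u" and ?z = "tgt S v" and ?vu = "v \<odot>\<^bsub>S\<^esub> u"
  note pn = arg_cong[OF p.pnat_comp[of v u, simplified], of "%s. s |> (g ?x)", simplified]
  note fn = f.p.pnat_comp[of v u, simplified]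
  note cu = arg_cong[OF c_eq[of u], of "%s. (pf1 N v) <| s", simplified]
  note cv = arg_cong[OF c_eq[of v], of "%s. s |> (pf1 X u)", simplified]
  note cvu = c_eq[of ?vu, simplified]
  have s1: "(pf1 N ?vu) <| i ?x \<bullet> pfc N (v, u) |> (pcomp p ?x \<odot> g ?x) = pfc N (v, u) |> (pcomp f ?x) \<bullet> (pf1 N v \<odot> pf1 N u) <| i ?x"
    using K.slide_refl[of "pfc N (v, u)" "i ?x"] by simp
  have s2: "i ?z |> (pf1 X ?vu) \<bullet> (pcomp p ?z \<odot> g ?z) <| pfc X (v, u) = (pcomp f ?z) <| pfc X (v, u) \<bullet> i ?z |> (pf1 X v \<odot> pf1 X u)"
    using K.slide_refl[of "i ?z" "pfc X (v, u)"] by simp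
  have s3: "(pcomp p ?z \<odot> pf1 L v) <| d u \<bullet> pnat p v |> (pf1 L u \<odot> g ?x) = pnat p v |> (g ?y \<odot> pf1 X u) \<bullet> (pf1 N v) <| c u"
    using K.slide_refl[of "pnat p v" "d u"] d_whisker(2)[of u "pf1 N v"] by simp
  let ?P = "pnat p v |> (pf1 L u \<odot> g ?x) \<bullet> (pf1 N v) <| pnat p u |> (g ?x)"
  have "d ?vu \<bullet> pfc L (v, u) |> (g ?x) = (g ?z) <| pfc X (v, u) \<bullet> d v |> (pf1 X u) \<bullet> (pf1 L v) <| d u"
  proof (rule cancel[where x = ?z and w = "pf1 X ?vu" and P = ?P])
    have "i ?z |> (pf1 X ?vu) \<bullet> (pcomp p ?z) <| (d ?vu \<bullet> (pfc L (v, u) |> (g ?x))) \<bullet> ?P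
      = i ?z |> (pf1 X ?vu) \<bullet> c ?vu \<bullet> pnat p ?vu |> (g ?x) \<bullet> pfc N (v, u) |> (pcomp p ?x \<odot> g ?x)"
      using d_simps(4)[of ?vu] by (simp add: pn)
    also have "\<dots> = pnat f ?vu \<bullet> pfc N (v, u) |> (pcomp f ?x) \<bullet> (pf1 N v \<odot> pf1 N u) <| i ?x"
      by (simp add: cvu[THEN K.vc32] s1)
    also have "\<dots> = (pcomp f ?z) <| pfc X (v, u) \<bullet> pnat f v |> (pf1 X u) \<bullet> (pf1 N v) <| pnat f u \<bullet> (pf1 N v \<odot> pf1 N u) <| i ?x"
      by (simp add: fn[THEN K.vc23])
    also have "\<dots> = i ?z |> (pf1 X ?vu) \<bullet> (pcomp p ?z) <| (((g ?z) <| pfc X (v, u)) \<bullet> d v |> (pf1 X u) \<bullet> ((pf1 L v) <| d u)) \<bullet> ?P"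
      using d_whisker(1)[of v "pf1 X u"] by (simp add: s2[THEN K.vc22] s3[THEN K.vc22] cv[THEN K.vc32] cu)
    finally show "i ?z |> (pf1 X ?vu) \<bullet> (pcomp p ?z) <| (d ?vu \<bullet> (pfc L (v, u) |> (g ?x))) \<bullet> ?P
      = i ?z |> (pf1 X ?vu) \<bullet> (pcomp p ?z) <| (((g ?z) <| pfc X (v, u)) \<bullet> d v |> (pf1 X u) \<bullet> ((pf1 L v) <| d u)) \<bullet> ?P" .
  qed simp_all
  then show "pnat G ?vu \<bullet> pfc (ptgt G) (v, u) |> (pcomp G ?x) = ((pcomp G ?z) <| pfc (psrc G) (v, u))
        \<bullet> pnat G v |> (pf1 (psrc G) u) \<bullet> (pf1 (ptgt G) v) <| pnat G u"
    by (simp add: G_def)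
next
  fix x assume x [simp]: "x : obs S"
  let ?u = "id1 S x"
  note pn = arg_cong[OF p.pnat_unit[of x, simplified], of "%s. s |> (g x)", simplified]
  note fn = f.p.pnat_unit[of x, simplified]
  have s1: "(pf1 N ?u) <| i x \<bullet> pfi N x |> (pcomp p x \<odot> g x) = pfi N x |> (pcomp f x) \<bullet> i x"
    using K.slide_refl[of "pfi N x" "i x"] by simp
  have s2: "i x |> (pf1 X ?u) \<bullet> (pcomp p x \<odot> g x) <| pfi X x = (pcomp f x) <| pfi X x \<bullet> i x"
    using K.slide_refl[of "i x" "pfi X x"] by simp
  have "d ?u \<bullet> pfi L x |> (g x) = (g x) <| pfi X x"
  proof (rule cancel[where x = x and w = "pf1 X ?u" and P = "id2 K (pcomp p x \<odot> g x)"])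
    show "i x |> (pf1 X ?u) \<bullet> (pcomp p x) <| (d ?u \<bullet> (pfi L x |> (g x))) \<bullet> id2 K (pcomp p x \<odot> g x)
      = i x |> (pf1 X ?u) \<bullet> (pcomp p x) <| ((g x) <| pfi X x) \<bullet> id2 K (pcomp p x \<odot> g x)"
      using d_simps(4)[of ?u] c_eq[of ?u] by (simp add: pn[symmetric] K.vc32 s1 s2 fn[THEN K.vc21])
  qed simp_all
  then show "pnat G ?u \<bullet> pfi (ptgt G) x |> (pcomp G x) = (pcomp G x) <| pfi (psrc G) x"
    by (simp add: G_def)
qed (auto simp: G_def in_hom1_def in_hom2_def invertible_d p.psrc_psfun f.p.psrc_psfun)

definition I where "I = \<lparr>msrc = p \<odot>\<^bsub>PS S K\<^esub> G, mtgt = f, mcomp = restrict i (obs S)\<rparr>"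

text \<open>Naturality of the lifts \<open>i\<close> is the equation \<open>c_eq\<close> by which
  the cells \<open>c\<close> were defined.\<close>

lemma modif_I: "modification S K I"
  unfolding I_def
proof (rule modifI)
  show "pseudonatural S K (p \<odot>\<^bsub>PS S K\<^esub> G)"
    using psnat_comp1[OF p.pseudonatural_axioms psnat_G] by (simp add: G_def)
  fix u assume [simp]: "u : ars S"
  show "pnat f u \<bullet> ((pf1 (ptgt (p \<odot>\<^bsub>PS S K\<^esub> G)) u) <| i (src S u))
      = i (tgt S u) |> (pf1 (psrc (p \<odot>\<^bsub>PS S K\<^esub> G)) u) \<bullet> pnat (p \<odot>\<^bsub>PS S K\<^esub> G) u"
    using c_eq[of u] by (simp add: G_def)
qed (auto simp: G_def f.p.pseudonatural_axioms S.two_category_axioms)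

end

context two_categories
begin

text \<open>The pointwise inverses satisfy the modification axiom because they may be moved to the
  other side of it.\<close>

lemma invertible_modif:
  assumes "modification S K \<Gamma>" and inv: "!!x. x : obs S ==> invertible2 K (mcomp \<Gamma> x)"
  shows "invertible2 (PS S K) \<Gamma>"
proof -
  interpret \<Gamma>: modification S K \<Gamma> by fact
  note [simp] = inv
  let ?\<Delta> = "\<lparr>msrc = mtgt \<Gamma>, mtgt = msrc \<Gamma>, mcomp = restrict (%x. inv2 K (mcomp \<Gamma> x)) (obs S)\<rparr>"
  have m: "modification S K ?\<Delta>"
  proof (rule modifI)
    fix u assume u [simp]: "u : ars S"
    let ?x = "src S u" and ?y = "tgt S u"
    note e = \<Gamma>.mcomp_nat[OF u]
    show "pnat (msrc \<Gamma>) u \<bullet> ((pf1 (ptgt (mtgt \<Gamma>)) u) <| inv2 K (mcomp \<Gamma> ?x))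
       = inv2 K (mcomp \<Gamma> ?y) |> (pf1 (psrc (mtgt \<Gamma>)) u) \<bullet> pnat (mtgt \<Gamma>) u"
    proof (rule K.vcomp_cancel_left[of "mcomp \<Gamma> ?y |> (pf1 (psrc (msrc \<Gamma>)) u)"])
      show "mcomp \<Gamma> ?y |> (pf1 (psrc (msrc \<Gamma>)) u) \<bullet> pnat (msrc \<Gamma>) u \<bullet> ((pf1 (ptgt (mtgt \<Gamma>)) u) <| inv2 K (mcomp \<Gamma> ?x))
        = mcomp \<Gamma> ?y |> (pf1 (psrc (msrc \<Gamma>)) u) \<bullet> inv2 K (mcomp \<Gamma> ?y) |> (pf1 (psrc (mtgt \<Gamma>)) u) \<bullet> pnat (mtgt \<Gamma>) u"
        by (simp add: e[symmetric, THEN K.vc22])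
    qed simp_all
  qed (auto simp: \<Gamma>.msrc_psnat \<Gamma>.mtgt_psnat S.two_category_axioms)
  have "?\<Delta> \<bullet>\<^bsub>PS S K\<^esub> \<Gamma> = id2 (PS S K) (msrc \<Gamma>)"
    by (rule modif_eqI[of S K]) (use m in \<open>simp_all add: modif_vcomp modif_id2 \<Gamma>.msrc_psnat \<Gamma>.modification_axioms\<close>)
  moreover have "\<Gamma> \<bullet>\<^bsub>PS S K\<^esub> ?\<Delta> = id2 (PS S K) (mtgt \<Gamma>)"
    by (rule modif_eqI[of S K]) (use m in \<open>simp_all add: modif_vcomp modif_id2 \<Gamma>.mtgt_psnat \<Gamma>.modification_axioms\<close>)
  ultimately show ?thesis
    unfolding PS.invertible2_iff PS.iso2_def using m \<Gamma>.modification_axioms by (intro exI[of _ ?\<Delta>]) simp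
qed

lemma invertible_at:
  assumes "invertible2 (PS S K) \<Gamma>" "x : obs S"
  shows "invertible2 K (mcomp \<Gamma> x)"
proof -
  obtain \<Delta> where d: "PS.iso2 \<Gamma> \<Delta>" using assms(1) unfolding PS.invertible2_iff by blast
  interpret \<Gamma>: modification S K \<Gamma> using d by (simp add: PS.iso2_def)
  interpret \<Delta>: modification S K \<Delta> using d by (simp add: PS.iso2_def)
  have [simp]: "msrc \<Delta> = mtgt \<Gamma>" "mtgt \<Delta> = msrc \<Gamma>" and 1: "\<Delta> \<bullet>\<^bsub>PS S K\<^esub> \<Gamma> = id2 (PS S K) (msrc \<Gamma>)" "\<Gamma> \<bullet>\<^bsub>PS S K\<^esub> \<Delta> = id2 (PS S K) (mtgt \<Gamma>)"
    using d by (simp_all add: PS.iso2_def)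
  have "K.iso2 (mcomp \<Gamma> x) (mcomp \<Delta> x)"
    using 1[THEN arg_cong, of "%m. mcomp m x"] assms(2) by (simp add: K.iso2_def)
  then show ?thesis unfolding K.invertible2_iff by blast
qed

end

context PS_em
begin

text \<open>Pointwise essential surjectivity only gives unrelated choices of \<open>g\<close> and
  \<open>i\<close>; \<open>PS_em_lift\<close> makes them coherent.\<close>

lemma PS_ess: "alg_ess1 (PS S K) T \<eta> \<mu> p h"
proof (rule PS.alg_ess1I[OF PS_monad])
  fix f k assume a: "alg2 (PS S K) T \<eta> \<mu> f k"
  interpret f: PS_alg S K N T \<eta> \<mu> f k using a by unfold_locales
  have "EX g s. g : ars K & src K g = pf0 (psrc f) x & tgt K g = pf0 (psrc p) x &
      s : cells K & cdom K s = pcomp p x \<odot> g & ccod K s = pcomp f x & invertible2 K s &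
      s \<bullet> (mcomp h x |> g) = mcomp k x \<bullet> (pcomp T x) <| s" if [simp]: "x : obs S" for x
    using K.alg_ess1D[OF monad_at _ em_ess alg_at[OF a], of x] by simp
  then obtain g i where
    "!!x. x : obs S ==> g x : ars K & src K (g x) = pf0 (psrc f) x & tgt K (g x) = pf0 (psrc p) x"
    "!!x. x : obs S ==> cdom K (i x) = pcomp p x \<odot> g x & ccod K (i x) = pcomp f x & invertible2 K (i x)"
    "!!x. x : obs S ==> i x \<bullet> (mcomp h x |> (g x)) = mcomp k x \<bullet> (pcomp T x) <| i x"
    by metis
  then interpret l: PS_em_lift S K N T \<eta> \<mu> p h f k g i by unfold_locales blast+
  have [simp]: "pseudonatural S K l.G" "modification S K l.I" using l.psnat_G l.modif_I by auto
  have [simp]: "psrc l.G = psrc f" "ptgt l.G = psrc p" by (simp_all add: l.G_def)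
  have [simp]: "msrc l.I = p \<odot>\<^bsub>PS S K\<^esub> l.G" "mtgt l.I = f" by (simp_all add: l.I_def)
  have inv: "invertible2 (PS S K) l.I"
    by (rule invertible_modif) (simp_all add: l.I_def[THEN arg_cong, of mcomp])
  have "l.I \<bullet>\<^bsub>PS S K\<^esub> (h |>\<^bsub>PS S K\<^esub> l.G) = k \<bullet>\<^bsub>PS S K\<^esub> T <|\<^bsub>PS S K\<^esub> l.I"
  proof (rule modif_eqI[of S K])
    fix x assume "x : obs S"
    then show "mcomp (l.I \<bullet>\<^bsub>PS S K\<^esub> (h |>\<^bsub>PS S K\<^esub> l.G)) x = mcomp (k \<bullet>\<^bsub>PS S K\<^esub> (T <|\<^bsub>PS S K\<^esub> l.I)) x"
      using l.i_alg[of x] by (simp add: l.I_def[THEN arg_cong, of mcomp] l.G_def[THEN arg_cong, of pcomp])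
  qed (auto simp: PS.comp1_assoc T.pseudonatural_axioms p.pseudonatural_axioms
      intro!: modif_vcomp modif_hcomp modif_id2 h.modification_axioms f.h.modification_axioms)
  with inv show "EX g s. g : ars (PS S K) & src (PS S K) g = src (PS S K) f & tgt (PS S K) g = src (PS S K) p &
      s : cells (PS S K) & cdom (PS S K) s = p \<odot>\<^bsub>PS S K\<^esub> g & ccod (PS S K) s = f & invertible2 (PS S K) s &
      s \<bullet>\<^bsub>PS S K\<^esub> (h |>\<^bsub>PS S K\<^esub> g) = k \<bullet>\<^bsub>PS S K\<^esub> T <|\<^bsub>PS S K\<^esub> s"
    by (intro exI[of _ l.G] exI[of _ l.I]) simp
qed (auto simp: p.pseudonatural_axioms)

lemma PS_em: "em (PS S K) T \<eta> \<mu> p h"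
  unfolding em_def using alg PS_faith PS_full PS_ess by blast

end

text \<open>The pointwise Eilenberg-Moore objects form a pseudofunctor: an arrow \<open>u\<close> of \<open>S\<close> acts through the
  strong monad morphism \<open>(N u, T u)\<close>. All coherence cells are lifts of those of \<open>N\<close>, and lifts are unique.\<close>

locale PS_em_objects = PS_monad S K N T \<eta> \<mu>
  for S :: "('o, 'm, 'c) tcat" and K :: "('p, 'n, 'd) tcat" (structure) and N T \<eta> \<mu> +
  fixes p h
  assumes em: "x : obs S ==> em K (pcomp T x) (mcomp \<eta> x) (mcomp \<mu> x) (p x) (h x)"
begin

definition E where "E x = src K (p x)"

lemma alg: "x : obs S ==> alg2 K (pcomp T x) (mcomp \<eta> x) (mcomp \<mu> x) (p x) (h x)"
  and em_faith: "x : obs S ==> faith1 K (p x)"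
  and em_full: "x : obs S ==> alg_full1 K (pcomp T x) (p x) (h x)"
  and em_ess: "x : obs S ==> alg_ess1 K (pcomp T x) (mcomp \<eta> x) (mcomp \<mu> x) (p x) (h x)"
  using em by (auto simp: em_def)

lemma ph [simp]:
  assumes "x : obs S"
  shows "p x : ars K" "src K (p x) = E x" "tgt K (p x) = pf0 N x" "h x : cells K"
    "cdom K (h x) = pcomp T x \<odot> p x" "ccod K (h x) = p x" "E x : obs K"
  using alg2D[OF alg[OF assms]] assms by (simp_all add: E_def)

text \<open>A 1-cell \<open>a\<close> between the sources of two universal algebras that lies over
  \<open>G\<close>, by way of the invertible cell \<open>P\<close>. The last equation says that
  \<open>P\<close> respects the actions when \<open>\<tau>\<close> is used to move the monad past
  \<open>G\<close>.\<close>

definition tr where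
  "tr x y G \<tau> a P \<longleftrightarrow> x : obs S & y : obs S & in_hom1 K G (pf0 N x) (pf0 N y) &
     in_hom2 K \<tau> (G \<odot> pcomp T x) (pcomp T y \<odot> G) & invertible2 K \<tau> & in_hom1 K a (E x) (E y) &
     in_hom2 K P (G \<odot> p x) (p y \<odot> a) & invertible2 K P &
     P \<bullet> G <| h x = h y |> a \<bullet> (pcomp T y) <| P \<bullet> \<tau> |> (p x)"

lemma trD:
  assumes "tr x y G t a P"
  shows "x : obs S" "y : obs S" "G : ars K" "src K G = pf0 N x" "tgt K G = pf0 N y"
    "t : cells K" "cdom K t = G \<odot> pcomp T x" "ccod K t = pcomp T y \<odot> G" "invertible2 K t"
    "a : ars K" "src K a = E x" "tgt K a = E y"
    "P : cells K" "cdom K P = G \<odot> p x" "ccod K P = p y \<odot> a" "invertible2 K P"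
    "P \<bullet> G <| h x = h y |> a \<bullet> (pcomp T y) <| P \<bullet> t |> (p x)"
  using assms by (simp_all add: tr_def in_hom1_def in_hom2_def)

text \<open>\<open>P\<close> is invertible and \<open>p y\<close> is faithful, so a cell out of
  \<open>a\<close> is determined by what it does underneath.\<close>

lemma lift_unique:
  assumes "tr x y G t a P" and r: "r : cells K" "r' : cells K" "cdom K r = a" "cdom K r' = a" "ccod K r = ccod K r'"
    and eq: "(p y) <| r \<bullet> P = (p y) <| r' \<bullet> P"
  shows "r = r'"
proof -
  note [simp] = trD(1-16)[OF assms(1)] r
  from eq have "(p y) <| r = (p y) <| r'" by (rule K.vcomp_cancel_right[rotated]) simp_all
  then show ?thesis by (rule K.faith1D[OF em_faith, rotated]) simp_all
qed

text \<open>If \<open>\<nu>\<close> commutes with \<open>\<tau>\<close> and \<open>\<tau>'\<close>,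
  its conjugate by \<open>P\<close> and \<open>P'\<close> is an algebra map, and \<open>p y\<close>
  is full on such maps.\<close>

lemma lift_exists:
  assumes t: "tr x y G \<tau> a P" and t': "tr x y G' \<tau>' a' P'"
    and n: "\<nu> : cells K" "cdom K \<nu> = G" "ccod K \<nu> = G'"
    and c: "\<tau>' \<bullet> \<nu> |> (pcomp T x) = (pcomp T y) <| \<nu> \<bullet> \<tau>"
  shows "EX r. r : cells K & cdom K r = a & ccod K r = a' & ((p y) <| r) \<bullet> P = P' \<bullet> \<nu> |> (p x)"
proof -
  note [simp] = trD(1-16)[OF t] trD(1-16)[OF t'] n
  note e = trD(17)[OF t] and e' = trD(17)[OF t']
  let ?t = "P' \<bullet> \<nu> |> (p x) \<bullet> inv2 K P"
  let ?Q = "(pcomp T y) <| P \<bullet> \<tau> |> (p x)"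
  have sl: "\<nu> |> (p x) \<bullet> G <| h x = G' <| h x \<bullet> \<nu> |> (pcomp T x \<odot> p x)"
    using K.slide_refl[of \<nu> "h x"] by simp
  note c' = arg_cong[OF c, of "%s. s |> (p x)", simplified]
  have "(?t \<bullet> (h y |> a)) \<bullet> ?Q = P' \<bullet> \<nu> |> (p x) \<bullet> G <| h x"
    by (simp add: e[symmetric])
  also have "\<dots> = h y |> a' \<bullet> (pcomp T y) <| P' \<bullet> \<tau>' |> (p x) \<bullet> \<nu> |> (pcomp T x \<odot> p x)"
    by (simp add: sl e'[THEN K.vc23])
  also have "\<dots> = ((h y |> a') \<bullet> ((pcomp T y) <| ?t)) \<bullet> ?Q"
    by (simp add: c')
  finally have "?t \<bullet> h y |> a = h y |> a' \<bullet> (pcomp T y) <| ?t"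
    by (rule K.vcomp_cancel_right[rotated]) simp_all
  then have "EX r. r : cells K & cdom K r = a & ccod K r = a' & (p y) <| r = ?t"
    by (intro K.alg_full1D[OF em_full]) simp_all
  then obtain r where r: "r : cells K" "cdom K r = a" "ccod K r = a'" "(p y) <| r = ?t" by blast
  then have "(p y) <| r \<bullet> P = P' \<bullet> \<nu> |> (p x)" by simp
  with r show ?thesis by blast
qed

text \<open>The inverse of \<open>\<nu>\<close> is compatible with the same data in the other
  direction, so it has a lift; uniqueness makes the lifts inverse to each other.\<close>

lemma lift_invertible:
  assumes t: "tr x y G \<tau> a P" and t': "tr x y G' \<tau>' a' P'"
    and n: "\<nu> : cells K" "cdom K \<nu> = G" "ccod K \<nu> = G'" "invertible2 K \<nu>"
    and c: "\<tau>' \<bullet> \<nu> |> (pcomp T x) = (pcomp T y) <| \<nu> \<bullet> \<tau>"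
    and r: "r : cells K" "cdom K r = a" "ccod K r = a'" "(p y) <| r \<bullet> P = P' \<bullet> \<nu> |> (p x)"
  shows "invertible2 K r"
proof -
  note [simp] = trD(1-16)[OF t] trD(1-16)[OF t'] n r(1-3)
  have "(\<tau> \<bullet> (inv2 K \<nu> |> (pcomp T x))) \<bullet> \<nu> |> (pcomp T x) = (((pcomp T y) <| inv2 K \<nu>) \<bullet> \<tau>') \<bullet> \<nu> |> (pcomp T x)"
    by (simp add: c)
  then have "\<tau> \<bullet> inv2 K \<nu> |> (pcomp T x) = (pcomp T y) <| inv2 K \<nu> \<bullet> \<tau>'"
    by (rule K.vcomp_cancel_right[rotated]) simp_all
  then obtain s where s [simp]: "s : cells K" "cdom K s = a'" "ccod K s = a"
    and s2: "(p y) <| s \<bullet> P' = P \<bullet> inv2 K \<nu> |> (p x)"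
    using lift_exists[OF t' t, of "inv2 K \<nu>"] by auto
  have "s \<bullet> r = id2 K a" by (rule lift_unique[OF t]) (simp_all add: r s2[THEN K.vc22])
  moreover have "r \<bullet> s = id2 K a'" by (rule lift_unique[OF t']) (simp_all add: s2 r(4)[THEN K.vc22])
  ultimately show ?thesis unfolding K.invertible2_iff K.iso2_def by (intro exI[of _ s]) simp
qed

lemma tr_id: "x : obs S ==> tr x x (id1 K (pf0 N x)) (id2 K (pcomp T x)) (id1 K (E x)) (id2 K (p x))"
  by (simp add: tr_def in_hom1_def in_hom2_def)

lemma tr_comp:
  assumes t: "tr x y G \<tau> a P" and t': "tr y z G' \<tau>' a' P'"
  shows "tr x z (G' \<odot> G) ((\<tau>' |> G) \<bullet> (G' <| \<tau>)) (a' \<odot> a) ((P' |> a) \<bullet> (G' <| P))"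
proof -
  note [simp] = trD(1-16)[OF t] trD(1-16)[OF t']
  note e = arg_cong[OF trD(17)[OF t], of "%s. G' <| s", simplified]
  note e' = arg_cong[OF trD(17)[OF t'], of "%s. s |> a", simplified]
  have sl: "\<tau>' |> (p y \<odot> a) \<bullet> (G' \<odot> pcomp T y) <| P = (pcomp T z \<odot> G') <| P \<bullet> \<tau>' |> (G \<odot> p x)"
    using K.slide_refl[of \<tau>' P] by simp
  show ?thesis
    by (simp add: tr_def in_hom1_def in_hom2_def e e'[THEN K.vc23] sl[THEN K.vc22])
qed

text \<open>The composite of \<open>N u\<close> with the universal algebra at the source of
  \<open>u\<close> is an algebra at its target, and factors through the universal algebra
  there.\<close>

lemma ex_arrow:
  assumes u [simp]: "u : ars S"
  shows "EX a P. tr (src S u) (tgt S u) (pf1 N u) (pnat T u) a P"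
proof -
  let ?x = "src S u" and ?y = "tgt S u"
  let ?Ti = "inv2 K (pnat T u)"
  \<comment> \<open>The action is moved past \<open>N u\<close> by the inverse of the naturality
    cell of \<open>T\<close>.\<close>
  let ?k = "(pf1 N u) <| h ?x \<bullet> ?Ti |> (p ?x)"
  note a1 = alg2D(6)[OF alg[of ?x], simplified] and a2 = alg2D(7)[OF alg[of ?x], simplified]
  \<comment> \<open>The algebra laws for \<open>?k\<close> rest on \<open>\<eta>\<close> and
    \<open>\<mu>\<close> being modifications; \<open>e1\<close> and \<open>e2\<close> are their
    axioms solved for the inverse cell.\<close>
  have e1: "?Ti \<bullet> mcomp \<eta> ?y |> (pf1 N u) = (pf1 N u) <| mcomp \<eta> ?x"
    by (rule K.vcomp_cancel_left[of "pnat T u"]) (use \<eta>.mcomp_nat[OF u] in simp_all)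
  have e2: "?Ti \<bullet> (mcomp \<mu> ?y |> (pf1 N u))
      = (pf1 N u) <| mcomp \<mu> ?x \<bullet> ?Ti |> (pcomp T ?x) \<bullet> (pcomp T ?y) <| ?Ti"
  proof (rule K.vcomp_cancel_right[of "(pcomp T ?y) <| pnat T u \<bullet> pnat T u |> (pcomp T ?x)"])
    show "(?Ti \<bullet> (mcomp \<mu> ?y |> (pf1 N u))) \<bullet> (pcomp T ?y) <| pnat T u \<bullet> (pnat T u |> (pcomp T ?x)) =
     (((pf1 N u) <| mcomp \<mu> ?x) \<bullet> ?Ti |> (pcomp T ?x) \<bullet> ((pcomp T ?y) <| ?Ti)) \<bullet>
      ((pcomp T ?y) <| pnat T u) \<bullet> pnat T u |> (pcomp T ?x)"
      using \<mu>.mcomp_nat[OF u, symmetric] by simp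
  qed simp_all
  have sl: "?Ti |> (p ?x) \<bullet> (pcomp T ?y \<odot> pf1 N u) <| h ?x = (pf1 N u \<odot> pcomp T ?x) <| h ?x \<bullet> ?Ti |> (pcomp T ?x \<odot> p ?x)"
    using K.slide_refl[of ?Ti "h ?x"] by simp
  note e1' = arg_cong[OF e1, of "%s. s |> (p ?x)", simplified]
  note e2' = arg_cong[OF e2, of "%s. s |> (p ?x)", simplified]
  note a1' = arg_cong[OF a1, of "%s. (pf1 N u) <| s", simplified]
  note a2' = arg_cong[OF a2, of "%s. (pf1 N u) <| s", simplified]
  have k: "alg2 K (pcomp T ?y) (mcomp \<eta> ?y) (mcomp \<mu> ?y) (pf1 N u \<odot> p ?x) ?k"
    by (simp add: alg2_def in_hom1_def in_hom2_def e1' e2' a1' sl[THEN K.vc22] a2'[THEN K.vc22])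
  obtain a s where [simp]: "a : ars K" "src K a = E ?x" "tgt K a = E ?y" "s : cells K" "cdom K s = p ?y \<odot> a"
    "ccod K s = pf1 N u \<odot> p ?x" "invertible2 K s" and s: "s \<bullet> (h ?y |> a) = ?k \<bullet> (pcomp T ?y) <| s"
    using K.alg_ess1D[OF monad_at[of ?y] _ em_ess[of ?y] k] by auto
  have [simp]: "inv2 K ((pcomp T ?y) <| s) = (pcomp T ?y) <| inv2 K s"
    by (rule K.inv2_eq, rule K.iso2_lwhisker) (simp_all add: K.iso2_inv2)
  have "inv2 K s \<bullet> (pf1 N u) <| h ?x = h ?y |> a \<bullet> (pcomp T ?y) <| inv2 K s \<bullet> pnat T u |> (p ?x)"
  proof (rule K.vcomp_cancel_left[of s])
    show "s \<bullet> inv2 K s \<bullet> ((pf1 N u) <| h ?x) = s \<bullet> h ?y |> a \<bullet> (pcomp T ?y) <| inv2 K s \<bullet> pnat T u |> (p ?x)"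
      by (simp add: s[THEN K.vc22])
  qed simp_all
  then have "tr ?x ?y (pf1 N u) (pnat T u) a (inv2 K s)" by (simp add: tr_def in_hom1_def in_hom2_def)
  then show ?thesis by blast
qed

definition act where "act u = (SOME aP. tr (src S u) (tgt S u) (pf1 N u) (pnat T u) (fst aP) (snd aP))"
definition e where "e u = fst (act u)"
definition P where "P u = snd (act u)"

lemma tr_arrow: "u : ars S ==> tr (src S u) (tgt S u) (pf1 N u) (pnat T u) (e u) (P u)"
  unfolding e_def P_def act_def by (rule someI_ex) (use ex_arrow[of u] in auto)

lemmas eP [simp] = trD(10-16)[OF tr_arrow]

lemma tr_arrow2:
  assumes "v : ars S" "u : ars S" "src S v = tgt S u"
  shows "tr (src S u) (tgt S v) (pf1 N v \<odot> pf1 N u) ((pnat T v |> (pf1 N u)) \<bullet> ((pf1 N v) <| pnat T u))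
     (e v \<odot> e u) ((P v |> (e u)) \<bullet> ((pf1 N v) <| P u))"
  using tr_comp[OF tr_arrow[OF assms(2)], of "tgt S v" "pf1 N v" "pnat T v" "e v" "P v"] tr_arrow[OF assms(1)] assms(3) by simp

definition lift where "lift y a a' Q Q' s = (SOME r. r : cells K & cdom K r = a & ccod K r = a' & ((p y) <| r) \<bullet> Q = Q' \<bullet> s)"

definition e2 where "e2 \<sigma> = lift (tgt S (cdom S \<sigma>)) (e (cdom S \<sigma>)) (e (ccod S \<sigma>)) (P (cdom S \<sigma>)) (P (ccod S \<sigma>))
  (pf2 N \<sigma> |> (p (src S (cdom S \<sigma>))))"

definition ec where "ec v u = lift (tgt S v) (e v \<odot> e u) (e (v \<odot>\<^bsub>S\<^esub> u)) ((P v |> (e u)) \<bullet> ((pf1 N v) <| P u)) (P (v \<odot>\<^bsub>S\<^esub> u))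
  (pfc N (v, u) |> (p (src S u)))"

definition ei where "ei x = lift x (id1 K (E x)) (e (id1 S x)) (id2 K (p x)) (P (id1 S x)) (pfi N x |> (p x))"

lemma liftI:
  assumes "tr x y G t a Q" "tr x y G' t' a' Q'" "\<nu> : cells K" "cdom K \<nu> = G" "ccod K \<nu> = G'"
    "t' \<bullet> \<nu> |> (pcomp T x) = (pcomp T y) <| \<nu> \<bullet> t"
  shows "lift y a a' Q Q' (\<nu> |> (p x)) : cells K" "cdom K (lift y a a' Q Q' (\<nu> |> (p x))) = a"
    "ccod K (lift y a a' Q Q' (\<nu> |> (p x))) = a'"
    "(p y) <| lift y a a' Q Q' (\<nu> |> (p x)) \<bullet> Q = Q' \<bullet> \<nu> |> (p x)"
  using someI_ex[OF lift_exists[OF assms]] unfolding lift_def by blast+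

lemma e2_props:
  assumes "s : cells S"
  shows "e2 s : cells K" "cdom K (e2 s) = e (cdom S s)" "ccod K (e2 s) = e (ccod S s)"
    and e2_eq: "(p (tgt S (cdom S s))) <| e2 s \<bullet> P (cdom S s) = P (ccod S s) \<bullet> pf2 N s |> (p (src S (cdom S s)))"
  unfolding e2_def using T.pnat_nat[OF assms] tr_arrow[of "ccod S s"] assms
  by (auto intro!: liftI[OF tr_arrow, simplified])

lemmas e2 [simp] = e2_props(1-3)

lemma ec_props:
  assumes "v : ars S" "u : ars S" "src S v = tgt S u"
  shows "ec v u : cells K" "cdom K (ec v u) = e v \<odot> e u" "ccod K (ec v u) = e (v \<odot>\<^bsub>S\<^esub> u)" "invertible2 K (ec v u)"
    and ec_eq: "(p (tgt S v)) <| ec v u \<bullet> P v |> (e u) \<bullet> ((pf1 N v) <| P u) = P (v \<odot>\<^bsub>S\<^esub> u) \<bullet> pfc N (v, u) |> (p (src S u))"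
proof -
  note [simp] = assms
  have t: "tr (src S u) (tgt S v) (pf1 N (v \<odot>\<^bsub>S\<^esub> u)) (pnat T (v \<odot>\<^bsub>S\<^esub> u)) (e (v \<odot>\<^bsub>S\<^esub> u)) (P (v \<odot>\<^bsub>S\<^esub> u))"
    using tr_arrow[of "v \<odot>\<^bsub>S\<^esub> u"] by simp
  have c: "pnat T (v \<odot>\<^bsub>S\<^esub> u) \<bullet> (pfc N (v, u) |> (pcomp T (src S u))) =
    ((pcomp T (tgt S v)) <| pfc N (v, u)) \<bullet> pnat T v |> (pf1 N u) \<bullet> (pf1 N v) <| pnat T u"
    using T.pnat_comp[of v u] by simp
  note l = liftI[OF tr_arrow2[OF assms] t _ _ _ c, folded ec_def, simplified]
  show "ec v u : cells K" "cdom K (ec v u) = e v \<odot> e u" "ccod K (ec v u) = e (v \<odot>\<^bsub>S\<^esub> u)"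
    "(p (tgt S v)) <| ec v u \<bullet> P v |> (e u) \<bullet> ((pf1 N v) <| P u) = P (v \<odot>\<^bsub>S\<^esub> u) \<bullet> pfc N (v, u) |> (p (src S u))"
    by (fact l)+
  show "invertible2 K (ec v u)"
    by (rule lift_invertible[OF tr_arrow2[OF assms] t _ _ _ _ c]) (simp_all add: l)
qed

lemmas ec [simp] = ec_props(1-4)

lemma ei_props:
  assumes "x : obs S"
  shows "ei x : cells K" "cdom K (ei x) = id1 K (E x)" "ccod K (ei x) = e (id1 S x)" "invertible2 K (ei x)"
    and ei_eq: "(p x) <| ei x = P (id1 S x) \<bullet> pfi N x |> (p x)"
proof -
  note [simp] = assms
  have t: "tr x x (pf1 N (id1 S x)) (pnat T (id1 S x)) (e (id1 S x)) (P (id1 S x))"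
    using tr_arrow[of "id1 S x"] by simp
  have c: "pnat T (id1 S x) \<bullet> pfi N x |> (pcomp T x) = (pcomp T x) <| pfi N x \<bullet> id2 K (pcomp T x)"
    using T.pnat_unit[of x] by simp
  note l = liftI[OF tr_id t _ _ _ c, folded ei_def, simplified]
  show "ei x : cells K" "cdom K (ei x) = id1 K (E x)" "ccod K (ei x) = e (id1 S x)"
    by (fact l)+
  then show "(p x) <| ei x = P (id1 S x) \<bullet> pfi N x |> (p x)"
    using l(4) by simp
  show "invertible2 K (ei x)"
    by (rule lift_invertible[OF tr_id t _ _ _ _ c]) (use l in simp_all)
qed

lemmas ei [simp] = ei_props(1-4)

definition EM where "EM = \<lparr>pf0 = restrict E (obs S), pf1 = restrict e (ars S), pf2 = restrict e2 (cells S),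
  pfc = (\<lambda>(v, u) \<in> cpairs S. ec v u), pfi = restrict ei (obs S)\<rparr>"

lemma psfun_EM: "pseudofunctor S K EM"
proof -
  have id: "e2 (id2 S f) = id2 K (e f)" if [simp]: "f : ars S" for f
    by (rule lift_unique[OF tr_arrow[of f]]) (use e2_eq[of "id2 S f"] in simp_all)
  have vc: "e2 (\<tau> \<bullet>\<^bsub>S\<^esub> \<sigma>) = e2 \<tau> \<bullet> e2 \<sigma>" if [simp]: "\<tau> : cells S" "\<sigma> : cells S" "cdom S \<tau> = ccod S \<sigma>" for \<tau> \<sigma>
    by (rule lift_unique[OF tr_arrow[of "cdom S \<sigma>"]])
      (use e2_eq[of "\<tau> \<bullet>\<^bsub>S\<^esub> \<sigma>"] e2_eq[of \<sigma>] e2_eq[of \<tau>, simplified, THEN K.vc22] in \<open>simp_all add: N.pf2_vcomp\<close>)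
  have nat: "e2 (\<tau> \<star>\<^bsub>S\<^esub> \<sigma>) \<bullet> ec (cdom S \<tau>) (cdom S \<sigma>) = ec (ccod S \<tau>) (ccod S \<sigma>) \<bullet> (e2 \<tau> \<star> e2 \<sigma>)"
    if [simp]: "\<tau> : cells S" "\<sigma> : cells S" "src S (cdom S \<tau>) = tgt S (cdom S \<sigma>)" for \<tau> \<sigma>
  proof -
    let ?v = "cdom S \<tau>" and ?v' = "ccod S \<tau>" and ?u = "cdom S \<sigma>" and ?u' = "ccod S \<sigma>"
    let ?x = "src S ?u" and ?y = "tgt S ?u" and ?z = "tgt S ?v"
    have s1: "(p ?z \<odot> e ?v) <| e2 \<sigma> \<bullet> P ?v |> (e ?u) = P ?v |> (e ?u') \<bullet> (pf1 N ?v \<odot> p ?y) <| e2 \<sigma>"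
      using K.slide_refl[of "P ?v" "e2 \<sigma>"] by simp
    have s2: "pf2 N \<tau> |> (p ?y \<odot> e ?u') \<bullet> (pf1 N ?v) <| P ?u' = (pf1 N ?v') <| P ?u' \<bullet> pf2 N \<tau> |> (pf1 N ?u' \<odot> p ?x)"
      using K.slide_refl[of "pf2 N \<tau>" "P ?u'"] by simp
    have s3: "pf2 N \<tau> |> (pf1 N ?u' \<odot> p ?x) \<bullet> ((pf1 N ?v) <| pf2 N \<sigma> |> (p ?x)) = pf2 N \<tau> \<star> pf2 N \<sigma> |> (p ?x)"
      using K.hcomp_eq(1)[of "pf2 N \<tau>" "pf2 N \<sigma> |> (p ?x)"] by simp
    note e1 = arg_cong[OF e2_eq[of \<sigma>], of "%s. (pf1 N ?v) <| s", simplified]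
    note e3 = arg_cong[OF e2_eq[of \<tau>], of "%s. s |> (e ?u')", simplified]
    note n = arg_cong[OF N.pfc_nat[of \<tau> \<sigma>], of "%s. s |> (p ?x)", simplified]
    note c = ec_eq[of ?v ?u, simplified] and c' = ec_eq[of ?v' ?u', simplified] and ets = e2_eq[of "\<tau> \<star>\<^bsub>S\<^esub> \<sigma>", simplified]
    show ?thesis
    proof (rule lift_unique[OF tr_arrow2[of ?v ?u]])
      show "(p (tgt S ?v)) <| (e2 (\<tau> \<star>\<^bsub>S\<^esub> \<sigma>) \<bullet> ec ?v ?u) \<bullet> P ?v |> (e ?u) \<bullet> ((pf1 N ?v) <| P ?u)
        = (p (tgt S ?v)) <| (ec ?v' ?u' \<bullet> (e2 \<tau> \<star> e2 \<sigma>)) \<bullet> P ?v |> (e ?u) \<bullet> (pf1 N ?v) <| P ?u"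
        unfolding K.hcomp_eq(1)[of "e2 \<tau>" "e2 \<sigma>", simplified]
        by (simp add: c ets[THEN K.vc22] s1[THEN K.vc22] e1 e3[THEN K.vc22] s2[THEN K.vc22] c'[THEN K.vc32] n s3)
    qed simp_all
  qed
  have assoc: "ec w (v \<odot>\<^bsub>S\<^esub> u) \<bullet> ((e w) <| ec v u) = ec (w \<odot>\<^bsub>S\<^esub> v) u \<bullet> ec w v |> (e u)"
    if [simp]: "w : ars S" "v : ars S" "u : ars S" "src S w = tgt S v" "src S v = tgt S u" for w v u
  proof -
    let ?x = "src S u" and ?y = "tgt S u" and ?z = "tgt S v" and ?t = "tgt S w"
    have s1: "(p ?t \<odot> e w) <| ec v u \<bullet> P w |> (e v \<odot> e u) = P w |> (e (v \<odot>\<^bsub>S\<^esub> u)) \<bullet> (pf1 N w \<odot> p ?z) <| ec v u"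
      using K.slide_refl[of "P w" "ec v u"] by simp
    have s2: "pfc N (w, v) |> (p ?y \<odot> e u) \<bullet> (pf1 N w \<odot> pf1 N v) <| P u = (pf1 N (w \<odot>\<^bsub>S\<^esub> v)) <| P u \<bullet> pfc N (w, v) |> (pf1 N u \<odot> p ?x)"
      using K.slide_refl[of "pfc N (w, v)" "P u"] by simp
    note c1 = arg_cong[OF ec_eq[of v u], of "%s. (pf1 N w) <| s", simplified]
    note c2 = ec_eq[of w "v \<odot>\<^bsub>S\<^esub> u", simplified]
    note c3 = arg_cong[OF ec_eq[of w v], of "%s. s |> (e u)", simplified]
    note c4 = ec_eq[of "w \<odot>\<^bsub>S\<^esub> v" u, simplified]
    note n = arg_cong[OF N.pfc_assoc[of w v u], of "%s. s |> (p ?x)", simplified]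
    let ?Q = "P w |> (e v \<odot> e u) \<bullet> (pf1 N w) <| P v |> (e u) \<bullet> (pf1 N w \<odot> pf1 N v) <| P u"
    \<comment> \<open>The domain of both sides of the associativity law is the transport along three
      arrows, so uniqueness of lifts is invoked for this triple composite.\<close>
    have t: "tr ?x ?t (pf1 N w \<odot> pf1 N v \<odot> pf1 N u) ((pnat T w |> (pf1 N v \<odot> pf1 N u)) \<bullet>
        ((pf1 N w) <| ((pnat T v |> (pf1 N u)) \<bullet> ((pf1 N v) <| pnat T u)))) (e w \<odot> e v \<odot> e u) ?Q"
      using tr_comp[OF tr_arrow2[of v u] tr_arrow[of w, simplified]] by simp
    have "(p ?t) <| (ec w (v \<odot>\<^bsub>S\<^esub> u) \<bullet> ((e w) <| ec v u)) \<bullet> ?Q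
        = P (w \<odot>\<^bsub>S\<^esub> v \<odot>\<^bsub>S\<^esub> u) \<bullet> pfc N (w, v \<odot>\<^bsub>S\<^esub> u) |> (p ?x) \<bullet> (pf1 N w) <| pfc N (v, u) |> (p ?x)"
      by (simp add: s1[THEN K.vc22] c1 c2[THEN K.vc32])
    also have "\<dots> = (p ?t) <| (ec (w \<odot>\<^bsub>S\<^esub> v) u \<bullet> (ec w v |> (e u))) \<bullet> ?Q"
      by (simp add: c3[THEN K.vc32] s2 c4[THEN K.vc32] n)
    finally show ?thesis by (rule lift_unique[OF t, rotated -1]) simp_all
  qed
  have ur: "ec f (id1 S (src S f)) \<bullet> ((e f) <| ei (src S f)) = id2 K (e f)" if [simp]: "f : ars S" for f
  proof -
    let ?x = "src S f" and ?y = "tgt S f" and ?i = "id1 S (src S f)"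
    have s1: "(p ?y \<odot> e f) <| ei ?x \<bullet> P f = P f |> (e ?i) \<bullet> (pf1 N f \<odot> p ?x) <| ei ?x"
      using K.slide_refl[of "P f" "ei ?x"] by simp
    note c1 = arg_cong[OF ei_eq[of ?x], of "%s. (pf1 N f) <| s", simplified]
    note n = arg_cong[OF N.pfc_unit_right[of f], of "%s. s |> (p ?x)", simplified]
    show ?thesis
      by (rule lift_unique[OF tr_arrow[of f]]) (simp_all add: s1 c1 ec_eq[of f ?i, simplified, THEN K.vc32] n)
  qed
  have ul: "ec (id1 S (tgt S f)) f \<bullet> (ei (tgt S f) |> (e f)) = id2 K (e f)" if [simp]: "f : ars S" for f
  proof -
    let ?x = "src S f" and ?y = "tgt S f" and ?i = "id1 S (tgt S f)"
    have s1: "pfi N ?y |> (p ?y \<odot> e f) \<bullet> P f = (pf1 N ?i) <| P f \<bullet> pfi N ?y |> (pf1 N f \<odot> p ?x)"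
      using K.slide_refl[of "pfi N ?y" "P f"] by simp
    have c1: "(p ?y) <| ei ?y |> (e f) = P ?i |> (e f) \<bullet> pfi N ?y |> (p ?y \<odot> e f)"
      using arg_cong[OF ei_eq[of ?y], of "%s. s |> (e f)"] K.hcomp_assoc[of "id2 K (p ?y)" "ei ?y" "id2 K (e f)"]
      by (simp del: K.hcomp_assoc) simp
    note n = arg_cong[OF N.pfc_unit_left[of f], of "%s. s |> (p ?x)", simplified]
    show ?thesis
      by (rule lift_unique[OF tr_arrow[of f]]) (simp_all add: s1 c1 ec_eq[of ?i f, simplified, THEN K.vc32] n)
  qed
  show ?thesis
    unfolding pseudofunctor_def
    by (auto simp: EM_def in_hom1_def in_hom2_def id vc nat assoc ur ul)
qed

definition PP where "PP = \<lparr>psrc = EM, ptgt = N, pcomp = restrict p (obs S), pnat = restrict P (ars S)\<rparr>"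

text \<open>The equations that characterise the lifts, \<open>e2_eq\<close>, \<open>ec_eq\<close>
  and \<open>ei_eq\<close>, are literally the axioms for the projection.\<close>

lemma psnat_PP: "pseudonatural S K PP"
  unfolding pseudonatural_def
  by (auto simp: PP_def EM_def[THEN arg_cong, of pf0] EM_def[THEN arg_cong, of pf1] EM_def[THEN arg_cong, of pf2]
      EM_def[THEN arg_cong, of pfc] EM_def[THEN arg_cong, of pfi] psfun_EM N.pseudofunctor_axioms in_hom1_def in_hom2_def
      e2_eq ec_eq ei_eq)

definition HH where "HH = \<lparr>msrc = T \<odot>\<^bsub>PS S K\<^esub> PP, mtgt = PP, mcomp = restrict h (obs S)\<rparr>"

text \<open>The modification axiom is the last equation of \<open>tr\<close> at each arrow.\<close>

lemma modif_HH: "modification S K HH"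
  unfolding HH_def
proof (rule modifI)
  show "pseudonatural S K (T \<odot>\<^bsub>PS S K\<^esub> PP)"
    using psnat_comp1[OF T.pseudonatural_axioms psnat_PP] by (simp add: PP_def)
  fix u assume [simp]: "u : ars S"
  show "pnat PP u \<bullet> ((pf1 (ptgt (T \<odot>\<^bsub>PS S K\<^esub> PP)) u) <| h (src S u))
      = h (tgt S u) |> (pf1 (psrc (T \<odot>\<^bsub>PS S K\<^esub> PP)) u) \<bullet> pnat (T \<odot>\<^bsub>PS S K\<^esub> PP) u"
    using trD(17)[OF tr_arrow[of u]] by (simp add: PP_def EM_def)
qed (auto simp: PP_def psnat_PP[unfolded PP_def] S.two_category_axioms)

lemma PS_em_EM: "PS_em S K N T \<eta> \<mu> PP HH"
proof unfold_locales
  have [simp]: "ptgt PP = N" "msrc HH = T \<odot>\<^bsub>PS S K\<^esub> PP" "mtgt HH = PP" by (simp_all add: PP_def HH_def)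
  have [simp]: "x : obs S ==> pcomp PP x = p x" "x : obs S ==> mcomp HH x = h x" for x by (simp_all add: PP_def HH_def)
  note [simp] = psnat_PP modif_HH
  note m = modif_vcomp modif_hcomp modif_id2 T.pseudonatural_axioms \<eta>.modification_axioms \<mu>.modification_axioms modif_HH
  show "alg2 (PS S K) T \<eta> \<mu> PP HH"
    unfolding alg2_def
  proof (intro conjI)
    show "HH \<bullet>\<^bsub>PS S K\<^esub> (\<eta> |>\<^bsub>PS S K\<^esub> PP) = id2 (PS S K) PP"
      by (rule modif_eqI[of S K]) (auto simp: alg2D(6)[OF alg] intro!: m)
    show "HH \<bullet>\<^bsub>PS S K\<^esub> (T <|\<^bsub>PS S K\<^esub> HH) = HH \<bullet>\<^bsub>PS S K\<^esub> \<mu> |>\<^bsub>PS S K\<^esub> PP"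
      by (rule modif_eqI[of S K]) (auto simp: alg2D(7)[OF alg] PS.comp1_assoc T.pseudonatural_axioms intro!: m)
  qed (auto simp: in_hom1_def in_hom2_def)
  show "x : obs S ==> em K (pcomp T x) (mcomp \<eta> x) (mcomp \<mu> x) (pcomp PP x) (mcomp HH x)" for x
    using em[of x] by simp
qed

end

section \<open>Comparing an arbitrary algebra with a universal one\<close>

context two_category
begin

text \<open>The isomorphism \<open>i\<close> gives an algebra square over the identity monad
  morphism, with the universal algebra on the primed side. The transfer lemmas then translate each
  property of \<open>u\<close> into the corresponding property of the comparison
  \<open>m\<close>.\<close>

lemma em_compare:
  assumes monad: "monad2 K b T \<eta> \<mu>" and u: "alg2 K T \<eta> \<mu> u k" and p: "em K T \<eta> \<mu> p h"
    and m: "m : ars K" "src K m = src K u" "tgt K m = src K p"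
    and i: "cdom K i = p \<odot> m" "ccod K i = u" "invertible2 K i" "i \<bullet> (h |> m) = k \<bullet> T <| i"
  shows "faith1 K u \<longleftrightarrow> faith1 K m"
    and "faith1 K u & alg_full1 K T u k \<longleftrightarrow> faith1 K m & full1 K m"
    and "em K T \<eta> \<mu> u k \<longleftrightarrow> equivalence1 K m"
proof -
  interpret monad_in K b T \<eta> \<mu> using monad by unfold_locales
  have p': "alg2 K T \<eta> \<mu> p h" "faith1 K p" "alg_full1 K T p h" "alg_ess1 K T \<eta> \<mu> p h"
    using p by (auto simp: em_def)
  note [simp] = alg2D(1-5)[OF u] alg2D(1-5)[OF p'(1)] m i(1-3) invertible2_cell[OF i(3)]
  interpret s: alg_square1 K b T \<eta> \<mu> b T \<eta> \<mu> "id1 K b" "id2 K T" u k p h m i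
    using p'(1) by unfold_locales (simp_all add: i(4))
  note q = identity_equivalence[OF monad_simps(1)]
  show 1: "faith1 K u \<longleftrightarrow> faith1 K m" using s.faith1_transfer q p' by blast
  show 2: "faith1 K u & alg_full1 K T u k \<longleftrightarrow> faith1 K m & full1 K m"
    using 1 s.alg_full1_transfer q p' by blast
  show "em K T \<eta> \<mu> u k \<longleftrightarrow> equivalence1 K m"
    unfolding equivalence1_iff[OF m(1)] em_def using u 1 2 s.alg_ess1_transfer q p' by blast
qed

end

context PS_monad
begin

text \<open>By uniqueness of Eilenberg-Moore objects, a universal algebra of pseudofunctors is pointwise universal.\<close>

lemma em_at:
  assumes ex: "!!b T \<eta> \<mu>. monad2 K b T \<eta> \<mu> ==> EX p h. em K T \<eta> \<mu> p h"
    and u: "em (PS S K) T \<eta> \<mu> u k" and x: "x : obs S"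
  shows "em K (pcomp T x) (mcomp \<eta> x) (mcomp \<mu> x) (pcomp u x) (mcomp k x)"
proof -
  \<comment> \<open>Universal algebras are chosen at every object, since a whole pseudofunctor of
    them is needed for comparison with \<open>u\<close>.\<close>
  have "EX ph. em K (pcomp T x) (mcomp \<eta> x) (mcomp \<mu> x) (fst ph) (snd ph)" if "x : obs S" for x
    using ex[OF monad_at[OF that]] by auto
  then obtain ph where "!!x. x : obs S ==> em K (pcomp T x) (mcomp \<eta> x) (mcomp \<mu> x) (fst (ph x)) (snd (ph x))"
    by metis
  then interpret o: PS_em_objects S K N T \<eta> \<mu> "%x. fst (ph x)" "%x. snd (ph x)" by unfold_locales
  interpret e: PS_em S K N T \<eta> \<mu> o.PP o.HH by (rule o.PS_em_EM)
  have ua: "alg2 (PS S K) T \<eta> \<mu> u k" using u by (simp add: em_def)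
  then interpret u: PS_alg S K N T \<eta> \<mu> u k by unfold_locales
  obtain m i where m: "pseudonatural S K m" "psrc m = psrc u" "ptgt m = psrc o.PP"
    and i: "modification S K i" "msrc i = o.PP \<odot>\<^bsub>PS S K\<^esub> m" "mtgt i = u" "invertible2 (PS S K) i"
      "i \<bullet>\<^bsub>PS S K\<^esub> (o.HH |>\<^bsub>PS S K\<^esub> m) = k \<bullet>\<^bsub>PS S K\<^esub> T <|\<^bsub>PS S K\<^esub> i"
    using PS.alg_ess1D[OF PS_monad _ _ ua, of o.PP o.HH] e.PS_em by (auto simp: em_def)
  interpret m: pseudonatural S K m by fact
  interpret i: modification S K i by fact
  \<comment> \<open>Both algebras are universal among pseudofunctors, so the comparison is an
    equivalence there. Its data evaluate at \<open>x\<close> to an equivalence in \<open>K\<close>,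
    which carries pointwise universality back to \<open>u\<close>.\<close>
  have "equivalence1 (PS S K) m"
    using PS.em_compare(3)[OF PS_monad ua e.PS_em, of m i] m i u by simp
  then obtain g \<sigma> \<tau> where g: "pseudonatural S K g" "psrc g = ptgt m" "ptgt g = psrc m"
    and s: "modification S K \<sigma>" "msrc \<sigma> = id1 (PS S K) (psrc m)" "mtgt \<sigma> = g \<odot>\<^bsub>PS S K\<^esub> m" "invertible2 (PS S K) \<sigma>"
    and t: "modification S K \<tau>" "msrc \<tau> = m \<odot>\<^bsub>PS S K\<^esub> g" "mtgt \<tau> = id1 (PS S K) (ptgt m)" "invertible2 (PS S K) \<tau>"
    by (auto simp: equivalence1_def in_hom1_def in_hom2_def)
  interpret g: pseudonatural S K g by fact
  interpret \<sigma>: modification S K \<sigma> by fact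
  interpret \<tau>: modification S K \<tau> by fact
  note [simp] = x m(2,3) i(2,3) g(2,3) s(2,3) t(2,3) invertible_at[OF s(4)] invertible_at[OF t(4)] invertible_at[OF i(4)]
  have "equivalence1 K (pcomp m x)"
    unfolding equivalence1_def in_hom1_def in_hom2_def
    by (intro conjI exI[of _ "pcomp g x"] exI[of _ "mcomp \<sigma> x"] exI[of _ "mcomp \<tau> x"]) simp_all
  moreover have "mcomp i x \<bullet> (mcomp o.HH x |> (pcomp m x)) = mcomp k x \<bullet> (pcomp T x) <| mcomp i x"
    using arg_cong[OF i(5), of "%m. mcomp m x"] by simp
  ultimately show ?thesis
    using K.em_compare(3)[OF monad_at[OF x] alg_at[OF ua x] e.em[OF x], of "pcomp m x" "mcomp i x"] by simp
qed

end

section \<open>The Beck-Chevalley condition makes the left adjoints pseudonatural\<close>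

locale BC = two_categories S K + \<alpha>: pseudonatural S K \<alpha>
  for S :: "('o, 'm, 'c) tcat" and K :: "('p, 'n, 'd) tcat" (structure) and \<alpha> +
  fixes l \<eta> \<epsilon>
  assumes adj: "w : obs S ==> adjunction1 K (l w) (pcomp \<alpha> w) (\<eta> w) (\<epsilon> w)"
    and mate_inv: "f : ars S ==> invertible2 K (mate S K \<alpha> l \<eta> \<epsilon> f)"
begin

abbreviation F where "F \<equiv> psrc \<alpha>"
abbreviation G where "G \<equiv> ptgt \<alpha>"

lemma adj_simps [simp]:
  assumes "w : obs S"
  shows "l w : ars K" "src K (l w) = pf0 G w" "tgt K (l w) = pf0 F w"
    "\<eta> w : cells K" "cdom K (\<eta> w) = id1 K (pf0 G w)" "ccod K (\<eta> w) = pcomp \<alpha> w \<odot> l w"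
    "\<epsilon> w : cells K" "cdom K (\<epsilon> w) = l w \<odot> pcomp \<alpha> w" "ccod K (\<epsilon> w) = id1 K (pf0 F w)"
  using K.adjunction_simps(1-10)[OF adj[OF assms]] assms by simp_all

lemma triangle:
  assumes "w : obs S"
  shows "(pcomp \<alpha> w) <| \<epsilon> w \<bullet> (\<eta> w |> (pcomp \<alpha> w)) = id2 K (pcomp \<alpha> w)"
    "\<epsilon> w |> (l w) \<bullet> ((l w) <| \<eta> w) = id2 K (l w)"
  using K.adjunction_simps(11,12)[OF adj[OF assms]] by simp_all

definition m where "m f = mate S K \<alpha> l \<eta> \<epsilon> f"

lemma m_simps [simp]:
  assumes [simp]: "f : ars S"
  shows "m f : cells K" "cdom K (m f) = l (tgt S f) \<odot> pf1 G f" "ccod K (m f) = pf1 F f \<odot> l (src S f)" "invertible2 K (m f)"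
  using mate_inv[OF assms] by (simp_all add: m_def) (simp_all add: mate_def)

text \<open>The defining property of the mate: its transpose under the adjunction at the target of
  \<open>f\<close> is \<open>\<alpha>\<close> at \<open>f\<close>, composed with the unit at the
  source. The proof uses interchange and one triangle identity.\<close>

lemma m_eta:
  assumes [simp]: "f : ars S"
  shows "(pcomp \<alpha> (tgt S f)) <| m f \<bullet> (\<eta> (tgt S f) |> (pf1 G f))
    = pnat \<alpha> f |> (l (src S f)) \<bullet> (pf1 G f) <| \<eta> (src S f)"
proof -
  let ?w = "src S f" and ?c = "tgt S f"
  have s1: "(pcomp \<alpha> ?c \<odot> l ?c \<odot> pf1 G f) <| \<eta> ?w \<bullet> \<eta> ?c |> (pf1 G f) = \<eta> ?c |> (pf1 G f \<odot> pcomp \<alpha> ?w \<odot> l ?w) \<bullet> (pf1 G f) <| \<eta> ?w"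
    using K.slide_refl[of "\<eta> ?c |> (pf1 G f)" "\<eta> ?w"] by simp
  have s2: "(pcomp \<alpha> ?c \<odot> l ?c) <| pnat \<alpha> f |> (l ?w) \<bullet> (\<eta> ?c |> (pf1 G f \<odot> pcomp \<alpha> ?w \<odot> l ?w))
     = \<eta> ?c |> (pcomp \<alpha> ?c \<odot> pf1 F f \<odot> l ?w) \<bullet> pnat \<alpha> f |> (l ?w)"
    using K.slide_refl[of "\<eta> ?c" "pnat \<alpha> f |> (l ?w)"] by simp
  note t = arg_cong[OF triangle(1)[of ?c], of "%s. s |> (pf1 F f \<odot> l ?w)", simplified]
  show ?thesis unfolding m_def mate_def by (simp add: s1 s2[THEN K.vc22] t[THEN K.vc21])
qed

text \<open>Transposition along an adjunction is injective. All equations between cells out of a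
  left adjoint are checked on transposes below.\<close>

lemma transpose_inj:
  assumes w [simp]: "w : obs S" and g [simp]: "g : ars K" "tgt K g = pf0 G w"
    and r [simp]: "r : cells K" "r' : cells K" "cdom K r = l w \<odot> g" "cdom K r' = l w \<odot> g" "ccod K r = ccod K r'"
    and eq: "(pcomp \<alpha> w) <| r \<bullet> \<eta> w |> g = (pcomp \<alpha> w) <| r' \<bullet> \<eta> w |> g"
  shows "r = r'"
proof -
  \<comment> \<open>The cell is recovered from its transpose by the counit and the second triangle
    identity.\<close>
  have *: "s = \<epsilon> w |> (ccod K s) \<bullet> (l w) <| (((pcomp \<alpha> w) <| s) \<bullet> (\<eta> w |> g))"
    if [simp]: "s : cells K" "cdom K s = l w \<odot> g" for s
  proof -
    have [simp]: "tgt K (ccod K s) = pf0 F w" "src K (ccod K s) = src K g" by simp_all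
    have sl: "\<epsilon> w |> (ccod K s) \<bullet> ((l w \<odot> pcomp \<alpha> w) <| s) = s \<bullet> \<epsilon> w |> (l w \<odot> g)"
      using K.slide_refl[of "\<epsilon> w" s] by simp
    note t = arg_cong[OF triangle(2)[of w], of "%s. s |> g", simplified]
    show ?thesis by (simp add: sl[THEN K.vc22] t)
  qed
  have "r = \<epsilon> w |> (ccod K r) \<bullet> (l w) <| (((pcomp \<alpha> w) <| r) \<bullet> (\<eta> w |> g))"
    by (rule *) simp_all
  also have "\<dots> = \<epsilon> w |> (ccod K r') \<bullet> (l w) <| (((pcomp \<alpha> w) <| r') \<bullet> (\<eta> w |> g))"
    by (simp only: eq r(5))
  also have "\<dots> = r'" by (rule *[symmetric]) simp_all
  finally show ?thesis .
qed

text \<open>The counterpart of \<open>m_eta\<close> for the counits; on transposes both sides reduce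
  to the naturality cell of \<open>\<alpha>\<close>.\<close>

lemma m_eps:
  assumes [simp]: "f : ars S"
  shows "\<epsilon> (tgt S f) |> (pf1 F f) \<bullet> ((l (tgt S f)) <| pnat \<alpha> f)
    = (pf1 F f) <| \<epsilon> (src S f) \<bullet> m f |> (pcomp \<alpha> (src S f))"
proof (rule transpose_inj[of "tgt S f" "pf1 G f \<odot> pcomp \<alpha> (src S f)"])
  let ?w = "src S f" and ?c = "tgt S f"
  have s1: "(pcomp \<alpha> ?c \<odot> l ?c) <| pnat \<alpha> f \<bullet> \<eta> ?c |> (pf1 G f \<odot> pcomp \<alpha> ?w) = \<eta> ?c |> (pcomp \<alpha> ?c \<odot> pf1 F f) \<bullet> pnat \<alpha> f"
    using K.slide_refl[of "\<eta> ?c" "pnat \<alpha> f"] by simp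
  have s2: "(pcomp \<alpha> ?c \<odot> pf1 F f) <| \<epsilon> ?w \<bullet> (pnat \<alpha> f |> (l ?w \<odot> pcomp \<alpha> ?w)) = pnat \<alpha> f \<bullet> (pf1 G f \<odot> pcomp \<alpha> ?w) <| \<epsilon> ?w"
    using K.slide_refl[of "pnat \<alpha> f" "\<epsilon> ?w"] by simp
  note t1 = arg_cong[OF triangle(1)[of ?c], of "%s. s |> (pf1 F f)", simplified]
  note t2 = arg_cong[OF triangle(1)[of ?w], of "%s. (pf1 G f) <| s", simplified]
  note m = arg_cong[OF m_eta[of f], of "%s. s |> (pcomp \<alpha> ?w)", simplified]
  show "(pcomp \<alpha> ?c) <| ((\<epsilon> ?c |> (pf1 F f)) \<bullet> ((l ?c) <| pnat \<alpha> f)) \<bullet> (\<eta> ?c |> (pf1 G f \<odot> pcomp \<alpha> ?w))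
    = (pcomp \<alpha> ?c) <| (((pf1 F f) <| \<epsilon> ?w) \<bullet> (m f |> (pcomp \<alpha> ?w))) \<bullet> \<eta> ?c |> (pf1 G f \<odot> pcomp \<alpha> ?w)"
    by (simp add: s1 t1[THEN K.vc21] m s2[THEN K.vc22] t2)
qed simp_all

lemma m_nat:
  assumes s [simp]: "\<sigma> : cells S"
  shows "m (ccod S \<sigma>) \<bullet> (l (tgt S (cdom S \<sigma>))) <| pf2 G \<sigma> = pf2 F \<sigma> |> (l (src S (cdom S \<sigma>))) \<bullet> m (cdom S \<sigma>)"
proof (rule transpose_inj[of "tgt S (cdom S \<sigma>)" "pf1 G (cdom S \<sigma>)"])
  let ?w = "src S (cdom S \<sigma>)" and ?c = "tgt S (cdom S \<sigma>)" and ?f = "cdom S \<sigma>" and ?f' = "ccod S \<sigma>"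
  have s1: "(pcomp \<alpha> ?c \<odot> l ?c) <| pf2 G \<sigma> \<bullet> \<eta> ?c |> (pf1 G ?f) = \<eta> ?c |> (pf1 G ?f') \<bullet> pf2 G \<sigma>"
    using K.slide_refl[of "\<eta> ?c" "pf2 G \<sigma>"] by simp
  have s2: "(pf1 G ?f') <| \<eta> ?w \<bullet> pf2 G \<sigma> = pf2 G \<sigma> |> (pcomp \<alpha> ?w \<odot> l ?w) \<bullet> (pf1 G ?f) <| \<eta> ?w"
    using K.slide_refl[of "pf2 G \<sigma>" "\<eta> ?w"] by simp
  note n = arg_cong[OF \<alpha>.pnat_nat[OF s], of "%s. s |> (l ?w)", simplified]
  note e = m_eta[of ?f, simplified] and e' = m_eta[of ?f', simplified]
  show "(pcomp \<alpha> ?c) <| (m ?f' \<bullet> ((l ?c) <| pf2 G \<sigma>)) \<bullet> (\<eta> ?c |> (pf1 G ?f))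
     = (pcomp \<alpha> ?c) <| ((pf2 F \<sigma> |> (l ?w)) \<bullet> m ?f) \<bullet> \<eta> ?c |> (pf1 G ?f)"
    by (simp add: s1 e'[THEN K.vc22] s2 n[THEN K.vc22] e)
qed simp_all

text \<open>Mates respect pasting. On transposes this is the composition axiom of
  \<open>\<alpha>\<close>, with \<open>m_eta\<close> used for \<open>g\<close>, for \<open>f\<close>
  and for their composite.\<close>

lemma m_comp:
  assumes [simp]: "g : ars S" "f : ars S" "src S g = tgt S f"
  shows "m (g \<odot>\<^bsub>S\<^esub> f) \<bullet> ((l (tgt S g)) <| pfc G (g, f))
    = pfc F (g, f) |> (l (src S f)) \<bullet> (pf1 F g) <| m f \<bullet> m g |> (pf1 G f)"
proof (rule transpose_inj[of "tgt S g" "pf1 G g \<odot> pf1 G f"])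
  let ?x = "src S f" and ?y = "tgt S f" and ?z = "tgt S g" and ?gf = "g \<odot>\<^bsub>S\<^esub> f"
  have s1: "(pcomp \<alpha> ?z \<odot> l ?z) <| pfc G (g, f) \<bullet> \<eta> ?z |> (pf1 G g \<odot> pf1 G f) = \<eta> ?z |> (pf1 G ?gf) \<bullet> pfc G (g, f)"
    using K.slide_refl[of "\<eta> ?z" "pfc G (g, f)"] by simp
  have s2: "(pf1 G ?gf) <| \<eta> ?x \<bullet> pfc G (g, f) = pfc G (g, f) |> (pcomp \<alpha> ?x \<odot> l ?x) \<bullet> (pf1 G g \<odot> pf1 G f) <| \<eta> ?x"
    using K.slide_refl[of "pfc G (g, f)" "\<eta> ?x"] by simp
  have s3: "(pcomp \<alpha> ?z \<odot> pf1 F g) <| m f \<bullet> pnat \<alpha> g |> (l ?y \<odot> pf1 G f) = pnat \<alpha> g |> (pf1 F f \<odot> l ?x) \<bullet> (pf1 G g \<odot> pcomp \<alpha> ?y) <| m f"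
    using K.slide_refl[of "pnat \<alpha> g" "m f"] by simp
  note n = arg_cong[OF \<alpha>.pnat_comp[of g f, simplified], of "%s. s |> (l ?x)", simplified]
  note eg = arg_cong[OF m_eta[of g], of "%s. s |> (pf1 G f)", simplified]
  note ef = arg_cong[OF m_eta[of f], of "%s. (pf1 G g) <| s", simplified]
  note egf = m_eta[of ?gf, simplified]
  show "(pcomp \<alpha> ?z) <| (m ?gf \<bullet> ((l ?z) <| pfc G (g, f))) \<bullet> (\<eta> ?z |> (pf1 G g \<odot> pf1 G f))
     = (pcomp \<alpha> ?z) <| ((pfc F (g, f) |> (l ?x)) \<bullet> (pf1 F g) <| m f \<bullet> (m g |> (pf1 G f))) \<bullet> \<eta> ?z |> (pf1 G g \<odot> pf1 G f)"
    by (simp add: s1 egf[THEN K.vc22] s2 n[THEN K.vc23] eg s3[THEN K.vc22] ef)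
qed simp_all

lemma m_unit:
  assumes [simp]: "x : obs S"
  shows "m (id1 S x) \<bullet> ((l x) <| pfi G x) = pfi F x |> (l x)"
proof (rule transpose_inj[of x "id1 K (pf0 G x)"])
  let ?i = "id1 S x"
  have s1: "(pcomp \<alpha> x \<odot> l x) <| pfi G x \<bullet> \<eta> x = \<eta> x |> (pf1 G ?i) \<bullet> pfi G x"
    using K.slide_refl[of "\<eta> x" "pfi G x"] by simp
  have s2: "(pf1 G ?i) <| \<eta> x \<bullet> pfi G x = pfi G x |> (pcomp \<alpha> x \<odot> l x) \<bullet> \<eta> x"
    using K.slide_refl[of "pfi G x" "\<eta> x"] by simp
  note n = arg_cong[OF \<alpha>.pnat_unit[of x], of "%s. s |> (l x)", simplified]
  note e = m_eta[of ?i, simplified]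
  show "(pcomp \<alpha> x) <| (m ?i \<bullet> ((l x) <| pfi G x)) \<bullet> (\<eta> x |> (id1 K (pf0 G x)))
     = (pcomp \<alpha> x) <| (pfi F x |> (l x)) \<bullet> \<eta> x |> (id1 K (pf0 G x))"
    by (simp add: s1 e[THEN K.vc22] s2 n[THEN K.vc21])
qed simp_all

text \<open>A mate goes from \<open>l c\<close> after \<open>G f\<close> to \<open>F f\<close> after
  \<open>l w\<close>, opposite to the direction required of a naturality cell. This is where
  invertibility of the mates enters.\<close>

definition \<Lambda> where "\<Lambda> = \<lparr>psrc = G, ptgt = F, pcomp = restrict l (obs S), pnat = (\<lambda>f \<in> ars S. inv2 K (m f))\<rparr>"

lemma Lambda_simps [simp]: "psrc \<Lambda> = G" "ptgt \<Lambda> = F" "x : obs S ==> pcomp \<Lambda> x = l x" "f : ars S ==> pnat \<Lambda> f = inv2 K (m f)"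
  by (simp_all add: \<Lambda>_def)

lemma psnat_Lambda: "pseudonatural S K \<Lambda>"
  unfolding pseudonatural_def
proof (intro conjI allI impI)
  fix \<sigma> assume s [simp]: "\<sigma> : cells S"
  let ?w = "src S (cdom S \<sigma>)" and ?c = "tgt S (cdom S \<sigma>)" and ?f = "cdom S \<sigma>" and ?f' = "ccod S \<sigma>"
  have "inv2 K (m ?f') \<bullet> pf2 F \<sigma> |> (l ?w) = (l ?c) <| pf2 G \<sigma> \<bullet> inv2 K (m ?f)"
    by (rule K.vcomp_cancel_left[of "m ?f'"]) (simp_all add: m_nat[OF s, THEN K.vc22])
  then show "pnat \<Lambda> ?f' \<bullet> pf2 (ptgt \<Lambda>) \<sigma> |> (pcomp \<Lambda> ?w) = (pcomp \<Lambda> ?c) <| pf2 (psrc \<Lambda>) \<sigma> \<bullet> pnat \<Lambda> ?f"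
    by simp
next
  fix g f assume "(g, f) : cpairs S"
  then have [simp]: "g : ars S" "f : ars S" "src S g = tgt S f" by simp_all
  let ?x = "src S f" and ?z = "tgt S g" and ?gf = "g \<odot>\<^bsub>S\<^esub> f"
  have "inv2 K (m ?gf) \<bullet> (pfc F (g, f) |> (l ?x))
    = (l ?z) <| pfc G (g, f) \<bullet> inv2 K (m g) |> (pf1 G f) \<bullet> (pf1 F g) <| inv2 K (m f)"
    by (rule K.vcomp_cancel_left[of "m ?gf"]) (simp_all add: m_comp[THEN K.vc23])
  then show "pnat \<Lambda> ?gf \<bullet> (pfc (ptgt \<Lambda>) (g, f) |> (pcomp \<Lambda> ?x))
    = (pcomp \<Lambda> ?z) <| pfc (psrc \<Lambda>) (g, f) \<bullet> pnat \<Lambda> g |> (pf1 (psrc \<Lambda>) f) \<bullet> (pf1 (ptgt \<Lambda>) g) <| pnat \<Lambda> f"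
    by simp
next
  fix x assume [simp]: "x : obs S"
  have "inv2 K (m (id1 S x)) \<bullet> pfi F x |> (l x) = (l x) <| pfi G x"
    by (rule K.vcomp_cancel_left[of "m (id1 S x)"]) (simp_all add: m_unit)
  then show "pnat \<Lambda> (id1 S x) \<bullet> pfi (ptgt \<Lambda>) x |> (pcomp \<Lambda> x) = (pcomp \<Lambda> x) <| pfi (psrc \<Lambda>) x"
    by simp
qed (auto simp: \<Lambda>_def in_hom1_def in_hom2_def \<alpha>.psrc_psfun \<alpha>.ptgt_psfun)

definition H where "H = \<lparr>msrc = id1 (PS S K) G, mtgt = \<alpha> \<odot>\<^bsub>PS S K\<^esub> \<Lambda>, mcomp = restrict \<eta> (obs S)\<rparr>"
definition E where "E = \<lparr>msrc = \<Lambda> \<odot>\<^bsub>PS S K\<^esub> \<alpha>, mtgt = id1 (PS S K) F, mcomp = restrict \<epsilon> (obs S)\<rparr>"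

lemma HE_simps [simp]: "msrc H = id1 (PS S K) G" "mtgt H = \<alpha> \<odot>\<^bsub>PS S K\<^esub> \<Lambda>" "x : obs S ==> mcomp H x = \<eta> x"
  "msrc E = \<Lambda> \<odot>\<^bsub>PS S K\<^esub> \<alpha>" "mtgt E = id1 (PS S K) F" "x : obs S ==> mcomp E x = \<epsilon> x"
  by (simp_all add: H_def E_def)

text \<open>Naturality of the units is \<open>m_eta\<close> with the mate moved to the other side;
  for the counits the same is done with \<open>m_eps\<close>.\<close>

lemma modif_H: "modification S K H"
  unfolding H_def
proof (rule modifI)
  fix f assume f [simp]: "f : ars S"
  let ?w = "src S f" and ?c = "tgt S f"
  have "(pcomp \<alpha> ?c) <| inv2 K (m f) \<bullet> pnat \<alpha> f |> (l ?w) \<bullet> ((pf1 G f) <| \<eta> ?w) = \<eta> ?c |> (pf1 G f)"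
    by (simp add: m_eta[symmetric])
  then show "pnat (\<alpha> \<odot>\<^bsub>PS S K\<^esub> \<Lambda>) f \<bullet> (pf1 (ptgt (id1 (PS S K) G)) f) <| \<eta> ?w = \<eta> ?c |> (pf1 (psrc (id1 (PS S K) G)) f) \<bullet> pnat (id1 (PS S K) G) f"
    by simp
qed (auto intro!: psnat_id1 psnat_comp1 \<alpha>.pseudonatural_axioms psnat_Lambda \<alpha>.ptgt_psfun S.two_category_axioms)

lemma modif_E: "modification S K E"
  unfolding E_def
proof (rule modifI)
  fix f assume f [simp]: "f : ars S"
  let ?w = "src S f" and ?c = "tgt S f"
  have "\<epsilon> ?c |> (pf1 F f) \<bullet> (l ?c) <| pnat \<alpha> f \<bullet> inv2 K (m f) |> (pcomp \<alpha> ?w) = (pf1 F f) <| \<epsilon> ?w"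
    by (simp add: m_eps[THEN K.vc22])
  then show "pnat (id1 (PS S K) F) f \<bullet> (pf1 (ptgt (\<Lambda> \<odot>\<^bsub>PS S K\<^esub> \<alpha>)) f) <| \<epsilon> ?w = \<epsilon> ?c |> (pf1 (psrc (\<Lambda> \<odot>\<^bsub>PS S K\<^esub> \<alpha>)) f) \<bullet> pnat (\<Lambda> \<odot>\<^bsub>PS S K\<^esub> \<alpha>) f"
    by simp
qed (auto intro!: psnat_id1 psnat_comp1 \<alpha>.pseudonatural_axioms psnat_Lambda \<alpha>.psrc_psfun S.two_category_axioms)

lemma PS_adjunction: "adjunction1 (PS S K) \<Lambda> \<alpha> H E"
proof
  note m = modif_vcomp modif_hcomp modif_id2 modif_H modif_E psnat_Lambda \<alpha>.pseudonatural_axioms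
  note [simp] = psnat_Lambda \<alpha>.pseudonatural_axioms
  show "\<alpha> <|\<^bsub>PS S K\<^esub> E \<bullet>\<^bsub>PS S K\<^esub> (H |>\<^bsub>PS S K\<^esub> \<alpha>) = id2 (PS S K) \<alpha>"
    by (rule modif_eqI[of S K]) (auto simp: triangle PS.comp1_assoc intro!: m)
  show "E |>\<^bsub>PS S K\<^esub> \<Lambda> \<bullet>\<^bsub>PS S K\<^esub> (\<Lambda> <|\<^bsub>PS S K\<^esub> H) = id2 (PS S K) \<Lambda>"
    by (rule modif_eqI[of S K]) (auto simp: triangle PS.comp1_assoc intro!: m)
qed (auto simp: in_hom1_def in_hom2_def modif_H modif_E psnat_Lambda \<alpha>.pseudonatural_axioms)

end

section \<open>Right biadjoints of strict 2-functors preserve Eilenberg-Moore objects\<close>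

locale strict_functor = X: two_category X + Y: two_category Y + pseudofunctor X Y U
  for X :: "('o, 'm, 'c) tcat" and Y :: "('p, 'n, 'd) tcat" and U +
  assumes strict: "two_functor X Y U"
begin

text \<open>Strictness is stated as the coherence cell being an identity 2-cell; comparing its
  domain with that of the identity yields strict preservation of composites.\<close>

lemma U_comp1 [simp]: "[|g : ars X; f : ars X; src X g = tgt X f|] ==> pf1 U (g \<odot>\<^bsub>X\<^esub> f) = pf1 U g \<odot>\<^bsub>Y\<^esub> pf1 U f"
proof -
  assume a [simp]: "g : ars X" "f : ars X" "src X g = tgt X f"
  have "pfc U (g, f) = id2 Y (pf1 U (g \<odot>\<^bsub>X\<^esub> f))"
    using strict unfolding two_functor_def by (auto simp: cpairs_def)
  from arg_cong[OF this, of "cdom Y"] show ?thesis by simp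
qed

lemma U_id1 [simp]: "x : obs X ==> pf1 U (id1 X x) = id1 Y (pf0 U x)"
proof -
  assume a [simp]: "x : obs X"
  have "pfi U x = id2 Y (pf1 U (id1 X x))"
    using strict unfolding two_functor_def by auto
  from arg_cong[OF this, of "cdom Y"] show ?thesis by simp
qed

lemma pfc_U: "[|g : ars X; f : ars X; src X g = tgt X f|] ==> pfc U (g, f) = id2 Y (pf1 U g \<odot>\<^bsub>Y\<^esub> pf1 U f)"
  using strict unfolding two_functor_def by (auto simp: cpairs_def)

lemma U_vcomp [simp]: "[|t : cells X; s : cells X; cdom X t = ccod X s|] ==> pf2 U (t \<bullet>\<^bsub>X\<^esub> s) = pf2 U t \<bullet>\<^bsub>Y\<^esub> pf2 U s"
  by (rule pf2_vcomp)

lemma U_hcomp [simp]: "[|t : cells X; s : cells X; src X (cdom X t) = tgt X (cdom X s)|]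
    ==> pf2 U (t \<star>\<^bsub>X\<^esub> s) = pf2 U t \<star>\<^bsub>Y\<^esub> pf2 U s"
  using pfc_nat[of t s] by (simp add: pfc_U)

lemma U_invertible [simp]: "invertible2 X s ==> invertible2 Y (pf2 U s)"
proof -
  assume a: "invertible2 X s"
  then have [simp]: "s : cells X" by (rule X.invertible2_cell)
  have "pf2 U (inv2 X s) \<bullet>\<^bsub>Y\<^esub> pf2 U s = id2 Y (pf1 U (cdom X s))" "pf2 U s \<bullet>\<^bsub>Y\<^esub> pf2 U (inv2 X s) = id2 Y (pf1 U (ccod X s))"
    by (subst U_vcomp[symmetric], use a in simp_all)+
  then show ?thesis
    unfolding Y.invertible2_iff Y.iso2_def using a X.inv2_simps(1-3)[OF a] by (intro exI[of _ "pf2 U (inv2 X s)"]) simp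
qed

lemma U_monad: "monad2 X b T \<eta> \<mu> ==> monad2 Y (pf0 U b) (pf1 U T) (pf2 U \<eta>) (pf2 U \<mu>)"
proof -
  assume m: "monad2 X b T \<eta> \<mu>"
  then interpret monad_in X b T \<eta> \<mu> by unfold_locales
  show ?thesis
    using arg_cong[OF monad_unit(1), of "pf2 U"] arg_cong[OF monad_unit(2), of "pf2 U"] arg_cong[OF monad_assoc, of "pf2 U"]
    by (simp add: monad2_def in_hom1_def in_hom2_def)
qed

end

text \<open>\<open>(N, e)\<close> is the value at \<open>D\<close> of a right biadjoint of \<open>U\<close>, with \<open>e\<close> the counit.\<close>

locale ran = strict_functor X Y U
  for X :: "('o, 'm, 'c) tcat" and Y :: "('p, 'n, 'd) tcat" and U +
  fixes N e D
  assumes N [simp]: "N : obs X" and e [simp]: "e : ars Y" "src Y e = pf0 U N" "tgt Y e = D"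
    and faith: "G : obs X ==> faithful_on (hom_cat X G N) (%r. e <|\<^bsub>Y\<^esub> pf2 U r)"
    and full: "G : obs X ==> full_on (hom_cat X G N) (hom_cat Y (pf0 U G) D) (%g. e \<odot>\<^bsub>Y\<^esub> pf1 U g) (%r. e <|\<^bsub>Y\<^esub> pf2 U r)"
    and ess: "G : obs X ==> ess_surj_on (hom_cat X G N) (hom_cat Y (pf0 U G) D) (%g. e \<odot>\<^bsub>Y\<^esub> pf1 U g)"
begin

lemma D_obs [simp]: "D : obs Y"
  using Y.tgt_obs[OF e(1)] by simp

lemma faithD:
  assumes "e <|\<^bsub>Y\<^esub> pf2 U r = e <|\<^bsub>Y\<^esub> pf2 U r'" "r : cells X" "r' : cells X" "cdom X r = cdom X r'" "ccod X r = ccod X r'"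
    "tgt X (cdom X r) = N"
  shows "r = r'"
  using faith[of "src X (cdom X r')", unfolded faithful_on_def, rule_format, of r r'] assms by simp

lemma fullD:
  assumes "g : ars X" "g' : ars X" "src X g = src X g'" "tgt X g = N" "tgt X g' = N" "s : cells Y"
    "cdom Y s = e \<odot>\<^bsub>Y\<^esub> pf1 U g" "ccod Y s = e \<odot>\<^bsub>Y\<^esub> pf1 U g'"
  shows "EX r. r : cells X & cdom X r = g & ccod X r = g' & e <|\<^bsub>Y\<^esub> pf2 U r = s"
  using full[of "src X g'", unfolded full_on_def, rule_format, of g g' s] assms
  by (simp add: Bex_def conj_ac)

lemma essD:
  assumes "G : obs X" "d : ars Y" "src Y d = pf0 U G" "tgt Y d = D"
  shows "EX g s. g : ars X & src X g = G & tgt X g = N & s : cells Y & cdom Y s = e \<odot>\<^bsub>Y\<^esub> pf1 U g & ccod Y s = d & invertible2 Y s"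
  using ess[OF assms(1), unfolded ess_surj_on_def, rule_format, of d] assms
  by (simp add: Bex_def Y.is_iso_hom_cat)

text \<open>The functor \<open>r \<mapsto> e U r\<close> is fully faithful on each hom-category into
  \<open>N\<close>, so the inverse has a preimage, which is an inverse by faithfulness.\<close>

lemma reflect_invertible:
  assumes r: "r : cells X" "tgt X (cdom X r) = N" and inv: "invertible2 Y (e <|\<^bsub>Y\<^esub> pf2 U r)"
  shows "invertible2 X r"
proof -
  note [simp] = r inv
  obtain s where [simp]: "s : cells X" "cdom X s = ccod X r" "ccod X s = cdom X r" and s: "e <|\<^bsub>Y\<^esub> pf2 U s = inv2 Y (e <|\<^bsub>Y\<^esub> pf2 U r)"
    using fullD[of "ccod X r" "cdom X r" "inv2 Y (e <|\<^bsub>Y\<^esub> pf2 U r)"] by auto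
  have "s \<bullet>\<^bsub>X\<^esub> r = id2 X (cdom X r)" by (rule faithD) (simp_all add: s)
  moreover have "r \<bullet>\<^bsub>X\<^esub> s = id2 X (ccod X r)" by (rule faithD) (simp_all add: s)
  ultimately show ?thesis unfolding X.invertible2_iff X.iso2_def by (intro exI[of _ s]) simp
qed

lemma comparison_functor: "functor_on (hom_cat X G N) (hom_cat Y (pf0 U G) D) (%g. e \<odot>\<^bsub>Y\<^esub> pf1 U g) (%r. e <|\<^bsub>Y\<^esub> pf2 U r)"
  by (simp add: functor_on_def)

end

text \<open>\<open>T'\<close> is the endomorphism of \<open>N\<close> which the universal property
  of the counit \<open>e\<close> assigns to \<open>T\<close> after \<open>e\<close>. The equations
  \<open>tau_eta\<close> and \<open>tau_mu\<close> determine its unit and multiplication, by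
  faithfulness.\<close>

locale ran_monad = ran X Y U N e D + monad_in Y D T \<eta> \<mu>
  for X :: "('o, 'm, 'c) tcat" and Y :: "('p, 'n, 'd) tcat" (structure) and U N e D T \<eta> \<mu> +
  fixes T' \<tau> \<eta>' \<mu>'
  assumes T' [simp]: "T' : ars X" "src X T' = N" "tgt X T' = N"
    and tau [simp]: "\<tau> : cells Y" "cdom Y \<tau> = e \<odot> pf1 U T'" "ccod Y \<tau> = T \<odot> e" "invertible2 Y \<tau>"
    and eta' [simp]: "\<eta>' : cells X" "cdom X \<eta>' = id1 X N" "ccod X \<eta>' = T'"
    and mu' [simp]: "\<mu>' : cells X" "cdom X \<mu>' = T' \<odot>\<^bsub>X\<^esub> T'" "ccod X \<mu>' = T'"
    and tau_eta: "\<tau> \<bullet> (e <| pf2 U \<eta>') = \<eta> |> e"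
    and tau_mu: "\<tau> \<bullet> e <| pf2 U \<mu>' = \<mu> |> e \<bullet> T <| \<tau> \<bullet> \<tau> |> (pf1 U T')"
begin

lemma tau_slide: "[|s : cells Y; tgt Y (cdom Y s) = pf0 U N; cdom Y s = f; ccod Y s = f'|]
    ==> (\<tau> |> f') \<bullet> (e \<odot> pf1 U T') <| s = (T \<odot> e) <| s \<bullet> \<tau> |> f"
  by (rule Y.slide) simp_all

text \<open>Faithfulness of \<open>r \<mapsto> e U r\<close>, with the invertible cell
  \<open>\<tau>\<close> composed on so that \<open>tau_mu\<close> can be applied at once. The monad
  laws use it with \<open>g\<close> an identity.\<close>

lemma tau_cancel:
  assumes "r : cells X" "r' : cells X" "cdom X r = cdom X r'" "ccod X r = T' \<odot>\<^bsub>X\<^esub> g" "ccod X r' = T' \<odot>\<^bsub>X\<^esub> g" "g : ars X" "tgt X g = N"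
    "\<tau> |> (pf1 U g) \<bullet> e <| pf2 U r = \<tau> |> (pf1 U g) \<bullet> e <| pf2 U r'"
  shows "r = r'"
proof -
  note [simp] = assms(1,2,4-7)
  have t: "tgt X (ccod X r) = N" "tgt X (ccod X r') = N" by simp_all
  have [simp]: "tgt X (cdom X r) = N" "tgt X (cdom X r') = N"
    using t X.tgt_cod[of r] X.tgt_cod[of r'] by (simp_all only: assms(1,2) simp_thms)
  have "e <| pf2 U r = e <| pf2 U r'"
    by (rule Y.vcomp_cancel_left[OF _ assms(8)]) (simp_all add: assms(3))
  then show ?thesis by (rule faithD) (simp_all add: assms(3))
qed

text \<open>Each law is tested under \<open>r \<mapsto> e U r\<close>, where \<open>tau_eta\<close>
  and \<open>tau_mu\<close> convert it into the law of \<open>T\<close> whiskered by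
  \<open>e\<close>.\<close>

lemma ran_monad: "monad2 X N T' \<eta>' \<mu>'"
proof -
  let ?T = "pf1 U T'"
  have 1: "\<mu>' \<bullet>\<^bsub>X\<^esub> (\<eta>' |>\<^bsub>X\<^esub> T') = id2 X T'"
  proof (rule tau_cancel[of _ _ "id1 X N"])
    note a = arg_cong[OF tau_eta, of "%s. s |> ?T", simplified]
    have b: "T <| \<tau> \<bullet> \<eta> |> (e \<odot> ?T) = \<eta> |> (T \<odot> e) \<bullet> \<tau>"
      using Y.slide_refl[of \<eta> \<tau>] by simp
    note c = arg_cong[OF monad_unit(1), of "%s. s |> e", simplified]
    show "\<tau> |> (pf1 U (id1 X N)) \<bullet> e <| pf2 U (\<mu>' \<bullet>\<^bsub>X\<^esub> (\<eta>' |>\<^bsub>X\<^esub> T')) = \<tau> |> (pf1 U (id1 X N)) \<bullet> e <| pf2 U (id2 X T')"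
      by (simp add: tau_mu[THEN Y.vc23] a b c[THEN Y.vc21])
  qed simp_all
  have 2: "\<mu>' \<bullet>\<^bsub>X\<^esub> (T' <|\<^bsub>X\<^esub> \<eta>') = id2 X T'"
  proof (rule tau_cancel[of _ _ "id1 X N"])
    note a = tau_slide[of "pf2 U \<eta>'", OF _ _ refl refl, simplified]
    note b = arg_cong[OF tau_eta, of "%s. T <| s", simplified]
    note c = arg_cong[OF monad_unit(2), of "%s. s |> e", simplified]
    show "\<tau> |> (pf1 U (id1 X N)) \<bullet> e <| pf2 U (\<mu>' \<bullet>\<^bsub>X\<^esub> (T' <|\<^bsub>X\<^esub> \<eta>')) = \<tau> |> (pf1 U (id1 X N)) \<bullet> e <| pf2 U (id2 X T')"
      by (simp add: tau_mu[THEN Y.vc23] a b[THEN Y.vc21] c[THEN Y.vc21])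
  qed simp_all
  have 3: "\<mu>' \<bullet>\<^bsub>X\<^esub> (T' <|\<^bsub>X\<^esub> \<mu>') = \<mu>' \<bullet>\<^bsub>X\<^esub> \<mu>' |>\<^bsub>X\<^esub> T'"
  proof (rule tau_cancel[of _ _ "id1 X N"])
    note a = tau_slide[of "pf2 U \<mu>'", OF _ _ refl refl, simplified]
    note b = arg_cong[OF tau_mu, of "%s. T <| s", simplified]
    note b' = arg_cong[OF tau_mu, of "%s. s |> ?T", simplified]
    note c = arg_cong[OF monad_assoc, of "%s. s |> e", simplified]
    have d: "T <| \<tau> \<bullet> \<mu> |> (e \<odot> ?T) = \<mu> |> (T \<odot> e) \<bullet> (T \<odot> T) <| \<tau>"
      using Y.slide_refl[of \<mu> \<tau>] by simp
    show "\<tau> |> (pf1 U (id1 X N)) \<bullet> e <| pf2 U (\<mu>' \<bullet>\<^bsub>X\<^esub> (T' <|\<^bsub>X\<^esub> \<mu>')) = \<tau> |> (pf1 U (id1 X N)) \<bullet> e <| pf2 U (\<mu>' \<bullet>\<^bsub>X\<^esub> (\<mu>' |>\<^bsub>X\<^esub> T'))"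
      by (simp add: tau_mu[THEN Y.vc23] a b[THEN Y.vc23] b' d[THEN Y.vc22] c[THEN Y.vc22])
  qed simp_all
  show ?thesis by (simp add: monad2_def in_hom1_def in_hom2_def 1 2 3)
qed

end

text \<open>Essential surjectivity supplies \<open>T'\<close> with \<open>\<tau>\<close>; fullness
  supplies the unit and multiplication as preimages of the cells that the two equations
  prescribe.\<close>

lemma (in ran) ex_ran_monad:
  assumes m: "monad2 Y D T \<eta> \<mu>"
  shows "EX T' t \<eta>' \<mu>'. ran_monad X Y U N e D T \<eta> \<mu> T' t \<eta>' \<mu>'"
proof -
  interpret monad_in Y D T \<eta> \<mu> using m by unfold_locales
  obtain T' t where T [simp]: "T' : ars X" "src X T' = N" "tgt X T' = N"
    "t : cells Y" "cdom Y t = e \<odot>\<^bsub>Y\<^esub> pf1 U T'" "ccod Y t = T \<odot>\<^bsub>Y\<^esub> e" "invertible2 Y t"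
    using essD[of N "T \<odot>\<^bsub>Y\<^esub> e"] by auto
  obtain \<eta>' where h [simp]: "\<eta>' : cells X" "cdom X \<eta>' = id1 X N" "ccod X \<eta>' = T'"
    and e1: "e <|\<^bsub>Y\<^esub> pf2 U \<eta>' = inv2 Y t \<bullet>\<^bsub>Y\<^esub> \<eta> |>\<^bsub>Y\<^esub> e"
    using fullD[of "id1 X N" T' "inv2 Y t \<bullet>\<^bsub>Y\<^esub> \<eta> |>\<^bsub>Y\<^esub> e"] by auto
  let ?m = "inv2 Y t \<bullet>\<^bsub>Y\<^esub> \<mu> |>\<^bsub>Y\<^esub> e \<bullet>\<^bsub>Y\<^esub> T <|\<^bsub>Y\<^esub> t \<bullet>\<^bsub>Y\<^esub> t |>\<^bsub>Y\<^esub> (pf1 U T')"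
  obtain \<mu>' where [simp]: "\<mu>' : cells X" "cdom X \<mu>' = T' \<odot>\<^bsub>X\<^esub> T'" "ccod X \<mu>' = T'"
    and e2: "e <|\<^bsub>Y\<^esub> pf2 U \<mu>' = ?m"
    using fullD[of "T' \<odot>\<^bsub>X\<^esub> T'" T' ?m] by auto
  have "ran_monad X Y U N e D T \<eta> \<mu> T' t \<eta>' \<mu>'"
    by unfold_locales (simp_all add: e1 e2)
  then show ?thesis by blast
qed

locale ran_em = ran_monad X Y U N e D T \<eta> \<mu> T' \<tau> \<eta>' \<mu>' + M: ran X Y U M e' D'
  for X :: "('o, 'm, 'c) tcat" and Y :: "('p, 'n, 'd) tcat" (structure) and U N e D T \<eta> \<mu> T' \<tau> \<eta>' \<mu>' M e' D' +
  fixes p h u i k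
  assumes em: "em Y T \<eta> \<mu> p h" and p [simp]: "src Y p = D'"
    and u [simp]: "u : ars X" "src X u = M" "tgt X u = N"
    and i [simp]: "i : cells Y" "cdom Y i = e \<odot> pf1 U u" "ccod Y i = p \<odot> e'" "invertible2 Y i"
    and k [simp]: "k : cells X" "cdom X k = T' \<odot>\<^bsub>X\<^esub> u" "ccod X k = u"
    and i_k: "i \<bullet> e <| pf2 U k = h |> e' \<bullet> T <| i \<bullet> \<tau> |> (pf1 U u)"
begin

sublocale m': monad_in X N T' \<eta>' \<mu>'
  using ran_monad by unfold_locales

lemma alg_p: "alg2 Y T \<eta> \<mu> p h"
  using em by (simp add: em_def)

lemma ph [simp]: "p : ars Y" "tgt Y p = D" "h : cells Y" "cdom Y h = T \<odot> p" "ccod Y h = p"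
  using alg2D(1-5)[OF alg_p] by simp_all

text \<open>As for the monad laws, the algebra laws are tested under
  \<open>r \<mapsto> e U r\<close>; the cell \<open>i\<close> converts them into the laws of
  \<open>p\<close> whiskered by \<open>e'\<close>.\<close>

lemma alg_u: "alg2 X T' \<eta>' \<mu>' u k"
proof -
  let ?u = "pf1 U u" and ?T = "pf1 U T'"
  have "i \<bullet> (e <| pf2 U (k \<bullet>\<^bsub>X\<^esub> (\<eta>' |>\<^bsub>X\<^esub> u))) = i \<bullet> e <| pf2 U (id2 X u)"
  proof -
    note a = arg_cong[OF tau_eta, of "%s. s |> ?u", simplified]
    have b: "T <| i \<bullet> \<eta> |> (e \<odot> ?u) = \<eta> |> (p \<odot> e') \<bullet> i"
      using Y.slide_refl[of \<eta> i] by simp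
    note c = arg_cong[OF alg2D(6)[OF alg_p], of "%s. s |> e'", simplified]
    show ?thesis by (simp add: i_k[THEN Y.vc23] a b c[THEN Y.vc21])
  qed
  then have "e <| pf2 U (k \<bullet>\<^bsub>X\<^esub> (\<eta>' |>\<^bsub>X\<^esub> u)) = e <| pf2 U (id2 X u)"
    by (rule Y.vcomp_cancel_left[rotated]) simp_all
  then have 1: "k \<bullet>\<^bsub>X\<^esub> (\<eta>' |>\<^bsub>X\<^esub> u) = id2 X u"
    by (rule faithD) simp_all
  have "i \<bullet> (e <| pf2 U (k \<bullet>\<^bsub>X\<^esub> (T' <|\<^bsub>X\<^esub> k))) = i \<bullet> e <| pf2 U (k \<bullet>\<^bsub>X\<^esub> (\<mu>' |>\<^bsub>X\<^esub> u))"
  proof -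
    note a = tau_slide[of "pf2 U k", OF _ _ refl refl, simplified]
    note b = arg_cong[OF i_k, of "%s. T <| s", simplified]
    note b' = arg_cong[OF tau_mu, of "%s. s |> ?u", simplified]
    have d: "T <| i \<bullet> \<mu> |> (e \<odot> ?u) = \<mu> |> (p \<odot> e') \<bullet> (T \<odot> T) <| i"
      using Y.slide_refl[of \<mu> i] by simp
    note c = arg_cong[OF alg2D(7)[OF alg_p], of "%s. s |> e'", simplified]
    show ?thesis by (simp add: i_k[THEN Y.vc23] a b[THEN Y.vc23] b' d[THEN Y.vc22] c[THEN Y.vc22])
  qed
  then have "e <| pf2 U (k \<bullet>\<^bsub>X\<^esub> (T' <|\<^bsub>X\<^esub> k)) = e <| pf2 U (k \<bullet>\<^bsub>X\<^esub> (\<mu>' |>\<^bsub>X\<^esub> u))"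
    by (rule Y.vcomp_cancel_left[rotated]) simp_all
  then have 2: "k \<bullet>\<^bsub>X\<^esub> (T' <|\<^bsub>X\<^esub> k) = k \<bullet>\<^bsub>X\<^esub> \<mu>' |>\<^bsub>X\<^esub> u"
    by (rule faithD) simp_all
  show ?thesis by (simp add: alg2_def in_hom1_def in_hom2_def 1 2)
qed

text \<open>The square runs from hom-categories of \<open>X\<close> to those of \<open>Y\<close>:
  both horizontal functors apply \<open>U\<close> and compose with a counit. It is a square of
  algebras because the lifted monad and action were defined through these functors.\<close>

lemma square:
  assumes [simp]: "G : obs X"
  shows "alg_square (hom_cat X G M) (hom_cat X G N) (hom_cat Y (pf0 U G) D') (hom_cat Y (pf0 U G) D)
     (%g. u \<odot>\<^bsub>X\<^esub> g) (%r. u <|\<^bsub>X\<^esub> r) (%g. k |>\<^bsub>X\<^esub> g) (%g. p \<odot> g) (%r. p <| r) (%g. h |> g)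
     (%g. e' \<odot> pf1 U g) (%r. e' <| pf2 U r) (%g. e \<odot> pf1 U g) (%r. e <| pf2 U r)
     (%g. T' \<odot>\<^bsub>X\<^esub> g) (%r. T' <|\<^bsub>X\<^esub> r) (%f. \<eta>' |>\<^bsub>X\<^esub> f) (%f. \<mu>' |>\<^bsub>X\<^esub> f)
     (%g. T \<odot> g) (%r. T <| r) (%f. \<eta> |> f) (%f. \<mu> |> f)
     (%g. inv2 Y \<tau> |> (pf1 U g)) (%g. inv2 Y i |> (pf1 U g))"
proof -
  have slX: "(ccod X \<tau>) <|\<^bsub>X\<^esub> \<sigma> \<bullet>\<^bsub>X\<^esub> \<tau> |>\<^bsub>X\<^esub> (cdom X \<sigma>) = \<tau> |>\<^bsub>X\<^esub> (ccod X \<sigma>) \<bullet>\<^bsub>X\<^esub> (cdom X \<tau>) <|\<^bsub>X\<^esub> \<sigma>"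
    if "\<tau> : cells X" "\<sigma> : cells X" "src X (cdom X \<tau>) = tgt X (cdom X \<sigma>)" for \<tau> \<sigma>
    using X.slide[OF that refl refl refl refl] by simp
  have sl: "(ccod Y \<tau>) <| \<sigma> \<bullet> \<tau> |> (cdom Y \<sigma>) = \<tau> |> (ccod Y \<sigma>) \<bullet> (cdom Y \<tau>) <| \<sigma>"
    if "\<tau> : cells Y" "\<sigma> : cells Y" "src Y (cdom Y \<tau>) = tgt Y (cdom Y \<sigma>)" for \<tau> \<sigma>
    using Y.slide[OF that refl refl refl refl] by simp
  have slU: "(ccod Y \<tau>) <| pf2 U \<sigma> \<bullet> \<tau> |> (pf1 U (cdom X \<sigma>)) = \<tau> |> (pf1 U (ccod X \<sigma>)) \<bullet> (cdom Y \<tau>) <| pf2 U \<sigma>"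
    if "\<tau> : cells Y" "\<sigma> : cells X" "src Y (cdom Y \<tau>) = pf0 U (tgt X (cdom X \<sigma>))" for \<tau> \<sigma>
    using sl[of \<tau> "pf2 U \<sigma>"] that by simp
  \<comment> \<open>A monad morphism in \<open>alg_square\<close> moves the monad of
    \<open>Y\<close> inwards, against the direction of \<open>\<tau>\<close> and \<open>i\<close>,
    so the defining equations are first solved for the inverse cells.\<close>
  have e1: "inv2 Y \<tau> \<bullet> (\<eta> |> e) = e <| pf2 U \<eta>'"
    by (rule Y.vcomp_cancel_left[of \<tau>]) (simp_all add: tau_eta)
  have e2: "inv2 Y \<tau> \<bullet> \<mu> |> e = e <| pf2 U \<mu>' \<bullet> inv2 Y \<tau> |> (pf1 U T') \<bullet> T <| inv2 Y \<tau>"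
    by (rule Y.vcomp_cancel_left[of \<tau>]) (simp_all add: tau_mu[THEN Y.vc23])
  have e3: "inv2 Y i \<bullet> h |> e' = e <| pf2 U k \<bullet> inv2 Y \<tau> |> (pf1 U u) \<bullet> T <| inv2 Y i"
    by (rule Y.vcomp_cancel_left[of i]) (simp_all add: i_k[THEN Y.vc23])
  have e: "inv2 Y \<tau> |> (pf1 U x) \<bullet> (\<eta> |> (e \<odot> pf1 U x)) = e <| pf2 U \<eta>' |> (pf1 U x)"
    "inv2 Y \<tau> |> (pf1 U x) \<bullet> (\<mu> |> (e \<odot> pf1 U x))
      = e <| pf2 U \<mu>' |> (pf1 U x) \<bullet> inv2 Y \<tau> |> (pf1 U T' \<odot> pf1 U x) \<bullet> T <| inv2 Y \<tau> |> (pf1 U x)"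
    if "x : ars X" "tgt X x = N" for x
    using arg_cong[OF e1, of "%s. s |> (pf1 U x)"] arg_cong[OF e2, of "%s. s |> (pf1 U x)"] that by simp_all
  have e': "inv2 Y i |> (pf1 U x) \<bullet> (h |> (e' \<odot> pf1 U x))
      = e <| pf2 U k |> (pf1 U x) \<bullet> inv2 Y \<tau> |> (pf1 U u \<odot> pf1 U x) \<bullet> T <| inv2 Y i |> (pf1 U x)"
    if "x : ars X" "tgt X x = M" for x
    using arg_cong[OF e3, of "%s. s |> (pf1 U x)"] that by simp
  note X.category_hom_cat [simp] Y.category_hom_cat [simp]
  have a: "alg_obj (hom_cat Y (pf0 U G) D) ((\<odot>) T) ((\<star>) (id2 Y T)) (%f. \<eta> |> f) (%f. \<mu> |> f)
     (p \<odot> c) (h |> c)" if "c : ars Y" "src Y c = pf0 U G" "tgt Y c = D'" for c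
    using alg2_comp1[OF alg_p, of c] that by (simp add: alg_obj_hom_cat)
  show ?thesis
    by (intro alg_square.intro alg_square_axioms.intro comparison_functor M.comparison_functor)
      (simp_all add: X.hom_functor Y.hom_functor Y.is_iso_hom_cat a e e' sl[of \<eta>, simplified] sl[of \<mu>, simplified] slX[of k, simplified]
        sl[of h, simplified] slU[of "inv2 Y \<tau>", simplified] slU[of "inv2 Y i", simplified])
qed

text \<open>By the universal properties of the counits both horizontal functors of the square are
  fully faithful and essentially surjective, so all parts of universality transfer from
  \<open>p\<close> to \<open>u\<close>.\<close>

lemma em_u: "em X T' \<eta>' \<mu>' u k"
proof -
  have o: "pf0 U G : obs Y" if "G : obs X" for G using that by simp
  have 1: "faith1 X u"
    unfolding faith1_def
    using alg_square.faithful_iff[OF square] faith M.faith em o by (auto simp: em_def faith1_def)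
  moreover have 2: "alg_full1 X T' u k"
    unfolding alg_full1_def
    using alg_square.full_iff[OF square] faith full M.full em o by (auto simp: em_def faith1_def alg_full1_def)
  moreover have "alg_ess1 X T' \<eta>' \<mu>' u k"
    unfolding alg_ess1_def
    using alg_square.ess_surj_iff[OF square] faith full ess M.faith M.full M.ess em o
    by (auto simp: em_def faith1_def alg_full1_def alg_ess1_def)
  ultimately show ?thesis unfolding em_def using alg_u by blast
qed

end

text \<open>The unit of the biadjunction is a strong monad morphism, compatible with the algebras \<open>p\<close> and \<open>u\<close>.\<close>

locale ran_unit = ran_em X Y U N e "pf0 U b" "pf1 U T" "pf2 U \<eta>" "pf2 U \<mu>" T' \<tau> \<eta>' \<mu>' M e' "pf0 U (src X p)" "pf1 U p" "pf2 U h" u i k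
  + x: monad_in X b T \<eta> \<mu>
  for X :: "('o, 'm, 'c) tcat" and Y :: "('p, 'n, 'd) tcat" (structure) and U N e b T \<eta> \<mu> T' \<tau> \<eta>' \<mu>' M e' p h u i k +
  fixes q iq m im
  assumes alg_x: "alg2 X T \<eta> \<mu> p h"
    and q [simp]: "q : ars X" "src X q = b" "tgt X q = N"
    and iq [simp]: "iq : cells Y" "cdom Y iq = e \<odot> pf1 U q" "ccod Y iq = id1 Y (pf0 U b)" "invertible2 Y iq"
    and m [simp]: "m : ars X" "src X m = src X p" "tgt X m = M"
    and im [simp]: "im : cells Y" "cdom Y im = e' \<odot> pf1 U m" "ccod Y im = id1 Y (pf0 U (src X p))" "invertible2 Y im"
begin

lemma px [simp]: "p : ars X" "tgt X p = b" "h : cells X" "cdom X h = T \<odot>\<^bsub>X\<^esub> p" "ccod X h = p"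
  using alg2D(1-5)[OF alg_x] by simp_all

text \<open>\<open>q\<close> and \<open>m\<close> are the units, so applying \<open>U\<close> and
  composing with the counit turns them into identities up to \<open>iq\<close> and
  \<open>im\<close>. This determines \<open>\<phi>\<close> and \<open>j\<close> as preimages, and
  their equations are checked after \<open>U\<close> and the counit.\<close>

lemma ex_square: "EX \<phi> j. alg_square1 X b T \<eta> \<mu> N T' \<eta>' \<mu>' q \<phi> p h u k m j"
proof -
  let ?q = "pf1 U q" and ?T = "pf1 U T" and ?T' = "pf1 U T'" and ?u = "pf1 U u" and ?m = "pf1 U m" and ?p = "pf1 U p"
  \<comment> \<open>Move the lifted monad past the counit by \<open>\<tau>\<close>, cancel the unit
    against the counit by \<open>iq\<close>, and reinsert it on the other side of the monad.\<close>
  let ?phi = "inv2 Y iq |> ?T \<bullet> ?T <| iq \<bullet> \<tau> |> ?q"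
  have iqi: "inv2 Y iq |> f' \<bullet> s = (e \<odot> ?q) <| s \<bullet> inv2 Y iq |> f"
    if "s : cells Y" "cdom Y s = f" "ccod Y s = f'" "tgt Y f = pf0 U b" for s f f'
    using Y.slide_refl[of "inv2 Y iq" s] that Y.tgt_cod[of s] by simp
  obtain \<phi> where phi [simp]: "\<phi> : cells X" "cdom X \<phi> = T' \<odot>\<^bsub>X\<^esub> q" "ccod X \<phi> = q \<odot>\<^bsub>X\<^esub> T"
    and phi2: "e <| pf2 U \<phi> = ?phi"
    using fullD[of "T' \<odot>\<^bsub>X\<^esub> q" "q \<odot>\<^bsub>X\<^esub> T" ?phi] by auto
  have [simp]: "invertible2 X \<phi>" by (rule reflect_invertible) (simp_all add: phi2)
  have 1: "\<phi> \<bullet>\<^bsub>X\<^esub> (\<eta>' |>\<^bsub>X\<^esub> q) = q <|\<^bsub>X\<^esub> \<eta>"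
  proof (rule faithD)
    note a = arg_cong[OF tau_eta, of "%s. s |> ?q", simplified]
    have b: "?T <| iq \<bullet> (pf2 U \<eta> |> (e \<odot> ?q)) = pf2 U \<eta> \<bullet> iq"
      using Y.slide_refl[of "pf2 U \<eta>" iq] by simp
    show "e <| pf2 U (\<phi> \<bullet>\<^bsub>X\<^esub> (\<eta>' |>\<^bsub>X\<^esub> q)) = e <| pf2 U (q <|\<^bsub>X\<^esub> \<eta>)"
      using iqi[of "pf2 U \<eta>", OF _ refl refl] by (simp add: phi2 a b) (simp add: Y.vc22)
  qed simp_all
  have 2: "\<phi> \<bullet>\<^bsub>X\<^esub> \<mu>' |>\<^bsub>X\<^esub> q = q <|\<^bsub>X\<^esub> \<mu> \<bullet>\<^bsub>X\<^esub> \<phi> |>\<^bsub>X\<^esub> T \<bullet>\<^bsub>X\<^esub> T' <|\<^bsub>X\<^esub> \<phi>"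
  proof (rule faithD)
    note a = arg_cong[OF tau_mu, of "%s. s |> ?q", simplified]
    have b: "?T <| iq \<bullet> (pf2 U \<mu> |> (e \<odot> ?q)) = pf2 U \<mu> \<bullet> (?T \<odot> ?T) <| iq"
      using Y.slide_refl[of "pf2 U \<mu>" iq] by simp
    have c: "e <| pf2 U \<phi> |> ?T = inv2 Y iq |> (?T \<odot> ?T) \<bullet> ?T <| iq |> ?T \<bullet> \<tau> |> (?q \<odot> ?T)"
      using arg_cong[OF phi2, of "%s. s |> ?T"] by simp
    have d: "\<tau> |> (?q \<odot> ?T) \<bullet> (e \<odot> ?T') <| pf2 U \<phi> = (?T \<odot> e) <| pf2 U \<phi> \<bullet> \<tau> |> (?T' \<odot> ?q)"
      using tau_slide[of "pf2 U \<phi>", OF _ _ refl refl] by simp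
    note d' = arg_cong[OF phi2, of "%s. ?T <| s", simplified]
    note f = iqi[of "pf2 U \<mu>", OF _ refl refl, simplified]
    show "e <| pf2 U (\<phi> \<bullet>\<^bsub>X\<^esub> (\<mu>' |>\<^bsub>X\<^esub> q)) = e <| pf2 U ((q <|\<^bsub>X\<^esub> \<mu>) \<bullet>\<^bsub>X\<^esub> \<phi> |>\<^bsub>X\<^esub> T \<bullet>\<^bsub>X\<^esub> (T' <|\<^bsub>X\<^esub> \<phi>))"
      by (simp add: phi2 a c d d' b[THEN Y.vc22] f[THEN Y.vc22])
  qed simp_all
  \<comment> \<open>The same path for the algebra instead of the monad: \<open>i\<close> moves it
    past the counit, \<open>im\<close> cancels one unit and the inverse of \<open>iq\<close> inserts
    the other.\<close>
  let ?j = "inv2 Y iq |> ?p \<bullet> ?p <| im \<bullet> i |> ?m"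
  obtain j where j [simp]: "j : cells X" "cdom X j = u \<odot>\<^bsub>X\<^esub> m" "ccod X j = q \<odot>\<^bsub>X\<^esub> p" and j2: "e <| pf2 U j = ?j"
    using fullD[of "u \<odot>\<^bsub>X\<^esub> m" "q \<odot>\<^bsub>X\<^esub> p" ?j] by auto
  have [simp]: "invertible2 X j" by (rule reflect_invertible) (simp_all add: j2)
  have 3: "j \<bullet>\<^bsub>X\<^esub> k |>\<^bsub>X\<^esub> m = q <|\<^bsub>X\<^esub> h \<bullet>\<^bsub>X\<^esub> \<phi> |>\<^bsub>X\<^esub> p \<bullet>\<^bsub>X\<^esub> T' <|\<^bsub>X\<^esub> j"
  proof (rule faithD)
    note a = arg_cong[OF i_k, of "%s. s |> ?m", simplified]
    have b: "?p <| im \<bullet> (pf2 U h |> (e' \<odot> ?m)) = pf2 U h \<bullet> (?T \<odot> ?p) <| im"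
      using Y.slide_refl[of "pf2 U h" im] by simp
    have c: "e <| pf2 U \<phi> |> ?p = inv2 Y iq |> (?T \<odot> ?p) \<bullet> ?T <| iq |> ?p \<bullet> \<tau> |> (?q \<odot> ?p)"
      using arg_cong[OF phi2, of "%s. s |> ?p"] by simp
    have d: "\<tau> |> (?q \<odot> ?p) \<bullet> (e \<odot> ?T') <| pf2 U j = (?T \<odot> e) <| pf2 U j \<bullet> \<tau> |> (?u \<odot> ?m)"
      using tau_slide[of "pf2 U j", OF _ _ refl refl] by simp
    note d' = arg_cong[OF j2, of "%s. ?T <| s", simplified]
    note f = iqi[of "pf2 U h", OF _ refl refl, simplified]
    show "e <| pf2 U (j \<bullet>\<^bsub>X\<^esub> (k |>\<^bsub>X\<^esub> m)) = e <| pf2 U ((q <|\<^bsub>X\<^esub> h) \<bullet>\<^bsub>X\<^esub> \<phi> |>\<^bsub>X\<^esub> p \<bullet>\<^bsub>X\<^esub> (T' <|\<^bsub>X\<^esub> j))"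
      by (simp add: j2 a c d d' b[THEN Y.vc22] f[THEN Y.vc22])
  qed simp_all
  have "alg_square1 X b T \<eta> \<mu> N T' \<eta>' \<mu>' q \<phi> p h u k m j"
    using alg_u by unfold_locales (simp_all add: 1 2 3)
  then show ?thesis by blast
qed

end

section \<open>Biadjunctions\<close>

locale strict_biadjunction = strict_functor X Y L + biadjunction X Y L R \<rho> \<epsilon> v w
  for X :: "('o, 'm, 'c) tcat" and Y :: "('p, 'n, 'd) tcat" and L R \<rho> \<epsilon> v w
begin

sublocale R: pseudofunctor Y X R
  by (rule R_psfun)

sublocale \<rho>: pseudonatural X X \<rho>
  using unit by (simp add: in_hom1_def)

sublocale \<epsilon>: pseudonatural Y Y \<epsilon>
  using counit by (simp add: in_hom1_def)

sublocale v: modification X Y v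
  using triangle_L by (simp add: in_hom2_def)

sublocale w: modification Y X w
  using triangle_R by (simp add: in_hom2_def)

lemma YY: "two_categories Y Y" and XY: "two_categories X Y" and YX: "two_categories Y X"
  by unfold_locales

lemma psrcs: "psrc \<rho> = psfun_id X" "ptgt \<rho> = psfun_comp X X R L" "psrc \<epsilon> = psfun_comp Y Y L R" "ptgt \<epsilon> = psfun_id Y"
  using unit counit by (simp_all add: in_hom1_def)

lemma pfs [simp]:
  "G : obs X ==> pf0 (psrc \<rho>) G = G" "G : obs X ==> pf0 (ptgt \<rho>) G = pf0 R (pf0 L G)"
  "g : ars X ==> pf1 (psrc \<rho>) g = g" "g : ars X ==> pf1 (ptgt \<rho>) g = pf1 R (pf1 L g)"
  "r : cells X ==> pf2 (psrc \<rho>) r = r" "r : cells X ==> pf2 (ptgt \<rho>) r = pf2 R (pf2 L r)"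
  "D : obs Y ==> pf0 (ptgt \<epsilon>) D = D" "D : obs Y ==> pf0 (psrc \<epsilon>) D = pf0 L (pf0 R D)"
  "d : ars Y ==> pf1 (ptgt \<epsilon>) d = d" "d : ars Y ==> pf1 (psrc \<epsilon>) d = pf1 L (pf1 R d)"
  "s : cells Y ==> pf2 (ptgt \<epsilon>) s = s" "s : cells Y ==> pf2 (psrc \<epsilon>) s = pf2 L (pf2 R s)"
  by (simp_all add: psrcs psfun_id_def strict_psfun_def psfun_comp_def)

lemma vw [simp]:
  "G : obs X ==> pcomp (msrc v) G = id1 Y (pf0 L G)"
  "G : obs X ==> pcomp (mtgt v) G = pcomp \<epsilon> (pf0 L G) \<odot>\<^bsub>Y\<^esub> pf1 L (pcomp \<rho> G)"
  "D : obs Y ==> pcomp (msrc w) D = pf1 R (pcomp \<epsilon> D) \<odot>\<^bsub>X\<^esub> pcomp \<rho> (pf0 R D)"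
  "D : obs Y ==> pcomp (mtgt w) D = id1 X (pf0 R D)"
  using triangle_L triangle_R by (simp_all add: in_hom2_def psnat_id_def psnat_comp_def psnat_wr_def psnat_wl_def)

lemma vw_invertible [simp]:
  "G : obs X ==> invertible2 Y (mcomp v G)" "D : obs Y ==> invertible2 X (mcomp w D)"
  using two_categories.invertible_at[OF XY triangle_L_inv] two_categories.invertible_at[OF YX triangle_R_inv] by auto

text \<open>Applying \<open>L\<close> and composing with the counit has the quasi-inverse that
  applies \<open>R\<close> and composes with the unit. The isomorphisms \<open>\<theta>\<close> and
  \<open>\<kappa>\<close> come from the two triangle modifications, and their naturality gives both
  functors faithful, hence the first one full.\<close>

lemma ran_counit:
  assumes D [simp]: "D : obs Y"
  shows "ran X Y L (pf0 R D) (pcomp \<epsilon> D) D"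
proof -
  let ?e = "pcomp \<epsilon> D" and ?N = "pf0 R D"
  \<comment> \<open>From right to left: split \<open>R\<close> of the composite, exchange
    \<open>g\<close> with the unit by naturality, and contract by the triangle
    \<open>w\<close>.\<close>
  define \<theta> where "\<theta> g = mcomp w D |>\<^bsub>X\<^esub> g \<bullet>\<^bsub>X\<^esub> ((pf1 R ?e) <|\<^bsub>X\<^esub> pnat \<rho> g)
    \<bullet>\<^bsub>X\<^esub> inv2 X (pfc R (?e, pf1 L g)) |>\<^bsub>X\<^esub> (pcomp \<rho> (src X g))" for g
  \<comment> \<open>Exchange \<open>d\<close> with the counit by naturality, then contract by the
    inverse of the triangle \<open>v\<close>.\<close>
  define \<kappa> where "\<kappa> G d = d <|\<^bsub>Y\<^esub> inv2 Y (mcomp v G) \<bullet>\<^bsub>Y\<^esub> inv2 Y (pnat \<epsilon> d) |>\<^bsub>Y\<^esub> (pf1 L (pcomp \<rho> G))" for G d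
  have \<theta>: "\<theta> g : cells X" "cdom X (\<theta> g) = pf1 R (?e \<odot>\<^bsub>Y\<^esub> pf1 L g) \<odot>\<^bsub>X\<^esub> pcomp \<rho> (src X g)" "ccod X (\<theta> g) = g" "invertible2 X (\<theta> g)"
    if "g : ars X" "tgt X g = ?N" for g
    using that by (simp_all add: \<theta>_def)
  have \<theta>_nat: "r \<bullet>\<^bsub>X\<^esub> \<theta> g = \<theta> g' \<bullet>\<^bsub>X\<^esub> pf2 R (?e <|\<^bsub>Y\<^esub> pf2 L r) |>\<^bsub>X\<^esub> (pcomp \<rho> G)"
    if r [simp]: "r : cells X" "cdom X r = g" "ccod X r = g'" "src X g = G" "tgt X g = ?N" for r g g' G
  proof -
    have [simp]: "g : ars X" "g' : ars X" "src X g' = G" "tgt X g' = ?N" "G : obs X"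
      using X.cdom_ars[OF r(1)] X.ccod_ars[OF r(1)] X.src_cod[OF r(1)] X.tgt_cod[OF r(1)] X.src_obs[of g] by (simp_all del: X.cdom_ars X.ccod_ars)
    have a: "r \<bullet>\<^bsub>X\<^esub> mcomp w D |>\<^bsub>X\<^esub> g = mcomp w D |>\<^bsub>X\<^esub> g' \<bullet>\<^bsub>X\<^esub> (pf1 R ?e \<odot>\<^bsub>X\<^esub> pcomp \<rho> ?N) <|\<^bsub>X\<^esub> r"
      using X.slide_refl[of "mcomp w D" r] by simp
    note b = arg_cong[OF \<rho>.pnat_nat[OF r(1)], of "%s. (pf1 R ?e) <|\<^bsub>X\<^esub> s", simplified]
    have c: "(pf1 R ?e) <|\<^bsub>X\<^esub> pf2 R (pf2 L r) \<bullet>\<^bsub>X\<^esub> inv2 X (pfc R (?e, pf1 L g)) = inv2 X (pfc R (?e, pf1 L g')) \<bullet>\<^bsub>X\<^esub> pf2 R (?e <|\<^bsub>Y\<^esub> pf2 L r)"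
    proof (rule X.vcomp_cancel_right[of "pfc R (?e, pf1 L g)"])
      show "(((pf1 R ?e) <|\<^bsub>X\<^esub> pf2 R (pf2 L r)) \<bullet>\<^bsub>X\<^esub> inv2 X (pfc R (?e, pf1 L g))) \<bullet>\<^bsub>X\<^esub> pfc R (?e, pf1 L g)
        = (inv2 X (pfc R (?e, pf1 L g')) \<bullet>\<^bsub>X\<^esub> pf2 R (?e <|\<^bsub>Y\<^esub> pf2 L r)) \<bullet>\<^bsub>X\<^esub> pfc R (?e, pf1 L g)"
        using R.pfc_nat[of "id2 Y ?e" "pf2 L r"] by simp
    qed simp_all
    note c' = arg_cong[OF c, of "%s. s |>\<^bsub>X\<^esub> (pcomp \<rho> G)", simplified]
    show ?thesis by (simp add: \<theta>_def a[THEN X.vc22] b[symmetric, THEN X.vc22] c')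
  qed
  have \<kappa>: "\<kappa> G d : cells Y" "cdom Y (\<kappa> G d) = ?e \<odot>\<^bsub>Y\<^esub> pf1 L (pf1 R d \<odot>\<^bsub>X\<^esub> pcomp \<rho> G)" "ccod Y (\<kappa> G d) = d" "invertible2 Y (\<kappa> G d)"
    if "G : obs X" "d : ars Y" "src Y d = pf0 L G" "tgt Y d = D" for G d
    using that by (simp_all add: \<kappa>_def)
  have \<kappa>_nat: "s \<bullet>\<^bsub>Y\<^esub> \<kappa> G d = \<kappa> G d' \<bullet>\<^bsub>Y\<^esub> ?e <|\<^bsub>Y\<^esub> pf2 L (pf2 R s |>\<^bsub>X\<^esub> (pcomp \<rho> G))"
    if s [simp]: "s : cells Y" "cdom Y s = d" "ccod Y s = d'" "src Y d = pf0 L G" "tgt Y d = D" "G : obs X" for s G d d'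
  proof -
    have [simp]: "d : ars Y" "d' : ars Y" "src Y d' = pf0 L G" "tgt Y d' = D"
      using Y.cdom_ars[OF s(1)] Y.ccod_ars[OF s(1)] Y.src_cod[OF s(1)] Y.tgt_cod[OF s(1)] by (simp_all del: Y.cdom_ars Y.ccod_ars)
    have a: "s \<bullet>\<^bsub>Y\<^esub> d <|\<^bsub>Y\<^esub> inv2 Y (mcomp v G) = d' <|\<^bsub>Y\<^esub> inv2 Y (mcomp v G) \<bullet>\<^bsub>Y\<^esub> s |>\<^bsub>Y\<^esub> (pcomp \<epsilon> (pf0 L G) \<odot>\<^bsub>Y\<^esub> pf1 L (pcomp \<rho> G))"
      using Y.slide_refl[of s "inv2 Y (mcomp v G)"] by simp
    have c: "s |>\<^bsub>Y\<^esub> (pcomp \<epsilon> (pf0 L G)) \<bullet>\<^bsub>Y\<^esub> inv2 Y (pnat \<epsilon> d) = inv2 Y (pnat \<epsilon> d') \<bullet>\<^bsub>Y\<^esub> ?e <|\<^bsub>Y\<^esub> pf2 L (pf2 R s)"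
    proof (rule Y.vcomp_cancel_left[of "pnat \<epsilon> d'"])
      show "pnat \<epsilon> d' \<bullet>\<^bsub>Y\<^esub> s |>\<^bsub>Y\<^esub> (pcomp \<epsilon> (pf0 L G)) \<bullet>\<^bsub>Y\<^esub> inv2 Y (pnat \<epsilon> d) = pnat \<epsilon> d' \<bullet>\<^bsub>Y\<^esub> inv2 Y (pnat \<epsilon> d') \<bullet>\<^bsub>Y\<^esub> ?e <|\<^bsub>Y\<^esub> pf2 L (pf2 R s)"
        using \<epsilon>.pnat_nat[OF s(1), simplified, THEN Y.vc22, of "inv2 Y (pnat \<epsilon> d)"] by simp
    qed simp_all
    note c' = arg_cong[OF c, of "%s. s |>\<^bsub>Y\<^esub> (pf1 L (pcomp \<rho> G))", simplified]
    show ?thesis by (simp add: \<kappa>_def a[THEN Y.vc22] c')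
  qed
  have faith: "r = r'" if r: "r : cells X" "r' : cells X" "cdom X r = cdom X r'" "ccod X r = ccod X r'" "tgt X (cdom X r') = ?N"
      and e: "?e <|\<^bsub>Y\<^esub> pf2 L r = ?e <|\<^bsub>Y\<^esub> pf2 L r'" for r r'
  proof -
    have "r \<bullet>\<^bsub>X\<^esub> \<theta> (cdom X r') = r' \<bullet>\<^bsub>X\<^esub> \<theta> (cdom X r')"
      using \<theta>_nat[of r, OF _ _ refl refl] \<theta>_nat[of r', OF _ refl refl refl] r e by simp
    then show ?thesis by (rule X.vcomp_cancel_right[rotated]) (use r \<theta> in simp_all)
  qed
  \<comment> \<open>Faithfulness of the quasi-inverse, needed to identify the image of the candidate
    preimage below.\<close>
  have faith': "s = s'" if s: "s : cells Y" "s' : cells Y" "cdom Y s = cdom Y s'" "ccod Y s = ccod Y s'" "tgt Y (cdom Y s') = D"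
      "src Y (cdom Y s') = pf0 L G" "G : obs X"
      and e: "pf2 R s |>\<^bsub>X\<^esub> (pcomp \<rho> G) = pf2 R s' |>\<^bsub>X\<^esub> (pcomp \<rho> G)" for s s' G
  proof -
    have "s \<bullet>\<^bsub>Y\<^esub> \<kappa> G (cdom Y s') = s' \<bullet>\<^bsub>Y\<^esub> \<kappa> G (cdom Y s')"
      using \<kappa>_nat[of s, OF _ _ refl] \<kappa>_nat[of s', OF _ refl refl] s e by simp
    then show ?thesis by (rule Y.vcomp_cancel_right[rotated]) (use s \<kappa> in simp_all)
  qed
  show ?thesis
  proof
    fix G assume G [simp]: "G : obs X"
    show "faithful_on (hom_cat X G ?N) (%r. ?e <|\<^bsub>Y\<^esub> pf2 L r)"
      unfolding faithful_on_def using faith by simp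
    show "full_on (hom_cat X G ?N) (hom_cat Y (pf0 L G) D) (%g. ?e \<odot>\<^bsub>Y\<^esub> pf1 L g) (%r. ?e <|\<^bsub>Y\<^esub> pf2 L r)"
      unfolding full_on_def
    proof (intro ballI)
      fix g g' s assume "g : Ob (hom_cat X G ?N)" "g' : Ob (hom_cat X G ?N)"
        "s : Homset (hom_cat Y (pf0 L G) D) (?e \<odot>\<^bsub>Y\<^esub> pf1 L g) (?e \<odot>\<^bsub>Y\<^esub> pf1 L g')"
      then have g [simp]: "g : ars X" "src X g = G" "tgt X g = ?N" "g' : ars X" "src X g' = G" "tgt X g' = ?N"
        "s : cells Y" "cdom Y s = ?e \<odot>\<^bsub>Y\<^esub> pf1 L g" "ccod Y s = ?e \<odot>\<^bsub>Y\<^esub> pf1 L g'" by simp_all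
      note [simp] = \<theta>[of g] \<theta>[of g']
      \<comment> \<open>The transpose of \<open>s\<close>, conjugated by \<open>\<theta>\<close> to
        have the right source and target.\<close>
      let ?r = "\<theta> g' \<bullet>\<^bsub>X\<^esub> pf2 R s |>\<^bsub>X\<^esub> (pcomp \<rho> G) \<bullet>\<^bsub>X\<^esub> inv2 X (\<theta> g)"
      have r [simp]: "?r : cells X" "cdom X ?r = g" "ccod X ?r = g'" by simp_all
      have "\<theta> g' \<bullet>\<^bsub>X\<^esub> (pf2 R (?e <|\<^bsub>Y\<^esub> pf2 L ?r) |>\<^bsub>X\<^esub> (pcomp \<rho> G)) = ?r \<bullet>\<^bsub>X\<^esub> \<theta> g"
        by (rule \<theta>_nat[OF r g(2,3), symmetric])
      also have "\<dots> = \<theta> g' \<bullet>\<^bsub>X\<^esub> pf2 R s |>\<^bsub>X\<^esub> (pcomp \<rho> G)" by simp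
      finally have "pf2 R (?e <|\<^bsub>Y\<^esub> pf2 L ?r) |>\<^bsub>X\<^esub> (pcomp \<rho> G) = pf2 R s |>\<^bsub>X\<^esub> (pcomp \<rho> G)"
        using r by (elim X.vcomp_cancel_left[rotated]) (simp_all del: U_vcomp X.vcomp_assoc)
      then have "?e <|\<^bsub>Y\<^esub> pf2 L ?r = s"
        using r by (elim faith'[rotated -1]) (simp_all del: U_vcomp X.vcomp_assoc)
      then show "EX r : Homset (hom_cat X G ?N) g g'. ?e <|\<^bsub>Y\<^esub> pf2 L r = s"
        using r by (intro bexI[of _ ?r]) (simp_all del: U_vcomp X.vcomp_assoc)
    qed
    show "ess_surj_on (hom_cat X G ?N) (hom_cat Y (pf0 L G) D) (%g. ?e \<odot>\<^bsub>Y\<^esub> pf1 L g)"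
      unfolding ess_surj_on_def
    proof (intro ballI)
      fix d assume "d : Ob (hom_cat Y (pf0 L G) D)"
      then have [simp]: "d : ars Y" "src Y d = pf0 L G" "tgt Y d = D" by simp_all
      note [simp] = \<kappa>[of G d]
      show "EX g : Ob (hom_cat X G ?N). EX s : Homset (hom_cat Y (pf0 L G) D) (?e \<odot>\<^bsub>Y\<^esub> pf1 L g) d. is_iso (hom_cat Y (pf0 L G) D) s"
        by (intro bexI[of _ "pf1 R d \<odot>\<^bsub>X\<^esub> pcomp \<rho> G"] bexI[of _ "\<kappa> G d"]) (simp_all add: Y.is_iso_hom_cat)
    qed
  qed simp_all
qed

end

section \<open>Categories, functors and representables\<close>

lemma func_id_simps [simp]:
  "fdom (func_id C) = C" "fcod (func_id C) = C"
  "x : Ob C ==> fob (func_id C) x = x" "f : Ar C ==> far (func_id C) f = f"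
  "fob (func_id C) : extensional (Ob C)" "far (func_id C) : extensional (Ar C)"
  by (simp_all add: func_id_def)

lemma func_comp_simps [simp]:
  "fdom (G \<circ>\<^sub>F F) = fdom F" "fcod (G \<circ>\<^sub>F F) = fcod G"
  "x : Ob (fdom F) ==> fob (G \<circ>\<^sub>F F) x = fob G (fob F x)" "f : Ar (fdom F) ==> far (G \<circ>\<^sub>F F) f = far G (far F f)"
  "fob (G \<circ>\<^sub>F F) : extensional (Ob (fdom F))" "far (G \<circ>\<^sub>F F) : extensional (Ar (fdom F))"
  by (simp_all add: func_comp_def)

lemma nt_id_simps [simp]:
  "ntdom (nt_id F) = F" "ntcod (nt_id F) = F" "x : Ob (fdom F) ==> ntc (nt_id F) x = Idt (fcod F) (fob F x)"
  "ntc (nt_id F) : extensional (Ob (fdom F))"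
  by (simp_all add: nt_id_def)

lemma nt_vcomp_simps [simp]:
  "ntdom (t \<cdot>\<^sub>N s) = ntdom s" "ntcod (t \<cdot>\<^sub>N s) = ntcod t"
  "x : Ob (fdom (ntdom s)) ==> ntc (t \<cdot>\<^sub>N s) x = ntc t x \<cdot>\<^bsub>fcod (ntdom s)\<^esub> ntc s x"
  "ntc (t \<cdot>\<^sub>N s) : extensional (Ob (fdom (ntdom s)))"
  by (simp_all add: nt_vcomp_def)

lemma nt_hcomp_simps [simp]:
  "ntdom (t \<star>\<^sub>N s) = ntdom t \<circ>\<^sub>F ntdom s" "ntcod (t \<star>\<^sub>N s) = ntcod t \<circ>\<^sub>F ntcod s"
  "x : Ob (fdom (ntdom s)) ==>
    ntc (t \<star>\<^sub>N s) x = ntc t (fob (ntcod s) x) \<cdot>\<^bsub>fcod (ntdom t)\<^esub> far (ntdom t) (ntc s x)"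
  "ntc (t \<star>\<^sub>N s) : extensional (Ob (fdom (ntdom s)))"
  by (simp_all add: nt_hcomp_def)

lemma CAT_simps [simp]:
  "C : obs CAT \<longleftrightarrow> category C" "F : ars CAT \<longleftrightarrow> is_functor F" "t : cells CAT \<longleftrightarrow> is_nattr t"
  "src CAT = fdom" "tgt CAT = fcod" "cdom CAT = ntdom" "ccod CAT = ntcod" "id1 CAT = func_id" "id2 CAT = nt_id"
  "comp1 CAT = func_comp" "vcomp CAT = nt_vcomp" "hcomp CAT = nt_hcomp"
  by (simp_all add: CAT_def)

section \<open>Categories, functors and natural transformations form a 2-category\<close>

context is_functor
begin

sublocale fdom: category "fdom F" by (rule cat_fdom)
sublocale fcod: category "fcod F" by (rule cat_fcod)

lemma functor_simps [simp]:
  "x : Ob (fdom F) ==> fob F x : Ob (fcod F)" "f : Ar (fdom F) ==> far F f : Ar (fcod F)"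
  "f : Ar (fdom F) ==> Dom (fcod F) (far F f) = fob F (Dom (fdom F) f)"
  "f : Ar (fdom F) ==> Cod (fcod F) (far F f) = fob F (Cod (fdom F) f)"
  "x : Ob (fdom F) ==> far F (Idt (fdom F) x) = Idt (fcod F) (fob F x)"
  "[|g : Ar (fdom F); f : Ar (fdom F); Dom (fdom F) g = Cod (fdom F) f|]
      ==> far F (g \<cdot>\<^bsub>fdom F\<^esub> f) = far F g \<cdot>\<^bsub>fcod F\<^esub> far F f"
  by (rule fob_Ob far_Ar Dom_far Cod_far far_Id far_Cmp; assumption)+

lemma functor_on: "functor_on (fdom F) (fcod F) (fob F) (far F)"
  by (simp add: functor_on_def)

end

context is_nattr
begin

sublocale nd: is_functor "ntdom \<tau>" by (rule fun_ntdom)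
sublocale nc: is_functor "ntcod \<tau>" by (rule fun_ntcod)

lemma nattr_simps [simp]:
  "fdom (ntcod \<tau>) = fdom (ntdom \<tau>)" "fcod (ntcod \<tau>) = fcod (ntdom \<tau>)"
  "x : Ob (fdom (ntdom \<tau>)) ==> ntc \<tau> x : Ar (fcod (ntdom \<tau>))"
  "x : Ob (fdom (ntdom \<tau>)) ==> Dom (fcod (ntdom \<tau>)) (ntc \<tau> x) = fob (ntdom \<tau>) x"
  "x : Ob (fdom (ntdom \<tau>)) ==> Cod (fcod (ntdom \<tau>)) (ntc \<tau> x) = fob (ntcod \<tau>) x"
  using same_fdom same_fcod ntc_hom by (auto simp: Homset_def)

end

lemma functor_eqI:
  fixes F G :: "('a, 'b, 'c, 'd) func"
  assumes "is_functor F" "is_functor G" "fdom F = fdom G" "fcod F = fcod G"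
    "!!x. x : Ob (fdom G) ==> fob F x = fob G x" "!!f. f : Ar (fdom G) ==> far F f = far G f"
  shows "F = G"
proof -
  have "fob F = fob G" "far F = far G"
    using assms(3,5,6) is_functor.fob_ext[OF assms(1)] is_functor.fob_ext[OF assms(2)]
      is_functor.far_ext[OF assms(1)] is_functor.far_ext[OF assms(2)]
    by (auto intro!: extensionalityI)
  with assms(3,4) show ?thesis by simp
qed

lemma nattr_eqI:
  fixes s t :: "('a, 'b, 'c, 'd) nattr"
  assumes "is_nattr s" "is_nattr t" "ntdom s = ntdom t" "ntcod s = ntcod t"
    "!!x. x : Ob (fdom (ntdom t)) ==> ntc s x = ntc t x"
  shows "s = t"
proof -
  have "ntc s = ntc t"
    using assms(3,5) is_nattr.ntc_ext[OF assms(1)] is_nattr.ntc_ext[OF assms(2)] by (auto intro!: extensionalityI)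
  with assms(3,4) show ?thesis by simp
qed

lemma is_functor_id [simp]: "category C ==> is_functor (func_id C)"
  by (simp add: is_functor_def category.cat_simps)

lemma is_functor_comp [simp]:
  assumes "is_functor G" "is_functor F" "fdom G = fcod F"
  shows "is_functor (G \<circ>\<^sub>F F)"
proof -
  interpret G: is_functor G by fact
  interpret F: is_functor F by fact
  note [simp] = assms(3)[symmetric]
  have "fob F x : Ob (fdom G)" if "x : Ob (fdom F)" for x using F.fob_Ob[OF that] by simp
  moreover have "far F f : Ar (fdom G)" if "f : Ar (fdom F)" for f using F.far_Ar[OF that] by simp
  ultimately show ?thesis
    using F.functor_simps(3-6) by (simp add: is_functor_def F.cat_fdom G.cat_fcod)
qed

lemma is_nattr_id [simp]:
  assumes "is_functor F" shows "is_nattr (nt_id F)"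
proof -
  interpret is_functor F by fact
  show ?thesis using assms by (simp add: is_nattr_def Homset_def)
qed

lemma is_nattr_vcomp [simp]:
  assumes "is_nattr \<tau>" "is_nattr s" "ntdom \<tau> = ntcod s"
  shows "is_nattr (\<tau> \<cdot>\<^sub>N s)"
proof -
  interpret \<tau>: is_nattr \<tau> by fact
  interpret s: is_nattr s by fact
  note [simp] = assms(3)
  note t = \<tau>.nattr_simps[unfolded assms(3), simplified]
  have [simp]: "fdom (ntcod \<tau>) = fdom (ntdom s)" "fcod (ntcod \<tau>) = fcod (ntdom s)"
    using \<tau>.same_fdom \<tau>.same_fcod by simp_all
  show ?thesis
    unfolding is_nattr_def
  proof (intro conjI allI impI)
    fix f assume "f : Ar (fdom (ntdom (\<tau> \<cdot>\<^sub>N s)))"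
    then have [simp]: "f : Ar (fdom (ntdom s))" by simp
    let ?D = "fcod (ntdom s)" and ?x = "Dom (fdom (ntdom s)) f" and ?y = "Cod (fdom (ntdom s)) f"
    have [simp]: "far (ntcod \<tau>) f : Ar ?D" "Dom ?D (far (ntcod \<tau>) f) = fob (ntcod \<tau>) ?x"
      "far (ntcod s) f : Ar ?D" "Dom ?D (far (ntcod s) f) = fob (ntcod s) ?x" "Cod ?D (far (ntcod s) f) = fob (ntcod s) ?y"
      using \<tau>.nc.functor_simps(2-4)[of f] s.nc.functor_simps(2-4)[of f] by simp_all
    note n1 = s.ntc_nat[of f, simplified] and n2 = \<tau>.ntc_nat[of f, simplified]
    show "ntc (\<tau> \<cdot>\<^sub>N s) (Cod (fdom (ntdom (\<tau> \<cdot>\<^sub>N s))) f) \<cdot>\<^bsub>fcod (ntdom (\<tau> \<cdot>\<^sub>N s))\<^esub> far (ntdom (\<tau> \<cdot>\<^sub>N s)) f =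
         far (ntcod (\<tau> \<cdot>\<^sub>N s)) f \<cdot>\<^bsub>fcod (ntdom (\<tau> \<cdot>\<^sub>N s))\<^esub> ntc (\<tau> \<cdot>\<^sub>N s) (Dom (fdom (ntdom (\<tau> \<cdot>\<^sub>N s))) f)"
      by (simp add: t n1 n2[THEN s.nd.fcod.c22])
  qed (auto simp: t s.fun_ntdom \<tau>.fun_ntcod Homset_def)
qed

lemma is_nattr_hcomp [simp]:
  assumes "is_nattr t" "is_nattr \<sigma>" "fdom (ntdom t) = fcod (ntdom \<sigma>)"
  shows "is_nattr (t \<star>\<^sub>N \<sigma>)"
proof -
  interpret t: is_nattr t by fact
  interpret \<sigma>: is_nattr \<sigma> by fact
  let ?B = "fdom (ntdom \<sigma>)" and ?C = "fcod (ntdom \<sigma>)" and ?D = "fcod (ntdom t)"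
  note C = assms(3)
  have s [simp]: "fob (ntdom \<sigma>) x : Ob (fdom (ntdom t))" "fob (ntcod \<sigma>) x : Ob (fdom (ntdom t))" "ntc \<sigma> x : Ar (fdom (ntdom t))"
    "Dom (fdom (ntdom t)) (ntc \<sigma> x) = fob (ntdom \<sigma>) x" "Cod (fdom (ntdom t)) (ntc \<sigma> x) = fob (ntcod \<sigma>) x" if "x : Ob ?B" for x
    unfolding C using that \<sigma>.nc.functor_simps(1)[of x] by simp_all
  have s2 [simp]: "far (ntdom \<sigma>) f : Ar (fdom (ntdom t))" "far (ntcod \<sigma>) f : Ar (fdom (ntdom t))"
    "Dom (fdom (ntdom t)) (far (ntdom \<sigma>) f) = fob (ntdom \<sigma>) (Dom ?B f)" "Cod (fdom (ntdom t)) (far (ntdom \<sigma>) f) = fob (ntdom \<sigma>) (Cod ?B f)"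
    "Dom (fdom (ntdom t)) (far (ntcod \<sigma>) f) = fob (ntcod \<sigma>) (Dom ?B f)" "Cod (fdom (ntdom t)) (far (ntcod \<sigma>) f) = fob (ntcod \<sigma>) (Cod ?B f)"
    if "f : Ar ?B" for f
    unfolding C using that \<sigma>.nc.functor_simps(2-4)[of f] by simp_all
  have [simp]: "fob (ntcod t) y : Ob ?D" if "y : Ob (fdom (ntdom t))" for y
    using t.nc.functor_simps(1)[of y] that by simp
  have [simp]: "far (ntcod t) g : Ar ?D" "Dom ?D (far (ntcod t) g) = fob (ntcod t) (Dom (fdom (ntdom t)) g)"
    "Cod ?D (far (ntcod t) g) = fob (ntcod t) (Cod (fdom (ntdom t)) g)" if "g : Ar (fdom (ntdom t))" for g
    using t.nc.functor_simps(2-4)[of g] that by simp_all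
  show ?thesis
    unfolding is_nattr_def
  proof (intro conjI allI impI)
    fix f assume "f : Ar (fdom (ntdom (t \<star>\<^sub>N \<sigma>)))"
    then have f [simp]: "f : Ar ?B" by simp
    let ?x = "Dom ?B f" and ?y = "Cod ?B f"
    have 1: "far (ntdom t) (ntc \<sigma> ?y) \<cdot>\<^bsub>?D\<^esub> far (ntdom t) (far (ntdom \<sigma>) f) = far (ntdom t) (far (ntcod \<sigma>) f) \<cdot>\<^bsub>?D\<^esub> far (ntdom t) (ntc \<sigma> ?x)"
      using arg_cong[OF \<sigma>.ntc_nat[OF f], of "far (ntdom t)"] by (simp add: C[symmetric])
    note 2 = t.ntc_nat[of "far (ntcod \<sigma>) f", simplified]
    show "ntc (t \<star>\<^sub>N \<sigma>) (Cod (fdom (ntdom (t \<star>\<^sub>N \<sigma>))) f) \<cdot>\<^bsub>fcod (ntdom (t \<star>\<^sub>N \<sigma>))\<^esub> far (ntdom (t \<star>\<^sub>N \<sigma>)) f =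
         far (ntcod (t \<star>\<^sub>N \<sigma>)) f \<cdot>\<^bsub>fcod (ntdom (t \<star>\<^sub>N \<sigma>))\<^esub> ntc (t \<star>\<^sub>N \<sigma>) (Dom (fdom (ntdom (t \<star>\<^sub>N \<sigma>))) f)"
      by (simp add: 1 2[THEN t.nd.fcod.c22])
  next
    fix x assume "x : Ob (fdom (ntdom (t \<star>\<^sub>N \<sigma>)))"
    then show "ntc (t \<star>\<^sub>N \<sigma>) x : Homset (fcod (ntdom (t \<star>\<^sub>N \<sigma>))) (fob (ntdom (t \<star>\<^sub>N \<sigma>)) x) (fob (ntcod (t \<star>\<^sub>N \<sigma>)) x)"
      by (simp add: Homset_def)
  qed (auto simp: C t.fun_ntdom t.fun_ntcod \<sigma>.fun_ntdom \<sigma>.fun_ntcod)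
qed

lemma two_category_CAT: "two_category CAT"
proof -
  note i = is_functor.functor_simps is_functor.cat_fdom is_functor.cat_fcod
    is_nattr.fun_ntdom is_nattr.fun_ntcod is_nattr.same_fdom is_nattr.same_fcod
  have n: "ntc \<tau> x : Ar (fcod (ntdom \<tau>))" "Dom (fcod (ntdom \<tau>)) (ntc \<tau> x) = fob (ntdom \<tau>) x"
    "Cod (fcod (ntdom \<tau>)) (ntc \<tau> x) = fob (ntcod \<tau>) x" "fob (ntdom \<tau>) x : Ob (fcod (ntdom \<tau>))" "fob (ntcod \<tau>) x : Ob (fcod (ntdom \<tau>))"
    if "is_nattr \<tau>" "x : Ob (fdom (ntdom \<tau>))" for \<tau> :: "('a, 'b, 'a, 'b) nattr" and x
  proof -
    interpret is_nattr \<tau> by fact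
    show "ntc \<tau> x : Ar (fcod (ntdom \<tau>))" "Dom (fcod (ntdom \<tau>)) (ntc \<tau> x) = fob (ntdom \<tau>) x"
    "Cod (fcod (ntdom \<tau>)) (ntc \<tau> x) = fob (ntcod \<tau>) x" "fob (ntdom \<tau>) x : Ob (fcod (ntdom \<tau>))" "fob (ntcod \<tau>) x : Ob (fcod (ntdom \<tau>))"
      using that nc.functor_simps(1)[of x] by simp_all
  qed
  have c: "category (fcod (ntdom \<tau>))" "category (fdom (ntdom \<tau>))" if "is_nattr \<tau>" for \<tau> :: "('a, 'b, 'a, 'b) nattr"
    using that by (simp_all add: i)
  show ?thesis
    unfolding two_category_def
  proof (intro conjI allI impI)
    show "category (cat1 (CAT :: (('a, 'b) cat, ('a, 'b, 'a, 'b) func, ('a, 'b, 'a, 'b) nattr) tcat))"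
    proof
      fix f :: "('a, 'b, 'a, 'b) func"
      assume "f : Ar (cat1 CAT)"
      then have f: "is_functor f" by (simp add: cat1_def)
      then interpret f: is_functor f .
      show "f \<cdot>\<^bsub>cat1 CAT\<^esub> Idt (cat1 CAT) (Dom (cat1 CAT) f) = f"
        using f by (intro functor_eqI) (simp_all add: cat1_def f.cat_fdom)
      show "Idt (cat1 CAT) (Cod (cat1 CAT) f) \<cdot>\<^bsub>cat1 CAT\<^esub> f = f"
        using f by (intro functor_eqI) (simp_all add: cat1_def f.cat_fcod)
    next
      fix h g f :: "('a, 'b, 'a, 'b) func"
      assume "h : Ar (cat1 CAT)" "g : Ar (cat1 CAT)" "f : Ar (cat1 CAT)" "Dom (cat1 CAT) h = Cod (cat1 CAT) g" "Dom (cat1 CAT) g = Cod (cat1 CAT) f"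
      then have a: "is_functor h" "is_functor g" "is_functor f" "fdom h = fcod g" "fdom g = fcod f" by (simp_all add: cat1_def)
      interpret f: is_functor f by fact
      show "(h \<cdot>\<^bsub>cat1 CAT\<^esub> g) \<cdot>\<^bsub>cat1 CAT\<^esub> f = h \<cdot>\<^bsub>cat1 CAT\<^esub> g \<cdot>\<^bsub>cat1 CAT\<^esub> f"
        using a(1-4) f.functor_simps(1,2) unfolding a(5)[symmetric] by (intro functor_eqI) (simp_all add: cat1_def a(5))
    qed (simp_all add: cat1_def is_functor.cat_fdom is_functor.cat_fcod)
    show "category (vcat (CAT :: (('a, 'b) cat, ('a, 'b, 'a, 'b) func, ('a, 'b, 'a, 'b) nattr) tcat))"
    proof
      fix f :: "('a, 'b, 'a, 'b) nattr"
      assume "f : Ar (vcat CAT)"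
      then have f: "is_nattr f" by (simp add: vcat_def)
      then interpret f: is_nattr f .
      show "f \<cdot>\<^bsub>vcat CAT\<^esub> Idt (vcat CAT) (Dom (vcat CAT) f) = f"
        using f by (intro nattr_eqI) (simp_all add: vcat_def f.fun_ntdom)
      show "Idt (vcat CAT) (Cod (vcat CAT) f) \<cdot>\<^bsub>vcat CAT\<^esub> f = f"
        using f by (intro nattr_eqI) (simp_all add: vcat_def f.fun_ntcod)
    next
      fix h g f :: "('a, 'b, 'a, 'b) nattr"
      assume "h : Ar (vcat CAT)" "g : Ar (vcat CAT)" "f : Ar (vcat CAT)" "Dom (vcat CAT) h = Cod (vcat CAT) g" "Dom (vcat CAT) g = Cod (vcat CAT) f"
      then have a: "is_nattr h" "is_nattr g" "is_nattr f" "ntdom h = ntcod g" "ntdom g = ntcod f" by (simp_all add: vcat_def)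
      then have b: "fdom (ntdom h) = fdom (ntdom f)" "fcod (ntdom h) = fcod (ntdom f)" "fdom (ntdom g) = fdom (ntdom f)" "fcod (ntdom g) = fcod (ntdom f)"
        by (simp_all add: i)
      show "(h \<cdot>\<^bsub>vcat CAT\<^esub> g) \<cdot>\<^bsub>vcat CAT\<^esub> f = h \<cdot>\<^bsub>vcat CAT\<^esub> g \<cdot>\<^bsub>vcat CAT\<^esub> f"
        using a category.Cmp_assoc[OF c(1)[OF a(3)]] n[OF a(1)] n[OF a(2)] n[OF a(3)] b
        by (intro nattr_eqI) (simp_all add: vcat_def)
    qed (simp_all add: vcat_def i)
  next
    fix \<tau>' \<tau> \<sigma>' \<sigma> :: "('a, 'b, 'a, 'b) nattr"
    assume "\<tau>' : cells CAT" "\<tau> : cells CAT" "\<sigma>' : cells CAT" "\<sigma> : cells CAT" "cdom CAT \<tau>' = ccod CAT \<tau>"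
      "cdom CAT \<sigma>' = ccod CAT \<sigma>" "src CAT (cdom CAT \<tau>) = tgt CAT (cdom CAT \<sigma>)"
    then have a: "is_nattr \<tau>'" "is_nattr \<tau>" "is_nattr \<sigma>'" "is_nattr \<sigma>" and d: "ntdom \<tau>' = ntcod \<tau>"
      "ntdom \<sigma>' = ntcod \<sigma>" "fdom (ntdom \<tau>) = fcod (ntdom \<sigma>)" by simp_all
    interpret \<tau>': is_nattr \<tau>' by fact
    interpret \<tau>: is_nattr \<tau> by fact
    interpret \<sigma>': is_nattr \<sigma>' by fact
    interpret \<sigma>: is_nattr \<sigma> by fact
    let ?B = "fdom (ntdom \<sigma>)" and ?C = "fdom (ntdom \<tau>)" and ?D = "fcod (ntdom \<tau>)"
    have b: "fdom (ntdom \<tau>') = ?C" "fcod (ntdom \<tau>') = ?D" "fdom (ntdom \<sigma>') = ?B" "fcod (ntdom \<sigma>') = ?C"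
      using d by simp_all
    have e: "(\<tau>' \<cdot>\<^sub>N \<tau>) \<star>\<^sub>N (\<sigma>' \<cdot>\<^sub>N \<sigma>) = (\<tau>' \<star>\<^sub>N \<sigma>') \<cdot>\<^sub>N (\<tau> \<star>\<^sub>N \<sigma>)"
    proof (rule nattr_eqI)
      fix x assume "x : Ob (fdom (ntdom ((\<tau>' \<star>\<^sub>N \<sigma>') \<cdot>\<^sub>N (\<tau> \<star>\<^sub>N \<sigma>))))"
      then have x [simp]: "x : Ob ?B" by simp
      have s [simp]: "ntc \<sigma> x : Ar ?C" "Dom ?C (ntc \<sigma> x) = fob (ntdom \<sigma>) x" "Cod ?C (ntc \<sigma> x) = fob (ntcod \<sigma>) x"
        "ntc \<sigma>' x : Ar ?C" "Dom ?C (ntc \<sigma>' x) = fob (ntcod \<sigma>) x" "Cod ?C (ntc \<sigma>' x) = fob (ntcod \<sigma>') x"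
        "fob (ntdom \<sigma>) x : Ob ?C" "fob (ntcod \<sigma>) x : Ob ?C" "fob (ntcod \<sigma>') x : Ob ?C"
        using n[OF a(4), of x] n[OF a(3), of x] d b by simp_all
      have t [simp]: "ntc \<tau>' y : Ar ?D" "Dom ?D (ntc \<tau>' y) = fob (ntcod \<tau>) y" "Cod ?D (ntc \<tau>' y) = fob (ntcod \<tau>') y" "fob (ntcod \<tau>) y : Ob ?D"
        if "y : Ob ?C" for y using n[OF a(1), of y] that d b by simp_all
      have u [simp]: "far (ntcod \<tau>) f : Ar ?D" "Dom ?D (far (ntcod \<tau>) f) = fob (ntcod \<tau>) (Dom ?C f)"
        "Cod ?D (far (ntcod \<tau>) f) = fob (ntcod \<tau>) (Cod ?C f)" if "f : Ar ?C" for f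
        using \<tau>.nc.functor_simps(2-4)[of f] that by simp_all
      \<comment> \<open>Interchange in \<open>CAT\<close> comes down to naturality of
        \<open>\<tau>\<close> at the component of \<open>\<sigma>'\<close>.\<close>
      have nat: "ntc \<tau> (fob (ntcod \<sigma>') x) \<cdot>\<^bsub>?D\<^esub> far (ntdom \<tau>) (ntc \<sigma>' x) = far (ntcod \<tau>) (ntc \<sigma>' x) \<cdot>\<^bsub>?D\<^esub> ntc \<tau> (fob (ntcod \<sigma>) x)"
        using \<tau>.ntc_nat[of "ntc \<sigma>' x"] by simp
      show "ntc ((\<tau>' \<cdot>\<^sub>N \<tau>) \<star>\<^sub>N (\<sigma>' \<cdot>\<^sub>N \<sigma>)) x = ntc ((\<tau>' \<star>\<^sub>N \<sigma>') \<cdot>\<^sub>N (\<tau> \<star>\<^sub>N \<sigma>)) x"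
        by (simp add: d(1,2) b d(3)[symmetric] nat[THEN \<tau>.nd.fcod.c22])
    qed (use a d b in simp_all)
    show "(\<tau>' \<bullet>\<^bsub>CAT\<^esub> \<tau>) \<star>\<^bsub>CAT\<^esub> (\<sigma>' \<bullet>\<^bsub>CAT\<^esub> \<sigma>) = (\<tau>' \<star>\<^bsub>CAT\<^esub> \<sigma>') \<bullet>\<^bsub>CAT\<^esub> (\<tau> \<star>\<^bsub>CAT\<^esub> \<sigma>)"
      using e by simp
  next
    fix \<rho> \<tau> \<sigma> :: "('a, 'b, 'a, 'b) nattr"
    assume "\<rho> : cells CAT" "\<tau> : cells CAT" "\<sigma> : cells CAT" "src CAT (cdom CAT \<rho>) = tgt CAT (cdom CAT \<tau>)"
      "src CAT (cdom CAT \<tau>) = tgt CAT (cdom CAT \<sigma>)"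
    then have a: "is_nattr \<rho>" "is_nattr \<tau>" "is_nattr \<sigma>" and d: "fdom (ntdom \<rho>) = fcod (ntdom \<tau>)" "fdom (ntdom \<tau>) = fcod (ntdom \<sigma>)" by simp_all
    interpret \<rho>: is_nattr \<rho> by fact
    interpret \<tau>: is_nattr \<tau> by fact
    interpret \<sigma>: is_nattr \<sigma> by fact
    have f: "(ntdom \<rho> \<circ>\<^sub>F ntdom \<tau>) \<circ>\<^sub>F ntdom \<sigma> = ntdom \<rho> \<circ>\<^sub>F ntdom \<tau> \<circ>\<^sub>F ntdom \<sigma>"
      "(ntcod \<rho> \<circ>\<^sub>F ntcod \<tau>) \<circ>\<^sub>F ntcod \<sigma> = ntcod \<rho> \<circ>\<^sub>F ntcod \<tau> \<circ>\<^sub>F ntcod \<sigma>"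
      using d \<sigma>.nd.functor_simps(1,2) \<sigma>.nc.functor_simps(1,2)
      by (auto intro!: functor_eqI simp: \<rho>.fun_ntdom \<tau>.fun_ntdom \<sigma>.fun_ntdom \<rho>.fun_ntcod \<tau>.fun_ntcod \<sigma>.fun_ntcod)
    have "(\<rho> \<star>\<^sub>N \<tau>) \<star>\<^sub>N \<sigma> = \<rho> \<star>\<^sub>N (\<tau> \<star>\<^sub>N \<sigma>)"
    proof (rule nattr_eqI)
      fix x assume "x : Ob (fdom (ntdom (\<rho> \<star>\<^sub>N (\<tau> \<star>\<^sub>N \<sigma>))))"
      then have x [simp]: "x : Ob (fdom (ntdom \<sigma>))" by simp
      have s [simp]: "ntc \<sigma> x : Ar (fdom (ntdom \<tau>))" "Dom (fdom (ntdom \<tau>)) (ntc \<sigma> x) = fob (ntdom \<sigma>) x"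
        "Cod (fdom (ntdom \<tau>)) (ntc \<sigma> x) = fob (ntcod \<sigma>) x"
        "fob (ntdom \<sigma>) x : Ob (fdom (ntdom \<tau>))" "fob (ntcod \<sigma>) x : Ob (fdom (ntdom \<tau>))"
        using n[OF a(3), of x] d by simp_all
      have t [simp]: "ntc \<tau> y : Ar (fdom (ntdom \<rho>))" "Dom (fdom (ntdom \<rho>)) (ntc \<tau> y) = fob (ntdom \<tau>) y"
        "Cod (fdom (ntdom \<rho>)) (ntc \<tau> y) = fob (ntcod \<tau>) y" "fob (ntdom \<tau>) y : Ob (fdom (ntdom \<rho>))" "fob (ntcod \<tau>) y : Ob (fdom (ntdom \<rho>))"
        if "y : Ob (fdom (ntdom \<tau>))" for y using n[OF a(2), of y] that d by simp_all
      have u [simp]: "far (ntdom \<tau>) f : Ar (fdom (ntdom \<rho>))" "Dom (fdom (ntdom \<rho>)) (far (ntdom \<tau>) f) = fob (ntdom \<tau>) (Dom (fdom (ntdom \<tau>)) f)"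
        "Cod (fdom (ntdom \<rho>)) (far (ntdom \<tau>) f) = fob (ntdom \<tau>) (Cod (fdom (ntdom \<tau>)) f)" if "f : Ar (fdom (ntdom \<tau>))" for f
        using \<tau>.nd.functor_simps(2-4)[of f] that d by simp_all
      show "ntc ((\<rho> \<star>\<^sub>N \<tau>) \<star>\<^sub>N \<sigma>) x = ntc (\<rho> \<star>\<^sub>N (\<tau> \<star>\<^sub>N \<sigma>)) x"
        by (simp add: d(1)[symmetric])
    qed (use a d f in simp_all)
    then show "(\<rho> \<star>\<^bsub>CAT\<^esub> \<tau>) \<star>\<^bsub>CAT\<^esub> \<sigma> = \<rho> \<star>\<^bsub>CAT\<^esub> (\<tau> \<star>\<^bsub>CAT\<^esub> \<sigma>)" by simp
  next
    fix \<sigma> :: "('a, 'b, 'a, 'b) nattr"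
    assume "\<sigma> : cells CAT"
    then have a: "is_nattr \<sigma>" by simp
    then interpret \<sigma>: is_nattr \<sigma> .
    have f: "ntdom \<sigma> \<circ>\<^sub>F func_id (fdom (ntdom \<sigma>)) = ntdom \<sigma>" "ntcod \<sigma> \<circ>\<^sub>F func_id (fdom (ntdom \<sigma>)) = ntcod \<sigma>"
      "func_id (fcod (ntdom \<sigma>)) \<circ>\<^sub>F ntdom \<sigma> = ntdom \<sigma>" "func_id (fcod (ntdom \<sigma>)) \<circ>\<^sub>F ntcod \<sigma> = ntcod \<sigma>"
      using \<sigma>.nc.functor_simps(1,2)
      by (auto intro!: functor_eqI simp: \<sigma>.fun_ntdom \<sigma>.fun_ntcod \<sigma>.nd.cat_fdom \<sigma>.nd.cat_fcod)
    have "\<sigma> \<star>\<^sub>N nt_id (func_id (fdom (ntdom \<sigma>))) = \<sigma>"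
      using a f by (intro nattr_eqI) (simp_all add: \<sigma>.nd.cat_fdom)
    then show "\<sigma> |>\<^bsub>CAT\<^esub> (id1 CAT (src CAT (cdom CAT \<sigma>))) = \<sigma>" by simp
    have "nt_id (func_id (fcod (ntdom \<sigma>))) \<star>\<^sub>N \<sigma> = \<sigma>"
      using a f n[OF a] by (intro nattr_eqI) (simp_all add: \<sigma>.nd.cat_fcod)
    then show "(id1 CAT (tgt CAT (cdom CAT \<sigma>))) <|\<^bsub>CAT\<^esub> \<sigma> = \<sigma>" by simp
  next
    fix g f :: "('a, 'b, 'a, 'b) func"
    assume "g : ars CAT" "f : ars CAT" "src CAT g = tgt CAT f"
    then have a: "is_functor g" "is_functor f" "fdom g = fcod f" by simp_all
    interpret g: is_functor g by fact
    interpret f: is_functor f by fact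
    have "nt_id g \<star>\<^sub>N nt_id f = nt_id (g \<circ>\<^sub>F f)"
      using a f.functor_simps(1) by (intro nattr_eqI) (simp_all add: a(3)[symmetric])
    then show "g <|\<^bsub>CAT\<^esub> id2 CAT f = id2 CAT (g \<odot>\<^bsub>CAT\<^esub> f)" by simp
  qed (simp_all add: i)
qed

interpretation CAT: two_category CAT
  by (rule two_category_CAT)

lemma strict_psfun_simps [simp]:
  "x : obs S ==> pf0 (strict_psfun S K F0 F1 F2) x = F0 x" "f : ars S ==> pf1 (strict_psfun S K F0 F1 F2) f = F1 f"
  "s : cells S ==> pf2 (strict_psfun S K F0 F1 F2) s = F2 s"
  "[|g : ars S; f : ars S; src S g = tgt S f|] ==> pfc (strict_psfun S K F0 F1 F2) (g, f) = id2 K (F1 (g \<odot>\<^bsub>S\<^esub> f))"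
  "x : obs S ==> pfi (strict_psfun S K F0 F1 F2) x = id2 K (F1 (id1 S x))"
  by (simp_all add: strict_psfun_def)

lemma (in two_categories) two_functor_strict:
  assumes "!!x. x : obs S ==> F0 x : obs K"
    and "!!f. f : ars S ==> F1 f : ars K" "!!f. f : ars S ==> src K (F1 f) = F0 (src S f)" "!!f. f : ars S ==> tgt K (F1 f) = F0 (tgt S f)"
    and "!!s. s : cells S ==> F2 s : cells K" "!!s. s : cells S ==> cdom K (F2 s) = F1 (cdom S s)"
      "!!s. s : cells S ==> ccod K (F2 s) = F1 (ccod S s)"
    and "!!x. x : obs S ==> F1 (id1 S x) = id1 K (F0 x)"
    and "!!g f. [|g : ars S; f : ars S; src S g = tgt S f|] ==> F1 (g \<odot>\<^bsub>S\<^esub> f) = F1 g \<odot> F1 f"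
    and "!!f. f : ars S ==> F2 (id2 S f) = id2 K (F1 f)"
    and "!!t s. [|t : cells S; s : cells S; cdom S t = ccod S s|] ==> F2 (t \<bullet>\<^bsub>S\<^esub> s) = F2 t \<bullet> F2 s"
    and "!!t s. [|t : cells S; s : cells S; src S (cdom S t) = tgt S (cdom S s)|] ==> F2 (t \<star>\<^bsub>S\<^esub> s) = F2 t \<star> F2 s"
  shows "two_functor S K (strict_psfun S K F0 F1 F2)"
proof -
  note [simp] = assms
  have "pseudofunctor S K (strict_psfun S K F0 F1 F2)"
    unfolding pseudofunctor_def
  proof (intro conjI allI impI)
    show "pf0 (strict_psfun S K F0 F1 F2) : extensional (obs S)" "pf1 (strict_psfun S K F0 F1 F2) : extensional (ars S)"
      "pf2 (strict_psfun S K F0 F1 F2) : extensional (cells S)" "pfc (strict_psfun S K F0 F1 F2) : extensional (cpairs S)"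
      "pfi (strict_psfun S K F0 F1 F2) : extensional (obs S)"
      by (simp_all add: strict_psfun_def)
  qed (simp_all add: in_hom1_def in_hom2_def)
  then show ?thesis by (auto simp: two_functor_def)
qed

lemma two_functorD: "two_functor S K F ==> pseudofunctor S K F"
  by (simp add: two_functor_def)

section \<open>Duals and representable 2-functors\<close>

lemma op1_simps [simp]:
  "obs (op1 K) = obs K" "ars (op1 K) = ars K" "cells (op1 K) = cells K" "src (op1 K) = tgt K" "tgt (op1 K) = src K"
  "cdom (op1 K) = cdom K" "ccod (op1 K) = ccod K" "id1 (op1 K) = id1 K" "id2 (op1 K) = id2 K"
  "g \<odot>\<^bsub>op1 K\<^esub> f = f \<odot>\<^bsub>K\<^esub> g" "vcomp (op1 K) = vcomp K" "t \<star>\<^bsub>op1 K\<^esub> s = s \<star>\<^bsub>K\<^esub> t"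
  by (simp_all add: op1_def)

lemma hom_cat_op1 [simp]: "hom_cat (op1 K) x y = hom_cat K y x"
  by (auto simp: hom_cat_def op1_def)

lemma corep_ar_simps [simp]:
  "fdom (corep_ar K x g) = hom_cat K x (src K g)" "fcod (corep_ar K x g) = hom_cat K x (tgt K g)"
  "[|f : ars K; src K f = x; tgt K f = src K g|] ==> fob (corep_ar K x g) f = g \<odot>\<^bsub>K\<^esub> f"
  "[|s : cells K; src K (cdom K s) = x; tgt K (cdom K s) = src K g|] ==> far (corep_ar K x g) s = g <|\<^bsub>K\<^esub> s"
  by (simp_all add: corep_ar_def)

lemma corep_cell_simps [simp]:
  "ntdom (corep_cell K x t) = corep_ar K x (cdom K t)" "ntcod (corep_cell K x t) = corep_ar K x (ccod K t)"
  "[|f : ars K; src K f = x; tgt K f = src K (cdom K t)|] ==> ntc (corep_cell K x t) f = t |>\<^bsub>K\<^esub> f"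
  by (simp_all add: corep_cell_def)

context two_category
begin

lemma two_category_op1: "two_category (op1 K)"
  unfolding two_category_def
proof (intro conjI allI impI)
  show "category (cat1 (op1 K))"
    by (simp add: category_def cat1_def)
  show "category (vcat (op1 K))"
    using category_vcat by (simp add: vcat_def)
qed (simp_all add: interchange)

lemma is_functor_corep_ar [simp]: "g : ars K ==> is_functor (corep_ar K x g)"
  unfolding is_functor_def
  by (simp add: category_hom_cat, simp add: corep_ar_def)

lemma is_nattr_corep_cell [simp]: "t : cells K ==> is_nattr (corep_cell K x t)"
  unfolding is_nattr_def
proof (intro conjI allI impI)
  fix f assume "t : cells K" "f : Ar (fdom (ntdom (corep_cell K x t)))"
  then show "ntc (corep_cell K x t) (Cod (fdom (ntdom (corep_cell K x t))) f) \<cdot>\<^bsub>fcod (ntdom (corep_cell K x t))\<^esub> far (ntdom (corep_cell K x t)) f =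
       far (ntcod (corep_cell K x t)) f \<cdot>\<^bsub>fcod (ntdom (corep_cell K x t))\<^esub> ntc (corep_cell K x t) (Dom (fdom (ntdom (corep_cell K x t))) f)"
    using slide_refl[of t f] by simp
qed (simp_all, simp add: corep_cell_def)

lemma two_functor_corep: "two_functor K CAT (corep K x)"
proof -
  interpret two_categories K CAT by unfold_locales
  show ?thesis
    unfolding corep_def
  proof (rule two_functor_strict)
    show "corep_ar K x (id1 K y) = id1 CAT (hom_cat K x y)" if "y : obs K" for y
      using that by (auto intro!: functor_eqI simp: category_hom_cat)
    show "corep_ar K x (g \<odot> f) = corep_ar K x g \<odot>\<^bsub>CAT\<^esub> corep_ar K x f" if "g : ars K" "f : ars K" "src K g = tgt K f" for g f
      using that by (auto intro!: functor_eqI)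
    show "corep_cell K x (id2 K f) = id2 CAT (corep_ar K x f)" if "f : ars K" for f
      using that by (auto intro!: nattr_eqI)
    show "corep_cell K x (t \<bullet> s) = corep_cell K x t \<bullet>\<^bsub>CAT\<^esub> corep_cell K x s"
      if "t : cells K" "s : cells K" "cdom K t = ccod K s" for t s
      using that by (auto intro!: nattr_eqI)
    show "corep_cell K x (t \<star> s) = corep_cell K x t \<star>\<^bsub>CAT\<^esub> corep_cell K x s"
      if a [simp]: "t : cells K" "s : cells K" "src K (cdom K t) = tgt K (cdom K s)" for t s
    proof -
      have f: "corep_ar K x (cdom K t \<odot> cdom K s) = corep_ar K x (cdom K t) \<circ>\<^sub>F corep_ar K x (cdom K s)"
        "corep_ar K x (ccod K t \<odot> ccod K s) = corep_ar K x (ccod K t) \<circ>\<^sub>F corep_ar K x (ccod K s)"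
        by (auto intro!: functor_eqI)
      have "corep_cell K x (t \<star> s) = corep_cell K x t \<star>\<^sub>N corep_cell K x s"
      proof (rule nattr_eqI)
        fix f assume "f : Ob (fdom (ntdom (corep_cell K x t \<star>\<^sub>N corep_cell K x s)))"
        then have "f : ars K" "src K f = x" "tgt K f = src K (cdom K s)" by simp_all
        then show "ntc (corep_cell K x (t \<star> s)) f = ntc (corep_cell K x t \<star>\<^sub>N corep_cell K x s) f"
          using hcomp_eq(1)[of t s] by simp
      qed (simp_all add: f)
      then show ?thesis by simp
    qed
  qed (simp_all add: category_hom_cat)
qed

end

lemma corep_simps [simp]:
  "y : obs K ==> pf0 (corep K x) y = hom_cat K x y" "g : ars K ==> pf1 (corep K x) g = corep_ar K x g"
  "t : cells K ==> pf2 (corep K x) t = corep_cell K x t"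
  by (simp_all add: corep_def)

section \<open>Equivalences as faithful, full and essentially surjective functors\<close>

lemma equivalence_functorD:
  assumes "equivalence_functor F"
  shows "is_functor F" "faithful_on (fdom F) (far F)" "full_on (fdom F) (fcod F) (fob F) (far F)"
    "ess_surj_on (fdom F) (fcod F) (fob F)"
proof -
  obtain G \<sigma> \<tau> where F: "is_functor F" and G: "is_functor G" "fdom G = fcod F" "fcod G = fdom F"
    and s: "is_nattr \<sigma>" "ntdom \<sigma> = func_id (fdom F)" "ntcod \<sigma> = G \<circ>\<^sub>F F" "!!x. x : Ob (fdom F) ==> is_iso (fdom F) (ntc \<sigma> x)"
    and t: "is_nattr \<tau>" "ntdom \<tau> = F \<circ>\<^sub>F G" "ntcod \<tau> = func_id (fcod F)" "!!x. x : Ob (fcod F) ==> is_iso (fcod F) (ntc \<tau> x)"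
    using assms unfolding equivalence_functor_def is_nat_iso_def by auto
  interpret F: is_functor F by fact
  interpret G: is_functor G by fact
  interpret \<sigma>: is_nattr \<sigma> by fact
  interpret \<tau>: is_nattr \<tau> by fact
  let ?C = "fdom F" and ?D = "fcod F"
  note [simp] = G(2,3)
  note [simp] = G.functor_simps[unfolded G(2,3)]
  have s' [simp]: "ntc \<sigma> x : Ar ?C" "Dom ?C (ntc \<sigma> x) = x" "Cod ?C (ntc \<sigma> x) = fob G (fob F x)" if "x : Ob ?C" for x
    using that \<sigma>.ntc_hom[of x] by (simp_all add: s Homset_def)
  have t' [simp]: "ntc \<tau> x : Ar ?D" "Dom ?D (ntc \<tau> x) = fob F (fob G x)" "Cod ?D (ntc \<tau> x) = x" if "x : Ob ?D" for x
    using that \<tau>.ntc_hom[of x] by (simp_all add: t Homset_def)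
  have sn: "ntc \<sigma> (Cod ?C f) \<cdot>\<^bsub>?C\<^esub> f = far G (far F f) \<cdot>\<^bsub>?C\<^esub> ntc \<sigma> (Dom ?C f)" if "f : Ar ?C" for f
    using \<sigma>.ntc_nat[of f] that by (simp add: s)
  have tn: "ntc \<tau> (Cod ?D f) \<cdot>\<^bsub>?D\<^esub> far F (far G f) = f \<cdot>\<^bsub>?D\<^esub> ntc \<tau> (Dom ?D f)" if "f : Ar ?D" for f
    using \<tau>.ntc_nat[of f] that by (simp add: t)
  show "is_functor F" by fact
  show "faithful_on ?C (far F)"
    unfolding faithful_on_def
  proof (intro ballI impI)
    fix r r' assume r: "r : Ar ?C" "r' : Ar ?C" "Dom ?C r = Dom ?C r'" "Cod ?C r = Cod ?C r'" "far F r = far F r'"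
    then have "ntc \<sigma> (Cod ?C r) \<cdot>\<^bsub>?C\<^esub> r = ntc \<sigma> (Cod ?C r) \<cdot>\<^bsub>?C\<^esub> r'"
      using sn[of r] sn[of r'] by simp
    moreover obtain i where "inverse_arrows ?C (ntc \<sigma> (Cod ?C r)) i" using s(4)[of "Cod ?C r"] r by (auto simp: is_iso_def)
    ultimately show "r = r'" by (elim F.fdom.iso_cancel_left[rotated]) (use r in simp_all)
  qed
  \<comment> \<open>The quasi-inverse is faithful as well; fullness of \<open>F\<close> follows from
    this by transposing through \<open>\<sigma>\<close>.\<close>
  have Gf: "r = r'" if r: "r : Ar ?D" "r' : Ar ?D" "Dom ?D r = Dom ?D r'" "Cod ?D r = Cod ?D r'" "far G r = far G r'" for r r'
  proof -
    have "r \<cdot>\<^bsub>?D\<^esub> ntc \<tau> (Dom ?D r) = r' \<cdot>\<^bsub>?D\<^esub> ntc \<tau> (Dom ?D r)"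
      using tn[of r] tn[of r'] r by simp
    moreover obtain i where "inverse_arrows ?D (ntc \<tau> (Dom ?D r)) i" using t(4)[of "Dom ?D r"] r by (auto simp: is_iso_def)
    ultimately show "r = r'" by (elim F.fcod.iso_cancel_right[rotated]) (use r in simp_all)
  qed
  show "full_on ?C ?D (fob F) (far F)"
    unfolding full_on_def
  proof (intro ballI)
    fix x y s assume x [simp]: "x : Ob ?C" "y : Ob ?C" and "s : Homset ?D (fob F x) (fob F y)"
    then have [simp]: "s : Ar ?D" "Dom ?D s = fob F x" "Cod ?D s = fob F y" by (auto simp: Homset_def)
    obtain i where i: "inverse_arrows ?C (ntc \<sigma> y) i" using s(4)[of y] by (auto simp: is_iso_def)
    then have [simp]: "i : Ar ?C" "Dom ?C i = fob G (fob F y)" "Cod ?C i = y" and yi: "ntc \<sigma> y \<cdot>\<^bsub>?C\<^esub> i = Idt ?C (fob G (fob F y))"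
      by (auto simp: inverse_arrows_def)
    obtain i' where i': "inverse_arrows ?C (ntc \<sigma> x) i'" using s(4)[of x] by (auto simp: is_iso_def)
    define r where "r = i \<cdot>\<^bsub>?C\<^esub> far G s \<cdot>\<^bsub>?C\<^esub> ntc \<sigma> x"
    have r [simp]: "r : Ar ?C" "Dom ?C r = x" "Cod ?C r = y" by (simp_all add: r_def)
    have "far G (far F r) \<cdot>\<^bsub>?C\<^esub> ntc \<sigma> x = ntc \<sigma> y \<cdot>\<^bsub>?C\<^esub> r"
      using sn[OF r(1)] by simp
    also have "\<dots> = far G s \<cdot>\<^bsub>?C\<^esub> ntc \<sigma> x" by (simp add: r_def yi[THEN F.fdom.c21])
    finally have "far G (far F r) = far G s"
      by (rule F.fdom.iso_cancel_right[OF i']) simp_all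
    then have "far F r = s" by (intro Gf) simp_all
    then show "EX r : Homset ?C x y. far F r = s" by (intro bexI[of _ r]) (simp_all add: Homset_def)
  qed
  show "ess_surj_on ?C ?D (fob F)"
    unfolding ess_surj_on_def
  proof
    fix y assume y: "y : Ob ?D"
    then show "EX x : Ob ?C. EX s : Homset ?D (fob F x) y. is_iso ?D s"
      using t(4)[OF y] by (intro bexI[of _ "fob G y"] bexI[of _ "ntc \<tau> y"]) (simp_all add: Homset_def)
  qed
qed

text \<open>The quasi-inverse chooses preimages \<open>g\<close> of objects and lifts, for each
  arrow, its conjugate by the chosen isomorphisms. Faithfulness turns all functor and naturality
  laws into cancellations in the target category.\<close>

lemma equivalence_functorI:
  assumes F: "is_functor F" and f: "faithful_on (fdom F) (far F)" and fu: "full_on (fdom F) (fcod F) (fob F) (far F)"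
    and e: "ess_surj_on (fdom F) (fcod F) (fob F)"
  shows "equivalence_functor F"
proof -
  interpret F: is_functor F by fact
  let ?C = "fdom F" and ?D = "fcod F"
  have "EX x s t. x : Ob ?C & s : Homset ?D (fob F x) y & inverse_arrows ?D s t" if "y : Ob ?D" for y
    using e that unfolding ess_surj_on_def is_iso_def by blast
  then obtain g s t where g [simp]: "!!y. y : Ob ?D ==> g y : Ob ?C" and s: "!!y. y : Ob ?D ==> s y : Homset ?D (fob F (g y)) y"
    and st: "!!y. y : Ob ?D ==> inverse_arrows ?D (s y) (t y)" by metis
  have s' [simp]: "s y : Ar ?D" "Dom ?D (s y) = fob F (g y)" "Cod ?D (s y) = y"
    "t y : Ar ?D" "Dom ?D (t y) = y" "Cod ?D (t y) = fob F (g y)" "s y \<cdot>\<^bsub>?D\<^esub> t y = Idt ?D y" "t y \<cdot>\<^bsub>?D\<^esub> s y = Idt ?D (fob F (g y))"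
    if "y : Ob ?D" for y
    using s[OF that] st[OF that] by (auto simp: Homset_def inverse_arrows_def)
  have l: "EX r. r : Ar ?C & Dom ?C r = x & Cod ?C r = y & far F r = v"
    if "x : Ob ?C" "y : Ob ?C" "v : Ar ?D" "Dom ?D v = fob F x" "Cod ?D v = fob F y" for x y v
    using fu that unfolding full_on_def Homset_def by blast
  have fD: "r = r'" if "r : Ar ?C" "r' : Ar ?C" "Dom ?C r = Dom ?C r'" "Cod ?C r = Cod ?C r'" "far F r = far F r'" for r r'
    using f that unfolding faithful_on_def by blast
  have "EX r. r : Ar ?C & Dom ?C r = g (Dom ?D v) & Cod ?C r = g (Cod ?D v) & far F r = t (Cod ?D v) \<cdot>\<^bsub>?D\<^esub> v \<cdot>\<^bsub>?D\<^esub> s (Dom ?D v)"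
    if "v : Ar ?D" for v
    using that by (intro l) simp_all
  then obtain ga where ga [simp]: "!!v. v : Ar ?D ==> ga v : Ar ?C" "!!v. v : Ar ?D ==> Dom ?C (ga v) = g (Dom ?D v)"
    "!!v. v : Ar ?D ==> Cod ?C (ga v) = g (Cod ?D v)" "!!v. v : Ar ?D ==> far F (ga v) = t (Cod ?D v) \<cdot>\<^bsub>?D\<^esub> v \<cdot>\<^bsub>?D\<^esub> s (Dom ?D v)"
    by metis
  define G where "G = \<lparr>fdom = ?D, fcod = ?C, fob = restrict g (Ob ?D), far = restrict ga (Ar ?D)\<rparr>"
  have [simp]: "fdom G = ?D" "fcod G = ?C" "!!y. y : Ob ?D ==> fob G y = g y" "!!v. v : Ar ?D ==> far G v = ga v"
    by (simp_all add: G_def)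
  have ss [simp]: "[|v : Ar ?D; Cod ?D v = y; y : Ob ?D|] ==> s y \<cdot>\<^bsub>?D\<^esub> t y \<cdot>\<^bsub>?D\<^esub> v = v"
    "[|v : Ar ?D; Cod ?D v = fob F (g y); y : Ob ?D|] ==> t y \<cdot>\<^bsub>?D\<^esub> s y \<cdot>\<^bsub>?D\<^esub> v = v" for y v
    using F.fcod.c21[OF s'(7)] F.fcod.c21[OF s'(8)] by auto
  have G [simp]: "is_functor G"
    unfolding is_functor_def
  proof (intro conjI allI impI)
    fix x assume "x : Ob (fdom G)"
    then show "far G (Idt (fdom G) x) = Idt (fcod G) (fob G x)" by (simp, intro fD) simp_all
  next
    fix v u assume a: "v : Ar (fdom G)" "u : Ar (fdom G)" "Dom (fdom G) v = Cod (fdom G) u"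
    then have [simp]: "v : Ar ?D" "u : Ar ?D" "Dom ?D v = Cod ?D u" by simp_all
    show "far G (v \<cdot>\<^bsub>fdom G\<^esub> u) = far G v \<cdot>\<^bsub>fcod G\<^esub> far G u"
      using ss(1)[of "u \<cdot>\<^bsub>?D\<^esub> s (Dom ?D u)"] by (simp, intro fD) simp_all
  qed (simp_all add: F.cat_fdom F.cat_fcod, simp_all add: G_def)
  have "EX r. r : Ar ?C & Dom ?C r = x & Cod ?C r = g (fob F x) & far F r = t (fob F x)"
    if "x : Ob ?C" for x
    using that by (intro l) simp_all
  then obtain n where n [simp]: "!!x. x : Ob ?C ==> n x : Ar ?C" "!!x. x : Ob ?C ==> Dom ?C (n x) = x"
    "!!x. x : Ob ?C ==> Cod ?C (n x) = g (fob F x)" "!!x. x : Ob ?C ==> far F (n x) = t (fob F x)" by metis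
  have "EX r. r : Ar ?C & Dom ?C r = g (fob F x) & Cod ?C r = x & far F r = s (fob F x)"
    if "x : Ob ?C" for x
    using that by (intro l) simp_all
  then obtain n' where n' [simp]: "!!x. x : Ob ?C ==> n' x : Ar ?C" "!!x. x : Ob ?C ==> Dom ?C (n' x) = g (fob F x)"
    "!!x. x : Ob ?C ==> Cod ?C (n' x) = x" "!!x. x : Ob ?C ==> far F (n' x) = s (fob F x)" by metis
  have ni: "inverse_arrows ?C (n x) (n' x)" if "x : Ob ?C" for x
    using that by (auto simp: inverse_arrows_def intro!: fD)
  define \<sigma> where "\<sigma> = \<lparr>ntdom = func_id ?C, ntcod = G \<circ>\<^sub>F F, ntc = restrict n (Ob ?C)\<rparr>"
  define \<tau> where "\<tau> = \<lparr>ntdom = F \<circ>\<^sub>F G, ntcod = func_id ?D, ntc = restrict s (Ob ?D)\<rparr>"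
  have [simp]: "ntdom \<sigma> = func_id ?C" "ntcod \<sigma> = G \<circ>\<^sub>F F" "!!x. x : Ob ?C ==> ntc \<sigma> x = n x"
    "ntdom \<tau> = F \<circ>\<^sub>F G" "ntcod \<tau> = func_id ?D" "!!x. x : Ob ?D ==> ntc \<tau> x = s x"
    by (simp_all add: \<sigma>_def \<tau>_def)
  have "is_nattr \<sigma>"
    unfolding is_nattr_def
  proof (intro conjI allI impI)
    fix f assume "f : Ar (fdom (ntdom \<sigma>))"
    then have [simp]: "f : Ar ?C" by simp
    show "ntc \<sigma> (Cod (fdom (ntdom \<sigma>)) f) \<cdot>\<^bsub>fcod (ntdom \<sigma>)\<^esub> far (ntdom \<sigma>) f = far (ntcod \<sigma>) f \<cdot>\<^bsub>fcod (ntdom \<sigma>)\<^esub> ntc \<sigma> (Dom (fdom (ntdom \<sigma>)) f)"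
      by (simp, intro fD) simp_all
  qed (simp_all add: F F.cat_fdom Homset_def, simp add: \<sigma>_def)
  moreover have "is_nattr \<tau>"
    unfolding is_nattr_def
  proof (intro conjI allI impI)
    fix f assume "f : Ar (fdom (ntdom \<tau>))"
    then have [simp]: "f : Ar ?D" by simp
    show "ntc \<tau> (Cod (fdom (ntdom \<tau>)) f) \<cdot>\<^bsub>fcod (ntdom \<tau>)\<^esub> far (ntdom \<tau>) f = far (ntcod \<tau>) f \<cdot>\<^bsub>fcod (ntdom \<tau>)\<^esub> ntc \<tau> (Dom (fdom (ntdom \<tau>)) f)"
      by simp
  qed (simp_all add: F F.cat_fcod Homset_def, simp add: \<tau>_def)
  ultimately show ?thesis
    unfolding equivalence_functor_def is_nat_iso_def is_iso_def using ni st
    by (intro conjI F exI[of _ G] exI[of _ \<sigma>] exI[of _ \<tau>]) auto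
qed

section \<open>Representability and monadicity\<close>

text \<open>The three properties are invariant under natural isomorphism. The second functor is
  given only by typed raw maps, which is how evaluation at a universal element arises below.\<close>

lemma functor_iso_transfer:
  assumes C: "category C" and D: "category D" and P: "functor_on C D Po Pa"
    and Fa: "!!r. r : Ar C ==> Fa r : Homset D (Fo (Dom C r)) (Fo (Cod C r))"
    and c: "!!x. x : Ob C ==> c x : Homset D (Fo x) (Po x)" "!!x. x : Ob C ==> is_iso D (c x)"
    and nat: "!!r. r : Ar C ==> c (Cod C r) \<cdot>\<^bsub>D\<^esub> Fa r = Pa r \<cdot>\<^bsub>D\<^esub> c (Dom C r)"
  shows "faithful_on C Pa ==> faithful_on C Fa"
    and "full_on C D Po Pa ==> full_on C D Fo Fa"
    and "ess_surj_on C D Po ==> ess_surj_on C D Fo"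
proof -
  interpret C: category C by fact
  interpret D: category D by fact
  note [simp] = functor_onD[OF P]
  have F [simp]: "Fa r : Ar D" "Dom D (Fa r) = Fo (Dom C r)" "Cod D (Fa r) = Fo (Cod C r)" if "r : Ar C" for r
    using Fa[OF that] by (auto simp: Homset_def)
  obtain i where i: "!!x. x : Ob C ==> inverse_arrows D (c x) (i x)"
    using c(2) unfolding is_iso_def by metis
  have c' [simp]: "c x : Ar D" "Dom D (c x) = Fo x" "Cod D (c x) = Po x" "i x : Ar D" "Dom D (i x) = Po x" "Cod D (i x) = Fo x"
    if "x : Ob C" for x
    using c(1)[OF that] i[OF that] by (auto simp: Homset_def inverse_arrows_def)
  have ci: "c x \<cdot>\<^bsub>D\<^esub> i x = Idt D (Po x)" "i x \<cdot>\<^bsub>D\<^esub> c x = Idt D (Fo x)" if "x : Ob C" for x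
    using i[OF that] that by (simp_all add: inverse_arrows_def)
  have Fo [simp]: "Fo x : Ob D" if "x : Ob C" for x using D.cat_simps(1)[of "c x"] that by simp
  show "faithful_on C Fa" if f: "faithful_on C Pa"
    unfolding faithful_on_def
  proof (intro ballI impI)
    fix r r' assume r [simp]: "r : Ar C" "r' : Ar C" "Dom C r = Dom C r'" "Cod C r = Cod C r'" "Fa r = Fa r'"
    then have "Pa r \<cdot>\<^bsub>D\<^esub> c (Dom C r') = Pa r' \<cdot>\<^bsub>D\<^esub> c (Dom C r')"
      using nat[of r] nat[of r'] by simp
    then have "Pa r = Pa r'" by (rule D.iso_cancel_right[OF i, rotated]) simp_all
    then show "r = r'" using f unfolding faithful_on_def by simp
  qed
  show "full_on C D Fo Fa" if f: "full_on C D Po Pa"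
    unfolding full_on_def
  proof (intro ballI)
    fix x y s assume x [simp]: "x : Ob C" "y : Ob C" and s: "s : Homset D (Fo x) (Fo y)"
    then have [simp]: "s : Ar D" "Dom D s = Fo x" "Cod D s = Fo y" by (auto simp: Homset_def)
    have "c y \<cdot>\<^bsub>D\<^esub> s \<cdot>\<^bsub>D\<^esub> i x : Homset D (Po x) (Po y)" by (simp add: Homset_def)
    then obtain r where r: "r : Homset C x y" "Pa r = c y \<cdot>\<^bsub>D\<^esub> s \<cdot>\<^bsub>D\<^esub> i x" using f x unfolding full_on_def by blast
    then have [simp]: "r : Ar C" "Dom C r = x" "Cod C r = y" by (auto simp: Homset_def)
    have "c y \<cdot>\<^bsub>D\<^esub> Fa r = c y \<cdot>\<^bsub>D\<^esub> s" using nat[of r] by (simp add: r(2) ci)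
    then have "Fa r = s" by (rule D.iso_cancel_left[OF i, rotated]) simp_all
    then show "EX r : Homset C x y. Fa r = s" using r by blast
  qed
  show "ess_surj_on C D Fo" if e: "ess_surj_on C D Po"
    unfolding ess_surj_on_def
  proof
    fix y assume "y : Ob D"
    then obtain x s where x [simp]: "x : Ob C" and s: "s : Homset D (Po x) y" "is_iso D s" using e unfolding ess_surj_on_def by blast
    from s obtain t where t: "inverse_arrows D s t" by (auto simp: is_iso_def)
    have "inverse_arrows D (s \<cdot>\<^bsub>D\<^esub> c x) (i x \<cdot>\<^bsub>D\<^esub> t)"
      by (rule D.inverse_arrows_Cmp[OF i t]) (use s in \<open>simp_all add: Homset_def\<close>)
    then show "EX x : Ob C. EX s : Homset D (Fo x) y. is_iso D s"
      using s(1) by (intro bexI[of _ x] bexI[of _ "s \<cdot>\<^bsub>D\<^esub> c x"]) (auto simp: is_iso_def Homset_def)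
  qed
qed

text \<open>Bicategorical Yoneda: a representation \<open>H(-, L) \<simeq> G\<close> is given by its universal element \<open>u\<close>.\<close>

locale representation = two_category H + pseudonat_equivalence "op1 H" "corep (op1 H) L" G \<Phi> \<phi>
  for H :: "('o, 'm, 'c) tcat" and L and G :: "('o, 'm, 'c, ('x, 'y) cat, ('x, 'y, 'x, 'y) func, ('x, 'y, 'x, 'y) nattr) psfun" and \<Phi> \<phi> +
  assumes L [simp]: "L : obs H"
begin

sublocale OP: two_category "op1 H" by (rule two_category_op1)

sublocale G: pseudofunctor "op1 H" CAT G by (rule psfun_G)

definition u where "u = fob (\<Phi> L) (id1 H L)"

lemma Phi:
  assumes "X : obs H"
  shows "is_functor (\<Phi> X)" "fdom (\<Phi> X) = hom_cat H X L" "fcod (\<Phi> X) = pf0 G X"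
  using equiv[of X] assms by (auto simp: equivalence_functor_def)

lemma u_Ob: "u : Ob (pf0 G L)"
  using is_functor.functor_simps(1)[OF Phi(1)[OF L], of "id1 H L"] Phi(2,3)[OF L] by (simp add: u_def)

lemma pf1_G:
  assumes "f : ars H"
  shows "is_functor (pf1 G f)" "fdom (pf1 G f) = pf0 G (tgt H f)" "fcod (pf1 G f) = pf0 G (src H f)"
  using G.pf_simps(2-4)[of f] assms by simp_all

lemma pf2_G:
  assumes "s : cells H"
  shows "is_nattr (pf2 G s)" "ntdom (pf2 G s) = pf1 G (cdom H s)" "ntcod (pf2 G s) = pf1 G (ccod H s)"
  using G.pf_simps(5-7)[of s] assms by simp_all

text \<open>The component at the identity of the naturality isomorphism: it compares the restriction
  of the universal element along \<open>f\<close> with the value of the representation at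
  \<open>f\<close>.\<close>

lemma comparison_iso:
  assumes [simp]: "f : ars H" "tgt H f = L"
  shows "ntc (\<phi> f) (id1 H L) : Homset (pf0 G (src H f)) (fob (pf1 G f) u) (fob (\<Phi> (src H f)) f)"
    and "is_iso (pf0 G (src H f)) (ntc (\<phi> f) (id1 H L))"
proof -
  have n: "is_nattr (\<phi> f)" and i: "!!x. x : Ob (fdom (ntdom (\<phi> f))) ==> is_iso (fcod (ntdom (\<phi> f))) (ntc (\<phi> f) x)"
    and d: "ntdom (\<phi> f) = pf1 G f \<circ>\<^sub>F \<Phi> L" "ntcod (\<phi> f) = \<Phi> (src H f) \<circ>\<^sub>F corep_ar (op1 H) L f"
    using nat_iso[of f] by (auto simp: is_nat_iso_def)
  interpret is_nattr "\<phi> f" by fact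
  have [simp]: "id1 H L : Ob (fdom (ntdom (\<phi> f)))" by (simp add: d Phi)
  show "ntc (\<phi> f) (id1 H L) : Homset (pf0 G (src H f)) (fob (pf1 G f) u) (fob (\<Phi> (src H f)) f)"
    using ntc_hom[of "id1 H L"] by (simp add: d Phi pf1_G u_def)
  show "is_iso (pf0 G (src H f)) (ntc (\<phi> f) (id1 H L))"
    using i[of "id1 H L"] by (simp add: d pf1_G Phi)
qed

lemma comparison_nat:
  assumes s [simp]: "\<sigma> : cells H" "tgt H (cdom H \<sigma>) = L"
  shows "ntc (\<phi> (ccod H \<sigma>)) (id1 H L) \<cdot>\<^bsub>pf0 G (src H (cdom H \<sigma>))\<^esub> ntc (pf2 G \<sigma>) u
    = far (\<Phi> (src H (cdom H \<sigma>))) \<sigma> \<cdot>\<^bsub>pf0 G (src H (cdom H \<sigma>))\<^esub> ntc (\<phi> (cdom H \<sigma>)) (id1 H L)"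
proof -
  let ?X = "src H (cdom H \<sigma>)"
  interpret PL: is_functor "\<Phi> L" by (rule Phi) simp
  interpret PX: is_functor "\<Phi> ?X" by (rule Phi) simp
  interpret g: is_nattr "pf2 G \<sigma>" by (rule pf2_G) simp
  note [simp] = Phi(2,3) pf1_G(2,3) pf2_G(2,3)
  note [simp] = g.nd.functor_simps[simplified]
  have d: "ntdom (\<phi> f) = pf1 G f \<circ>\<^sub>F \<Phi> L" "ntcod (\<phi> f) = \<Phi> (src H f) \<circ>\<^sub>F corep_ar (op1 H) L f" if "f : ars H" "tgt H f = L" for f
    using nat_iso[of f] that by auto
  have [simp]: "category (pf0 G ?X)" "category (pf0 G L)" using G.pf_simps(1)[of ?X] G.pf_simps(1)[of L] by simp_all
  have gu: "ntc (pf2 G \<sigma>) u : Ar (pf0 G ?X)" "Dom (pf0 G ?X) (ntc (pf2 G \<sigma>) u) = fob (pf1 G (cdom H \<sigma>)) u"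
    using g.ntc_hom[of u] u_Ob by (simp_all add: Homset_def)
  have far: "far (pf1 G (cdom H \<sigma>)) (Idt (pf0 G L) u) = Idt (pf0 G ?X) (fob (pf1 G (cdom H \<sigma>)) u)"
    using g.nd.far_Id[of u] u_Ob by simp
  have fs: "far (\<Phi> ?X) \<sigma> : Ar (pf0 G ?X)" "Cod (pf0 G ?X) (far (\<Phi> ?X) \<sigma>) = fob (\<Phi> ?X) (ccod H \<sigma>)"
    using PX.functor_simps(2)[of \<sigma>] PX.functor_simps(4)[of \<sigma>] by simp_all
  have ou: "fob (\<Phi> ?X) (ccod H \<sigma>) : Ob (pf0 G ?X)"
    using PX.functor_simps(1)[of "ccod H \<sigma>"] by simp
  have "ntc (\<phi> (ccod H \<sigma>) \<cdot>\<^sub>N (pf2 G \<sigma> \<star>\<^sub>N nt_id (\<Phi> L))) (id1 H L)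
    = ntc ((nt_id (\<Phi> ?X) \<star>\<^sub>N pf2 (corep (op1 H) L) \<sigma>) \<cdot>\<^sub>N \<phi> (cdom H \<sigma>)) (id1 H L)"
    using natural[of \<sigma>] by simp
  then show ?thesis
    using category.cat_simps(9)[of "pf0 G ?X" "ntc (pf2 G \<sigma>) u"] category.cat_simps(10)[of "pf0 G ?X" "far (\<Phi> ?X) \<sigma>"] gu fs ou
    by (simp add: d u_def[symmetric] far category.cat_simps(3,4,5))
qed

text \<open>Each \<open>\<Phi> X\<close> is an equivalence, and \<open>comparison_iso\<close> with
  \<open>comparison_nat\<close> makes it naturally isomorphic to evaluation at \<open>u\<close>; so
  evaluation inherits all three properties.\<close>

lemma universal:
  assumes X: "X : obs H"
  shows "faithful_on (hom_cat H X L) (%s. ntc (pf2 G s) u)"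
    and "full_on (hom_cat H X L) (pf0 G X) (%f. fob (pf1 G f) u) (%s. ntc (pf2 G s) u)"
    and "ess_surj_on (hom_cat H X L) (pf0 G X) (%f. fob (pf1 G f) u)"
proof -
  note [simp] = Phi(2,3)[OF X]
  have e: "equivalence_functor (\<Phi> X)" using equiv[of X] X by simp
  note e = equivalence_functorD[OF e, simplified]
  have c: "category (hom_cat H X L)" "category (pf0 G X)"
    using G.pf_simps(1)[of X] X by (simp_all add: category_hom_cat)
  have f: "functor_on (hom_cat H X L) (pf0 G X) (fob (\<Phi> X)) (far (\<Phi> X))"
    using is_functor.functor_on[OF e(1)] by simp
  have Fa: "ntc (pf2 G r) u : Homset (pf0 G X) (fob (pf1 G (Dom (hom_cat H X L) r)) u) (fob (pf1 G (Cod (hom_cat H X L) r)) u)"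
    if "r : Ar (hom_cat H X L)" for r
  proof -
    have r: "r : cells H" "src H (cdom H r) = X" "tgt H (cdom H r) = L" using that by simp_all
    interpret g: is_nattr "pf2 G r" by (rule pf2_G) fact
    show ?thesis using g.ntc_hom[of u] u_Ob r by (simp add: pf2_G pf1_G)
  qed
  have c1: "ntc (\<phi> f) (id1 H L) : Homset (pf0 G X) (fob (pf1 G f) u) (fob (\<Phi> X) f)" "is_iso (pf0 G X) (ntc (\<phi> f) (id1 H L))"
    if "f : Ob (hom_cat H X L)" for f
    using comparison_iso[of f] that by auto
  have n: "ntc (\<phi> (Cod (hom_cat H X L) r)) (id1 H L) \<cdot>\<^bsub>pf0 G X\<^esub> ntc (pf2 G r) u = far (\<Phi> X) r \<cdot>\<^bsub>pf0 G X\<^esub> ntc (\<phi> (Dom (hom_cat H X L) r)) (id1 H L)"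
    if "r : Ar (hom_cat H X L)" for r
    using comparison_nat[of r] that by auto
  note t = functor_iso_transfer[OF c f, of "%s. ntc (pf2 G s) u" "%f. fob (pf1 G f) u" "%f. ntc (\<phi> f) (id1 H L)", OF Fa c1 n]
  show "faithful_on (hom_cat H X L) (%s. ntc (pf2 G s) u)"
    "full_on (hom_cat H X L) (pf0 G X) (%f. fob (pf1 G f) u) (%s. ntc (pf2 G s) u)"
    "ess_surj_on (hom_cat H X L) (pf0 G X) (%f. fob (pf1 G f) u)"
    using t e(2-4) by auto
qed

end

section \<open>The 2-functor of algebras of a monad\<close>

context monad_in
begin

text \<open>This definition and the next three name the local parts of \<open>algebras\<close>,
  which are bound by a let there and otherwise inaccessible to simplification.\<close>

definition algc where "algc X = algebra_cat (hom_cat K X b) (pf1 (corep K X) T) (pf2 (corep K X) \<eta>) (pf2 (corep K X) \<mu>)"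
definition act where "act f = (%(x, h). (x \<odot> f, h |> f))"
definition alg1 where "alg1 f = \<lparr>fdom = algc (tgt K f), fcod = algc (src K f),
       fob = restrict (act f) (Ob (algc (tgt K f))),
       far = (\<lambda>(p, q, s) \<in> Ar (algc (tgt K f)). (act f p, act f q, s |> f))\<rparr>"
definition alg2c where "alg2c \<phi> = \<lparr>ntdom = alg1 (cdom K \<phi>), ntcod = alg1 (ccod K \<phi>),
       ntc = (\<lambda>p \<in> Ob (algc (tgt K (cdom K \<phi>))). (act (cdom K \<phi>) p, act (ccod K \<phi>) p, (fst p) <| \<phi>))\<rparr>"

lemma algebras_eq: "algebras K b T \<eta> \<mu> = strict_psfun (op1 K) CAT algc alg1 alg2c"
  unfolding algebras_def Let_def algc_def[abs_def] alg1_def[abs_def] alg2c_def[abs_def] act_def[abs_def] by simp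

lemma algc_simps [simp]:
  "(x, h) : Ob (algc X) \<longleftrightarrow> alg2 K T \<eta> \<mu> x h & src K x = X"
  "((x, h), (y, k), s) : Ar (algc X) \<longleftrightarrow> (x, h) : Ob (algc X) & (y, k) : Ob (algc X) & s : cells K & cdom K s = x & ccod K s = y &
     s \<bullet> h = k \<bullet> T <| s"
  "Dom (algc X) (p, q, s) = p" "Cod (algc X) (p, q, s) = q" "Idt (algc X) (x, h) = ((x, h), (x, h), id2 K x)"
  "(q', r, s') \<cdot>\<^bsub>algc X\<^esub> (p, q, s) = (p, r, s' \<bullet> s)"
proof -
  have a: "is_algebra (hom_cat K X b) (corep_ar K X T) (corep_cell K X \<eta>) (corep_cell K X \<mu>) (x, h) \<longleftrightarrow> alg2 K T \<eta> \<mu> x h & src K x = X" for x h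
    unfolding is_algebra_def alg2_def in_hom1_def in_hom2_def
    by (rule iffI; simp; elim conjE; simp)
  show "(x, h) : Ob (algc X) \<longleftrightarrow> alg2 K T \<eta> \<mu> x h & src K x = X"
    by (simp add: algc_def algebra_cat_def a)
  show "((x, h), (y, k), s) : Ar (algc X) \<longleftrightarrow> (x, h) : Ob (algc X) & (y, k) : Ob (algc X) & s : cells K & cdom K s = x & ccod K s = y &
     s \<bullet> h = k \<bullet> T <| s"
    by (rule iffI; simp add: algc_def algebra_cat_def a; elim conjE; frule alg2D(1); frule alg2D(2); simp)
qed (simp_all add: algc_def algebra_cat_def)

lemma algc_ArE:
  assumes "a : Ar (algc X)"
  obtains x h y k s where "a = ((x, h), (y, k), s)" "alg2 K T \<eta> \<mu> x h" "alg2 K T \<eta> \<mu> y k" "src K x = X" "src K y = X"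
    "s : cells K" "cdom K s = x" "ccod K s = y" "s \<bullet> h = k \<bullet> T <| s"
  using assms by (cases a) (metis algc_simps(1,2) prod.collapse)

lemma algc_cases:
  assumes "p : Ob (algc X)"
  obtains x h where "p = (x, h)" "alg2 K T \<eta> \<mu> x h" "src K x = X"
  using assms by (cases p) simp

lemmas alg2_typing = alg2D(1-5)[of K T \<eta> \<mu>]

lemma category_algc: "category (algc X)"
proof
  fix f assume "f : Ar (algc X)"
  then obtain x h y k s where [simp]: "f = ((x, h), (y, k), s)" and a: "alg2 K T \<eta> \<mu> x h" "alg2 K T \<eta> \<mu> y k" "src K x = X" "src K y = X"
    "s : cells K" "cdom K s = x" "ccod K s = y" "s \<bullet> h = k \<bullet> T <| s" by (rule algc_ArE)
  show "Dom (algc X) f : Ob (algc X)" "Cod (algc X) f : Ob (algc X)" using a by simp_all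
  show "f \<cdot>\<^bsub>algc X\<^esub> Idt (algc X) (Dom (algc X) f) = f" "Idt (algc X) (Cod (algc X) f) \<cdot>\<^bsub>algc X\<^esub> f = f" using a by simp_all
  fix g assume g: "g : Ar (algc X)" and gf: "Dom (algc X) g = Cod (algc X) f"
  from g obtain x' h' z m t where [simp]: "g = ((x', h'), (z, m), t)" and a': "alg2 K T \<eta> \<mu> x' h'" "alg2 K T \<eta> \<mu> z m" "src K x' = X" "src K z = X"
    "t : cells K" "cdom K t = x'" "ccod K t = z" "t \<bullet> h' = m \<bullet> T <| t" by (rule algc_ArE)
  from gf have [simp]: "x' = y" "h' = k" by simp_all
  note [simp] = a(3-7) a'(4-7) alg2_typing[OF a(1)] alg2_typing[OF a(2)] alg2_typing[OF a'(2)]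
  have "(t \<bullet> s) \<bullet> h = m \<bullet> T <| (t \<bullet> s)"
    by (simp add: a(8) a'(8)[simplified, THEN vc22])
  then show "g \<cdot>\<^bsub>algc X\<^esub> f : Ar (algc X)" using a(1,2) a'(2) by simp
  show "Dom (algc X) (g \<cdot>\<^bsub>algc X\<^esub> f) = Dom (algc X) f" "Cod (algc X) (g \<cdot>\<^bsub>algc X\<^esub> f) = Cod (algc X) g" by simp_all
  fix l assume l: "l : Ar (algc X)" and lg: "Dom (algc X) l = Cod (algc X) g"
  from l obtain x'' h'' z' m' t' where [simp]: "l = ((x'', h''), (z', m'), t')" and "t' : cells K" "cdom K t' = x''"
    by (rule algc_ArE)
  then show "(l \<cdot>\<^bsub>algc X\<^esub> g) \<cdot>\<^bsub>algc X\<^esub> f = l \<cdot>\<^bsub>algc X\<^esub> g \<cdot>\<^bsub>algc X\<^esub> f" using lg by simp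
next
  fix p assume "p : Ob (algc X)"
  then obtain x h where [simp]: "p = (x, h)" and a: "alg2 K T \<eta> \<mu> x h" "src K x = X" by (rule algc_cases)
  note [simp] = alg2_typing[OF a(1)]
  show "Idt (algc X) p : Ar (algc X)" "Dom (algc X) (Idt (algc X) p) = p" "Cod (algc X) (Idt (algc X) p) = p"
    using a by simp_all
qed

lemma alg1_simps [simp]:
  "fdom (alg1 f) = algc (tgt K f)" "fcod (alg1 f) = algc (src K f)"
  "[|alg2 K T \<eta> \<mu> x h; src K x = tgt K f|] ==> fob (alg1 f) (x, h) = (x \<odot> f, h |> f)"
  "a : Ar (algc (tgt K f)) ==> far (alg1 f) a = (act f (fst a), act f (fst (snd a)), snd (snd a) |> f)"
  by (simp_all add: alg1_def act_def split: prod.splits)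

lemma act_simps [simp]: "act f (x, h) = (x \<odot> f, h |> f)"
  by (simp add: act_def)

lemma is_functor_alg1: "f : ars K ==> is_functor (alg1 f)"
proof -
  assume f [simp]: "f : ars K"
  have far: "far (alg1 f) a : Ar (algc (src K f)) & Dom (algc (src K f)) (far (alg1 f) a) = fob (alg1 f) (Dom (algc (tgt K f)) a)
      & Cod (algc (src K f)) (far (alg1 f) a) = fob (alg1 f) (Cod (algc (tgt K f)) a)" if a: "a : Ar (algc (tgt K f))" for a
  proof -
    from a obtain x h y k s where [simp]: "a = ((x, h), (y, k), s)" and b: "alg2 K T \<eta> \<mu> x h" "alg2 K T \<eta> \<mu> y k" "src K x = tgt K f" "src K y = tgt K f"
      "s : cells K" "cdom K s = x" "ccod K s = y" "s \<bullet> h = k \<bullet> T <| s" by (rule algc_ArE)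
    note [simp] = alg2_typing[OF b(1)] alg2_typing[OF b(2)] b(3-7)
    note w = arg_cong[OF b(8), of "%s. s |> f", simplified]
    show ?thesis
      using a alg2_comp1[OF b(1), of f] alg2_comp1[OF b(2), of f] b(1,2) by (simp add: w)
  qed
  show ?thesis
    unfolding is_functor_def
  proof (intro conjI allI impI)
    fix p assume "p : Ob (fdom (alg1 f))"
    then obtain x h where [simp]: "p = (x, h)" and a: "alg2 K T \<eta> \<mu> x h" "src K x = tgt K f" by (auto elim: algc_cases)
    note [simp] = alg2_typing[OF a(1)] a(2)
    show "fob (alg1 f) p : Ob (fcod (alg1 f))" using a alg2_comp1[OF a(1), of f] by simp
    show "far (alg1 f) (Idt (fdom (alg1 f)) p) = Idt (fcod (alg1 f)) (fob (alg1 f) p)"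
      using a by simp
  next
    fix g a assume b: "g : Ar (fdom (alg1 f))" "a : Ar (fdom (alg1 f))" "Dom (fdom (alg1 f)) g = Cod (fdom (alg1 f)) a"
    then have c: "g \<cdot>\<^bsub>algc (tgt K f)\<^esub> a : Ar (algc (tgt K f))" using category.Cmp_Ar[OF category_algc] by simp
    from b(2) obtain x h y k s where [simp]: "a = ((x, h), (y, k), s)" and a2: "alg2 K T \<eta> \<mu> x h" "src K x = tgt K f" "s : cells K" "cdom K s = x" "ccod K s = y"
      by (auto elim: algc_ArE)
    from b(1) obtain x' h' z m t where [simp]: "g = ((x', h'), (z, m), t)" and g2: "t : cells K" "cdom K t = x'"
      by (auto elim: algc_ArE)
    from b(3) have [simp]: "x' = y" by simp
    note [simp] = alg2_typing[OF a2(1)] a2(2-) g2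
    show "far (alg1 f) (g \<cdot>\<^bsub>fdom (alg1 f)\<^esub> a) = far (alg1 f) g \<cdot>\<^bsub>fcod (alg1 f)\<^esub> far (alg1 f) a"
      using b c by simp
  qed (use far in \<open>auto simp: category_algc\<close>, auto simp: alg1_def)
qed

lemma alg2c_simps [simp]:
  "ntdom (alg2c s) = alg1 (cdom K s)" "ntcod (alg2c s) = alg1 (ccod K s)"
  "[|alg2 K T \<eta> \<mu> x h; src K x = tgt K (cdom K s)|] ==>
    ntc (alg2c s) (x, h) = ((x \<odot> cdom K s, h |> (cdom K s)), (x \<odot> ccod K s, h |> (ccod K s)), x <| s)"
  by (simp_all add: alg2c_def)

lemma is_nattr_alg2c: "\<sigma> : cells K ==> is_nattr (alg2c \<sigma>)"
proof -
  assume s [simp]: "\<sigma> : cells K"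
  let ?f = "cdom K \<sigma>" and ?g = "ccod K \<sigma>"
  show ?thesis
    unfolding is_nattr_def
  proof (intro conjI allI impI)
    fix p assume "p : Ob (fdom (ntdom (alg2c \<sigma>)))"
    then obtain x h where [simp]: "p = (x, h)" and a: "alg2 K T \<eta> \<mu> x h" "src K x = tgt K ?f" by (auto elim: algc_cases)
    note [simp] = alg2_typing[OF a(1)] a(2)
    have "x <| \<sigma> \<bullet> h |> ?f = h |> ?g \<bullet> (T \<odot> x) <| \<sigma>"
      using slide_refl[of h \<sigma>] by simp
    then show "ntc (alg2c \<sigma>) p : Homset (fcod (ntdom (alg2c \<sigma>))) (fob (ntdom (alg2c \<sigma>)) p) (fob (ntcod (alg2c \<sigma>)) p)"
      using a alg2_comp1[OF a(1), of ?f] alg2_comp1[OF a(1), of ?g] by (simp add: Homset_def)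
  next
    fix a assume b: "a : Ar (fdom (ntdom (alg2c \<sigma>)))"
    then obtain x h y k s where [simp]: "a = ((x, h), (y, k), s)" and a: "alg2 K T \<eta> \<mu> x h" "alg2 K T \<eta> \<mu> y k" "src K x = tgt K ?f" "src K y = tgt K ?f"
      "s : cells K" "cdom K s = x" "ccod K s = y" by (auto elim: algc_ArE)
    note [simp] = alg2_typing[OF a(1)] alg2_typing[OF a(2)] a(3-7)
    have "y <| \<sigma> \<bullet> s |> ?f = s |> ?g \<bullet> x <| \<sigma>"
      using slide_refl[of s \<sigma>] by simp
    then show "ntc (alg2c \<sigma>) (Cod (fdom (ntdom (alg2c \<sigma>))) a) \<cdot>\<^bsub>fcod (ntdom (alg2c \<sigma>))\<^esub> far (ntdom (alg2c \<sigma>)) a =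
         far (ntcod (alg2c \<sigma>)) a \<cdot>\<^bsub>fcod (ntdom (alg2c \<sigma>))\<^esub> ntc (alg2c \<sigma>) (Dom (fdom (ntdom (alg2c \<sigma>))) a)"
      using a b by simp
  qed (simp_all add: is_functor_alg1, simp add: alg2c_def)
qed

lemma alg1_comp:
  assumes gf [simp]: "g : ars K" "f : ars K" "tgt K g = src K f"
  shows "alg1 (f \<odot> g) = alg1 g \<circ>\<^sub>F alg1 f"
  proof (rule functor_eqI)
    fix p assume "p : Ob (fdom (alg1 g \<circ>\<^sub>F alg1 f))"
    then obtain x h where [simp]: "p = (x, h)" and a: "alg2 K T \<eta> \<mu> x h" "src K x = tgt K f" by (auto elim: algc_cases)
    note [simp] = alg2_typing[OF a(1)] a(2)
    show "fob (alg1 (f \<odot> g)) p = fob (alg1 g \<circ>\<^sub>F alg1 f) p"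
      using a alg2_comp1[OF a(1), of f] by simp
  next
    fix a assume "a : Ar (fdom (alg1 g \<circ>\<^sub>F alg1 f))"
    then have b: "a : Ar (algc (tgt K f))" by simp
    then obtain y h z k s where e [simp]: "a = ((y, h), (z, k), s)" and a: "alg2 K T \<eta> \<mu> y h" "alg2 K T \<eta> \<mu> z k" "src K y = tgt K f" "src K z = tgt K f"
    "s : cells K" "cdom K s = y" "ccod K s = z" by (rule algc_ArE)
    note [simp] = alg2_typing[OF a(1)] alg2_typing[OF a(2)] a(3-7)
    have "far (alg1 f) a : Ar (algc (tgt K g))"
      using is_functor.functor_simps(2)[OF is_functor_alg1[OF gf(2)], of a] b by (simp del: algc_simps(2) alg1_simps(4))
    then show "far (alg1 (f \<odot> g)) a = far (alg1 g \<circ>\<^sub>F alg1 f) a" using b by (simp del: algc_simps(2))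
  qed (simp_all add: is_functor_alg1)

lemma two_functor_algebras: "two_functor (op1 K) CAT (algebras K b T \<eta> \<mu>)"
proof -
  interpret OP: two_category "op1 K" by (rule two_category_op1)
  interpret two_categories "op1 K" CAT by unfold_locales
  show ?thesis
    unfolding algebras_eq
  proof (rule two_functor_strict)
    fix x assume x [simp]: "x : obs (op1 K)"
    have "alg1 (id1 K x) = func_id (algc x)"
    proof (rule functor_eqI)
      fix p assume "p : Ob (fdom (func_id (algc x)))"
      then obtain y h where [simp]: "p = (y, h)" and a: "alg2 K T \<eta> \<mu> y h" "src K y = x" by (auto elim: algc_cases)
      note [simp] = alg2_typing[OF a(1)] a(2)
      show "fob (alg1 (id1 K x)) p = fob (func_id (algc x)) p"
        using x a by simp
    next
      fix a assume "a : Ar (fdom (func_id (algc x)))"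
      then have b: "a : Ar (algc x)" by simp
      then obtain y h z k s where [simp]: "a = ((y, h), (z, k), s)" and a: "alg2 K T \<eta> \<mu> y h" "alg2 K T \<eta> \<mu> z k" "src K y = x" "src K z = x"
      "s : cells K" "cdom K s = y" "ccod K s = z" by (rule algc_ArE)
      note [simp] = alg2_typing[OF a(1)] alg2_typing[OF a(2)] a(3-7)
      show "far (alg1 (id1 K x)) a = far (func_id (algc x)) a" using b x by simp
    qed (use x in \<open>simp_all add: is_functor_alg1 category_algc\<close>)
    then show "alg1 (id1 (op1 K) x) = id1 CAT (algc x)" by simp
  next
    fix g f assume "g : ars (op1 K)" "f : ars (op1 K)" "src (op1 K) g = tgt (op1 K) f"
    then have gf [simp]: "g : ars K" "f : ars K" "tgt K g = src K f" by simp_all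
    then show "alg1 (g \<odot>\<^bsub>op1 K\<^esub> f) = alg1 g \<odot>\<^bsub>CAT\<^esub> alg1 f" by (simp add: alg1_comp)
  next
    fix f assume "f : ars (op1 K)"
    then have f [simp]: "f : ars K" by simp
    have "alg2c (id2 K f) = nt_id (alg1 f)"
    proof (rule nattr_eqI)
      fix p assume "p : Ob (fdom (ntdom (nt_id (alg1 f))))"
      then obtain x h where [simp]: "p = (x, h)" and a: "alg2 K T \<eta> \<mu> x h" "src K x = tgt K f" by (auto elim: algc_cases)
      note [simp] = alg2_typing[OF a(1)] a(2)
      show "ntc (alg2c (id2 K f)) p = ntc (nt_id (alg1 f)) p" using a by simp
    qed (simp_all add: is_nattr_alg2c is_functor_alg1)
    then show "alg2c (id2 (op1 K) f) = id2 CAT (alg1 f)" by simp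
  next
    fix t \<sigma> assume "t : cells (op1 K)" "\<sigma> : cells (op1 K)" "cdom (op1 K) t = ccod (op1 K) \<sigma>"
    then have [simp]: "t : cells K" "\<sigma> : cells K" "cdom K t = ccod K \<sigma>" by simp_all
    have "alg2c (t \<bullet> \<sigma>) = alg2c t \<cdot>\<^sub>N alg2c \<sigma>"
    proof (rule nattr_eqI)
      fix p assume "p : Ob (fdom (ntdom (alg2c t \<cdot>\<^sub>N alg2c \<sigma>)))"
      then obtain x h where [simp]: "p = (x, h)" and a: "alg2 K T \<eta> \<mu> x h" "src K x = tgt K (cdom K \<sigma>)" by (auto elim: algc_cases)
      note [simp] = alg2_typing[OF a(1)] a(2)
      show "ntc (alg2c (t \<bullet> \<sigma>)) p = ntc (alg2c t \<cdot>\<^sub>N alg2c \<sigma>) p" using a by simp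
    qed (simp_all add: is_nattr_alg2c)
    then show "alg2c (t \<bullet>\<^bsub>op1 K\<^esub> \<sigma>) = alg2c t \<bullet>\<^bsub>CAT\<^esub> alg2c \<sigma>" by simp
  next
    fix t \<sigma> assume "t : cells (op1 K)" "\<sigma> : cells (op1 K)" "src (op1 K) (cdom (op1 K) t) = tgt (op1 K) (cdom (op1 K) \<sigma>)"
    then have [simp]: "t : cells K" "\<sigma> : cells K" "tgt K (cdom K t) = src K (cdom K \<sigma>)" by simp_all
    have "alg2c (\<sigma> \<star> t) = alg2c t \<star>\<^sub>N alg2c \<sigma>"
    proof (rule nattr_eqI)
      fix p assume "p : Ob (fdom (ntdom (alg2c t \<star>\<^sub>N alg2c \<sigma>)))"
      then obtain x h where [simp]: "p = (x, h)" and a: "alg2 K T \<eta> \<mu> x h" "src K x = tgt K (cdom K \<sigma>)" by (auto elim: algc_cases)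
      note [simp] = alg2_typing[OF a(1)] a(2)
      have m: "ntc (alg2c \<sigma>) (x, h) : Ar (algc (tgt K (cdom K t)))"
        using is_nattr.ntc_hom[OF is_nattr_alg2c[of \<sigma>], of "(x, h)"] a by (simp add: Homset_def)
      show "ntc (alg2c (\<sigma> \<star> t)) p = ntc (alg2c t \<star>\<^sub>N alg2c \<sigma>) p"
        using a m alg2_comp1[OF a(1), of "ccod K \<sigma>"] hcomp_eq(2)[of \<sigma> t] hcomp_eq(1)[of \<sigma> t] slide_refl[of \<sigma> t]
        by (simp del: algc_simps(2))
    qed (simp_all add: is_nattr_alg2c alg1_comp)
    then show "alg2c (t \<star>\<^bsub>op1 K\<^esub> \<sigma>) = alg2c t \<star>\<^bsub>CAT\<^esub> alg2c \<sigma>" by simp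
  qed (simp_all add: category_algc is_functor_alg1 is_nattr_alg2c)
qed

end

lemma func_comp_assoc:
  assumes "is_functor F" "fdom G = fcod F"
  shows "(H \<circ>\<^sub>F G) \<circ>\<^sub>F F = H \<circ>\<^sub>F G \<circ>\<^sub>F F"
  using assms is_functor.functor_simps(1,2)[of F] by (auto simp: func_comp_def fun_eq_iff restrict_def)

text \<open>When the naturality squares commute on the nose, identities serve as the comparison
  cells and every coherence axiom reduces to composites of identities. The two sides may have
  different types, so this is not an instance of a statement about pseudonatural
  transformations.\<close>

lemma strict_pseudonat_equivalence:
  assumes S: "two_category S" and F: "two_functor S CAT F" and G: "two_functor S CAT G"
    and \<Phi>: "!!x. x : obs S ==> equivalence_functor (\<Phi> x) & fdom (\<Phi> x) = pf0 F x & fcod (\<Phi> x) = pf0 G x"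
    and sq: "!!f. f : ars S ==> pf1 G f \<circ>\<^sub>F \<Phi> (src S f) = \<Phi> (tgt S f) \<circ>\<^sub>F pf1 F f"
    and nat: "!!s x. [|s : cells S; x : Ob (pf0 F (src S (cdom S s)))|] ==>
      ntc (pf2 G s) (fob (\<Phi> (src S (cdom S s))) x) = far (\<Phi> (tgt S (cdom S s))) (ntc (pf2 F s) x)"
  shows "pseudonat_equivalence S F G \<Phi> (%f. nt_id (pf1 G f \<circ>\<^sub>F \<Phi> (src S f)))"
proof -
  interpret S: two_category S by fact
  interpret F: pseudofunctor S CAT F by (rule two_functorD) fact
  interpret G: pseudofunctor S CAT G by (rule two_functorD) fact
  have Fs: "pfc F (g, f) = nt_id (pf1 F (g \<odot>\<^bsub>S\<^esub> f))" "pfc G (g, f) = nt_id (pf1 G (g \<odot>\<^bsub>S\<^esub> f))"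
    if "g : ars S" "f : ars S" "src S g = tgt S f" for g f
    using F G that by (auto simp: two_functor_def)
  have Fi: "pfi F x = nt_id (pf1 F (id1 S x))" "pfi G x = nt_id (pf1 G (id1 S x))" if "x : obs S" for x
    using F G that by (auto simp: two_functor_def)
  have P: "is_functor (\<Phi> x)" "fdom (\<Phi> x) = pf0 F x" "fcod (\<Phi> x) = pf0 G x" if "x : obs S" for x
    using \<Phi>[OF that] equivalence_functorD(1) by auto
  have F1: "is_functor (pf1 F f)" "fdom (pf1 F f) = pf0 F (src S f)" "fcod (pf1 F f) = pf0 F (tgt S f)"
    and G1: "is_functor (pf1 G f)" "fdom (pf1 G f) = pf0 G (src S f)" "fcod (pf1 G f) = pf0 G (tgt S f)"
    if "f : ars S" for f
    using F.pf_simps(2-4)[OF that] G.pf_simps(2-4)[OF that] by simp_all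
  have F2: "is_nattr (pf2 F s)" "ntdom (pf2 F s) = pf1 F (cdom S s)" "ntcod (pf2 F s) = pf1 F (ccod S s)"
    and G2: "is_nattr (pf2 G s)" "ntdom (pf2 G s) = pf1 G (cdom S s)" "ntcod (pf2 G s) = pf1 G (ccod S s)"
    if "s : cells S" for s
    using F.pf_simps(5-7)[OF that] G.pf_simps(5-7)[OF that] by simp_all
  have F0: "category (pf0 F x)" "category (pf0 G x)" if "x : obs S" for x
    using F.pf_simps(1)[OF that] G.pf_simps(1)[OF that] by simp_all
  have F1o: "fob (pf1 F f) x : Ob (pf0 F (tgt S f))" if "f : ars S" "x : Ob (pf0 F (src S f))" for f x
    using is_functor.fob_Ob[OF F1(1)] F1 that by metis
  have G1o: "fob (pf1 G f) x : Ob (pf0 G (tgt S f))" if "f : ars S" "x : Ob (pf0 G (src S f))" for f x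
    using is_functor.fob_Ob[OF G1(1)] G1 that by metis
  have Po: "fob (\<Phi> y) x : Ob (pf0 G y)" if "y : obs S" "x : Ob (pf0 F y)" for y x
    using is_functor.fob_Ob[OF P(1)] P that by metis
  have sqo: "fob (pf1 G f) (fob (\<Phi> (src S f)) x) = fob (\<Phi> (tgt S f)) (fob (pf1 F f) x)" if "f : ars S" "x : Ob (pf0 F (src S f))" for f x
    using arg_cong[OF sq[OF that(1)], of "%f. fob f x"] that by (simp add: P F1)
  have far_Idt: "far (\<Phi> y) (Idt (pf0 F y) x) = Idt (pf0 G y) (fob (\<Phi> y) x)" if "y : obs S" "x : Ob (pf0 F y)" for y x
    using is_functor.far_Id[OF P(1)] P that by metis
  have far_Idt1: "far (pf1 G f) (Idt (pf0 G (src S f)) x) = Idt (pf0 G (tgt S f)) (fob (pf1 G f) x)" if "f : ars S" "x : Ob (pf0 G (src S f))" for f x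
    using is_functor.far_Id[OF G1(1)] G1 that by metis
  have two: "pf1 F (g \<odot>\<^bsub>S\<^esub> f) = pf1 F g \<circ>\<^sub>F pf1 F f" "pf1 G (g \<odot>\<^bsub>S\<^esub> f) = pf1 G g \<circ>\<^sub>F pf1 G f"
    if "g : ars S" "f : ars S" "src S g = tgt S f" for g f
    using F.pf_simps(10)[OF that] G.pf_simps(10)[OF that] Fs[OF that] by simp_all
  have one: "pf1 F (id1 S x) = func_id (pf0 F x)" "pf1 G (id1 S x) = func_id (pf0 G x)" if "x : obs S" for x
    using F.pf_simps(14)[OF that] G.pf_simps(14)[OF that] Fi[OF that] by simp_all
  note [simp] = P F1 G1 F2 G2 F0 F1o G1o Po sqo far_Idt far_Idt1 category.cat_simps(3,4,5,6) nat
  note idl = category.Id_Cmp and idr = category.Cmp_Id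
  show ?thesis
    unfolding pseudonat_equivalence_def
  proof (intro conjI allI impI)
    fix f assume "f : ars S"
    then show "is_nat_iso (nt_id (pf1 G f \<circ>\<^sub>F \<Phi> (src S f)))"
      by (auto simp: is_nat_iso_def is_iso_def intro!: exI category.inverse_arrows_Idt)
  next
    fix s assume [simp]: "s : cells S"
    let ?X = "src S (cdom S s)" and ?Y = "tgt S (cdom S s)"
    show "nt_id (pf1 G (ccod S s) \<circ>\<^sub>F \<Phi> (src S (ccod S s))) \<cdot>\<^sub>N (pf2 G s \<star>\<^sub>N nt_id (\<Phi> ?X)) =
         (nt_id (\<Phi> ?Y) \<star>\<^sub>N pf2 F s) \<cdot>\<^sub>N nt_id (pf1 G (cdom S s) \<circ>\<^sub>F \<Phi> (src S (cdom S s)))"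
    proof (rule nattr_eqI)
      fix x assume "x : Ob (fdom (ntdom ((nt_id (\<Phi> ?Y) \<star>\<^sub>N pf2 F s) \<cdot>\<^sub>N nt_id (pf1 G (cdom S s) \<circ>\<^sub>F \<Phi> (src S (cdom S s))))))"
      then have x [simp]: "x : Ob (pf0 F ?X)" by simp
      have h: "ntc (pf2 F s) x : Homset (pf0 F ?Y) (fob (pf1 F (cdom S s)) x) (fob (pf1 F (ccod S s)) x)"
        using is_nattr.ntc_hom[OF F2(1), of s x] by simp
      have g: "far (\<Phi> ?Y) (ntc (pf2 F s) x) : Ar (pf0 G ?Y)" "Dom (pf0 G ?Y) (far (\<Phi> ?Y) (ntc (pf2 F s) x)) = fob (\<Phi> ?Y) (fob (pf1 F (cdom S s)) x)"
        "Cod (pf0 G ?Y) (far (\<Phi> ?Y) (ntc (pf2 F s) x)) = fob (\<Phi> ?Y) (fob (pf1 F (ccod S s)) x)"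
        using is_functor.functor_simps(2-4)[OF P(1)[of ?Y], of "ntc (pf2 F s) x"] h by (simp_all add: Homset_def)
      have c: "fob (pf1 G (ccod S s)) (fob (\<Phi> ?X) x) = fob (\<Phi> ?Y) (fob (pf1 F (ccod S s)) x)"
        "fob (pf1 F (ccod S s)) x : Ob (pf0 F ?Y)"
        using sqo[of "ccod S s" x] F1o[of "ccod S s" x] by simp_all
      show "ntc (nt_id (pf1 G (ccod S s) \<circ>\<^sub>F \<Phi> (src S (ccod S s))) \<cdot>\<^sub>N (pf2 G s \<star>\<^sub>N nt_id (\<Phi> ?X))) x =
         ntc ((nt_id (\<Phi> ?Y) \<star>\<^sub>N pf2 F s) \<cdot>\<^sub>N nt_id (pf1 G (cdom S s) \<circ>\<^sub>F \<Phi> (src S (cdom S s)))) x"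
        using idl[OF F0(2), of ?Y "far (\<Phi> ?Y) (ntc (pf2 F s) x)"] idr[OF F0(2), of ?Y "far (\<Phi> ?Y) (ntc (pf2 F s) x)"] g c
        by simp
    qed (use sq[of "ccod S s"] in \<open>simp_all add: sq\<close>)
  next
    fix g f assume "(g, f) : cpairs S"
    then have gf [simp]: "g : ars S" "f : ars S" "src S g = tgt S f" by simp_all
    show "nt_id (pf1 G (g \<odot>\<^bsub>S\<^esub> f) \<circ>\<^sub>F \<Phi> (src S (g \<odot>\<^bsub>S\<^esub> f))) \<cdot>\<^sub>N (pfc G (g, f) \<star>\<^sub>N nt_id (\<Phi> (src S f))) =
       (nt_id (\<Phi> (tgt S g)) \<star>\<^sub>N pfc F (g, f)) \<cdot>\<^sub>N (nt_id (pf1 G g \<circ>\<^sub>F \<Phi> (src S g)) \<star>\<^sub>N nt_id (pf1 F f)) \<cdot>\<^sub>N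
       (nt_id (pf1 G g) \<star>\<^sub>N nt_id (pf1 G f \<circ>\<^sub>F \<Phi> (src S f)))" (is "?L = ?R")
    proof (rule nattr_eqI)
      fix x assume "x : Ob (fdom (ntdom ?R))"
      then have [simp]: "x : Ob (pf0 F (src S f))" by simp
      let ?y = "fob (\<Phi> (tgt S g)) (fob (pf1 F g) (fob (pf1 F f) x))"
      have o: "fob (\<Phi> (tgt S g)) (fob (pf1 F g) (fob (pf1 F f) x)) : Ob (pf0 G (tgt S g))" using F1o[of g "fob (pf1 F f) x"] by simp
      have e: "far (pf1 G g) (Idt (pf0 G (tgt S f)) (fob (\<Phi> (tgt S f)) (fob (pf1 F f) x))) = Idt (pf0 G (tgt S g)) (fob (\<Phi> (tgt S g)) (fob (pf1 F g) (fob (pf1 F f) x)))"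
        "fob (pf1 G g) (fob (\<Phi> (tgt S f)) (fob (pf1 F f) x)) = fob (\<Phi> (tgt S g)) (fob (pf1 F g) (fob (pf1 F f) x))"
        using far_Idt1[of g "fob (\<Phi> (tgt S f)) (fob (pf1 F f) x)"] sqo[of g "fob (pf1 F f) x"] by simp_all
      have i: "Idt (pf0 G (tgt S g)) ?y \<cdot>\<^bsub>pf0 G (tgt S g)\<^esub> Idt (pf0 G (tgt S g)) ?y = Idt (pf0 G (tgt S g)) ?y"
        using idl[OF F0(2), of "tgt S g" "Idt (pf0 G (tgt S g)) ?y"] o by (simp add: category.cat_simps)
      show "ntc ?L x =
         ntc ?R x"
        using e by (simp add: Fs two i)
    next
      show "ntdom ?L = ntdom
       ?R"
        by (simp add: Fs two func_comp_assoc)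
      show "ntcod ?L = ntcod
       ?R"
        using sq[of "g \<odot>\<^bsub>S\<^esub> f"] by (simp add: Fs)
      have q: "pf1 G f \<circ>\<^sub>F \<Phi> (src S f) = \<Phi> (tgt S f) \<circ>\<^sub>F pf1 F f" by (rule sq) simp
      show "is_nattr ?R"
        using sq[of g]
        by (intro is_nattr_vcomp is_nattr_hcomp) (simp_all add: Fs two q, simp_all add: func_comp_assoc[symmetric])
    qed (simp_all add: Fs)
  next
    fix x assume [simp]: "x : obs S"
    show "nt_id (pf1 G (id1 S x) \<circ>\<^sub>F \<Phi> (src S (id1 S x))) \<cdot>\<^sub>N (pfi G x \<star>\<^sub>N nt_id (\<Phi> x)) = nt_id (\<Phi> x) \<star>\<^sub>N pfi F x"
    proof (rule nattr_eqI)
      fix y assume "y : Ob (fdom (ntdom (nt_id (\<Phi> x) \<star>\<^sub>N pfi F x)))"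
      then have [simp]: "y : Ob (pf0 F x)" by (simp add: Fi)
      have i: "Idt (pf0 G x) (fob (\<Phi> x) y) \<cdot>\<^bsub>pf0 G x\<^esub> Idt (pf0 G x) (fob (\<Phi> x) y) = Idt (pf0 G x) (fob (\<Phi> x) y)"
        using idl[OF F0(2), of x "Idt (pf0 G x) (fob (\<Phi> x) y)"] Po[of x y] by (simp add: category.cat_simps)
      show "ntc (nt_id (pf1 G (id1 S x) \<circ>\<^sub>F \<Phi> (src S (id1 S x))) \<cdot>\<^sub>N (pfi G x \<star>\<^sub>N nt_id (\<Phi> x))) y = ntc (nt_id (\<Phi> x) \<star>\<^sub>N pfi F x) y"
        by (simp add: Fi one i)
    qed (use sq[of "id1 S x"] in \<open>simp_all add: Fi\<close>)
  qed (use \<Phi> sq F G in \<open>simp_all add: two_functorD\<close>)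
qed

section \<open>Universal algebras correspond to representations of the 2-functor of algebras\<close>

context monad_in
begin

text \<open>The inverse of an invertible algebra map is automatically an algebra map, so
  invertibility may be tested on the underlying cell.\<close>

lemma algc_iso:
  assumes a: "alg2 K T \<eta> \<mu> x h" "src K x = X" "alg2 K T \<eta> \<mu> y k" "src K y = X"
  shows "(EX s : Homset (algc X) (x, h) (y, k). is_iso (algc X) s)
    \<longleftrightarrow> (EX s. s : cells K & cdom K s = x & ccod K s = y & invertible2 K s & s \<bullet> h = k \<bullet> (T <| s))" (is "?L \<longleftrightarrow> ?R")
proof
  note [simp] = alg2_typing[OF a(1)] alg2_typing[OF a(3)] a(2,4)
  assume ?L
  then obtain r r' where r: "r : Homset (algc X) (x, h) (y, k)" and i: "inverse_arrows (algc X) r r'" by (auto simp: is_iso_def)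
  from r have "r : Ar (algc X)" "Dom (algc X) r = (x, h)" "Cod (algc X) r = (y, k)" by (auto simp: Homset_def)
  then obtain s where s [simp]: "r = ((x, h), (y, k), s)" "s : cells K" "cdom K s = x" "ccod K s = y" "s \<bullet> h = k \<bullet> T <| s"
    by (elim algc_ArE) auto
  from i have "r' : Ar (algc X)" "Dom (algc X) r' = (y, k)" "Cod (algc X) r' = (x, h)" by (simp_all add: inverse_arrows_def)
  then obtain s' where s' [simp]: "r' = ((y, k), (x, h), s')" "s' : cells K" "cdom K s' = y" "ccod K s' = x"
    by (elim algc_ArE) auto
  have "iso2 s s'" using i by (simp add: inverse_arrows_def iso2_def)
  then show ?R using s invertible2_iff by blast
next
  assume ?R
  then obtain s where s: "s : cells K" "cdom K s = x" "ccod K s = y" "invertible2 K s" "s \<bullet> h = k \<bullet> T <| s" by blast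
  note [simp] = alg2_typing[OF a(1)] alg2_typing[OF a(3)] a(2,4) s(1-4)
  have "s \<bullet> inv2 K s \<bullet> k = s \<bullet> h \<bullet> T <| inv2 K s" by (simp add: s(5)[THEN vc22])
  then have w: "inv2 K s \<bullet> k = h \<bullet> T <| inv2 K s" by (rule vcomp_cancel_left[rotated]) simp_all
  have "inverse_arrows (algc X) ((x, h), (y, k), s) ((y, k), (x, h), inv2 K s)"
    using a s w by (simp add: inverse_arrows_def)
  then have "is_iso (algc X) ((x, h), (y, k), s)" unfolding is_iso_def by blast
  then show ?L using a s by (intro bexI[of _ "((x, h), (y, k), s)"]) (auto simp: Homset_def)
qed

text \<open>Restricting the universal algebra along 1-cells gives functors that commute strictly
  with precomposition; the three parts of \<open>em\<close> say that they are equivalences.\<close>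

lemma em_representation:
  assumes e: "em K T \<eta> \<mu> p h"
  obtains \<Phi> \<phi> where "pseudonat_equivalence (op1 K) (corep (op1 K) (src K p)) (algebras K b T \<eta> \<mu>) \<Phi> \<phi>"
    "!!k. [|k : ars K; tgt K k = src K p|] ==> fob (\<Phi> (src K k)) k = (p \<odot> k, h |> k)"
proof -
  interpret OP: two_category "op1 K" by (rule two_category_op1)
  define L where "L = src K p"
  have ph: "alg2 K T \<eta> \<mu> p h" "faith1 K p" "alg_full1 K T p h" "alg_ess1 K T \<eta> \<mu> p h" using e by (auto simp: em_def)
  note [simp] = alg2_typing[OF ph(1)] L_def[symmetric] alg2_comp1[OF ph(1)]
  define \<Phi> where "\<Phi> X = \<lparr>fdom = hom_cat K X L, fcod = algc X, fob = (\<lambda>g \<in> Ob (hom_cat K X L). (p \<odot> g, h |> g)),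
    far = (\<lambda>\<sigma> \<in> Ar (hom_cat K X L). ((p \<odot> cdom K \<sigma>, h |> (cdom K \<sigma>)), (p \<odot> ccod K \<sigma>, h |> (ccod K \<sigma>)), p <| \<sigma>))\<rparr>" for X
  have P [simp]: "fdom (\<Phi> X) = hom_cat K X L" "fcod (\<Phi> X) = algc X"
    "[|g : ars K; src K g = X; tgt K g = L|] ==> fob (\<Phi> X) g = (p \<odot> g, h |> g)"
    "[|\<sigma> : cells K; src K (cdom K \<sigma>) = X; tgt K (cdom K \<sigma>) = L|] ==>
      far (\<Phi> X) \<sigma> = ((p \<odot> cdom K \<sigma>, h |> (cdom K \<sigma>)), (p \<odot> ccod K \<sigma>, h |> (ccod K \<sigma>)), p <| \<sigma>)" for X g \<sigma>
    by (simp_all add: \<Phi>_def)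
  have F: "is_functor (\<Phi> X)" for X
    unfolding is_functor_def
  proof (intro conjI allI impI)
    fix \<sigma> assume "\<sigma> : Ar (fdom (\<Phi> X))"
    then have [simp]: "\<sigma> : cells K" "src K (cdom K \<sigma>) = X" "tgt K (cdom K \<sigma>) = L" by simp_all
    show "far (\<Phi> X) \<sigma> : Ar (fcod (\<Phi> X))"
      using slide_refl[of h \<sigma>] by simp
  next
    show "fob (\<Phi> X) : extensional (Ob (fdom (\<Phi> X)))" "far (\<Phi> X) : extensional (Ar (fdom (\<Phi> X)))" by (simp_all add: \<Phi>_def)
  qed (auto simp: category_hom_cat category_algc)
  have E: "equivalence_functor (\<Phi> X)" if X: "X : obs K" for X
  proof (rule equivalence_functorI)
    show "is_functor (\<Phi> X)" by (rule F)
    show "faithful_on (fdom (\<Phi> X)) (far (\<Phi> X))"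
      unfolding faithful_on_def
    proof (intro ballI impI)
      fix r r' assume "r : Ar (fdom (\<Phi> X))" "r' : Ar (fdom (\<Phi> X))" "Dom (fdom (\<Phi> X)) r = Dom (fdom (\<Phi> X)) r'"
        "Cod (fdom (\<Phi> X)) r = Cod (fdom (\<Phi> X)) r'" "far (\<Phi> X) r = far (\<Phi> X) r'"
      then show "r = r'" using faith1D[OF ph(2), of r r'] by simp
    qed
    show "full_on (fdom (\<Phi> X)) (fcod (\<Phi> X)) (fob (\<Phi> X)) (far (\<Phi> X))"
      unfolding full_on_def
    proof (intro ballI)
      fix g g' a assume g: "g : Ob (fdom (\<Phi> X))" "g' : Ob (fdom (\<Phi> X))" and a: "a : Homset (fcod (\<Phi> X)) (fob (\<Phi> X) g) (fob (\<Phi> X) g')"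
      from g have [simp]: "g : ars K" "src K g = X" "tgt K g = L" "g' : ars K" "src K g' = X" "tgt K g' = L" by simp_all
      from a have "a : Ar (algc X)" "Dom (algc X) a = (p \<odot> g, h |> g)" "Cod (algc X) a = (p \<odot> g', h |> g')" by (auto simp: Homset_def)
      then obtain s where s: "a = ((p \<odot> g, h |> g), (p \<odot> g', h |> g'), s)" "s : cells K" "cdom K s = p \<odot> g" "ccod K s = p \<odot> g'"
        "s \<bullet> h |> g = h |> g' \<bullet> T <| s"
        by (elim algc_ArE) auto
      obtain r where "r : cells K" "cdom K r = g" "ccod K r = g'" "p <| r = s"
        using alg_full1D[OF ph(3), of g g' s] s by auto
      then show "EX r : Homset (fdom (\<Phi> X)) g g'. far (\<Phi> X) r = a"
        by (intro bexI[of _ r]) (simp_all add: s(1))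
    qed
    show "ess_surj_on (fdom (\<Phi> X)) (fcod (\<Phi> X)) (fob (\<Phi> X))"
      unfolding ess_surj_on_def
    proof
      fix a assume "a : Ob (fcod (\<Phi> X))"
      then obtain x k where a [simp]: "a = (x, k)" and x: "alg2 K T \<eta> \<mu> x k" "src K x = X" by (auto elim: algc_cases)
      note [simp] = alg2_typing[OF x(1)] x(2)
      obtain g s where g [simp]: "g : ars K" "src K g = X" "tgt K g = L"
        and s: "s : cells K" "cdom K s = p \<odot> g" "ccod K s = x" "invertible2 K s" "s \<bullet> (h |> g) = k \<bullet> T <| s"
        using alg_ess1D[OF monad _ ph(4) x(1)] by auto
      have "EX s : Homset (algc X) (p \<odot> g, h |> g) (x, k). is_iso (algc X) s"
        using algc_iso[OF alg2_comp1[OF ph(1), of g] _ x] s by auto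
      then show "EX g : Ob (fdom (\<Phi> X)). EX s : Homset (fcod (\<Phi> X)) (fob (\<Phi> X) g) a. is_iso (fcod (\<Phi> X)) s"
        by (intro bexI[of _ g]) simp_all
    qed
  qed
  have "pseudonat_equivalence (op1 K) (corep (op1 K) L) (algebras K b T \<eta> \<mu>) \<Phi>
    (%f. nt_id (pf1 (algebras K b T \<eta> \<mu>) f \<circ>\<^sub>F \<Phi> (src (op1 K) f)))"
  proof (rule strict_pseudonat_equivalence)
    fix f assume "f : ars (op1 K)"
    then have [simp]: "f : ars K" by simp
    have "alg1 f \<circ>\<^sub>F \<Phi> (tgt K f) = \<Phi> (src K f) \<circ>\<^sub>F corep_ar (op1 K) L f"
    proof (rule functor_eqI)
      fix \<sigma> assume "\<sigma> : Ar (fdom (\<Phi> (src K f) \<circ>\<^sub>F corep_ar (op1 K) L f))"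
      then have [simp]: "\<sigma> : cells K" "src K (cdom K \<sigma>) = tgt K f" "tgt K (cdom K \<sigma>) = L" by simp_all
      have "far (\<Phi> (tgt K f)) \<sigma> : Ar (algc (tgt K f))" using is_functor.far_Ar[OF F, of \<sigma> "tgt K f"] by simp
      then show "far (alg1 f \<circ>\<^sub>F \<Phi> (tgt K f)) \<sigma> = far (\<Phi> (src K f) \<circ>\<^sub>F corep_ar (op1 K) L f) \<sigma>" by (simp del: algc_simps(2))
    qed (simp_all add: F is_functor_alg1 OP.is_functor_corep_ar)
    then show "pf1 (algebras K b T \<eta> \<mu>) f \<circ>\<^sub>F \<Phi> (src (op1 K) f) = \<Phi> (tgt (op1 K) f) \<circ>\<^sub>F pf1 (corep (op1 K) L) f"
      by (simp add: algebras_eq)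
  next
    show "two_functor (op1 K) CAT (corep (op1 K) L)" by (rule OP.two_functor_corep)
  qed (simp_all add: OP.two_category_axioms two_functor_algebras E, simp_all add: algebras_eq)
  then show ?thesis by (rule that[folded L_def]) simp
qed

text \<open>The universal algebra is the universal element of the representation, and the three
  parts of \<open>em\<close> are the three statements of \<open>universal\<close>.\<close>

lemma representation_em:
  assumes "pseudonat_equivalence (op1 K) (corep (op1 K) L) (algebras K b T \<eta> \<mu>) \<Phi> \<phi>" and L [simp]: "L : obs K"
  obtains p h where "em K T \<eta> \<mu> p h" "src K p = L"
    "!!k. [|k : ars K; tgt K k = L|] ==>
      EX s : Homset (algc (src K k)) (p \<odot> k, h |> k) (fob (\<Phi> (src K k)) k). is_iso (algc (src K k)) s"
proof -
  interpret R: representation K L "algebras K b T \<eta> \<mu>" \<Phi> \<phi>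
    using assms by (intro representation.intro) (simp_all add: two_category_axioms representation_axioms_def)
  obtain p h where u: "R.u = (p, h)" and p: "alg2 K T \<eta> \<mu> p h" "src K p = L"
    using R.u_Ob by (auto simp: algebras_eq elim: algc_cases)
  note [simp] = alg2_typing[OF p(1)] p(2)
  note U = R.universal[unfolded u]
  have hom: "ntc (alg2c r) (p, h) = ((p \<odot> cdom K r, h |> (cdom K r)), (p \<odot> ccod K r, h |> (ccod K r)), p <| r)"
    if "r : cells K" "tgt K (cdom K r) = L" for r using that p by simp
  have "faith1 K p"
  proof (rule faith1I)
    fix r r' assume r: "r : cells K" "r' : cells K" "cdom K r = cdom K r'" "ccod K r = ccod K r'" "tgt K (cdom K r') = src K p"
      "p <| r = p <| r'"
    then show "r = r'"
      using U(1)[of "src K (cdom K r')"] p unfolding faithful_on_def by (simp add: algebras_eq)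
  qed
  moreover have "alg_full1 K T p h"
  proof (rule alg_full1I)
    fix g g' s assume g [simp]: "g : ars K" "g' : ars K" "src K g = src K g'" "tgt K g = src K p" "tgt K g' = src K p"
      and s: "s : cells K" "cdom K s = p \<odot> g" "ccod K s = p \<odot> g'" "s \<bullet> h |> g = h |> g' \<bullet> T <| s"
    have "((p \<odot> g, h |> g), (p \<odot> g', h |> g'), s) : Homset (algc (src K g')) (p \<odot> g, h |> g) (p \<odot> g', h |> g')"
      using s alg2_comp1[OF p(1), of g] alg2_comp1[OF p(1), of g'] by (simp add: Homset_def)
    then have "EX r : Homset (hom_cat K (src K g') L) g g'. ntc (alg2c r) (p, h) = ((p \<odot> g, h |> g), (p \<odot> g', h |> g'), s)"
      using bspec[OF bspec[OF bspec[OF U(2)[of "src K g'", unfolded full_on_def], of g], of g'], of "((p \<odot> g, h |> g), (p \<odot> g', h |> g'), s)"] p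
      by (auto simp: algebras_eq)
    then obtain r where "r : cells K" "cdom K r = g" "ccod K r = g'" "ntc (alg2c r) (p, h) = ((p \<odot> g, h |> g), (p \<odot> g', h |> g'), s)" by auto
    then show "EX r. r : cells K & cdom K r = g & ccod K r = g' & p <| r = s"
      using p by (intro exI[of _ r]) (simp add: algebras_eq)
  qed
  moreover have "alg_ess1 K T \<eta> \<mu> p h"
  proof (rule alg_ess1I[OF monad])
    fix f k assume f: "alg2 K T \<eta> \<mu> f k"
    note [simp] = alg2_typing[OF f]
    have o: "src K f : obs K" by simp
    have "(f, k) : Ob (pf0 (algebras K b T \<eta> \<mu>) (src K f))" using f by (simp add: algebras_eq)
    then obtain g where g0: "g : Ob (hom_cat K (src K f) L)" and s0: "EX s : Homset (pf0 (algebras K b T \<eta> \<mu>) (src K f))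
        (fob (pf1 (algebras K b T \<eta> \<mu>) g) (p, h)) (f, k). is_iso (pf0 (algebras K b T \<eta> \<mu>) (src K f)) s"
      using U(3)[OF o, unfolded ess_surj_on_def] by blast
    from g0 have g [simp]: "g : ars K" "src K g = src K f" "tgt K g = L" by simp_all
    from s0 have s: "EX s : Homset (algc (src K f)) (p \<odot> g, h |> g) (f, k). is_iso (algc (src K f)) s"
      using p by (simp add: algebras_eq)
    then obtain s where "s : cells K" "cdom K s = p \<odot> g" "ccod K s = f" "invertible2 K s" "s \<bullet> (h |> g) = k \<bullet> T <| s"
      using algc_iso[OF alg2_comp1[OF p(1), of g] _ f refl] by auto
    then show "EX g s. g : ars K & src K g = src K f & tgt K g = src K p &
      s : cells K & cdom K s = p \<odot> g & ccod K s = f & invertible2 K s & s \<bullet> (h |> g) = k \<bullet> T <| s"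
      by (intro exI[of _ g] exI[of _ s]) simp
  qed simp_all
  moreover have "EX s : Homset (algc (src K k)) (p \<odot> k, h |> k) (fob (\<Phi> (src K k)) k). is_iso (algc (src K k)) s"
    if [simp]: "k : ars K" "tgt K k = L" for k
    using R.comparison_iso[of k] p by (auto simp: u algebras_eq)
  ultimately show ?thesis using that p by (simp add: em_def)
qed

end

section \<open>The degrees of monadicity in elementary form\<close>

context two_category
begin

lemma faithful1_iff: "f : ars K ==> faithful1 K f \<longleftrightarrow> faith1 K f"
proof -
  assume f [simp]: "f : ars K"
  have "faithful_functor (corep_ar K x f) \<longleftrightarrow> faithful_on (hom_cat K x (src K f)) (%r. f <| r)" for x
  proof
    assume a: "faithful_functor (corep_ar K x f)"
    show "faithful_on (hom_cat K x (src K f)) (%r. f <| r)"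
      unfolding faithful_on_def
    proof (intro ballI impI)
      fix r r' assume r: "r : Ar (hom_cat K x (src K f))" "r' : Ar (hom_cat K x (src K f))"
        "Dom (hom_cat K x (src K f)) r = Dom (hom_cat K x (src K f)) r'" "Cod (hom_cat K x (src K f)) r = Cod (hom_cat K x (src K f)) r'" "f <| r = f <| r'"
      then have "inj_on (far (corep_ar K x f)) (Homset (hom_cat K x (src K f)) (cdom K r') (ccod K r'))"
        using a by (simp add: faithful_functor_def)
      then show "r = r'" by (rule inj_onD) (use r in simp_all)
    qed
  next
    assume a: "faithful_on (hom_cat K x (src K f)) (%r. f <| r)"
    have "inj_on (far (corep_ar K x f)) (Homset (hom_cat K x (src K f)) g g')" for g g'
    proof (rule inj_onI)
      fix r r' assume "r : Homset (hom_cat K x (src K f)) g g'" "r' : Homset (hom_cat K x (src K f)) g g'" "far (corep_ar K x f) r = far (corep_ar K x f) r'"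
      then show "r = r'" using a[unfolded faithful_on_def, rule_format, of r r'] by simp
    qed
    then show "faithful_functor (corep_ar K x f)" by (simp add: faithful_functor_def)
  qed
  then show ?thesis by (simp add: faithful1_def faith1_def)
qed

lemma fully_faithful1_iff: "f : ars K ==> fully_faithful1 K f \<longleftrightarrow> faith1 K f & full1 K f"
proof -
  assume f [simp]: "f : ars K"
  have "bij_betw (far (corep_ar K x f)) (Homset (hom_cat K x (src K f)) g g') (Homset (hom_cat K x (tgt K f)) (f \<odot> g) (f \<odot> g'))
    \<longleftrightarrow> inj_on (far (corep_ar K x f)) (Homset (hom_cat K x (src K f)) g g') &
      (ALL s : Homset (hom_cat K x (tgt K f)) (f \<odot> g) (f \<odot> g'). EX r : Homset (hom_cat K x (src K f)) g g'. f <| r = s)"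
    if [simp]: "g : ars K" "src K g = x" "tgt K g = src K f" "g' : ars K" "src K g' = x" "tgt K g' = src K f" for x g g'
  proof -
    have e: "far (corep_ar K x f) r = f <| r" if "r : Homset (hom_cat K x (src K f)) g g'" for r using that by simp
    have img: "far (corep_ar K x f) ` Homset (hom_cat K x (src K f)) g g' = (%r. f <| r) ` Homset (hom_cat K x (src K f)) g g'"
      using e by (rule image_cong[OF refl])
    have sub: "f <| r : Homset (hom_cat K x (tgt K f)) (f \<odot> g) (f \<odot> g')" if "r : Homset (hom_cat K x (src K f)) g g'" for r
      using that by simp
    have "(h ` A = B) \<longleftrightarrow> (ALL s : B. EX r : A. h r = s)" if "!!r. r : A ==> h r : B" for h :: "'c \<Rightarrow> 'c" and A B
      unfolding set_eq_iff image_iff using that by metis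
    from this[where h = "(\<star>) (id2 K f)" and A = "Homset (hom_cat K x (src K f)) g g'", OF sub] show ?thesis unfolding bij_betw_def img by simp
  qed
  then have "fully_faithful1 K f \<longleftrightarrow> faithful1 K f & full1 K f"
    by (auto simp: fully_faithful1_def faithful1_def fully_faithful_functor_def faithful_functor_def full1_def full_on_def)
  then show ?thesis by (simp add: faithful1_iff)
qed

text \<open>Representations of the 2-functor of algebras are exchanged for universal algebras. The
  comparison 1-cell is then a factorisation of the canonical algebra on \<open>u\<close> through a
  universal one, as required by \<open>em_compare\<close>.\<close>

lemma comparison1_iff:
  assumes a: "adjunction1 K l u \<eta> \<epsilon>"
  shows "comparison1 K l u \<eta> \<epsilon> k \<longleftrightarrow> (EX p h i. em K (u \<odot> l) \<eta> (u <| \<epsilon> |> l) p h & k : ars K & src K k = src K u & tgt K k = src K p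
    & cdom K i = p \<odot> k & ccod K i = u & invertible2 K i & i \<bullet> h |> k = u <| \<epsilon> \<bullet> ((u \<odot> l) <| i))" (is "_ \<longleftrightarrow> ?R")
proof -
  let ?\<mu> = "u <| \<epsilon> |> l"
  interpret m: monad_in K "tgt K u" "u \<odot> l" \<eta> ?\<mu>
    by unfold_locales (rule adjunction_monad(1)[OF a])
  have ua: "alg2 K (u \<odot> l) \<eta> ?\<mu> u (u <| \<epsilon>)" by (rule adjunction_monad(2)[OF a])
  note [simp] = adjunction_simps(1-10)[OF a]
  have A [simp]: "pf0 (algebras K (tgt K u) (u \<odot> l) \<eta> ?\<mu>) (src K u) = m.algc (src K u)" by (simp add: m.algebras_eq)
  show ?thesis
  proof
    assume "comparison1 K l u \<eta> \<epsilon> k"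
    then obtain L \<Phi> \<phi> s where L: "L : obs K" and e: "pseudonat_equivalence (op1 K) (corep (op1 K) L) (algebras K (tgt K u) (u \<odot> l) \<eta> ?\<mu>) \<Phi> \<phi>"
      and k [simp]: "k : ars K" "src K k = src K u" "tgt K k = L"
      and s: "s : Homset (m.algc (src K u)) (fob (\<Phi> (src K u)) k) (u, u <| \<epsilon>)" "is_iso (m.algc (src K u)) s"
      unfolding comparison1_def Let_def in_hom1_def by (auto simp only: A)
    obtain p h where p: "em K (u \<odot> l) \<eta> ?\<mu> p h" "src K p = L"
      and c: "!!k. [|k : ars K; tgt K k = L|] ==> EX s : Homset (m.algc (src K k)) (p \<odot> k, h |> k) (fob (\<Phi> (src K k)) k). is_iso (m.algc (src K k)) s"
      using m.representation_em[OF e L] by blast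
    have pa: "alg2 K (u \<odot> l) \<eta> ?\<mu> p h" using p by (simp add: em_def)
    obtain r where r: "r : Homset (m.algc (src K u)) (p \<odot> k, h |> k) (fob (\<Phi> (src K u)) k)" "is_iso (m.algc (src K u)) r"
      using c[of k] by auto
    interpret C: category "m.algc (src K u)" by (rule m.category_algc)
    obtain r' s' where i: "inverse_arrows (m.algc (src K u)) r r'" "inverse_arrows (m.algc (src K u)) s s'" using r s by (auto simp: is_iso_def)
    \<comment> \<open>The isomorphism in the definition starts at the value of the representation;
      the Yoneda comparison \<open>r\<close> replaces that value by the restriction of the universal
      algebra along \<open>k\<close>.\<close>
    have "inverse_arrows (m.algc (src K u)) (s \<cdot>\<^bsub>m.algc (src K u)\<^esub> r) (r' \<cdot>\<^bsub>m.algc (src K u)\<^esub> s')"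
      by (rule C.inverse_arrows_Cmp[OF i]) (use r s in \<open>simp add: Homset_def\<close>)
    then have "is_iso (m.algc (src K u)) (s \<cdot>\<^bsub>m.algc (src K u)\<^esub> r)" unfolding is_iso_def by blast
    moreover have "s \<cdot>\<^bsub>m.algc (src K u)\<^esub> r : Homset (m.algc (src K u)) (p \<odot> k, h |> k) (u, u <| \<epsilon>)"
      using r s by (simp add: Homset_def)
    ultimately have "EX s : Homset (m.algc (src K u)) (p \<odot> k, h |> k) (u, u <| \<epsilon>). is_iso (m.algc (src K u)) s" by blast
    then obtain i where "i : cells K" "cdom K i = p \<odot> k" "ccod K i = u" "invertible2 K i" "i \<bullet> h |> k = u <| \<epsilon> \<bullet> (u \<odot> l) <| i"
      using m.algc_iso[OF m.alg2_comp1[OF pa, of k] _ ua refl] p m.alg2_typing[OF pa] by auto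
    then show ?R using p k by blast
  next
    assume ?R
    then obtain p h i where p: "em K (u \<odot> l) \<eta> ?\<mu> p h" and k [simp]: "k : ars K" "src K k = src K u" "tgt K k = src K p"
      and i: "cdom K i = p \<odot> k" "ccod K i = u" "invertible2 K i" "i \<bullet> h |> k = u <| \<epsilon> \<bullet> (u \<odot> l) <| i" by blast
    have pa: "alg2 K (u \<odot> l) \<eta> ?\<mu> p h" using p by (simp add: em_def)
    obtain \<Phi> \<phi> where e: "pseudonat_equivalence (op1 K) (corep (op1 K) (src K p)) (algebras K (tgt K u) (u \<odot> l) \<eta> ?\<mu>) \<Phi> \<phi>"
      and c: "!!k. [|k : ars K; tgt K k = src K p|] ==> fob (\<Phi> (src K k)) k = (p \<odot> k, h |> k)"
      using m.em_representation[OF p] by blast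
    have "EX s : Homset (m.algc (src K u)) (p \<odot> k, h |> k) (u, u <| \<epsilon>). is_iso (m.algc (src K u)) s"
      using m.algc_iso[OF m.alg2_comp1[OF pa, of k] _ ua refl] m.alg2_typing[OF pa] i invertible2_cell[OF i(3)] by auto
    moreover have "src K p : obs K" using m.alg2_typing[OF pa] by simp
    ultimately show "comparison1 K l u \<eta> \<epsilon> k"
      unfolding comparison1_def Let_def in_hom1_def A using e c[OF k(1,3), unfolded k(2)] k
      by (intro exI[of _ "src K p"] exI[of _ \<Phi>] exI[of _ \<phi>]) simp
  qed
qed

text \<open>Monadicity comes with some left adjoint, which \<open>em_change\<close> replaces by the
  given one.\<close>

lemma monadic_em:
  assumes "monadic K u" and a: "adjunction1 K l u \<eta> \<epsilon>"
  shows "em K (u \<odot> l) \<eta> (u <| \<epsilon> |> l) u (u <| \<epsilon>)"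
proof -
  obtain l' \<eta>' \<epsilon>' k where a': "adjunction1 K l' u \<eta>' \<epsilon>'" and c: "comparison1 K l' u \<eta>' \<epsilon>' k" and k: "equivalence1 K k"
    using assms(1) unfolding monadic_def by blast
  from c obtain p h i where p: "em K (u \<odot> l') \<eta>' (u <| \<epsilon>' |> l') p h"
    and m: "k : ars K" "src K k = src K u" "tgt K k = src K p" and i: "cdom K i = p \<odot> k" "ccod K i = u" "invertible2 K i"
      "i \<bullet> h |> k = u <| \<epsilon>' \<bullet> (u \<odot> l') <| i"
    unfolding comparison1_iff[OF a'] by blast
  show ?thesis
    using em_compare(3)[OF adjunction_monad[OF a'] p m i] k em_change(2)[OF a a'] by simp
qed

lemma comparison1_properties:
  assumes a: "adjunction1 K l u \<eta> \<epsilon>" and c: "comparison1 K l u \<eta> \<epsilon> k"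
  shows "k : ars K" and "faith1 K u \<longleftrightarrow> faith1 K k"
    and "faith1 K u & alg_full1 K (u \<odot> l) u (u <| \<epsilon>) \<longleftrightarrow> faith1 K k & full1 K k"
    and "em K (u \<odot> l) \<eta> (u <| \<epsilon> |> l) u (u <| \<epsilon>) \<longleftrightarrow> equivalence1 K k"
proof -
  from c obtain p h i where p: "em K (u \<odot> l) \<eta> (u <| \<epsilon> |> l) p h"
    and m: "k : ars K" "src K k = src K u" "tgt K k = src K p" and i: "cdom K i = p \<odot> k" "ccod K i = u" "invertible2 K i"
      "i \<bullet> h |> k = u <| \<epsilon> \<bullet> (u \<odot> l) <| i"
    unfolding comparison1_iff[OF a] by blast
  show "k : ars K" by fact
  show "faith1 K u \<longleftrightarrow> faith1 K k"
    "faith1 K u & alg_full1 K (u \<odot> l) u (u <| \<epsilon>) \<longleftrightarrow> faith1 K k & full1 K k"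
    "em K (u \<odot> l) \<eta> (u <| \<epsilon> |> l) u (u <| \<epsilon>) \<longleftrightarrow> equivalence1 K k"
    by (rule em_compare[OF adjunction_monad[OF a] p m i])+
qed

lemma ex_comparison1:
  assumes ex: "!!b T \<eta> \<mu>. monad2 K b T \<eta> \<mu> ==> EX p h. em K T \<eta> \<mu> p h" and a: "adjunction1 K l u \<eta> \<epsilon>"
  shows "EX k. comparison1 K l u \<eta> \<epsilon> k"
proof -
  let ?\<mu> = "u <| \<epsilon> |> l"
  note m = adjunction_monad[OF a]
  note [simp] = adjunction_simps(1-10)[OF a]
  obtain p h where p: "em K (u \<odot> l) \<eta> ?\<mu> p h" using ex[OF m(1)] by blast
  then have "alg_ess1 K (u \<odot> l) \<eta> ?\<mu> p h" "tgt K p = tgt K u"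
    using alg2D(2)[of K "u \<odot> l"] by (auto simp: em_def)
  from alg_ess1D[OF m(1) this(2,1) m(2)] show ?thesis unfolding comparison1_iff[OF a] using p by blast
qed

text \<open>The definitions quantify over some adjunction and some comparison. Existence of
  Eilenberg-Moore objects provides a comparison for the given adjunction, and
  \<open>em_change\<close> shows that the right-hand sides do not depend on the adjunction.\<close>

lemma monadicity:
  assumes ex: "!!b T \<eta> \<mu>. monad2 K b T \<eta> \<mu> ==> EX p h. em K T \<eta> \<mu> p h" and a: "adjunction1 K l u \<eta> \<epsilon>"
  shows "almost_monadic K u \<longleftrightarrow> faith1 K u"
    and "premonadic K u \<longleftrightarrow> faith1 K u & alg_full1 K (u \<odot> l) u (u <| \<epsilon>)"
    and "monadic K u \<longleftrightarrow> em K (u \<odot> l) \<eta> (u <| \<epsilon> |> l) u (u <| \<epsilon>)"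
proof -
  obtain k where k: "comparison1 K l u \<eta> \<epsilon> k"
    using ex_comparison1[OF _ a] ex by blast
  note c = comparison1_properties
  show "almost_monadic K u \<longleftrightarrow> faith1 K u"
    unfolding almost_monadic_def using a k c(1,2) faithful1_iff by metis
  show "premonadic K u \<longleftrightarrow> faith1 K u & alg_full1 K (u \<odot> l) u (u <| \<epsilon>)"
    unfolding premonadic_def using a k c(1,3) fully_faithful1_iff em_change(1)[OF a] by metis
  show "monadic K u \<longleftrightarrow> em K (u \<odot> l) \<eta> (u <| \<epsilon> |> l) u (u <| \<epsilon>)"
    using monadic_em[OF _ a] a k c(4)[OF a k] unfolding monadic_def by blast
qed

end

section \<open>Eilenberg-Moore objects from bilimits\<close>

text \<open>The weight for inserting a 2-cell \<open>k : f x \<Rightarrow> g x\<close> between a parallel pair \<open>f, g : d\<^sub>0 \<rightarrow> d\<^sub>1\<close>. Objects are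
  named by their identities: the domain of the pair is \<open>z4\<close> and its codomain \<open>z5\<close>, the pair itself is \<open>z0, z1\<close>.
  The elements of \<open>P\<close> are 2-cells \<open>z0 \<Rightarrow> z1\<close> of the diagram, with each of which the inserted 2-cell is forced to
  agree: \<open>P = {}\<close> gives inserters, and \<open>P\<close> with two elements gives equifiers.\<close>

locale inserter_shape =
  fixes z0 z1 z2 z3 z4 z5 :: 'k and P :: "'k set"
  assumes dist: "distinct [z0, z1, z2, z3, z4, z5]" and P: "P \<subseteq> {z2, z3}"
begin

lemma z [simp]:
  "z0 \<noteq> z1" "z0 \<noteq> z2" "z0 \<noteq> z4" "z0 \<noteq> z5" "z1 \<noteq> z2" "z1 \<noteq> z4" "z1 \<noteq> z5" "z2 \<noteq> z4" "z2 \<noteq> z5" "z4 \<noteq> z5"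
  "z1 \<noteq> z0" "z2 \<noteq> z0" "z4 \<noteq> z0" "z5 \<noteq> z0" "z2 \<noteq> z1" "z4 \<noteq> z1" "z5 \<noteq> z1" "z4 \<noteq> z2" "z5 \<noteq> z2" "z5 \<noteq> z4"
  "z0 \<notin> P" "z1 \<notin> P" "z4 \<notin> P" "z5 \<notin> P"
  using dist P by auto

lemma zP: "p : P ==> p \<noteq> z0 & p \<noteq> z1 & p \<noteq> z4 & p \<noteq> z5"
  by auto

text \<open>No two nonidentity cells of the shape are composable, so each composition has only to
  return the factor that is not an identity. Identities carry the same name at all levels, hence
  \<open>id1\<close> and \<open>id2\<close> are the identity map.\<close>

definition S where
  "S = \<lparr>obs = {z4, z5}, ars = {z4, z5, z0, z1}, cells = {z4, z5, z0, z1} \<union> P,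
     src = (%x. if x = z5 then z5 else z4), tgt = (%x. if x = z4 then z4 else z5),
     cdom = (%\<sigma>. if \<sigma> : P then z0 else \<sigma>), ccod = (%\<sigma>. if \<sigma> : P then z1 else \<sigma>),
     id1 = (%x. x), id2 = (%x. x), comp1 = (%g f. if f = z4 then g else f),
     vcomp = (%\<tau> \<sigma>. if \<tau> : P then \<tau> else \<sigma>), hcomp = (%g f. if f = z4 then g else f)\<rparr>"

lemma S_simps [simp]:
  "obs S = {z4, z5}" "ars S = {z4, z5, z0, z1}" "cells S = {z4, z5, z0, z1} \<union> P"
  "src S x = (if x = z5 then z5 else z4)" "tgt S x = (if x = z4 then z4 else z5)"
  "cdom S s = (if s : P then z0 else s)" "ccod S s = (if s : P then z1 else s)"
  "id1 S x = x" "id2 S x = x" "g \<odot>\<^bsub>S\<^esub> f = (if f = z4 then g else f)"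
  "t \<bullet>\<^bsub>S\<^esub> s = (if t : P then t else s)" "g \<star>\<^bsub>S\<^esub> f = (if f = z4 then g else f)"
  by (simp_all add: S_def)

lemma two_category_S: "two_category S"
  unfolding two_category_def
proof (intro conjI allI impI)
  show "category (cat1 S)"
    unfolding category_def by (auto simp: cat1_def split: if_splits)
  show "category (vcat S)"
    unfolding category_def by (auto simp: vcat_def split: if_splits)
qed (auto split: if_splits)

definition One :: "('k, 'k) cat" where
  "One = \<lparr>Ob = {z0}, Ar = {z0}, Dom = (%_. z0), Cod = (%_. z0), Idt = (%_. z0), Cmp = (%_ _. z0)\<rparr>"

text \<open>The arrow category, with \<open>z2\<close> as its nonidentity arrow from
  \<open>z0\<close> to \<open>z1\<close>. The names are those of the shape, which keeps everything
  in one type.\<close>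

definition Two :: "('k, 'k) cat" where
  "Two = \<lparr>Ob = {z0, z1}, Ar = {z0, z1, z2}, Dom = (%a. if a = z2 then z0 else a), Cod = (%a. if a = z2 then z1 else a),
     Idt = (%x. x), Cmp = (%g f. if f = z2 then z2 else g)\<rparr>"

lemma One_simps [simp]: "Ob One = {z0}" "Ar One = {z0}" "Dom One a = z0" "Cod One a = z0" "Idt One x = z0" "a \<cdot>\<^bsub>One\<^esub> a' = z0"
  by (simp_all add: One_def)

lemma Two_simps [simp]: "Ob Two = {z0, z1}" "Ar Two = {z0, z1, z2}" "Dom Two a = (if a = z2 then z0 else a)"
  "Cod Two a = (if a = z2 then z1 else a)" "Idt Two x = x" "a \<cdot>\<^bsub>Two\<^esub> a' = (if a' = z2 then z2 else a)"
  by (simp_all add: Two_def)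

lemma category_One [simp]: "category One" and category_Two [simp]: "category Two"
  by (unfold category_def) (auto split: if_splits)

definition point where
  "point C x = \<lparr>fdom = One, fcod = C, fob = (\<lambda>_ \<in> {z0}. x), far = (\<lambda>_ \<in> {z0}. Idt C x)\<rparr>"

definition arrow where
  "arrow C k = \<lparr>fdom = Two, fcod = C, fob = (\<lambda>x \<in> {z0, z1}. if x = z0 then Dom C k else Cod C k),
     far = (\<lambda>a \<in> {z0, z1, z2}. if a = z2 then k else if a = z0 then Idt C (Dom C k) else Idt C (Cod C k))\<rparr>"

definition point_nt where
  "point_nt F G s = \<lparr>ntdom = F, ntcod = G, ntc = (\<lambda>_ \<in> {z0}. s)\<rparr>"

definition arrow_nt where
  "arrow_nt F G s t = \<lparr>ntdom = F, ntcod = G, ntc = (\<lambda>x \<in> {z0, z1}. if x = z0 then s else t)\<rparr>"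

lemma shape_simps [simp]:
  "fdom (point C x) = One" "fcod (point C x) = C" "fob (point C x) z0 = x" "far (point C x) z0 = Idt C x"
  "fdom (arrow C k) = Two" "fcod (arrow C k) = C" "fob (arrow C k) z0 = Dom C k" "fob (arrow C k) z1 = Cod C k"
  "far (arrow C k) z0 = Idt C (Dom C k)" "far (arrow C k) z1 = Idt C (Cod C k)" "far (arrow C k) z2 = k"
  by (simp_all add: point_def arrow_def)

lemma shape_nt_simps [simp]:
  "ntdom (point_nt F G s) = F" "ntcod (point_nt F G s) = G" "ntc (point_nt F G s) z0 = s"
  "ntdom (arrow_nt F G s t) = F" "ntcod (arrow_nt F G s t) = G" "ntc (arrow_nt F G s t) z0 = s" "ntc (arrow_nt F G s t) z1 = t"
  by (simp_all add: point_nt_def arrow_nt_def)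

lemma is_functor_point [simp]: "category C ==> x : Ob C ==> is_functor (point C x)"
proof -
  assume c: "category C" "x : Ob C"
  then have "Idt C x \<cdot>\<^bsub>C\<^esub> Idt C x = Idt C x" using category.Id_Cmp[OF c(1), of "Idt C x"] by (simp add: category.cat_simps)
  then show ?thesis using c unfolding is_functor_def by (simp add: category.cat_simps, simp add: point_def)
qed

lemma is_functor_arrow [simp]: "category C ==> k : Ar C ==> is_functor (arrow C k)"
proof -
  assume c: "category C" "k : Ar C"
  then have "Idt C x \<cdot>\<^bsub>C\<^esub> Idt C x = Idt C x" if "x : Ob C" for x
    using category.Id_Cmp[OF c(1), of "Idt C x"] that by (simp add: category.cat_simps)
  then show ?thesis using c unfolding is_functor_def
    by (simp add: category.cat_simps split: if_splits, auto simp: category.cat_simps split: if_splits, simp_all add: arrow_def)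
qed

lemma is_nattr_point [simp]:
  assumes "is_functor F" "is_functor G" "fdom F = One" "fdom G = One" "fcod G = fcod F"
    "s : Ar (fcod F)" "Dom (fcod F) s = fob F z0" "Cod (fcod F) s = fob G z0"
  shows "is_nattr (point_nt F G s)"
proof -
  interpret F: is_functor F by fact
  interpret G: is_functor G by fact
  have "far F z0 = Idt (fcod F) (fob F z0)" "far G z0 = Idt (fcod F) (fob G z0)"
    using F.far_Id[of z0] G.far_Id[of z0] assms by simp_all
  then show ?thesis
    using assms F.fcod.Cmp_Id[of s] F.fcod.Id_Cmp[of s] unfolding is_nattr_def by (simp add: Homset_def, simp add: point_nt_def)
qed

lemma is_nattr_arrow [simp]:
  assumes "is_functor F" "is_functor G" "fdom F = Two" "fdom G = Two" "fcod G = fcod F"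
    "s : Ar (fcod F)" "Dom (fcod F) s = fob F z0" "Cod (fcod F) s = fob G z0"
    "t : Ar (fcod F)" "Dom (fcod F) t = fob F z1" "Cod (fcod F) t = fob G z1"
    "t \<cdot>\<^bsub>fcod F\<^esub> far F z2 = far G z2 \<cdot>\<^bsub>fcod F\<^esub> s"
  shows "is_nattr (arrow_nt F G s t)"
proof -
  interpret F: is_functor F by fact
  interpret G: is_functor G by fact
  have "far F z0 = Idt (fcod F) (fob F z0)" "far G z0 = Idt (fcod F) (fob G z0)" "far F z1 = Idt (fcod F) (fob F z1)" "far G z1 = Idt (fcod F) (fob G z1)"
    using F.far_Id[of z0] G.far_Id[of z0] F.far_Id[of z1] G.far_Id[of z1] assms by simp_all
  then show ?thesis
    using assms F.fcod.Cmp_Id[of s] F.fcod.Id_Cmp[of s] F.fcod.Cmp_Id[of t] F.fcod.Id_Cmp[of t] unfolding is_nattr_def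
    by (simp add: Homset_def, simp add: arrow_nt_def)
qed

definition W0 where "W0 x = (if x = z4 then One else Two)"
definition W1 where "W1 a = (if a = z4 then func_id One else if a = z5 then func_id Two else if a = z0 then point Two z0 else point Two z1)"
text \<open>All elements of \<open>P\<close> act by the same transformation, picking out the arrow
  \<open>z2\<close>. This forces the corresponding 2-cells of the diagram to agree with the inserted
  one on a cone.\<close>

definition W2 where "W2 \<sigma> = (if \<sigma> : P then point_nt (point Two z0) (point Two z1) z2 else nt_id (W1 \<sigma>))"
definition W where "W = strict_psfun S CAT W0 W1 W2"

lemma W0_simps [simp]: "W0 z4 = One" "W0 z5 = Two"
  by (simp_all add: W0_def)

lemma W1_simps [simp]: "W1 z4 = func_id One" "W1 z5 = func_id Two" "W1 z0 = point Two z0" "W1 z1 = point Two z1"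
  by (simp_all add: W1_def)

lemma W2_simps [simp]: "p : P ==> W2 p = point_nt (point Two z0) (point Two z1) z2" "s \<notin> P ==> W2 s = nt_id (W1 s)"
  by (simp_all add: W2_def)

sublocale S: two_category S by (rule two_category_S)

text \<open>A 2-functor out of the shape is a parallel pair with a family of 2-cells indexed by
  \<open>P\<close>; identities force the rest. It serves for the weight as well as for the
  diagrams.\<close>

lemma two_functor_shape:
  assumes K: "two_category K" and d: "d0 : obs K" "d1 : obs K"
    and f: "f : ars K" "src K f = d0" "tgt K f = d1" and g: "g : ars K" "src K g = d0" "tgt K g = d1"
    and s: "!!p. p : P ==> s p : cells K & cdom K (s p) = f & ccod K (s p) = g"
    and F0: "F0 z4 = d0" "F0 z5 = d1" and F1: "F1 z4 = id1 K d0" "F1 z5 = id1 K d1" "F1 z0 = f" "F1 z1 = g"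
    and F2: "!!p. p : P ==> F2 p = s p" "!!p. p \<notin> P ==> F2 p = id2 K (F1 p)"
  shows "two_functor S K (strict_psfun S K F0 F1 F2)"
proof -
  interpret K: two_category K by fact
  interpret two_categories S K by unfold_locales
  note [simp] = d f g s F0 F1 F2
  have u: "s p |>\<^bsub>K\<^esub> (id1 K d0) = s p" "(id1 K d1) <|\<^bsub>K\<^esub> s p = s p" if "p : P" for p
    using K.hcomp_units[of "s p"] that by simp_all
  show ?thesis
    by (rule two_functor_strict) (auto simp: u dest: zP split: if_splits)
qed

lemma two_functor_W: "two_functor S CAT W"
  unfolding W_def by (rule two_functor_shape[OF two_category_CAT]) simp_all

end

lemma psfun_comp_simps [simp]:
  "x : obs S ==> pf0 (psfun_comp S M G F) x = pf0 G (pf0 F x)" "f : ars S ==> pf1 (psfun_comp S M G F) f = pf1 G (pf1 F f)"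
  "s : cells S ==> pf2 (psfun_comp S M G F) s = pf2 G (pf2 F s)"
  by (simp_all add: psfun_comp_def)

lemma strict_functorI: "two_category X ==> two_category Y ==> two_functor X Y U ==> strict_functor X Y U"
  by (simp add: strict_functor_def strict_functor_axioms_def two_functorD)

lemma two_functor_comp:
  assumes "strict_functor S K F" "strict_functor K M G"
  shows "two_functor S M (psfun_comp S M G F)"
proof -
  interpret F: strict_functor S K F by fact
  interpret G: strict_functor K M G by fact
  interpret two_categories S M by unfold_locales
  have i: "x : obs S ==> pfi F x = id2 K (id1 K (pf0 F x))" "y : obs K ==> pfi G y = id2 M (id1 M (pf0 G y))" for x y
    using F.strict G.strict by (simp_all add: two_functor_def)
  have "psfun_comp S M G F = strict_psfun S M (%x. pf0 G (pf0 F x)) (%f. pf1 G (pf1 F f)) (%s. pf2 G (pf2 F s))"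
    by (auto simp: psfun_comp_def strict_psfun_def cpairs_def F.pfc_U G.pfc_U i intro!: restrict_ext)
  moreover have "two_functor S M (strict_psfun S M (%x. pf0 G (pf0 F x)) (%f. pf1 G (pf1 F f)) (%s. pf2 G (pf2 F s)))"
    by (rule two_functor_strict) simp_all
  ultimately show ?thesis by simp
qed

section \<open>Pseudonatural transformations between 2-functors\<close>

context two_categories
begin

lemma strict_pseudonatural:
  assumes "two_functor S K F" "two_functor S K G"
    and [simp]: "!!x. x : obs S ==> c x : ars K" "!!x. x : obs S ==> src K (c x) = pf0 F x" "!!x. x : obs S ==> tgt K (c x) = pf0 G x"
    and sq: "!!f. f : ars S ==> pf1 G f \<odot>\<^bsub>K\<^esub> c (src S f) = c (tgt S f) \<odot>\<^bsub>K\<^esub> pf1 F f"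
    and nat: "!!s. s : cells S ==> pf2 G s |>\<^bsub>K\<^esub> (c (src S (cdom S s))) = (c (tgt S (cdom S s))) <|\<^bsub>K\<^esub> pf2 F s"
  shows "pseudonatural S K \<lparr>psrc = F, ptgt = G, pcomp = restrict c (obs S), pnat = (\<lambda>f \<in> ars S. id2 K (pf1 G f \<odot>\<^bsub>K\<^esub> c (src S f)))\<rparr>" (is "pseudonatural S K ?\<alpha>")
proof -
  interpret F: strict_functor S K F using assms(1) by (intro strict_functorI) unfold_locales
  interpret G: strict_functor S K G using assms(2) by (intro strict_functorI) unfold_locales
  have i: "pfi F x = id2 K (id1 K (pf0 F x))" "pfi G x = id2 K (id1 K (pf0 G x))" if "x : obs S" for x
    using F.strict G.strict that by (simp_all add: two_functor_def)
  have c: "pf1 G h \<odot>\<^bsub>K\<^esub> c (tgt S f) \<odot>\<^bsub>K\<^esub> pf1 F f = c (tgt S h) \<odot>\<^bsub>K\<^esub> pf1 F h \<odot>\<^bsub>K\<^esub> pf1 F f"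
    if [simp]: "h : ars S" "f : ars S" "src S h = tgt S f" for h f
    using arg_cong[OF sq[of h], of "%k. k \<odot>\<^bsub>K\<^esub> pf1 F f"] by simp
  show ?thesis
    unfolding pseudonatural_def
  proof (intro conjI allI impI)
    fix s assume [simp]: "s : cells S"
    note sq[of "cdom S s", simplified, simp] sq[of "ccod S s", simplified, simp]
    show "pnat ?\<alpha> (ccod S s) \<bullet>\<^bsub>K\<^esub>
         (pf2 (ptgt ?\<alpha>) s |>\<^bsub>K\<^esub> (pcomp ?\<alpha> (src S (cdom S s)))) =
         (id2 K (pcomp ?\<alpha> (tgt S (cdom S s))) \<star>\<^bsub>K\<^esub>
          pf2 (psrc ?\<alpha>) s) \<bullet>\<^bsub>K\<^esub>
         pnat ?\<alpha> (cdom S s)"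
      by (simp add: nat)
  qed (simp_all add: F.pfc_U G.pfc_U i sq c F.pseudofunctor_axioms G.pseudofunctor_axioms in_hom1_def in_hom2_def)
qed

text \<open>For 2-functors the unit coherence cells are identities, so the unit axiom says that
  naturality cells at identities are identities. A cone thus has only two naturality cells to
  describe.\<close>

lemma pnat_id1:
  assumes "pseudonatural S K \<alpha>" "two_functor S K (psrc \<alpha>)" "two_functor S K (ptgt \<alpha>)" and x [simp]: "x : obs S"
  shows "pnat \<alpha> (id1 S x) = id2 K (pcomp \<alpha> x)"
proof -
  interpret \<alpha>: pseudonatural S K \<alpha> by fact
  interpret F: strict_functor S K "psrc \<alpha>" using assms(2) by (intro strict_functorI) unfold_locales
  interpret G: strict_functor S K "ptgt \<alpha>" using assms(3) by (intro strict_functorI) unfold_locales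
  have i: "pfi (psrc \<alpha>) x = id2 K (id1 K (pf0 (psrc \<alpha>) x))" "pfi (ptgt \<alpha>) x = id2 K (id1 K (pf0 (ptgt \<alpha>) x))"
    using F.strict G.strict by (simp_all add: two_functor_def)
  show ?thesis using \<alpha>.pnat_unit[OF x] by (simp add: i)
qed

end

lemma invertible_nattr:
  assumes "invertible2 CAT \<tau>" "x : Ob (fdom (ntdom \<tau>))"
  shows "is_iso (fcod (ntdom \<tau>)) (ntc \<tau> x)"
proof -
  obtain \<tau>' where i: "CAT.iso2 \<tau> \<tau>'" using assms(1) by (auto simp: CAT.invertible2_iff)
  then have t: "is_nattr \<tau>" "is_nattr \<tau>'" "ntdom \<tau>' = ntcod \<tau>" "ntcod \<tau>' = ntdom \<tau>"
    and e: "\<tau>' \<cdot>\<^sub>N \<tau> = nt_id (ntdom \<tau>)" "\<tau> \<cdot>\<^sub>N \<tau>' = nt_id (ntcod \<tau>)"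
    by (auto simp: CAT.iso2_def)
  interpret \<tau>: is_nattr \<tau> by fact
  interpret \<tau>': is_nattr \<tau>' by fact
  have "inverse_arrows (fcod (ntdom \<tau>)) (ntc \<tau> x) (ntc \<tau>' x)"
    using arg_cong[OF e(1), of "%n. ntc n x"] arg_cong[OF e(2), of "%n. ntc n x"] assms(2) t
      \<tau>'.nattr_simps(3-5)[of x]
    by (simp add: inverse_arrows_def)
  then show ?thesis by (auto simp: is_iso_def)
qed

section \<open>Cones over an inserter diagram\<close>

locale inserter_diagram = inserter_shape z0 z1 z2 z3 z4 z5 P + H: two_category H
  for z0 z1 z2 z3 z4 z5 :: 'k and P and H :: "('o, 'k, 'k) tcat" (structure) +
  fixes d0 d1 f g \<sigma>
  assumes d: "d0 : obs H" "d1 : obs H"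
    and f: "f : ars H" "src H f = d0" "tgt H f = d1" and g: "g : ars H" "src H g = d0" "tgt H g = d1"
    and \<sigma>: "!!p. p : P ==> \<sigma> p : cells H & cdom H (\<sigma> p) = f & ccod H (\<sigma> p) = g"
begin

lemma dfg [simp]: "d0 : obs H" "d1 : obs H" "f : ars H" "src H f = d0" "tgt H f = d1" "g : ars H" "src H g = d0" "tgt H g = d1"
  "p : P ==> \<sigma> p : cells H" "p : P ==> cdom H (\<sigma> p) = f" "p : P ==> ccod H (\<sigma> p) = g"
  using d f g \<sigma> by auto

definition D0 where "D0 x = (if x = z4 then d0 else d1)"
definition D1 where "D1 a = (if a = z4 then id1 H d0 else if a = z5 then id1 H d1 else if a = z0 then f else g)"
definition D2 where "D2 p = (if p : P then \<sigma> p else id2 H (D1 p))"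
definition D where "D = strict_psfun S H D0 D1 D2"

lemma D_simps [simp]: "D0 z4 = d0" "D0 z5 = d1" "D1 z4 = id1 H d0" "D1 z5 = id1 H d1" "D1 z0 = f" "D1 z1 = g"
  "p : P ==> D2 p = \<sigma> p" "p \<notin> P ==> D2 p = id2 H (D1 p)"
  by (simp_all add: D0_def D1_def D2_def)

lemma two_functor_D: "two_functor S H D"
  unfolding D_def by (rule two_functor_shape[OF H.two_category_axioms d f g, of \<sigma>]) simp_all

definition HD where "HD X = psfun_comp S CAT (corep H X) D"

lemma two_functor_HD: "two_functor S CAT (HD X)"
  unfolding HD_def
  by (rule two_functor_comp[OF strict_functorI strict_functorI])
    (rule S.two_category_axioms H.two_category_axioms two_functor_D two_category_CAT H.two_functor_corep)+

sublocale SC: two_categories S CAT by unfold_locales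

lemma HD_simps [simp]: "pf0 (HD X) z4 = hom_cat H X d0" "pf0 (HD X) z5 = hom_cat H X d1"
  "pf1 (HD X) z4 = func_id (hom_cat H X d0)" "pf1 (HD X) z5 = func_id (hom_cat H X d1)" "pf1 (HD X) z0 = corep_ar H X f" "pf1 (HD X) z1 = corep_ar H X g"
  "p : P ==> pf2 (HD X) p = corep_cell H X (\<sigma> p)"
  "pf2 (HD X) z4 = nt_id (func_id (hom_cat H X d0))" "pf2 (HD X) z5 = nt_id (func_id (hom_cat H X d1))"
  "pf2 (HD X) z0 = nt_id (corep_ar H X f)" "pf2 (HD X) z1 = nt_id (corep_ar H X g)"
proof -
  interpret C: strict_functor S CAT "HD X" by (intro strict_functorI two_functor_HD S.two_category_axioms two_category_CAT)
  show o: "pf0 (HD X) z4 = hom_cat H X d0" "pf0 (HD X) z5 = hom_cat H X d1" by (simp_all add: HD_def D_def)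
  show a: "pf1 (HD X) z4 = func_id (hom_cat H X d0)" "pf1 (HD X) z5 = func_id (hom_cat H X d1)"
    using C.U_id1[of z4] C.U_id1[of z5] o by simp_all
  show a': "pf1 (HD X) z0 = corep_ar H X f" "pf1 (HD X) z1 = corep_ar H X g" by (simp_all add: HD_def D_def)
  show "p : P ==> pf2 (HD X) p = corep_cell H X (\<sigma> p)" by (simp add: HD_def D_def)
  show "pf2 (HD X) z4 = nt_id (func_id (hom_cat H X d0))" "pf2 (HD X) z5 = nt_id (func_id (hom_cat H X d1))"
    "pf2 (HD X) z0 = nt_id (corep_ar H X f)" "pf2 (HD X) z1 = nt_id (corep_ar H X g)"
    using C.pf_simps(8)[of z4] C.pf_simps(8)[of z5] C.pf_simps(8)[of z0] C.pf_simps(8)[of z1] a a' by simp_all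
qed

lemma W_simps [simp]: "pf0 W z4 = One" "pf0 W z5 = Two" "pf1 W z4 = func_id One" "pf1 W z5 = func_id Two" "pf1 W z0 = point Two z0" "pf1 W z1 = point Two z1"
  "p : P ==> pf2 W p = point_nt (point Two z0) (point Two z1) z2"
  "pf2 W z4 = nt_id (func_id One)" "pf2 W z5 = nt_id (func_id Two)" "pf2 W z0 = nt_id (point Two z0)" "pf2 W z1 = nt_id (point Two z1)"
  by (simp_all add: W_def)

text \<open>The strict cone of a pair \<open>(x, k)\<close>: the object \<open>x\<close> over the
  domain, the arrow \<open>k\<close> over the codomain, and identities as naturality cells.\<close>

definition cone where
  "cone X x k = \<lparr>psrc = W, ptgt = HD X, pcomp = restrict (%s. if s = z4 then point (hom_cat H X d0) x else arrow (hom_cat H X d1) k) (obs S),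
     pnat = (\<lambda>a \<in> ars S. nt_id (pf1 (HD X) a \<circ>\<^sub>F (if src S a = z4 then point (hom_cat H X d0) x else arrow (hom_cat H X d1) k)))\<rparr>"

lemma pseudonatural_cone:
  assumes x [simp]: "x : ars H" "src H x = X" "tgt H x = d0" and k [simp]: "k : cells H" "cdom H k = f \<odot> x" "ccod H k = g \<odot> x"
    and p: "!!p. p : P ==> k = \<sigma> p |> x"
  shows "pseudonatural S CAT (cone X x k)"
proof -
  note [simp] = H.category_hom_cat
  let ?c = "%s. if s = z4 then point (hom_cat H X d0) x else arrow (hom_cat H X d1) k"
  have sq0: "corep_ar H X f \<circ>\<^sub>F point (hom_cat H X d0) x = arrow (hom_cat H X d1) k \<circ>\<^sub>F point Two z0"
    "corep_ar H X g \<circ>\<^sub>F point (hom_cat H X d0) x = arrow (hom_cat H X d1) k \<circ>\<^sub>F point Two z1"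
    by (rule functor_eqI; auto)+
  have id: "func_id (hom_cat H X d0) \<circ>\<^sub>F point (hom_cat H X d0) x = point (hom_cat H X d0) x" "point (hom_cat H X d0) x \<circ>\<^sub>F func_id One = point (hom_cat H X d0) x"
    "func_id (hom_cat H X d1) \<circ>\<^sub>F arrow (hom_cat H X d1) k = arrow (hom_cat H X d1) k" "arrow (hom_cat H X d1) k \<circ>\<^sub>F func_id Two = arrow (hom_cat H X d1) k"
    using CAT.two_cat1(9,10)[of "point (hom_cat H X d0) x"] CAT.two_cat1(9,10)[of "arrow (hom_cat H X d1) k"] by simp_all
  have sq: "pf1 (HD X) a \<circ>\<^sub>F ?c (src S a) = ?c (tgt S a) \<circ>\<^sub>F pf1 W a" if "a : ars S" for a
    using that by (auto simp: sq0 id)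
  have nt: "nt_id F \<star>\<^sub>N nt_id G = nt_id (F \<circ>\<^sub>F G)" if "is_functor F" "is_functor G" "fdom F = fcod G"
    for F G :: "('k, 'k, 'k, 'k) func"
    using CAT.hcomp_id2[of F G] that by simp
  have np: "corep_cell H X (\<sigma> p) \<star>\<^sub>N nt_id (point (hom_cat H X d0) x) = nt_id (arrow (hom_cat H X d1) k) \<star>\<^sub>N point_nt (point Two z0) (point Two z1) z2"
    if [simp]: "p : P" for p
  proof (rule nattr_eqI)
    fix w assume "w : Ob (fdom (ntdom (nt_id (arrow (hom_cat H X d1) k) \<star>\<^sub>N point_nt (point Two z0) (point Two z1) z2)))"
    then have [simp]: "w = z0" by simp
    have "\<sigma> p |> x = k" using p[OF that] by simp
    then show "ntc (corep_cell H X (\<sigma> p) \<star>\<^sub>N nt_id (point (hom_cat H X d0) x)) w = ntc (nt_id (arrow (hom_cat H X d1) k) \<star>\<^sub>N point_nt (point Two z0) (point Two z1) z2) w"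
      by simp
  qed (simp_all add: sq0 H.is_nattr_corep_cell)
  have nat: "pf2 (HD X) s \<star>\<^sub>N nt_id (?c (src S (cdom S s))) = nt_id (?c (tgt S (cdom S s))) \<star>\<^sub>N pf2 W s" if "s : cells S" for s
    using that by (auto simp: nt id sq0 np dest: zP)
  have "pseudonatural S CAT \<lparr>psrc = W, ptgt = HD X, pcomp = restrict ?c (obs S),
    pnat = (\<lambda>a \<in> ars S. id2 CAT (pf1 (HD X) a \<odot>\<^bsub>CAT\<^esub> ?c (src S a)))\<rparr>"
  proof (rule SC.strict_pseudonatural[OF two_functor_W two_functor_HD])
    fix s assume "s : obs S"
    then have "s = z4 | s = z5" by simp
    then show "?c s : ars CAT" "src CAT (?c s) = pf0 W s" "tgt CAT (?c s) = pf0 (HD X) s" by auto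
  next
    fix a assume "a : ars S"
    then show "pf1 (HD X) a \<odot>\<^bsub>CAT\<^esub> ?c (src S a) = ?c (tgt S a) \<odot>\<^bsub>CAT\<^esub> pf1 W a"
      unfolding CAT_simps by (rule sq)
  next
    fix s assume "s : cells S"
    then show "pf2 (HD X) s |>\<^bsub>CAT\<^esub> (?c (src S (cdom S s))) = (?c (tgt S (cdom S s))) <|\<^bsub>CAT\<^esub> pf2 W s"
      unfolding CAT_simps by (rule nat)
  qed
  then show ?thesis unfolding cone_def CAT_simps .
qed

end

context inserter_diagram
begin

text \<open>A general cone consists of an object \<open>cq\<close> of \<open>H(X, d0)\<close>, an
  arrow \<open>cc\<close> from \<open>cy0\<close> to \<open>cy1\<close> in \<open>H(X, d1)\<close>,
  and isomorphisms \<open>ca\<close> and \<open>cb\<close> from \<open>f\<close> and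
  \<open>g\<close> applied to \<open>cq\<close> onto the ends of this arrow. It thus encodes a cell
  from \<open>f\<close> to \<open>g\<close> on \<open>cq\<close>, namely \<open>cc\<close>
  conjugated by \<open>ca\<close> and \<open>cb\<close>.\<close>

definition cq where "cq \<alpha> = fob (pcomp \<alpha> z4) z0"
definition cy0 where "cy0 \<alpha> = fob (pcomp \<alpha> z5) z0"
definition cy1 where "cy1 \<alpha> = fob (pcomp \<alpha> z5) z1"
definition cc where "cc \<alpha> = far (pcomp \<alpha> z5) z2"
definition ca where "ca \<alpha> = ntc (pnat \<alpha> z0) z0"
definition cb where "cb \<alpha> = ntc (pnat \<alpha> z1) z0"

definition is_cone where "is_cone X \<alpha> \<longleftrightarrow> pseudonatural S CAT \<alpha> & psrc \<alpha> = W & ptgt \<alpha> = HD X"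

lemma cone_components:
  assumes "is_cone X \<alpha>"
  shows "is_functor (pcomp \<alpha> z4)" "fdom (pcomp \<alpha> z4) = One" "fcod (pcomp \<alpha> z4) = hom_cat H X d0"
    "is_functor (pcomp \<alpha> z5)" "fdom (pcomp \<alpha> z5) = Two" "fcod (pcomp \<alpha> z5) = hom_cat H X d1"
    "is_nattr (pnat \<alpha> z0)" "ntdom (pnat \<alpha> z0) = corep_ar H X f \<circ>\<^sub>F pcomp \<alpha> z4" "ntcod (pnat \<alpha> z0) = pcomp \<alpha> z5 \<circ>\<^sub>F point Two z0"
    "is_nattr (pnat \<alpha> z1)" "ntdom (pnat \<alpha> z1) = corep_ar H X g \<circ>\<^sub>F pcomp \<alpha> z4" "ntcod (pnat \<alpha> z1) = pcomp \<alpha> z5 \<circ>\<^sub>F point Two z1"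
    "pnat \<alpha> z4 = nt_id (pcomp \<alpha> z4)" "pnat \<alpha> z5 = nt_id (pcomp \<alpha> z5)"
  using assms[unfolded is_cone_def] pseudonatural.pn_simps(1-3)[of S CAT \<alpha> z4] pseudonatural.pn_simps(1-3)[of S CAT \<alpha> z5]
    pseudonatural.pn_simps(4-6)[of S CAT \<alpha> z0] pseudonatural.pn_simps(4-6)[of S CAT \<alpha> z1]
    SC.pnat_id1[of \<alpha> z4] SC.pnat_id1[of \<alpha> z5] two_functor_W two_functor_HD
  by simp_all

lemma cone_data:
  assumes "is_cone X \<alpha>"
  shows "cq \<alpha> : ars H" "src H (cq \<alpha>) = X" "tgt H (cq \<alpha>) = d0"
    "cy0 \<alpha> : ars H" "src H (cy0 \<alpha>) = X" "tgt H (cy0 \<alpha>) = d1" "cy1 \<alpha> : ars H" "src H (cy1 \<alpha>) = X" "tgt H (cy1 \<alpha>) = d1"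
    "cc \<alpha> : cells H" "cdom H (cc \<alpha>) = cy0 \<alpha>" "ccod H (cc \<alpha>) = cy1 \<alpha>"
    "ca \<alpha> : cells H" "cdom H (ca \<alpha>) = f \<odot> cq \<alpha>" "ccod H (ca \<alpha>) = cy0 \<alpha>"
    "cb \<alpha> : cells H" "cdom H (cb \<alpha>) = g \<odot> cq \<alpha>" "ccod H (cb \<alpha>) = cy1 \<alpha>"
    "far (pcomp \<alpha> z4) z0 = id2 H (cq \<alpha>)" "far (pcomp \<alpha> z5) z0 = id2 H (cy0 \<alpha>)" "far (pcomp \<alpha> z5) z1 = id2 H (cy1 \<alpha>)"
proof -
  note c = cone_components[OF assms]
  interpret F: is_functor "pcomp \<alpha> z4" by fact
  interpret G: is_functor "pcomp \<alpha> z5" by fact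
  show q: "cq \<alpha> : ars H" "src H (cq \<alpha>) = X" "tgt H (cq \<alpha>) = d0"
    using F.fob_Ob[of z0] by (simp_all add: cq_def c)
  show "cy0 \<alpha> : ars H" "src H (cy0 \<alpha>) = X" "tgt H (cy0 \<alpha>) = d1" "cy1 \<alpha> : ars H" "src H (cy1 \<alpha>) = X" "tgt H (cy1 \<alpha>) = d1"
    using G.fob_Ob[of z0] G.fob_Ob[of z1] by (simp_all add: cy0_def cy1_def c)
  show "cc \<alpha> : cells H" "cdom H (cc \<alpha>) = cy0 \<alpha>" "ccod H (cc \<alpha>) = cy1 \<alpha>"
    using G.functor_simps(2-4)[of z2] by (simp_all add: cc_def cy0_def cy1_def c)
  show "ca \<alpha> : cells H" "cdom H (ca \<alpha>) = f \<odot> cq \<alpha>" "ccod H (ca \<alpha>) = cy0 \<alpha>"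
    using is_nattr.nattr_simps(3-5)[OF c(7), of z0] q by (simp_all add: ca_def c cq_def cy0_def)
  show "cb \<alpha> : cells H" "cdom H (cb \<alpha>) = g \<odot> cq \<alpha>" "ccod H (cb \<alpha>) = cy1 \<alpha>"
    using is_nattr.nattr_simps(3-5)[OF c(10), of z0] q by (simp_all add: cb_def c cq_def cy1_def)
  show "far (pcomp \<alpha> z4) z0 = id2 H (cq \<alpha>)" "far (pcomp \<alpha> z5) z0 = id2 H (cy0 \<alpha>)" "far (pcomp \<alpha> z5) z1 = id2 H (cy1 \<alpha>)"
    using F.far_Id[of z0] G.far_Id[of z0] G.far_Id[of z1] by (simp_all add: c cq_def cy0_def cy1_def)
qed

lemma cone_invertible:
  assumes a: "is_cone X \<alpha>"
  shows "invertible2 H (ca \<alpha>)" "invertible2 H (cb \<alpha>)"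
proof -
  interpret pseudonatural S CAT \<alpha> using assms by (simp add: is_cone_def)
  show "invertible2 H (ca \<alpha>)" "invertible2 H (cb \<alpha>)"
    using invertible_nattr[OF pnat_inv, of z0 z0] invertible_nattr[OF pnat_inv, of z1 z0]
    by (simp_all add: cone_components[OF a] ca_def cb_def H.is_iso_hom_cat)
qed

text \<open>Naturality at the 2-cell \<open>p\<close>, evaluated at the only object of
  \<open>One\<close>; the weight sends \<open>p\<close> to the arrow \<open>z2\<close>, whose image
  is \<open>cc\<close>.\<close>

lemma cone_P:
  assumes a: "is_cone X \<alpha>" and p [simp]: "p : P"
  shows "cb \<alpha> \<bullet> (\<sigma> p |> (cq \<alpha>)) = cc \<alpha> \<bullet> ca \<alpha>"
proof -
  interpret pseudonatural S CAT \<alpha> using assms by (simp add: is_cone_def)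
  have e: "psrc \<alpha> = W" "ptgt \<alpha> = HD X" using a by (simp_all add: is_cone_def)
  note c = cone_components[OF a] and [simp] = cone_data[OF a]
  have "ntc (pnat \<alpha> z1 \<cdot>\<^sub>N (corep_cell H X (\<sigma> p) \<star>\<^sub>N nt_id (pcomp \<alpha> z4))) z0 = ntc ((nt_id (pcomp \<alpha> z5) \<star>\<^sub>N pf2 W p) \<cdot>\<^sub>N pnat \<alpha> z0) z0"
    using pnat_nat[of p] by (simp add: e)
  then show ?thesis
    by (simp add: c cq_def[symmetric] cy0_def[symmetric] cy1_def[symmetric] cc_def[symmetric] ca_def[symmetric] cb_def[symmetric])
qed

lemma modif_cone:
  assumes a: "is_cone X \<alpha>" "is_cone X \<beta>" and G: "modification S CAT \<Gamma>" "msrc \<Gamma> = \<alpha>" "mtgt \<Gamma> = \<beta>"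
  defines "s \<equiv> ntc (mcomp \<Gamma> z4) z0" and "t0 \<equiv> ntc (mcomp \<Gamma> z5) z0" and "t1 \<equiv> ntc (mcomp \<Gamma> z5) z1"
  shows "s : cells H" "cdom H s = cq \<alpha>" "ccod H s = cq \<beta>" "t0 : cells H" "cdom H t0 = cy0 \<alpha>" "ccod H t0 = cy0 \<beta>"
    "t1 : cells H" "cdom H t1 = cy1 \<alpha>" "ccod H t1 = cy1 \<beta>"
    "t1 \<bullet> cc \<alpha> = cc \<beta> \<bullet> t0" "ca \<beta> \<bullet> (f <| s) = t0 \<bullet> ca \<alpha>" "cb \<beta> \<bullet> (g <| s) = t1 \<bullet> cb \<alpha>"
    "!!w. w : Ob One ==> w = z0"
proof -
  interpret \<Gamma>: modification S CAT \<Gamma> by fact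
  note c = cone_components[OF a(1)] cone_components[OF a(2)] and [simp] = cone_data[OF a(1)] cone_data[OF a(2)]
  have e: "psrc \<alpha> = W" "ptgt \<alpha> = HD X" using a by (simp_all add: is_cone_def)
  have m: "is_nattr (mcomp \<Gamma> z4)" "ntdom (mcomp \<Gamma> z4) = pcomp \<alpha> z4" "ntcod (mcomp \<Gamma> z4) = pcomp \<beta> z4"
    "is_nattr (mcomp \<Gamma> z5)" "ntdom (mcomp \<Gamma> z5) = pcomp \<alpha> z5" "ntcod (mcomp \<Gamma> z5) = pcomp \<beta> z5"
    using \<Gamma>.mod_simps(3-5)[of z4] \<Gamma>.mod_simps(3-5)[of z5] by (simp_all add: G)
  show st [simp]: "s : cells H" "cdom H s = cq \<alpha>" "ccod H s = cq \<beta>" "t0 : cells H" "cdom H t0 = cy0 \<alpha>" "ccod H t0 = cy0 \<beta>"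
    "t1 : cells H" "cdom H t1 = cy1 \<alpha>" "ccod H t1 = cy1 \<beta>"
    using is_nattr.nattr_simps(3-5)[OF m(1), of z0] is_nattr.nattr_simps(3-5)[OF m(4), of z0] is_nattr.nattr_simps(3-5)[OF m(4), of z1]
    by (simp_all add: m c s_def t0_def t1_def cq_def cy0_def cy1_def)
  note f = cq_def[symmetric] cy0_def[symmetric] cy1_def[symmetric] cc_def[symmetric] ca_def[symmetric] cb_def[symmetric]
  note s = s_def[symmetric] t0_def[symmetric] t1_def[symmetric]
  show "t1 \<bullet> cc \<alpha> = cc \<beta> \<bullet> t0"
    using is_nattr.ntc_nat[OF m(4), of z2] by (simp add: m c f s)
  show "ca \<beta> \<bullet> (f <| s) = t0 \<bullet> ca \<alpha>"
    using arg_cong[OF \<Gamma>.mcomp_nat[of z0], of "%n. ntc n z0"] by (simp add: G e m c f s)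
  show "cb \<beta> \<bullet> (g <| s) = t1 \<bullet> cb \<alpha>"
    using arg_cong[OF \<Gamma>.mcomp_nat[of z1], of "%n. ntc n z0"] by (simp add: G e m c f s)
qed simp

text \<open>A modification of cones is a cell \<open>s\<close> between the objects with two cells
  between the ends of the arrows. The three equations are naturality along \<open>z2\<close> in
  \<open>Two\<close> and the modification axiom at the two arrows of the pair.\<close>

lemma cone_modif:
  assumes a: "is_cone X \<alpha>" "is_cone X \<beta>"
    and s [simp]: "s : cells H" "cdom H s = cq \<alpha>" "ccod H s = cq \<beta>" "t0 : cells H" "cdom H t0 = cy0 \<alpha>" "ccod H t0 = cy0 \<beta>"
      "t1 : cells H" "cdom H t1 = cy1 \<alpha>" "ccod H t1 = cy1 \<beta>"
    and t: "t1 \<bullet> cc \<alpha> = cc \<beta> \<bullet> t0" "ca \<beta> \<bullet> (f <| s) = t0 \<bullet> ca \<alpha>" "cb \<beta> \<bullet> (g <| s) = t1 \<bullet> cb \<alpha>"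
  shows "modification S CAT \<lparr>msrc = \<alpha>, mtgt = \<beta>,
    mcomp = (\<lambda>x \<in> obs S. if x = z4 then point_nt (pcomp \<alpha> z4) (pcomp \<beta> z4) s else arrow_nt (pcomp \<alpha> z5) (pcomp \<beta> z5) t0 t1)\<rparr>"
    (is "modification S CAT ?\<Gamma>")
proof -
  interpret \<alpha>: pseudonatural S CAT \<alpha> using a by (simp add: is_cone_def)
  interpret \<beta>: pseudonatural S CAT \<beta> using a by (simp add: is_cone_def)
  note c = cone_components[OF a(1)] cone_components[OF a(2)] and [simp] = cone_data[OF a(1)] cone_data[OF a(2)]
  have e: "psrc \<alpha> = W" "ptgt \<alpha> = HD X" "psrc \<beta> = W" "ptgt \<beta> = HD X" using a by (simp_all add: is_cone_def)
  note f = cq_def[symmetric] cy0_def[symmetric] cy1_def[symmetric] cc_def[symmetric] ca_def[symmetric] cb_def[symmetric]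
  let ?m4 = "point_nt (pcomp \<alpha> z4) (pcomp \<beta> z4) s" and ?m5 = "arrow_nt (pcomp \<alpha> z5) (pcomp \<beta> z5) t0 t1"
  have n: "is_nattr ?m4" "is_nattr ?m5"
    by (rule is_nattr_point is_nattr_arrow; simp add: c f t)+
  have i4: "nt_id (pcomp \<beta> z4) \<cdot>\<^sub>N (nt_id (func_id (hom_cat H X d0)) \<star>\<^sub>N ?m4) = (?m4 \<star>\<^sub>N nt_id (func_id One)) \<cdot>\<^sub>N nt_id (pcomp \<alpha> z4)"
    using CAT.hcomp_units[of ?m4] CAT.vcomp_id2[of ?m4] CAT.id2_vcomp[of ?m4] n by (simp add: c)
  have i5: "nt_id (pcomp \<beta> z5) \<cdot>\<^sub>N (nt_id (func_id (hom_cat H X d1)) \<star>\<^sub>N ?m5) = (?m5 \<star>\<^sub>N nt_id (func_id Two)) \<cdot>\<^sub>N nt_id (pcomp \<alpha> z5)"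
    using CAT.hcomp_units[of ?m5] CAT.vcomp_id2[of ?m5] CAT.id2_vcomp[of ?m5] n by (simp add: c)
  have i0: "pnat \<beta> z0 \<cdot>\<^sub>N (nt_id (corep_ar H X f) \<star>\<^sub>N ?m4) = (?m5 \<star>\<^sub>N nt_id (point Two z0)) \<cdot>\<^sub>N pnat \<alpha> z0"
    by (rule nattr_eqI) (simp_all add: c n, simp add: c f t H.category_hom_cat)
  have i1: "pnat \<beta> z1 \<cdot>\<^sub>N (nt_id (corep_ar H X g) \<star>\<^sub>N ?m4) = (?m5 \<star>\<^sub>N nt_id (point Two z1)) \<cdot>\<^sub>N pnat \<alpha> z1"
    by (rule nattr_eqI) (simp_all add: c n, simp add: c f t H.category_hom_cat)
  show ?thesis
    unfolding modification_def in_hom2_def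
  proof (intro conjI allI impI)
    fix a assume "a : ars S"
    then have "a = z4 | a = z5 | a = z0 | a = z1" by simp
    then show "pnat (mtgt ?\<Gamma>) a \<bullet>\<^bsub>CAT\<^esub> ((pf1 (ptgt (msrc ?\<Gamma>)) a) <|\<^bsub>CAT\<^esub> mcomp ?\<Gamma> (src S a))
      = mcomp ?\<Gamma> (tgt S a) |>\<^bsub>CAT\<^esub> (pf1 (psrc (msrc ?\<Gamma>)) a) \<bullet>\<^bsub>CAT\<^esub> pnat (msrc ?\<Gamma>) a"
      by (elim disjE; simp add: e c(13,14,27,28) i4 i5 i0 i1)
  qed (auto simp: e n \<alpha>.pseudonatural_axioms \<beta>.pseudonatural_axioms c)
qed

lemma cone_cone:
  assumes x [simp]: "x : ars H" "src H x = X" "tgt H x = d0" and k [simp]: "k : cells H" "cdom H k = f \<odot> x" "ccod H k = g \<odot> x"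
    and p: "!!p. p : P ==> k = \<sigma> p |> x"
  shows "is_cone X (cone X x k)" "cq (cone X x k) = x" "cy0 (cone X x k) = f \<odot> x" "cy1 (cone X x k) = g \<odot> x" "cc (cone X x k) = k"
    "ca (cone X x k) = id2 H (f \<odot> x)" "cb (cone X x k) = id2 H (g \<odot> x)"
  using pseudonatural_cone[OF x k p]
  by (simp_all add: is_cone_def cone_def cq_def cy0_def cy1_def cc_def ca_def cb_def)

end

section \<open>Precomposition of cones with 1-cells\<close>

context two_category
begin

lemma is_functor_corep_op [simp]: "m : ars K ==> is_functor (corep_ar (op1 K) y m)"
  using two_category.is_functor_corep_ar[OF two_category_op1] by simp

lemma is_nattr_corep_op [simp]: "r : cells K ==> is_nattr (corep_cell (op1 K) y r)"
  using two_category.is_nattr_corep_cell[OF two_category_op1] by simp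

lemma corep_commute:
  "[|m : ars K; a : ars K|] ==> corep_ar K (src K m) a \<circ>\<^sub>F corep_ar (op1 K) (src K a) m = corep_ar (op1 K) (tgt K a) m \<circ>\<^sub>F corep_ar K (tgt K m) a"
  by (rule functor_eqI) simp_all

lemma corep_cell_commute:
  "[|m : ars K; s : cells K|] ==> corep_cell K (src K m) s \<star>\<^sub>N nt_id (corep_ar (op1 K) (src K (cdom K s)) m)
    = nt_id (corep_ar (op1 K) (tgt K (cdom K s)) m) \<star>\<^sub>N corep_cell K (tgt K m) s"
  using corep_commute[of m "cdom K s"] corep_commute[of m "ccod K s"]
  by (intro nattr_eqI) simp_all

lemma psnat_yoneda: "m : ars K ==> pseudonatural K CAT (yoneda_ar K m)"
proof -
  assume m [simp]: "m : ars K"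
  interpret KC: two_categories K CAT by unfold_locales
  have "pseudonatural K CAT \<lparr>psrc = corep K (tgt K m), ptgt = corep K (src K m), pcomp = restrict (%y. corep_ar (op1 K) y m) (obs K),
    pnat = (\<lambda>a \<in> ars K. id2 CAT (pf1 (corep K (src K m)) a \<odot>\<^bsub>CAT\<^esub> corep_ar (op1 K) (src K a) m))\<rparr>"
    by (rule KC.strict_pseudonatural[OF two_functor_corep two_functor_corep])
      (simp_all add: corep_commute corep_cell_commute)
  also have "\<lparr>psrc = corep K (tgt K m), ptgt = corep K (src K m), pcomp = restrict (%y. corep_ar (op1 K) y m) (obs K),
    pnat = (\<lambda>a \<in> ars K. id2 CAT (pf1 (corep K (src K m)) a \<odot>\<^bsub>CAT\<^esub> corep_ar (op1 K) (src K a) m))\<rparr> = yoneda_ar K m"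
    by (auto simp: yoneda_ar_def intro!: restrict_ext)
  finally show ?thesis .
qed

lemma yoneda_ar_simps [simp]:
  "psrc (yoneda_ar K m) = corep K (tgt K m)" "ptgt (yoneda_ar K m) = corep K (src K m)"
  "y : obs K ==> pcomp (yoneda_ar K m) y = corep_ar (op1 K) y m"
  "a : ars K ==> pnat (yoneda_ar K m) a = nt_id (corep_ar K (src K m) a \<circ>\<^sub>F corep_ar (op1 K) (src K a) m)"
  by (simp_all add: yoneda_ar_def)

lemma yoneda_cell_simps [simp]:
  "msrc (yoneda_cell K r) = yoneda_ar K (cdom K r)" "mtgt (yoneda_cell K r) = yoneda_ar K (ccod K r)"
  "y : obs K ==> mcomp (yoneda_cell K r) y = corep_cell (op1 K) y r"
  by (simp_all add: yoneda_cell_def)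

lemma modif_yoneda: "r : cells K ==> modification K CAT (yoneda_cell K r)"
proof -
  assume r [simp]: "r : cells K"
  show ?thesis
    unfolding modification_def
  proof (intro conjI allI impI)
    fix a assume a [simp]: "a : ars K"
    have "nt_id (corep_ar K (src K (cdom K r)) a \<circ>\<^sub>F corep_ar (op1 K) (src K a) (ccod K r)) \<cdot>\<^sub>N
        (nt_id (corep_ar K (src K (cdom K r)) a) \<star>\<^sub>N corep_cell (op1 K) (src K a) r)
      = (corep_cell (op1 K) (tgt K a) r \<star>\<^sub>N nt_id (corep_ar K (tgt K (cdom K r)) a)) \<cdot>\<^sub>N
        nt_id (corep_ar K (src K (cdom K r)) a \<circ>\<^sub>F corep_ar (op1 K) (src K a) (cdom K r))"
      using corep_commute[of "ccod K r" a] corep_commute[of "cdom K r" a]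
      by (intro nattr_eqI) simp_all
    then show "pnat (mtgt (yoneda_cell K r)) a \<bullet>\<^bsub>CAT\<^esub> ((pf1 (ptgt (msrc (yoneda_cell K r))) a) <|\<^bsub>CAT\<^esub> mcomp (yoneda_cell K r) (src K a)) =
         (mcomp (yoneda_cell K r) (tgt K a) |>\<^bsub>CAT\<^esub> (pf1 (psrc (msrc (yoneda_cell K r))) a)) \<bullet>\<^bsub>CAT\<^esub> pnat (msrc (yoneda_cell K r)) a"
      by simp
  qed (simp_all add: psnat_yoneda in_hom2_def, simp add: yoneda_cell_def)
qed

end

context inserter_diagram
begin

sublocale DD: strict_functor S H D
  by (rule strict_functorI[OF S.two_category_axioms H.two_category_axioms two_functor_D])

text \<open>Whiskered with the diagram, precomposition by \<open>m\<close> is a strict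
  transformation between the 2-functors \<open>HD\<close>: composing on the left commutes with
  composing on the right.\<close>

lemma psnat_yoneda_D: "m : ars H ==> pseudonatural S CAT (psnat_wr S CAT (yoneda_ar H m) D)"
proof -
  assume m [simp]: "m : ars H"
  have h: "pf0 (HD X) x = hom_cat H X (pf0 D x)" "pf1 (HD X) a = corep_ar H X (pf1 D a)" "pf2 (HD X) s = corep_cell H X (pf2 D s)"
    if "x : obs S" "a : ars S" "s : cells S" for X x a s
    using DD.pf_simps(1)[OF that(1)] DD.pf_simps(2)[OF that(2)] DD.pf_simps(5)[OF that(3)] that
    by (simp_all only: HD_def psfun_comp_simps corep_simps)
  have z: "z4 : obs S" "z4 : ars S" "z4 : cells S" by simp_all
  \<comment> \<open>The equations were proved jointly, under memberships of an object, an arrow and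
    a cell; in each, the two memberships that do not concern it are discharged by
    \<open>z4\<close>.\<close>
  note h = h(1)[OF _ z(2,3)] h(2)[OF z(1) _ z(3)] h(3)[OF z(1,2)]
  have "pseudonatural S CAT \<lparr>psrc = HD (tgt H m), ptgt = HD (src H m), pcomp = restrict (%x. corep_ar (op1 H) (pf0 D x) m) (obs S),
    pnat = (\<lambda>a \<in> ars S. id2 CAT (pf1 (HD (src H m)) a \<odot>\<^bsub>CAT\<^esub> corep_ar (op1 H) (pf0 D (src S a)) m))\<rparr>"
  proof (rule SC.strict_pseudonatural[OF two_functor_HD two_functor_HD])
    fix a assume a: "a : ars S"
    show "pf1 (HD (src H m)) a \<odot>\<^bsub>CAT\<^esub> corep_ar (op1 H) (pf0 D (src S a)) m = corep_ar (op1 H) (pf0 D (tgt S a)) m \<odot>\<^bsub>CAT\<^esub> pf1 (HD (tgt H m)) a"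
      using H.corep_commute[OF m DD.pf_simps(2)[OF a]] DD.pf_simps(3,4)[OF a] by (simp only: h a CAT_simps)
  next
    fix s assume s: "s : cells S"
    note d = S.cdom_ars[OF s]
    show "pf2 (HD (src H m)) s |>\<^bsub>CAT\<^esub> (corep_ar (op1 H) (pf0 D (src S (cdom S s))) m) =
         (corep_ar (op1 H) (pf0 D (tgt S (cdom S s))) m) <|\<^bsub>CAT\<^esub> pf2 (HD (tgt H m)) s"
      using H.corep_cell_commute[OF m DD.pf_simps(5)[OF s]] DD.pf_simps(3,4)[OF d] DD.pf_simps(6)[OF s] by (simp only: h s CAT_simps)
  next
    fix x assume x: "x : obs S"
    show "corep_ar (op1 H) (pf0 D x) m : ars CAT" "src CAT (corep_ar (op1 H) (pf0 D x) m) = pf0 (HD (tgt H m)) x"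
      "tgt CAT (corep_ar (op1 H) (pf0 D x) m) = pf0 (HD (src H m)) x"
      by (simp_all add: h x del: S_simps HD_simps)
  qed
  also have "\<lparr>psrc = HD (tgt H m), ptgt = HD (src H m), pcomp = restrict (%x. corep_ar (op1 H) (pf0 D x) m) (obs S),
    pnat = (\<lambda>a \<in> ars S. id2 CAT (pf1 (HD (src H m)) a \<odot>\<^bsub>CAT\<^esub> corep_ar (op1 H) (pf0 D (src S a)) m))\<rparr> = psnat_wr S CAT (yoneda_ar H m) D"
    by (auto simp: psnat_wr_def HD_def[symmetric] h simp del: S_simps HD_simps intro!: restrict_ext)
  finally show ?thesis .
qed

lemma yoneda_D_simps [simp]:
  "psrc (psnat_wr S CAT (yoneda_ar H m) D) = HD (tgt H m)" "ptgt (psnat_wr S CAT (yoneda_ar H m) D) = HD (src H m)"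
  "pcomp (psnat_wr S CAT (yoneda_ar H m) D) z4 = corep_ar (op1 H) d0 m" "pcomp (psnat_wr S CAT (yoneda_ar H m) D) z5 = corep_ar (op1 H) d1 m"
  "pnat (psnat_wr S CAT (yoneda_ar H m) D) z0 = nt_id (corep_ar H (src H m) f \<circ>\<^sub>F corep_ar (op1 H) d0 m)"
  "pnat (psnat_wr S CAT (yoneda_ar H m) D) z1 = nt_id (corep_ar H (src H m) g \<circ>\<^sub>F corep_ar (op1 H) d0 m)"
  "msrc (modif_wr S CAT (yoneda_cell H r) D) = psnat_wr S CAT (yoneda_ar H (cdom H r)) D"
  "mtgt (modif_wr S CAT (yoneda_cell H r) D) = psnat_wr S CAT (yoneda_ar H (ccod H r)) D"
  "mcomp (modif_wr S CAT (yoneda_cell H r) D) z4 = corep_cell (op1 H) d0 r" "mcomp (modif_wr S CAT (yoneda_cell H r) D) z5 = corep_cell (op1 H) d1 r"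
  by (simp_all add: psnat_wr_def modif_wr_def HD_def) (simp_all add: D_def)

lemma modif_yoneda_D: "r : cells H ==> modification S CAT (modif_wr S CAT (yoneda_cell H r) D)"
proof -
  assume r [simp]: "r : cells H"
  interpret r: modification H CAT "yoneda_cell H r" by (rule H.modif_yoneda) fact
  have "\<lparr>msrc = psnat_wr S CAT (yoneda_ar H (cdom H r)) D, mtgt = psnat_wr S CAT (yoneda_ar H (ccod H r)) D,
     mcomp = restrict (%x. mcomp (yoneda_cell H r) (pf0 D x)) (obs S)\<rparr> = modif_wr S CAT (yoneda_cell H r) D"
    by (simp add: modif_wr_def)
  moreover have "modification S CAT \<lparr>msrc = psnat_wr S CAT (yoneda_ar H (cdom H r)) D, mtgt = psnat_wr S CAT (yoneda_ar H (ccod H r)) D,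
     mcomp = restrict (%x. mcomp (yoneda_cell H r) (pf0 D x)) (obs S)\<rparr>"
  proof (rule modifI[OF psnat_yoneda_D psnat_yoneda_D])
    fix a assume a: "a : ars S"
    show "pnat (psnat_wr S CAT (yoneda_ar H (ccod H r)) D) a \<bullet>\<^bsub>CAT\<^esub> ((pf1 (ptgt (psnat_wr S CAT (yoneda_ar H (cdom H r)) D)) a) <|\<^bsub>CAT\<^esub> mcomp (yoneda_cell H r) (pf0 D (src S a)))
      = mcomp (yoneda_cell H r) (pf0 D (tgt S a)) |>\<^bsub>CAT\<^esub> (pf1 (psrc (psnat_wr S CAT (yoneda_ar H (cdom H r)) D)) a) \<bullet>\<^bsub>CAT\<^esub> pnat (psnat_wr S CAT (yoneda_ar H (cdom H r)) D) a"
      using r.mcomp_nat[OF DD.pf_simps(2)[OF a]] DD.pf_simps(3,4)[OF a] a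
      by (simp add: psnat_wr_def del: S_simps)
  next
    fix x assume x: "x : obs S"
    then show "mcomp (yoneda_cell H r) (pf0 D x) : cells CAT & cdom CAT (mcomp (yoneda_cell H r) (pf0 D x)) = pcomp (psnat_wr S CAT (yoneda_ar H (cdom H r)) D) x &
      ccod CAT (mcomp (yoneda_cell H r) (pf0 D x)) = pcomp (psnat_wr S CAT (yoneda_ar H (ccod H r)) D) x"
      using DD.pf_simps(1)[OF x] by (simp add: psnat_wr_def del: S_simps)
  qed (simp_all add: S.two_category_axioms del: S_simps)
  ultimately show ?thesis by simp
qed

lemma cones_simps:
  "X : obs H ==> pf0 (weighted_cones H S W D) X = hom_cat (PS S CAT) W (HD X)"
  "m : ars H ==> pf1 (weighted_cones H S W D) m = corep_ar (PS S CAT) W (psnat_wr S CAT (yoneda_ar H m) D)"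
  "r : cells H ==> pf2 (weighted_cones H S W D) r = corep_cell (PS S CAT) W (modif_wr S CAT (yoneda_cell H r) D)"
  using two_functorD[OF two_functor_HD] psnat_yoneda_D modif_yoneda_D
  by (simp_all add: weighted_cones_def yoneda_def precomp_def two_functorD[OF H.two_functor_corep] HD_def H.psnat_yoneda H.modif_yoneda corep_simps)

end

text \<open>The elementary form of the bilimit, parallel to \<open>em\<close>: faithfulness,
  fullness on compatible cells, and realisation of every pair \<open>(x, k)\<close>. The family
  \<open>\<sigma>\<close> indexed by \<open>P\<close> is the one with which the inserted cell must
  agree.\<close>

definition inserts where
  "inserts H P f g \<sigma> q h \<longleftrightarrow> q : ars H & tgt H q = src H g & h : cells H & cdom H h = f \<odot>\<^bsub>H\<^esub> q & ccod H h = g \<odot>\<^bsub>H\<^esub> q &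
     (ALL p : P. h = \<sigma> p |>\<^bsub>H\<^esub> q) & faith1 H q &
     (ALL m : ars H. ALL m' : ars H. ALL s : cells H. src H m = src H m' --> tgt H m = src H q --> tgt H m' = src H q -->
       cdom H s = q \<odot>\<^bsub>H\<^esub> m --> ccod H s = q \<odot>\<^bsub>H\<^esub> m' --> (g <|\<^bsub>H\<^esub> s) \<bullet>\<^bsub>H\<^esub> h |>\<^bsub>H\<^esub> m = h |>\<^bsub>H\<^esub> m' \<bullet>\<^bsub>H\<^esub> (f <|\<^bsub>H\<^esub> s) -->
       (EX r. r : cells H & cdom H r = m & ccod H r = m' & q <|\<^bsub>H\<^esub> r = s)) &
     (ALL x : ars H. ALL k : cells H. tgt H x = src H g --> cdom H k = f \<odot>\<^bsub>H\<^esub> x --> ccod H k = g \<odot>\<^bsub>H\<^esub> x -->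
       (ALL p : P. k = \<sigma> p |>\<^bsub>H\<^esub> x) --> (EX m s. m : ars H & src H m = src H x & tgt H m = src H q & s : cells H & cdom H s = q \<odot>\<^bsub>H\<^esub> m & ccod H s = x & invertible2 H s &
        (g <|\<^bsub>H\<^esub> s) \<bullet>\<^bsub>H\<^esub> (h |>\<^bsub>H\<^esub> m) = k \<bullet>\<^bsub>H\<^esub> (f <|\<^bsub>H\<^esub> s)))"

lemma insertsD:
  assumes "inserts H P f g \<sigma> q h"
  shows "q : ars H" "tgt H q = src H g" "h : cells H" "cdom H h = f \<odot>\<^bsub>H\<^esub> q" "ccod H h = g \<odot>\<^bsub>H\<^esub> q" "p : P ==> h = \<sigma> p |>\<^bsub>H\<^esub> q" "faith1 H q"
    and "[|m : ars H; m' : ars H; src H m = src H m'; tgt H m = src H q; tgt H m' = src H q; s : cells H; cdom H s = q \<odot>\<^bsub>H\<^esub> m; ccod H s = q \<odot>\<^bsub>H\<^esub> m';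
      (g <|\<^bsub>H\<^esub> s) \<bullet>\<^bsub>H\<^esub> h |>\<^bsub>H\<^esub> m = h |>\<^bsub>H\<^esub> m' \<bullet>\<^bsub>H\<^esub> (f <|\<^bsub>H\<^esub> s)|] ==> EX r. r : cells H & cdom H r = m & ccod H r = m' & q <|\<^bsub>H\<^esub> r = s"
    and "[|x : ars H; tgt H x = src H g; k : cells H; cdom H k = f \<odot>\<^bsub>H\<^esub> x; ccod H k = g \<odot>\<^bsub>H\<^esub> x; !!p. p : P ==> k = \<sigma> p |>\<^bsub>H\<^esub> x|] ==>
      EX m s. m : ars H & src H m = src H x & tgt H m = src H q & s : cells H & cdom H s = q \<odot>\<^bsub>H\<^esub> m & ccod H s = x & invertible2 H s &
        (g <|\<^bsub>H\<^esub> s) \<bullet>\<^bsub>H\<^esub> (h |>\<^bsub>H\<^esub> m) = k \<bullet>\<^bsub>H\<^esub> f <|\<^bsub>H\<^esub> s"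
  using assms unfolding inserts_def by (elim conjE, simp)+

context inserter_diagram
begin

text \<open>The bilimit represents cones, hence has a universal cone \<open>u\<close>. The universal
  inserted cell is read off \<open>u\<close>, and the three clauses of \<open>inserts\<close> are
  deduced from \<open>universal\<close> by passing between cones and pairs.\<close>

lemma inserter:
  assumes "is_bilimit H S W D L"
  shows "EX q h. inserts H P f g \<sigma> q h & src H q = L"
proof -
  obtain \<Phi> \<phi> where L [simp]: "L : obs H" and rep: "pseudonat_equivalence (op1 H) (corep (op1 H) L) (weighted_cones H S W D) \<Phi> \<phi>"
    using assms by (auto simp: is_bilimit_def)
  interpret R: representation H L "weighted_cones H S W D" \<Phi> \<phi>
    using rep by (intro representation.intro) (simp_all add: H.two_category_axioms representation_axioms_def)
  define u where "u = R.u"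
  have u: "is_cone L u" using R.u_Ob by (simp add: cones_simps u_def is_cone_def)
  note [simp] = cone_data(1-18)[OF u] cone_invertible[OF u]
  note uc = cone_components[OF u]
  define q where "q = cq u"
  \<comment> \<open>Removes the isomorphisms of the pseudo-cone: the arrow \<open>cc\<close> is
    moved to a cell between \<open>f\<close> and \<open>g\<close> applied to \<open>q\<close>
    itself.\<close>
  define h where "h = inv2 H (cb u) \<bullet> cc u \<bullet> ca u"
  have [simp]: "cq u = q" by (simp add: q_def)
  have q [simp]: "q : ars H" "src H q = L" "tgt H q = d0" using cone_data(1-3)[OF u] by simp_all
  have h [simp]: "h : cells H" "cdom H h = f \<odot> q" "ccod H h = g \<odot> q" by (simp_all add: h_def)
  have bh: "cb u \<bullet> h = cc u \<bullet> ca u" by (simp add: h_def)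
  have hP: "h = \<sigma> p |> q" if "p : P" for p
    using cone_P[OF u that] that bh by (intro H.vcomp_cancel_left[of "cb u" h "\<sigma> p |> q"]) simp_all
  define act where "act m = psnat_wr S CAT (yoneda_ar H m) D \<odot>\<^bsub>PS S CAT\<^esub> u" for m
  define acti where "acti r = modif_wr S CAT (yoneda_cell H r) D |>\<^bsub>PS S CAT\<^esub> u" for r
  have up: "pseudonatural S CAT u" "psrc u = W" "ptgt u = HD L" using u by (simp_all add: is_cone_def)
  have act: "is_cone (src H m) (act m)" if "m : ars H" "tgt H m = L" for m
    using SC.psnat_comp1[OF psnat_yoneda_D up(1)] that up unfolding is_cone_def by (simp add: act_def)
  have act_data: "cq (act m) = q \<odot> m" "cy0 (act m) = cy0 u \<odot> m" "cy1 (act m) = cy1 u \<odot> m" "cc (act m) = cc u |> m"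
      "ca (act m) = ca u |> m" "cb (act m) = cb u |> m" if [simp]: "m : ars H" "tgt H m = L" for m
  proof -
    have o: "fob (pcomp u z4) z0 = q" "fob (pcomp u z5) z0 = cy0 u" "fob (pcomp u z5) z1 = cy1 u" "far (pcomp u z5) z2 = cc u"
      "ntc (pnat u z0) z0 = ca u" "ntc (pnat u z1) z0 = cb u"
      by (simp_all add: cy0_def cy1_def cc_def ca_def cb_def q_def cq_def)
    show "cq (act m) = q \<odot> m" "cy0 (act m) = cy0 u \<odot> m" "cy1 (act m) = cy1 u \<odot> m" "cc (act m) = cc u |> m"
      "ca (act m) = ca u |> m" "cb (act m) = cb u |> m"
      unfolding cq_def[of "act m"] cy0_def[of "act m"] cy1_def[of "act m"] cc_def[of "act m"] ca_def[of "act m"] cb_def[of "act m"]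
      by (simp_all add: act_def uc up o)
  qed
  have acti: "modification S CAT (acti r)" "msrc (acti r) = act (cdom H r)" "mtgt (acti r) = act (ccod H r)"
      "ntc (mcomp (acti r) z4) z0 = q <| r"
    if [simp]: "r : cells H" "tgt H (cdom H r) = L" for r
  proof -
    have o: "fob (pcomp u z4) z0 = q" "far (pcomp u z4) z0 = id2 H q"
      using cone_data(19)[OF u] by (simp_all add: q_def cq_def)
    show "modification S CAT (acti r)"
      unfolding acti_def by (rule SC.modif_hcomp) (simp_all add: modif_yoneda_D SC.modif_id2 up)
    show "msrc (acti r) = act (cdom H r)" "mtgt (acti r) = act (ccod H r)" by (simp_all add: acti_def act_def)
    show "ntc (mcomp (acti r) z4) z0 = q <| r"
      by (simp add: acti_def uc o)
  qed
  have G: "fob (pf1 (weighted_cones H S W D) m) R.u = act m" if "m : ars H" "tgt H m = L" for m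
    using that up by (simp add: cones_simps act_def u_def[symmetric])
  have G2: "ntc (pf2 (weighted_cones H S W D) r) R.u = acti r" if "r : cells H" "tgt H (cdom H r) = L" for r
    using that up by (simp add: cones_simps acti_def u_def[symmetric])
  have fq: "faith1 H q"
  proof (rule H.faith1I)
    fix r r' assume r: "r : cells H" "r' : cells H" "cdom H r = cdom H r'" "ccod H r = ccod H r'" "tgt H (cdom H r') = src H q"
      and e: "q <| r = q <| r'"
    note [simp] = r[simplified]
    let ?m = "cdom H r'" and ?m' = "ccod H r'"
    have k: "is_cone (src H ?m) (act ?m)" "is_cone (src H ?m) (act ?m')" using act[of ?m] act[of ?m'] by simp_all
    note d = modif_cone[OF k acti(1), of r, simplified] modif_cone[OF k acti(1), of r', simplified]
    have "acti r = acti r'"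
    proof (rule modif_eqI)
      show "modification S CAT (acti r)" "modification S CAT (acti r')" "msrc (acti r) = msrc (acti r')" "mtgt (acti r) = mtgt (acti r')"
        by (simp_all add: acti)
      let ?t = "%r. ntc (mcomp (acti r) z5)"
      note c = act_data[of ?m, simplified] act_data[of ?m', simplified]
      note c1 = cone_components[OF k(1)]
      have n: "is_nattr (mcomp (acti s) z4)" "ntdom (mcomp (acti s) z4) = pcomp (act ?m) z4" "ntcod (mcomp (acti s) z4) = pcomp (act ?m') z4"
        "is_nattr (mcomp (acti s) z5)" "ntdom (mcomp (acti s) z5) = pcomp (act ?m) z5" "ntcod (mcomp (acti s) z5) = pcomp (act ?m') z5"
        if s: "s : {r, r'}" for s
      proof -
        interpret s: modification S CAT "acti s" using s acti(1)[of r] acti(1)[of r'] by auto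
        show "is_nattr (mcomp (acti s) z4)" "ntdom (mcomp (acti s) z4) = pcomp (act ?m) z4" "ntcod (mcomp (acti s) z4) = pcomp (act ?m') z4"
          "is_nattr (mcomp (acti s) z5)" "ntdom (mcomp (acti s) z5) = pcomp (act ?m) z5" "ntcod (mcomp (acti s) z5) = pcomp (act ?m') z5"
          using s.mod_simps(3-5)[of z4] s.mod_simps(3-5)[of z5] s acti(2,3)[of r] acti(2,3)[of r'] by auto
      qed
      have t: "ntc (mcomp (acti s) z5) z0 : cells H" "cdom H (ntc (mcomp (acti s) z5) z0) = cy0 u \<odot> ?m" "ntc (mcomp (acti s) z5) z1 : cells H"
        "cdom H (ntc (mcomp (acti s) z5) z1) = cy1 u \<odot> ?m"
        "ntc (mcomp (acti s) z5) z0 \<bullet> ca u |> ?m = ca u |> ?m' \<bullet> (f \<odot> q) <| r"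
        "ntc (mcomp (acti s) z5) z1 \<bullet> cb u |> ?m = cb u |> ?m' \<bullet> (g \<odot> q) <| r" if s: "s : {r, r'}" for s
      proof -
        have s1: "modification S CAT (acti s)" "msrc (acti s) = act ?m" "mtgt (acti s) = act ?m'" and s2: "ntc (mcomp (acti s) z4) z0 = q <| r"
          using s acti[of r] acti[of r'] e by auto
        show "ntc (mcomp (acti s) z5) z0 : cells H" "cdom H (ntc (mcomp (acti s) z5) z0) = cy0 u \<odot> ?m" "ntc (mcomp (acti s) z5) z1 : cells H"
          "cdom H (ntc (mcomp (acti s) z5) z1) = cy1 u \<odot> ?m"
          using modif_cone(4,5,7,8)[OF k s1] by (simp_all add: c)
        show "ntc (mcomp (acti s) z5) z0 \<bullet> ca u |> ?m = ca u |> ?m' \<bullet> (f \<odot> q) <| r"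
          "ntc (mcomp (acti s) z5) z1 \<bullet> cb u |> ?m = cb u |> ?m' \<bullet> (g \<odot> q) <| r"
          using modif_cone(11,12)[OF k s1] by (simp_all add: c s2)
      qed
      \<comment> \<open>The other components of a modification out of \<open>u\<close> are
        determined by the one at \<open>q\<close>, because \<open>ca\<close> and \<open>cb\<close>
        are invertible.\<close>
      have t0: "?t r z0 = ?t r' z0"
        using t(1,2,5)[of r] t(1,2,5)[of r'] by (intro H.vcomp_cancel_right[of "ca u |> ?m" "?t r z0" "?t r' z0"]) simp_all
      have t1: "?t r z1 = ?t r' z1"
        using t(3,4,6)[of r] t(3,4,6)[of r'] by (intro H.vcomp_cancel_right[of "cb u |> ?m" "?t r z1" "?t r' z1"]) simp_all
      have "mcomp (acti r) z4 = mcomp (acti r') z4"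
        by (rule nattr_eqI) (use acti(4)[of r] acti(4)[of r'] in \<open>simp_all add: n c1 e\<close>)
      moreover have "mcomp (acti r) z5 = mcomp (acti r') z5"
        by (rule nattr_eqI) (use t0 t1 in \<open>auto simp: n c1\<close>)
      ultimately show "mcomp (acti r) x = mcomp (acti r') x" if "x : obs S" for x using that by auto
    qed
    then show "r = r'"
      using R.universal(1)[of "src H ?m"] r unfolding faithful_on_def by (simp add: G2)
  qed
  have ffq: "EX r. r : cells H & cdom H r = m & ccod H r = m' & q <| r = s"
    if m [simp]: "m : ars H" "m' : ars H" "src H m = src H m'" "tgt H m = L" "tgt H m' = L" and s [simp]: "s : cells H" "cdom H s = q \<odot> m" "ccod H s = q \<odot> m'"
      and e: "g <| s \<bullet> h |> m = h |> m' \<bullet> f <| s" for m m' s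
  proof -
    let ?X = "src H m'"
    have k: "is_cone ?X (act m)" "is_cone ?X (act m')" using act[of m] act[of m'] by simp_all
    \<comment> \<open>Conversely a cell over \<open>q\<close> extends to a modification by these
      forced components; compatibility of \<open>s\<close> with \<open>h\<close> becomes naturality
      along the arrow of \<open>Two\<close>.\<close>
    define t0 where "t0 = ca u |> m' \<bullet> f <| s \<bullet> inv2 H (ca u) |> m"
    define t1 where "t1 = cb u |> m' \<bullet> g <| s \<bullet> inv2 H (cb u) |> m"
    have t [simp]: "t0 : cells H" "cdom H t0 = cy0 u \<odot> m" "ccod H t0 = cy0 u \<odot> m'" "t1 : cells H" "cdom H t1 = cy1 u \<odot> m" "ccod H t1 = cy1 u \<odot> m'"
      by (simp_all add: t0_def t1_def)
    have ta: "t0 \<bullet> ca u |> m = ca u |> m' \<bullet> f <| s" "t1 \<bullet> cb u |> m = cb u |> m' \<bullet> g <| s"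
      by (simp_all add: t0_def t1_def)
    note bm = arg_cong[OF bh, of "%c. c |> m", simplified] and bm' = arg_cong[OF bh, of "%c. c |> m'", simplified]
    have "(t1 \<bullet> (cc u |> m)) \<bullet> (ca u |> m) = t1 \<bullet> cb u |> m \<bullet> h |> m" by (simp add: bm)
    also have "\<dots> = cb u |> m' \<bullet> h |> m' \<bullet> f <| s"
      by (simp add: ta(2)[THEN H.vc22] e)
    also have "\<dots> = cc u |> m' \<bullet> ca u |> m' \<bullet> f <| s" by (simp add: bm'[THEN H.vc22])
    also have "\<dots> = ((cc u |> m') \<bullet> t0) \<bullet> ca u |> m" by (simp add: ta(1))
    finally have tc: "t1 \<bullet> cc u |> m = cc u |> m' \<bullet> t0" by (rule H.vcomp_cancel_right[rotated]) simp_all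
    let ?G = "\<lparr>msrc = act m, mtgt = act m', mcomp = (\<lambda>x \<in> obs S. if x = z4 then point_nt (pcomp (act m) z4) (pcomp (act m') z4) s
      else arrow_nt (pcomp (act m) z5) (pcomp (act m') z5) t0 t1)\<rparr>"
    have "modification S CAT ?G"
      by (rule cone_modif[OF k]) (simp_all add: act_data tc ta)
    then have "?G : Homset (pf0 (weighted_cones H S W D) ?X) (fob (pf1 (weighted_cones H S W D) m) R.u) (fob (pf1 (weighted_cones H S W D) m') R.u)"
      using k by (simp add: G cones_simps(1) is_cone_def)
    then obtain r where r: "r : Homset (hom_cat H ?X L) m m'" "ntc (pf2 (weighted_cones H S W D) r) R.u = ?G"
      using R.universal(2)[of ?X] unfolding full_on_def by (metis hom_cat_simps(1) m H.src_obs)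
    then have "acti r = ?G" using G2[of r] by simp
    then have "q <| r = s" using acti(4)[of r] r(1) by simp
    then show ?thesis using r(1) by auto
  qed
  have esq: "EX m s. m : ars H & src H m = src H x & tgt H m = L & s : cells H & cdom H s = q \<odot> m & ccod H s = x & invertible2 H s &
        (g <| s) \<bullet> (h |> m) = k \<bullet> f <| s"
    if x [simp]: "x : ars H" "tgt H x = d0" and k [simp]: "k : cells H" "cdom H k = f \<odot> x" "ccod H k = g \<odot> x" and kP: "!!p. p : P ==> k = \<sigma> p |> x" for x k
  proof -
    let ?X = "src H x"
    \<comment> \<open>The pair \<open>(x, k)\<close> is realised by applying essential surjectivity
      to its strict cone.\<close>
    have c: "is_cone ?X (cone ?X x k)" "cq (cone ?X x k) = x" "cy0 (cone ?X x k) = f \<odot> x" "cy1 (cone ?X x k) = g \<odot> x" "cc (cone ?X x k) = k"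
      "ca (cone ?X x k) = id2 H (f \<odot> x)" "cb (cone ?X x k) = id2 H (g \<odot> x)"
      by (rule cone_cone[OF x(1) refl x(2) k]; erule kP)+
    have "cone ?X x k : Ob (pf0 (weighted_cones H S W D) ?X)" using c(1) by (simp add: cones_simps is_cone_def)
    then obtain m \<Gamma> where m: "m : Ob (hom_cat H ?X L)" and G': "\<Gamma> : Homset (pf0 (weighted_cones H S W D) ?X) (fob (pf1 (weighted_cones H S W D) m) R.u) (cone ?X x k)"
      "is_iso (pf0 (weighted_cones H S W D) ?X) \<Gamma>"
      using R.universal(3)[of ?X] x unfolding ess_surj_on_def by (meson H.src_obs)
    from m have m [simp]: "m : ars H" "src H m = ?X" "tgt H m = L" by simp_all
    have am: "is_cone ?X (act m)" using act[of m] by simp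
    have g: "modification S CAT \<Gamma>" "msrc \<Gamma> = act m" "mtgt \<Gamma> = cone ?X x k" "invertible2 (PS S CAT) \<Gamma>"
      using G' by (simp_all add: G cones_simps(1) SC.PS.is_iso_hom_cat)
    have n: "is_nattr (mcomp \<Gamma> z4)" "ntdom (mcomp \<Gamma> z4) = pcomp (act m) z4"
      using modification.mod_simps(3,4)[OF g(1), of z4] g(2) by simp_all
    define s where "s = ntc (mcomp \<Gamma> z4) z0"
    note d = modif_cone[OF am c(1) g(1-3), folded s_def, unfolded c act_data[OF m(1,3)]]
    note [simp] = d(1-9)
    have s: "invertible2 H s"
      using invertible_nattr[OF SC.invertible_at[OF g(4)], of z4 z0] n cone_components[OF am]
      by (simp add: s_def H.is_iso_hom_cat)
    note bm = arg_cong[OF bh, of "%c. c |> m", simplified]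
    have "g <| s \<bullet> (h |> m) = ntc (mcomp \<Gamma> z5) z1 \<bullet> cb u |> m \<bullet> h |> m"
      using d(12)[THEN H.vc22[of "id2 H (g \<odot> x)" "g <| s" "ntc (mcomp \<Gamma> z5) z1" "cb u |> m" "h |> m"]] by simp
    also have "\<dots> = k \<bullet> ntc (mcomp \<Gamma> z5) z0 \<bullet> ca u |> m" by (simp add: bm d(10)[THEN H.vc22])
    also have "\<dots> = k \<bullet> f <| s" using d(11) by simp
    finally show ?thesis using s by (intro exI[of _ m] exI[of _ s]) simp
  qed
  have "inserts H P f g \<sigma> q h"
    unfolding inserts_def
  proof (intro conjI ballI impI)
    fix m m' s assume "m : ars H" "m' : ars H" "s : cells H" "src H m = src H m'" "tgt H m = src H q" "tgt H m' = src H q"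
      "cdom H s = q \<odot> m" "ccod H s = q \<odot> m'" "g <| s \<bullet> h |> m = h |> m' \<bullet> f <| s"
    then show "EX r. r : cells H & cdom H r = m & ccod H r = m' & q <| r = s" using ffq[of m m' s] by simp
  next
    fix x k assume "x : ars H" "k : cells H" "tgt H x = src H g" "cdom H k = f \<odot> x" "ccod H k = g \<odot> x" "ALL p : P. k = \<sigma> p |> x"
    then show "EX m s. m : ars H & src H m = src H x & tgt H m = src H q & s : cells H & cdom H s = q \<odot> m & ccod H s = x & invertible2 H s &
        (g <| s) \<bullet> (h |> m) = k \<bullet> f <| s"
      unfolding q(2) dfg by (intro esq) (erule bspec | assumption)+
  qed (use hP fq in simp_all)
  then show ?thesis using q(2) by blast
qed

end

text \<open>Transport of an algebra along an isomorphism, with the new action given and only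
  required to be compatible. In the applications it is a restriction of the universal
  action.\<close>

lemma (in monad_in) alg2_iso:
  assumes x: "alg2 K T \<eta> \<mu> x k" and s: "invertible2 K s" "ccod K s = x"
    and h: "h : cells K" "cdom K h = T \<odot> cdom K s" "ccod K h = cdom K s" "s \<bullet> h = k \<bullet> T <| s"
  shows "alg2 K T \<eta> \<mu> (cdom K s) h"
proof -
  note [simp] = alg2_typing[OF x] s h(1-3) invertible2_cell[OF s(1)]
  have t: "src K (cdom K s) = src K x" "tgt K (cdom K s) = b" using src_cod[of s] tgt_cod[of s] by simp_all
  note [simp] = t
  have T: "T <| s \<bullet> T <| h = T <| k \<bullet> (T \<odot> T) <| s"
    using arg_cong[OF h(4), of "%s. T <| s"] by simp
  have "s \<bullet> h \<bullet> (\<eta> |> (cdom K s)) = k \<bullet> T <| s \<bullet> \<eta> |> (cdom K s)" by (simp add: h(4)[THEN vc22])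
  also have "\<dots> = k \<bullet> \<eta> |> x \<bullet> s" using slide_refl[of \<eta> s] by simp
  also have "\<dots> = s \<bullet> id2 K (cdom K s)" by (simp add: alg2D(6)[OF x, THEN vc21])
  finally have u: "h \<bullet> (\<eta> |> (cdom K s)) = id2 K (cdom K s)" by (rule vcomp_cancel_left[rotated]) simp_all
  have "s \<bullet> h \<bullet> (T <| h) = k \<bullet> T <| s \<bullet> T <| h" by (simp add: h(4)[THEN vc22])
  also have "\<dots> = k \<bullet> \<mu> |> x \<bullet> (T \<odot> T) <| s" by (simp add: T alg2D(7)[OF x, THEN vc22])
  also have "\<dots> = k \<bullet> T <| s \<bullet> \<mu> |> (cdom K s)" using slide_refl[of \<mu> s] by simp
  also have "\<dots> = s \<bullet> h \<bullet> \<mu> |> (cdom K s)" by (simp add: h(4)[THEN vc22])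
  finally have "h \<bullet> (T <| h) = h \<bullet> \<mu> |> (cdom K s)" by (rule vcomp_cancel_left[rotated]) simp_all
  with u show ?thesis by (simp add: alg2_def in_hom1_def in_hom2_def)
qed

section \<open>Inserters, equifiers and Eilenberg-Moore objects from completeness\<close>

locale bicomplete = two_category H for H :: "('o, 'k, 'k) tcat" (structure) +
  fixes \<kappa> :: "'k rel"
  assumes card: "Card_order \<kappa>" and large: "natLeq <o \<kappa>" and complete: "bicategorically_complete \<kappa> H"
begin

lemma small_finite: "finite X ==> small_set \<kappa> X"
  unfolding small_set_def using finite_iff_ordLess_natLeq ordLess_transitive large by blast

text \<open>The names of the shape must come from the type of small sets; six of them exist because
  a type carrying a cardinal above \<open>natLeq\<close> is infinite.\<close>

lemma ex_distinct: "EX z0 z1 z2 z3 z4 z5 :: 'k. distinct [z0, z1, z2, z3, z4, z5]"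
proof -
  have "infinite (UNIV :: 'k set)"
  proof
    assume "finite (UNIV :: 'k set)"
    then have "finite (Field \<kappa>)" by (rule finite_subset[rotated]) simp
    then have "|Field \<kappa>| <o natLeq" by (simp add: finite_iff_ordLess_natLeq)
    then have "\<kappa> <o natLeq" using card card_of_Field_ordIso ordIso_symmetric ordIso_ordLess_trans by blast
    then show False using large ordLess_transitive ordLess_irreflexive by blast
  qed
  then obtain B :: "'k set" where B: "finite B" "card B = 6" using infinite_arbitrarily_large by blast
  then obtain xs where xs: "set xs = B" "distinct xs" using finite_distinct_list by blast
  then have "length xs = 6" using B distinct_card by metis
  then obtain z0 z1 z2 z3 z4 z5 where "xs = [z0, z1, z2, z3, z4, z5]"
    by (auto simp: numeral_eq_Suc length_Suc_conv)
  with xs show ?thesis by metis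
qed

lemma ex_bilimit:
  assumes "inserter_diagram z0 z1 z2 z3 z4 z5 P H d0 d1 f g \<sigma>"
  shows "EX L. is_bilimit H (inserter_shape.S z0 z1 z4 z5 P) (inserter_shape.W z0 z1 z2 z4 z5 P) (inserter_diagram.D z0 z1 z4 z5 P H d0 d1 f g \<sigma>) L"
proof -
  interpret i: inserter_diagram z0 z1 z2 z3 z4 z5 P H d0 d1 f g \<sigma> by fact
  have "finite P" using i.P finite_subset by blast
  then have "small_two_category \<kappa> i.S"
    by (simp add: small_two_category_def i.two_category_S small_finite)
  moreover have "small_cat \<kappa> (pf0 i.W s)" if "s : obs i.S" for s
    using that by (auto simp: small_cat_def small_finite)
  ultimately show ?thesis
    using complete two_functorD[OF i.two_functor_W] two_functorD[OF i.two_functor_D]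
    unfolding bicategorically_complete_def by blast
qed

text \<open>With \<open>P\<close> empty nothing constrains the inserted cell, so the family of
  prescribed cells is left \<open>undefined\<close>.\<close>

lemma ex_inserter:
  assumes "f : ars H" "g : ars H" "src H f = src H g" "tgt H f = tgt H g"
  obtains q h where "inserts H ({} :: 'k set) f g undefined q h"
proof -
  obtain z0 z1 z2 z3 z4 z5 :: 'k where z: "distinct [z0, z1, z2, z3, z4, z5]" using ex_distinct by blast
  interpret i: inserter_diagram z0 z1 z2 z3 z4 z5 "{}" H "src H g" "tgt H g" f g undefined
    using z assms by unfold_locales auto
  show ?thesis using that i.inserter ex_bilimit[OF i.inserter_diagram_axioms] by blast
qed

text \<open>With \<open>P\<close> consisting of two names, one standing for \<open>\<sigma>\<close>
  and one for \<open>t\<close>, the inserted cell equals the restriction of both, which makes them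
  equal.\<close>

lemma ex_equifier:
  assumes s: "\<sigma> : cells H" "t : cells H" "cdom H \<sigma> = cdom H t" "ccod H \<sigma> = ccod H t"
  obtains q where "q : ars H" "tgt H q = src H (cdom H t)" "\<sigma> |> q = t |> q" "faith1 H q" "full1 H q"
    "!!x. [|x : ars H; tgt H x = src H (cdom H t); \<sigma> |> x = t |> x|]
      ==> EX m s. m : ars H & src H m = src H x & tgt H m = src H q & s : cells H & cdom H s = q \<odot> m & ccod H s = x & invertible2 H s"
proof -
  note [simp] = s
  obtain z0 z1 z2 z3 z4 z5 :: 'k where z: "distinct [z0, z1, z2, z3, z4, z5]" using ex_distinct by blast
  let ?s = "%p. if p = z2 then \<sigma> else t" and ?f = "cdom H t" and ?g = "ccod H t"
  define d0 d1 where "d0 = src H ?f" and "d1 = tgt H ?f"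
  interpret i: inserter_diagram z0 z1 z2 z3 z4 z5 "{z2, z3}" H d0 d1 ?f ?g ?s
    using z by unfold_locales (simp_all add: d0_def d1_def)
  obtain q h where i: "inserts H {z2, z3} ?f ?g ?s q h"
    using i.inserter ex_bilimit[OF i.inserter_diagram_axioms] by blast
  note q = insertsD(1-5,7)[OF i]
  note [simp] = q(1-5)
  \<comment> \<open>The inserted cell agrees with the prescribed cell at each name in
    \<open>P\<close>.\<close>
  have h: "h = \<sigma> |> q" "h = t |> q" using insertsD(6)[OF i, of z2] insertsD(6)[OF i, of z3] z by (simp_all add: eq_commute[of z3 z2])
  show ?thesis
  proof (rule that[OF q(1) _ _ q(6)])
    show "tgt H q = src H ?f" using q(2) by simp
    show "\<sigma> |> q = t |> q" using h by simp
    show "full1 H q"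
    proof (rule full1I)
      fix m m' s assume m [simp]: "m : ars H" "m' : ars H" "src H m = src H m'" "tgt H m = src H q" "tgt H m' = src H q"
        "s : cells H" "cdom H s = q \<odot> m" "ccod H s = q \<odot> m'"
      \<comment> \<open>Interchange makes every cell compatible with the inserted one, so the
        conditional fullness of an inserter becomes plain fullness.\<close>
      have "?g <| s \<bullet> t |> (q \<odot> m) = t |> (q \<odot> m') \<bullet> ?f <| s"
        using slide_refl[of t s] by simp
      then have "?g <| s \<bullet> h |> m = h |> m' \<bullet> ?f <| s" by (simp add: h(2) del: q(4,5))
      then show "EX r. r : cells H & cdom H r = m & ccod H r = m' & q <| r = s" using insertsD(8)[OF i, of m m' s] by simp
    qed
    fix x assume x [simp]: "x : ars H" "tgt H x = src H ?f" and e: "\<sigma> |> x = t |> x"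
    have "EX m s. m : ars H & src H m = src H x & tgt H m = src H q & s : cells H & cdom H s = q \<odot> m & ccod H s = x & invertible2 H s &
        (?g <| s) \<bullet> h |> m = t |> x \<bullet> ?f <| s"
      by (rule insertsD(9)[OF i]) (auto simp: e)
    then show "EX m s. m : ars H & src H m = src H x & tgt H m = src H q & s : cells H & cdom H s = q \<odot> m & ccod H s = x & invertible2 H s"
      by blast
  qed
qed

text \<open>The inserter of \<open>T\<close> and the identity classifies bare actions; the equifiers
  impose the unit law and then associativity. Both equifiers are fully faithful, so maps of algebras
  are already governed by the inserter.\<close>

lemma ex_em:
  assumes "monad2 H b T \<eta> \<mu>"
  shows "EX p h. em H T \<eta> \<mu> p h"
proof -
  interpret monad_in H b T \<eta> \<mu> using assms by unfold_locales
  obtain q1 h1 where i: "inserts H ({} :: 'k set) T (id1 H b) undefined q1 h1"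
    by (rule ex_inserter[of T "id1 H b"]) simp_all
  have q1 [simp]: "q1 : ars H" "tgt H q1 = b" "h1 : cells H" "cdom H h1 = T \<odot> q1" "ccod H h1 = q1" and f1: "faith1 H q1"
    using insertsD(1-5,7)[OF i] by simp_all
  \<comment> \<open>The right-hand side of the equation is \<open>id2 H q1\<close> restricted along
    \<open>q2\<close>: both whiskering notations abbreviate the same horizontal composite.\<close>
  obtain q2 where q2 [simp]: "q2 : ars H" "tgt H q2 = src H q1" and e2: "(h1 \<bullet> (\<eta> |> q1)) |> q2 = q1 <| id2 H q2"
    and f2: "faith1 H q2" "full1 H q2"
    and es2: "!!x. [|x : ars H; tgt H x = src H q1; (h1 \<bullet> (\<eta> |> q1)) |> x = q1 <| id2 H x|]
      ==> EX m s. m : ars H & src H m = src H x & tgt H m = src H q2 & s : cells H & cdom H s = q2 \<odot> m & ccod H s = x & invertible2 H s"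
    by (rule ex_equifier[of "h1 \<bullet> \<eta> |> q1" "id2 H q1"]) (simp_all add: conj_ac)
  \<comment> \<open>The associativity law is imposed on the actions that already satisfy the unit
    law, hence both cells are first restricted along \<open>q2\<close>.\<close>
  obtain q3 where q3 [simp]: "q3 : ars H" "tgt H q3 = src H q2"
    and e3: "((h1 \<bullet> (T <| h1)) |> q2) |> q3 = ((h1 \<bullet> (\<mu> |> q1)) |> q2) |> q3"
    and f3: "faith1 H q3" "full1 H q3"
    and es3: "!!x. [|x : ars H; tgt H x = src H q2; ((h1 \<bullet> (T <| h1)) |> q2) |> x = ((h1 \<bullet> (\<mu> |> q1)) |> q2) |> x|]
      ==> EX m s. m : ars H & src H m = src H x & tgt H m = src H q3 & s : cells H & cdom H s = q3 \<odot> m & ccod H s = x & invertible2 H s"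
    by (rule ex_equifier[of "(h1 \<bullet> (T <| h1)) |> q2" "(h1 \<bullet> (\<mu> |> q1)) |> q2"]) simp_all
  let ?p = "q1 \<odot> q2 \<odot> q3" and ?h = "h1 |> (q2 \<odot> q3)"
  have pa: "alg2 H T \<eta> \<mu> ?p ?h"
    using arg_cong[OF e2, of "%s. s |> q3"] e3 by (simp add: alg2_def in_hom1_def in_hom2_def)
  moreover have "faith1 H ?p"
  proof (rule faith1I)
    fix r r' assume r [simp]: "r : cells H" "r' : cells H" "cdom H r = cdom H r'" "ccod H r = ccod H r'" "tgt H (cdom H r') = src H ?p"
      and e: "?p <| r = ?p <| r'"
    have [simp]: "tgt H (cdom H r') = src H q3" using r(5) by simp
    have g1: "(q2 \<odot> q3) <| r = (q2 \<odot> q3) <| r'" by (rule faith1D[OF f1]) (use e in simp_all)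
    have g2: "q3 <| r = q3 <| r'" by (rule faith1D[OF f2(1)]) (use g1 in simp_all)
    show "r = r'" by (rule faith1D[OF f3(1) g2]) simp_all
  qed
  moreover have "alg_full1 H T ?p ?h"
  proof (rule alg_full1I)
    fix m m' s assume m [simp]: "m : ars H" "m' : ars H" "src H m = src H m'" and m': "tgt H m = src H ?p" "tgt H m' = src H ?p"
      and s [simp]: "s : cells H" "cdom H s = ?p \<odot> m" "ccod H s = ?p \<odot> m'" and e: "s \<bullet> ?h |> m = ?h |> m' \<bullet> T <| s"
    have [simp]: "tgt H m = src H q3" "tgt H m' = src H q3" using m' by simp_all
    obtain r1 where r1 [simp]: "r1 : cells H" "cdom H r1 = q2 \<odot> q3 \<odot> m" "ccod H r1 = q2 \<odot> q3 \<odot> m'" and e1: "q1 <| r1 = s"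
      using insertsD(8)[OF i, of "q2 \<odot> q3 \<odot> m" "q2 \<odot> q3 \<odot> m'" s] e by auto
    obtain r2 where r2 [simp]: "r2 : cells H" "cdom H r2 = q3 \<odot> m" "ccod H r2 = q3 \<odot> m'" and e2: "q2 <| r2 = r1"
      using full1D[OF f2(2), of "q3 \<odot> m" "q3 \<odot> m'" r1] by auto
    obtain r3 where r3 [simp]: "r3 : cells H" "cdom H r3 = m" "ccod H r3 = m'" and e3: "q3 <| r3 = r2"
      using full1D[OF f3(2), of m m' r2] by auto
    have "q1 <| q2 <| q3 <| r3 = s" by (simp only: e1 e2 e3)
    then show "EX r. r : cells H & cdom H r = m & ccod H r = m' & ?p <| r = s"
      by (intro exI[of _ r3]) simp
  qed
  moreover have "alg_ess1 H T \<eta> \<mu> ?p ?h"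
  proof (rule alg_ess1I[OF monad])
    fix x k assume x: "alg2 H T \<eta> \<mu> x k"
    note [simp] = alg2D(1-5)[OF x]
    have xb: "tgt H x = b" by simp
    have "EX m s. m : ars H & src H m = src H x & tgt H m = src H q1 & s : cells H & cdom H s = q1 \<odot> m & ccod H s = x & invertible2 H s &
        ((id1 H b) <| s) \<bullet> (h1 |> m) = k \<bullet> T <| s"
      by (rule insertsD(9)[OF i]) (simp_all add: xb)
    then obtain m1 s1 where m1 [simp]: "m1 : ars H" "src H m1 = src H x" "tgt H m1 = src H q1" and s1 [simp]: "s1 : cells H" "cdom H s1 = q1 \<odot> m1" "ccod H s1 = x" "invertible2 H s1"
      and e1': "(id1 H b) <| s1 \<bullet> (h1 |> m1) = k \<bullet> T <| s1"
      by blast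
    have e1: "s1 \<bullet> (h1 |> m1) = k \<bullet> T <| s1" using e1' by simp
    \<comment> \<open>The factorisation through the inserter is isomorphic to the given algebra, so
      its action satisfies the laws and can be factored further. The same happens after the next
      stage.\<close>
    have a1: "alg2 H T \<eta> \<mu> (q1 \<odot> m1) (h1 |> m1)" using alg2_iso[OF x, of s1 "h1 |> m1"] e1 by simp
    have "(h1 \<bullet> (\<eta> |> q1)) |> m1 = q1 <| id2 H m1" using alg2D(6)[OF a1] by simp
    note x2 = es2[OF m1(1,3) this, unfolded m1(2)]
    obtain m2 s2 where m2 [simp]: "m2 : ars H" "src H m2 = src H x" "tgt H m2 = src H q2" and s2 [simp]: "s2 : cells H" "cdom H s2 = q2 \<odot> m2" "ccod H s2 = m1" "invertible2 H s2"
      using x2 by blast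
    have sl: "q1 <| s2 \<bullet> h1 |> (q2 \<odot> m2) = h1 |> m1 \<bullet> (T \<odot> q1) <| s2"
      using slide_refl[of h1 s2] by simp
    have c2: "s1 \<bullet> q1 <| s2 \<bullet> (h1 |> (q2 \<odot> m2)) = k \<bullet> T <| s1 \<bullet> (T \<odot> q1) <| s2"
      by (simp add: sl e1[THEN vc22])
    have a2: "alg2 H T \<eta> \<mu> (q1 \<odot> q2 \<odot> m2) (h1 |> (q2 \<odot> m2))"
      using alg2_iso[OF x, of "s1 \<bullet> q1 <| s2" "h1 |> (q2 \<odot> m2)"] c2 by simp
    have "((h1 \<bullet> (T <| h1)) |> q2) |> m2 = ((h1 \<bullet> (\<mu> |> q1)) |> q2) |> m2" using alg2D(7)[OF a2] by simp
    note x3 = es3[OF m2(1,3) this, unfolded m2(2)]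
    obtain m3 s3 where m3 [simp]: "m3 : ars H" "src H m3 = src H x" "tgt H m3 = src H q3" and s3 [simp]: "s3 : cells H" "cdom H s3 = q3 \<odot> m3" "ccod H s3 = m2" "invertible2 H s3"
      using x3 by blast
    have sl': "(q1 \<odot> q2) <| s3 \<bullet> h1 |> (q2 \<odot> q3 \<odot> m3) = h1 |> (q2 \<odot> m2) \<bullet> (T \<odot> q1 \<odot> q2) <| s3"
      using slide_refl[of h1 "q2 <| s3"] by simp
    have "s1 \<bullet> q1 <| s2 \<bullet> (q1 \<odot> q2) <| s3 \<bullet> (h1 |> (q2 \<odot> q3 \<odot> m3))
      = k \<bullet> T <| s1 \<bullet> (T \<odot> q1) <| s2 \<bullet> (T \<odot> q1 \<odot> q2) <| s3"
      by (simp add: sl' arg_cong[OF c2, of "%c. c \<bullet> (T \<odot> q1 \<odot> q2) <| s3", simplified])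
    then show "EX m s. m : ars H & src H m = src H x & tgt H m = src H ?p & s : cells H & cdom H s = ?p \<odot> m & ccod H s = x & invertible2 H s &
       s \<bullet> (?h |> m) = k \<bullet> T <| s"
      by (intro exI[of _ m3] exI[of _ "s1 \<bullet> q1 <| s2 \<bullet> (q1 \<odot> q2) <| s3"]) simp
  qed simp_all
  ultimately show ?thesis unfolding em_def by blast
qed

end

section \<open>Descent along monadic transformations\<close>

lemma (in strict_functor) U_alg:
  assumes m: "monad2 X b T \<eta> \<mu>" and a: "alg2 X T \<eta> \<mu> f h"
  shows "alg2 Y (pf1 U T) (pf2 U \<eta>) (pf2 U \<mu>) (pf1 U f) (pf2 U h)"
proof -
  interpret m: monad_in X b T \<eta> \<mu> using m by unfold_locales
  note [simp] = m.alg2_typing[OF a]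
  show ?thesis
    using arg_cong[OF alg2D(6)[OF a], of "pf2 U"] arg_cong[OF alg2D(7)[OF a], of "pf2 U"]
    by (simp add: alg2_def in_hom1_def in_hom2_def)
qed

text \<open>All operations on pseudonatural transformations and modifications are componentwise, so
  every equation of the square can be evaluated at \<open>x\<close>.\<close>

lemma (in two_categories) alg_square1_at:
  assumes a: "alg_square1 (PS S K) b T \<eta> \<mu> b' T' \<eta>' \<mu>' q \<phi> p h p' h' m i" and x [simp]: "x : obs S"
  shows "alg_square1 K (pf0 b x) (pcomp T x) (mcomp \<eta> x) (mcomp \<mu> x) (pf0 b' x) (pcomp T' x) (mcomp \<eta>' x) (mcomp \<mu>' x)
    (pcomp q x) (mcomp \<phi> x) (pcomp p x) (mcomp h x) (pcomp p' x) (mcomp h' x) (pcomp m x) (mcomp i x)"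
proof -
  interpret a: alg_square1 "PS S K" b T \<eta> \<mu> b' T' \<eta>' \<mu>' q \<phi> p h p' h' m i by fact
  interpret m: PS_monad S K b T \<eta> \<mu> by unfold_locales (rule a.m.monad)
  interpret m': PS_monad S K b' T' \<eta>' \<mu>' by unfold_locales (rule a.m'.monad)
  have ps: "pseudonatural S K q" "pseudonatural S K p" "pseudonatural S K m" "pseudonatural S K p'" "modification S K h" "modification S K i" "modification S K \<phi>" "modification S K h'"
    using a.q a.p a.m a.typing a.h by simp_all
  interpret q: pseudonatural S K q by fact
  interpret p: pseudonatural S K p by fact
  interpret mm: pseudonatural S K m by fact
  interpret p': pseudonatural S K p' by fact
  interpret h: modification S K h by fact
  interpret i: modification S K i by fact
  interpret \<phi>: modification S K \<phi> by fact
  interpret h': modification S K h' by fact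
  interpret T: pseudonatural S K T using a.m.monad_simps(2) by simp
  interpret T': pseudonatural S K T' using a.m'.monad_simps(2) by simp
  have [simp]: "psrc T = b" "ptgt T = b" "psrc T' = b'" "ptgt T' = b'" "psrc q = b" "ptgt q = b'" "ptgt p = b" "msrc h = T \<odot>\<^bsub>PS S K\<^esub> p" "mtgt h = p" "psrc m = psrc p"
    "ptgt m = psrc p'" "msrc i = p' \<odot>\<^bsub>PS S K\<^esub> m" "mtgt i = q \<odot>\<^bsub>PS S K\<^esub> p" "msrc \<phi> = T' \<odot>\<^bsub>PS S K\<^esub> q" "mtgt \<phi> = q \<odot>\<^bsub>PS S K\<^esub> T"
    using a.m.monad_simps a.m'.monad_simps a.q a.p a.h a.m a.i a.phi by simp_all
  show ?thesis
  proof (intro alg_square1.intro monad_in.intro monad_in_axioms.intro alg_square1_axioms.intro)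
    show "monad2 K (pf0 b x) (pcomp T x) (mcomp \<eta> x) (mcomp \<mu> x)" "monad2 K (pf0 b' x) (pcomp T' x) (mcomp \<eta>' x) (mcomp \<mu>' x)"
      by (rule m.monad_at m'.monad_at; fact)+
    show "alg2 K (pcomp T' x) (mcomp \<eta>' x) (mcomp \<mu>' x) (pcomp p' x) (mcomp h' x)" by (rule m'.alg_at[OF a.alg' x])
    show "invertible2 K (mcomp \<phi> x)" "invertible2 K (mcomp i x)"
      by (rule invertible_at[OF a.phi(3) x] invertible_at[OF a.i(3) x])+
    show "mcomp \<phi> x \<bullet> mcomp \<eta>' x |> (pcomp q x) = (pcomp q x) <| mcomp \<eta> x"
      using arg_cong[OF a.phi_eta, of "%\<Gamma>. mcomp \<Gamma> x"] by simp
    show "mcomp \<phi> x \<bullet> (mcomp \<mu>' x |> (pcomp q x)) =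
      ((pcomp q x) <| mcomp \<mu> x) \<bullet> mcomp \<phi> x |> (pcomp T x) \<bullet> (pcomp T' x) <| mcomp \<phi> x"
      using arg_cong[OF a.phi_mu, of "%\<Gamma>. mcomp \<Gamma> x"] by simp
    show "mcomp i x \<bullet> (mcomp h' x |> (pcomp m x)) =
      ((pcomp q x) <| mcomp h x) \<bullet> mcomp \<phi> x |> (pcomp p x) \<bullet> (pcomp T' x) <| mcomp i x"
      using arg_cong[OF a.i_alg, of "%\<Gamma>. mcomp \<Gamma> x"] by simp
  qed (simp_all add: K.two_category_axioms)
qed

text \<open>Strictness is immediate from the definition by \<open>strict_psfun\<close>. That
  precomposition is a pseudofunctor is part of the biadjunction data, from which it is taken
  later.\<close>

lemma two_functor_precomp:
  assumes "two_category (PS T K)" "pseudofunctor (PS T K) (PS S K) (precomp S T K D)"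
  shows "two_functor (PS T K) (PS S K) (precomp S T K D)"
proof -
  interpret two_category "PS T K" by fact
  show ?thesis
    using assms(2) unfolding two_functor_def precomp_def
    by (auto simp del: PS_simps simp: strict_psfun_def)
qed

lemma precomp_simps:
  "pseudonatural T K \<alpha> ==> pf1 (precomp S T K D) \<alpha> = psnat_wr S K \<alpha> D"
  "modification T K \<Gamma> ==> pf2 (precomp S T K D) \<Gamma> = modif_wr S K \<Gamma> D"
  "pseudofunctor T K F ==> pf0 (precomp S T K D) F = psfun_comp S K F D"
  by (simp_all add: precomp_def)

section \<open>The square of algebras at \<open>a\<close>\<close>

locale monadic_transformation = K: bicomplete K \<kappa> + BC Ad K \<alpha> l \<eta> \<epsilon> + A: two_category A
  for K :: "('o, 'k, 'k) tcat" (structure) and \<kappa> and A Ad :: "('k, 'k, 'k) tcat" and \<alpha> l \<eta> \<epsilon> +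
  fixes t :: "('k, 'k, 'k, 'k, 'k, 'k) psfun"
  assumes t: "pseudofunctor A Ad t"
    and monadic: "x : obs A ==> monadic K (pcomp \<alpha> (pf0 t x))"
begin

sublocale t: pseudofunctor A Ad t by (rule t)

sublocale AH: two_categories A K by unfold_locales

abbreviation U where "U \<equiv> precomp A Ad K t"

text \<open>On one side is the canonical algebra on \<open>\<alpha>\<close>, on the other its Kan
  extension, which is universal; the units connect them. Everything is constructed in the 2-category
  of pseudofunctors and evaluated at \<open>a\<close> at the end.\<close>

lemma square:
  assumes "psran_unit A Ad t K \<rho>1" "psran_unit A Ad t K \<rho>2" and a [simp]: "a : obs Ad"
  obtains b' T' \<eta>' \<mu>' \<phi> p' h' i where
    "alg_square1 K (pf0 G a) (pcomp \<alpha> a \<odot> l a) (\<eta> a) ((pcomp \<alpha> a) <| \<epsilon> a |> (l a)) b' T' \<eta>' \<mu>'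
       (pcomp (pcomp \<rho>1 G) a) \<phi> (pcomp \<alpha> a) ((pcomp \<alpha> a) <| \<epsilon> a) p' h' (pcomp (pcomp \<rho>2 F) a) i"
    "em K T' \<eta>' \<mu>' p' h'"
proof -
  let ?X = "PS Ad K" and ?Y = "PS A K"
  obtain R1 \<epsilon>1 v1 w1 where B1: "biadjunction ?X ?Y U R1 \<rho>1 \<epsilon>1 v1 w1" using assms(1) by (auto simp: psran_unit_def)
  obtain R2 \<epsilon>2 v2 w2 where B2: "biadjunction ?X ?Y U R2 \<rho>2 \<epsilon>2 v2 w2" using assms(2) by (auto simp: psran_unit_def)
  interpret U: strict_functor ?X ?Y U
    by (intro strict_functorI two_functor_precomp PS.two_category_axioms AH.PS.two_category_axioms biadjunction.L_psfun[OF B1])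
  interpret B1: strict_biadjunction ?X ?Y U R1 \<rho>1 \<epsilon>1 v1 w1
    by (intro strict_biadjunction.intro U.strict_functor_axioms B1)
  interpret B2: strict_biadjunction ?X ?Y U R2 \<rho>2 \<epsilon>2 v2 w2
    by (intro strict_biadjunction.intro U.strict_functor_axioms B2)
  let ?T = "\<alpha> \<odot>\<^bsub>?X\<^esub> \<Lambda>" and ?h = "\<alpha> <|\<^bsub>?X\<^esub> E" and ?\<mu> = "\<alpha> <|\<^bsub>?X\<^esub> E |>\<^bsub>?X\<^esub> \<Lambda>"
  have mx: "monad2 ?X G ?T H ?\<mu>" and ax: "alg2 ?X ?T H ?\<mu> \<alpha> ?h"
    using PS.adjunction_monad[OF PS_adjunction] by simp_all
  interpret mx: monad_in ?X G ?T H ?\<mu> using mx by unfold_locales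
  note [simp del] = PS_simps(1-7)
  note al [simp] = mx.alg2_typing[OF ax]
  have my: "monad2 ?Y (pf0 U G) (pf1 U ?T) (pf2 U H) (pf2 U ?\<mu>)" by (rule U.U_monad[OF mx])
  have ay: "alg2 ?Y (pf1 U ?T) (pf2 U H) (pf2 U ?\<mu>) (pf1 U \<alpha>) (pf2 U ?h)" by (rule U.U_alg[OF mx ax])
  have cells: "pseudonatural Ad K ?T" "modification Ad K H" "modification Ad K ?\<mu>" "modification Ad K ?h" "pseudonatural Ad K \<alpha>"
    using mx.monad_simps al by (simp_all add: PS_simps)
  \<comment> \<open>Monadicity of the restricted components, in the elementary form for the left
    adjoints of the Beck-Chevalley data, says that the restricted algebra is pointwise
    universal.\<close>
  interpret e: PS_em A K "pf0 U G" "pf1 U ?T" "pf2 U H" "pf2 U ?\<mu>" "pf1 U \<alpha>" "pf2 U ?h"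
  proof unfold_locales
    fix x assume x [simp]: "x : obs A"
    show "em K (pcomp (pf1 U ?T) x) (mcomp (pf2 U H) x) (mcomp (pf2 U ?\<mu>) x) (pcomp (pf1 U \<alpha>) x) (mcomp (pf2 U ?h) x)"
      using K.monadic_em[OF monadic[OF x] adj[OF t.pf_simps(1)[OF x]]] t.pf_simps(1)[OF x]
      by (simp add: precomp_simps cells psnat_wr_def modif_wr_def)
  qed (use my ay in simp_all)
  have em: "em ?Y (pf1 U ?T) (pf2 U H) (pf2 U ?\<mu>) (pf1 U \<alpha>) (pf2 U ?h)" by (rule e.PS_em)
  have FG [simp]: "G : obs ?X" "F : obs ?X" "src ?X \<alpha> = F" by (simp_all add: PS_simps \<alpha>.psrc_psfun \<alpha>.ptgt_psfun)
  let ?N = "pf0 R1 (pf0 U G)" and ?M = "pf0 R2 (pf0 U F)" and ?e = "pcomp \<epsilon>1 (pf0 U G)" and ?e' = "pcomp \<epsilon>2 (pf0 U F)"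
  interpret N: ran ?X ?Y U ?N ?e "pf0 U G" by (rule B1.ran_counit) simp
  interpret M: ran ?X ?Y U ?M ?e' "pf0 U F" by (rule B2.ran_counit) simp
  obtain T' \<tau> \<eta>' \<mu>' where rm: "ran_monad ?X ?Y U ?N ?e (pf0 U G) (pf1 U ?T) (pf2 U H) (pf2 U ?\<mu>) T' \<tau> \<eta>' \<mu>'"
    using N.ex_ran_monad[OF my] by blast
  interpret rm: ran_monad ?X ?Y U ?N ?e "pf0 U G" "pf1 U ?T" "pf2 U H" "pf2 U ?\<mu>" T' \<tau> \<eta>' \<mu>' by (rule rm)
  \<comment> \<open>\<open>u\<close> is the extension of the restricted transformation, defined as a
    lift through the counit of the first biadjunction of its composite with the counit of the
    second.\<close>
  obtain u i where u [simp]: "u : ars ?X" "src ?X u = ?M" "tgt ?X u = ?N"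
    and i [simp]: "i : cells ?Y" "cdom ?Y i = ?e \<odot>\<^bsub>?Y\<^esub> pf1 U u" "ccod ?Y i = pf1 U \<alpha> \<odot>\<^bsub>?Y\<^esub> ?e'" "invertible2 ?Y i"
    using N.essD[of ?M "pf1 U \<alpha> \<odot>\<^bsub>?Y\<^esub> ?e'"] by auto
  let ?s = "pf2 U ?h |>\<^bsub>?Y\<^esub> ?e' \<bullet>\<^bsub>?Y\<^esub> (pf1 U ?T) <|\<^bsub>?Y\<^esub> i \<bullet>\<^bsub>?Y\<^esub> \<tau> |>\<^bsub>?Y\<^esub> (pf1 U u)"
  \<comment> \<open>The action on \<open>u\<close> is the preimage of the action of the restricted
    algebra, moved past the counits by \<open>i\<close> and \<open>\<tau>\<close>.\<close>
  obtain k where k [simp]: "k : cells ?X" "cdom ?X k = T' \<odot>\<^bsub>?X\<^esub> u" "ccod ?X k = u" and ek: "?e <|\<^bsub>?Y\<^esub> pf2 U k = inv2 ?Y i \<bullet>\<^bsub>?Y\<^esub> ?s"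
    using N.fullD[of "T' \<odot>\<^bsub>?X\<^esub> u" u "inv2 ?Y i \<bullet>\<^bsub>?Y\<^esub> ?s"] by auto
  have ik: "i \<bullet>\<^bsub>?Y\<^esub> (?e <|\<^bsub>?Y\<^esub> pf2 U k) = ?s" unfolding ek by simp
  have re: "ran_em ?X ?Y U ?N ?e (pf0 U G) (pf1 U ?T) (pf2 U H) (pf2 U ?\<mu>) T' \<tau> \<eta>' \<mu>' ?M ?e' (pf0 U (src ?X \<alpha>)) (pf1 U \<alpha>) (pf2 U ?h) u i k"
    unfolding FG(3) by (intro ran_em.intro ran_em_axioms.intro rm M.ran_axioms em u i k ik) simp
  \<comment> \<open>The triangle modifications \<open>v1\<close> and \<open>v2\<close> go from the
    identity to the counit after the restricted unit; their inverses are the cells needed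
    here.\<close>
  have ru: "ran_unit ?X ?Y U ?N ?e G ?T H ?\<mu> T' \<tau> \<eta>' \<mu>' ?M ?e' \<alpha> ?h u i k (pcomp \<rho>1 G) (inv2 ?Y (mcomp v1 G)) (pcomp \<rho>2 F) (inv2 ?Y (mcomp v2 F))"
  proof (intro ran_unit.intro re monad_in.intro monad_in_axioms.intro mx PS.two_category_axioms ran_unit_axioms.intro ax)
    show "pcomp \<rho>1 G : ars ?X" "src ?X (pcomp \<rho>1 G) = G" "tgt ?X (pcomp \<rho>1 G) = ?N"
      "pcomp \<rho>2 F : ars ?X" "src ?X (pcomp \<rho>2 F) = src ?X \<alpha>" "tgt ?X (pcomp \<rho>2 F) = ?M" by simp_all
    show "inv2 ?Y (mcomp v1 G) : cells ?Y" "cdom ?Y (inv2 ?Y (mcomp v1 G)) = ?e \<odot>\<^bsub>?Y\<^esub> pf1 U (pcomp \<rho>1 G)"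
      "ccod ?Y (inv2 ?Y (mcomp v1 G)) = id1 ?Y (pf0 U G)" "invertible2 ?Y (inv2 ?Y (mcomp v1 G))" by simp_all
    show "inv2 ?Y (mcomp v2 F) : cells ?Y" "cdom ?Y (inv2 ?Y (mcomp v2 F)) = ?e' \<odot>\<^bsub>?Y\<^esub> pf1 U (pcomp \<rho>2 F)"
      "ccod ?Y (inv2 ?Y (mcomp v2 F)) = id1 ?Y (pf0 U (src ?X \<alpha>))" "invertible2 ?Y (inv2 ?Y (mcomp v2 F))" by simp_all
  qed
  obtain \<phi> j where sq: "alg_square1 ?X G ?T H ?\<mu> ?N T' \<eta>' \<mu>' (pcomp \<rho>1 G) \<phi> \<alpha> ?h u k (pcomp \<rho>2 F) j"
    using ran_unit.ex_square[OF ru] by blast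
  interpret m': PS_monad Ad K ?N T' \<eta>' \<mu>' by unfold_locales (rule rm.ran_monad)
  \<comment> \<open>The extension is universal among pseudofunctors; only by \<open>em_at\<close> is
    this known at the single object \<open>a\<close>.\<close>
  have "em K (pcomp T' a) (mcomp \<eta>' a) (mcomp \<mu>' a) (pcomp u a) (mcomp k a)"
    by (rule m'.em_at[OF K.ex_em ran_em.em_u[OF re] a])
  moreover have "alg_square1 K (pf0 G a) (pcomp \<alpha> a \<odot> l a) (\<eta> a) ((pcomp \<alpha> a) <| \<epsilon> a |> (l a)) (pf0 ?N a) (pcomp T' a) (mcomp \<eta>' a) (mcomp \<mu>' a)
       (pcomp (pcomp \<rho>1 G) a) (mcomp \<phi> a) (pcomp \<alpha> a) ((pcomp \<alpha> a) <| \<epsilon> a) (pcomp u a) (mcomp k a) (pcomp (pcomp \<rho>2 F) a) (mcomp j a)"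
    using alg_square1_at[OF sq a] by simp
  ultimately show ?thesis using that by blast
qed

end

context monadic_transformation
begin

text \<open>In the square at \<open>a\<close> the unit for the target of \<open>\<alpha>\<close> is
  the monad morphism and the unit for its source is the connecting 1-cell. The primed algebra is
  universal, so each property of the first unit allows the corresponding transfer from the second
  unit to \<open>\<alpha>\<close> at \<open>a\<close>.\<close>

lemma descent_iff:
  assumes a [simp]: "a : obs Ad" and \<rho>: "psran_unit A Ad t K \<rho>1" "psran_unit A Ad t K \<rho>2"
  shows "faithful1 K (pcomp (pcomp \<rho>1 G) a) ==> almost_monadic K (pcomp \<alpha> a) \<longleftrightarrow> faithful1 K (pcomp (pcomp \<rho>2 F) a)"
    and "fully_faithful1 K (pcomp (pcomp \<rho>1 G) a) ==> premonadic K (pcomp \<alpha> a) \<longleftrightarrow> fully_faithful1 K (pcomp (pcomp \<rho>2 F) a)"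
    and "equivalence1 K (pcomp (pcomp \<rho>1 G) a) ==> monadic K (pcomp \<alpha> a) \<longleftrightarrow> equivalence1 K (pcomp (pcomp \<rho>2 F) a)"
proof -
  let ?q = "pcomp (pcomp \<rho>1 G) a" and ?m = "pcomp (pcomp \<rho>2 F) a" and ?p = "pcomp \<alpha> a"
  obtain b' T' \<eta>' \<mu>' \<phi> p' h' i where sq: "alg_square1 K (pf0 G a) (?p \<odot> l a) (\<eta> a) (?p <| \<epsilon> a |> (l a)) b' T' \<eta>' \<mu>'
       ?q \<phi> ?p (?p <| \<epsilon> a) p' h' ?m i" and em: "em K T' \<eta>' \<mu>' p' h'"
    using square[OF \<rho> a] by blast
  interpret sq: alg_square1 K "pf0 G a" "?p \<odot> l a" "\<eta> a" "?p <| \<epsilon> a |> (l a)" b' T' \<eta>' \<mu>' ?q \<phi> ?p "?p <| \<epsilon> a" p' h' ?m i by (rule sq)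
  have em: "faith1 K p'" "alg_full1 K T' p' h'" "alg_ess1 K T' \<eta>' \<mu>' p' h'" using em by (auto simp: em_def)
  \<comment> \<open>Monadicity of the component at \<open>a\<close> is rephrased through its
    canonical algebra, with the left adjoint of the Beck-Chevalley data; this is the form that the
    transfer lemmas decide.\<close>
  have m: "almost_monadic K ?p \<longleftrightarrow> faith1 K ?p"
    "premonadic K ?p \<longleftrightarrow> faith1 K ?p & alg_full1 K (?p \<odot> l a) ?p (?p <| \<epsilon> a)"
    "monadic K ?p \<longleftrightarrow> em K (?p \<odot> l a) (\<eta> a) (?p <| \<epsilon> a |> (l a)) ?p (?p <| \<epsilon> a)"
    by (rule K.monadicity[OF _ adj[OF a]]; erule K.ex_em)+
  have alg: "alg2 K (?p \<odot> l a) (\<eta> a) (?p <| \<epsilon> a |> (l a)) ?p (?p <| \<epsilon> a)"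
    by (rule K.adjunction_monad(2)[OF adj[OF a]])
  show "faithful1 K ?q ==> almost_monadic K ?p \<longleftrightarrow> faithful1 K ?m"
    unfolding m(1) K.faithful1_iff[OF sq.q(1)] K.faithful1_iff[OF sq.m(1)] using sq.faith1_transfer em by blast
  show "fully_faithful1 K ?q ==> premonadic K ?p \<longleftrightarrow> fully_faithful1 K ?m"
    unfolding m(2) K.fully_faithful1_iff[OF sq.q(1)] K.fully_faithful1_iff[OF sq.m(1)]
    using sq.faith1_transfer sq.alg_full1_transfer em by blast
  show "equivalence1 K ?q ==> monadic K ?p \<longleftrightarrow> equivalence1 K ?m"
    unfolding m(3) K.equivalence1_iff[OF sq.q(1)] K.equivalence1_iff[OF sq.m(1)] em_def[of K "?p \<odot> l a"]
    using sq.faith1_transfer sq.alg_full1_transfer sq.alg_ess1_transfer em alg by blast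
qed

end

theorem theorem7p4:
  fixes \<kappa> :: "'k rel"
    and A Ad :: "('k, 'k, 'k) tcat" and t :: "('k, 'k, 'k, 'k, 'k, 'k) psfun" and a :: 'k
    and H :: "('o, 'k, 'k) tcat"
    and FA FB :: "('k, 'k, 'k, 'o, 'k, 'k) psfun"
    and \<alpha> :: "('k, 'k, 'k, 'o, 'k, 'k) psnat"
  assumes "Card_order \<kappa>" and "natLeq <o \<kappa>"
    and "a_inclusion \<kappa> A Ad t a"
    and "two_category H" and "bicategorically_complete \<kappa> H"
    and "pseudofunctor Ad H FA" and "pseudofunctor Ad H FB"
    and "pseudonatural Ad H \<alpha>" and "psrc \<alpha> = FA" and "ptgt \<alpha> = FB"
    and "beck_chevalley Ad H \<alpha>"
    and "\<forall>x \<in> obs A. monadic H (pcomp (psnat_wr A H \<alpha> t) x)"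
  shows "(almost_descent A Ad t a H FB \<longrightarrow>
            (almost_monadic H (pcomp \<alpha> a) \<longleftrightarrow> almost_descent A Ad t a H FA)) \<and>
         (descent A Ad t a H FB \<longrightarrow>
            (premonadic H (pcomp \<alpha> a) \<longleftrightarrow> descent A Ad t a H FA)) \<and>
         (effective_descent A Ad t a H FB \<longrightarrow>
            (monadic H (pcomp \<alpha> a) \<longleftrightarrow> effective_descent A Ad t a H FA))"
proof -
  from assms(11) obtain l \<eta> \<epsilon> where adj: "!!w. w : obs Ad ==> adjunction1 H (l w) (pcomp \<alpha> w) (\<eta> w) (\<epsilon> w)"
    and mate: "!!f. f : ars Ad ==> invertible2 H (mate Ad H \<alpha> l \<eta> \<epsilon> f)"
    unfolding beck_chevalley_def by blast
  have incl: "two_category A" "two_category Ad" "two_functor A Ad t" "a : obs Ad"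
    using assms(3) by (auto simp: a_inclusion_def small_two_category_def)
  interpret monadic_transformation H \<kappa> A Ad \<alpha> l \<eta> \<epsilon> t
  proof (intro monadic_transformation.intro bicomplete.intro bicomplete_axioms.intro BC.intro BC_axioms.intro
      two_categories.intro monadic_transformation_axioms.intro adj mate incl assms(1,2,4,5,8) two_functorD)
    fix x assume "x : obs A"
    then show "monadic H (pcomp \<alpha> (pf0 t x))" using assms(12) by (simp add: psnat_wr_def)
  qed
  \<comment> \<open>The equivalences hold for every pair of units, so the existential choices of
    units in the descent conditions need not agree.\<close>
  note d = descent_iff[OF incl(4), unfolded assms(9,10)]
  show ?thesis
    unfolding almost_descent_def descent_def effective_descent_def using d by blast
qed

end
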